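(* If $n \leq 4$, then $Ab(n) = Red(n)$. If $n \geq 5$, then $Red(n) \subsetneq Ab(n)$.
   Context: Let $C \leq SL_n(\mathbb{R})$ be the group of positive diagonal matrices of determinant $1$. The set of all closed subgroups of $SL_n(\mathbb{R})$ carries the Chabauty topology: a sequence of closed subgroups $H_r$ converges to a closed subgroup $H$ iff (a) every $h\in H$ is the limit of some sequence $h_r\in H_r$, and (b) whenever $h_r \in H_r$ and a subsequence of $(h_r)$ converges to $h$, then $h\in H$. A subgroup $L \leq SL_n(\mathbb{R})$ is a (conjugacy) limit of $C$ if there is a sequence $P_r\in SL_n(\mathbb{R})$ such that $P_r C P_r^{-1} \to L$ in the Chabauty topology. Let $\widehat{Ab}(n)$ be the set of closed subgroups $G \leq SL_n(\mathbb{R})$ with $G \cong (\mathbb{R}^{n-1},+)$ and let $\widehat{Red}(n) = \{G \leq SL_n(\mathbb{R}) : G \text{ is a conjugacy limit of } C\}$. Put $Ab(n) = \widehat{Ab}(n)/\text{conjugacy}$ and $Red(n) = \widehat{Red}(n)/\text{conjugacy}$ (sets of conjugacy classes of subgroups, under conjugation in $SL_n(\mathbb{R})$). Every conjugacy limit of $C$ is isomorphic to $\mathbb{R}^{n-1}$, so $Red(n)\subset Ab(n)$. *)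

theory Defs
  imports "HOL-Analysis.Analysis" "HOL-Algebra.Group"
begin

text \<open>
  The size \<open>n \<ge> 1\<close> of the matrices is the cardinality of the index type \<open>'n\<close>.
\<close>

definition SL :: "(real^'n^'n) monoid" where
  "SL = \<lparr>carrier = {A. det A = 1}, mult = (**), one = mat 1\<rparr>"

lemma group_SL: "group (SL :: (real^'n^'n) monoid)"
proof (rule groupI)
  fix A :: "real^'n^'n"
  assume "A \<in> carrier SL"
  then have A: "det A = 1" by (simp add: SL_def)
  then have "invertible A" by (simp add: invertible_det_nz)
  then obtain B where B: "B ** A = mat 1" by (auto simp: invertible_def)
  then have "det B * det A = 1" by (metis det_mul det_I)
  with A B show "\<exists>B\<in>carrier SL. B \<otimes>\<^bsub>SL\<^esub> A = \<one>\<^bsub>SL\<^esub>"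
    by (auto simp: SL_def)
qed (auto simp: SL_def det_mul matrix_mul_assoc)

definition closed_subgroup_SL :: "(real^'n^'n) set \<Rightarrow> bool" where
  "closed_subgroup_SL G \<longleftrightarrow> subgroup G SL \<and> closedin (top_of_set (carrier SL)) G"

definition pos_diag :: "(real^'n^'n) set" where
  "pos_diag = {A \<in> carrier SL. (\<forall>i j. i \<noteq> j \<longrightarrow> A $ i $ j = 0) \<and> (\<forall>i. A $ i $ i > 0)}"

definition conjugate :: "real^'n^'n \<Rightarrow> (real^'n^'n) set \<Rightarrow> (real^'n^'n) set" where
  "conjugate P G = (\<lambda>A. P \<otimes>\<^bsub>SL\<^esub> A \<otimes>\<^bsub>SL\<^esub> inv\<^bsub>SL\<^esub> P) ` G"

definition chabauty_limit ::
    "(nat \<Rightarrow> (real^'n^'n) set) \<Rightarrow> (real^'n^'n) set \<Rightarrow> bool" where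
  "chabauty_limit H L \<longleftrightarrow>
     (\<forall>r. closed_subgroup_SL (H r)) \<and> closed_subgroup_SL L \<and>
     (\<forall>h\<in>L. \<exists>g. (\<forall>r. g r \<in> H r) \<and> g \<longlonglongrightarrow> h) \<and>
     (\<forall>g s h. (\<forall>r. g r \<in> H r) \<and> strict_mono (s :: nat \<Rightarrow> nat) \<and> (g \<circ> s) \<longlonglongrightarrow> h \<longrightarrow> h \<in> L)"

definition conjugacy_limit :: "(real^'n^'n) set \<Rightarrow> (real^'n^'n) set \<Rightarrow> bool" where
  "conjugacy_limit C L \<longleftrightarrow>
     (\<exists>P. (\<forall>r. P r \<in> carrier SL) \<and> chabauty_limit (\<lambda>r. conjugate (P r) C) L)"

definition euclidean_group :: "nat \<Rightarrow> (nat \<Rightarrow> real) monoid" where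
  "euclidean_group m =
     \<lparr>carrier = topspace (Euclidean_space m), mult = (\<lambda>x y i. x i + y i), one = (\<lambda>i. 0)\<rparr>"

text \<open>
  Isomorphism with \<open>\<real>\<^sup>m\<close> is meant in the sense of topological groups. As abstract groups, all
  \<open>\<real>\<^sup>m\<close> with \<open>m \<ge> 1\<close> are isomorphic to each other.
\<close>

definition isomorphic_to_euclidean :: "nat \<Rightarrow> (real^'n^'n) set \<Rightarrow> bool" where
  "isomorphic_to_euclidean m G \<longleftrightarrow>
     (\<exists>f. f \<in> iso (euclidean_group m) (SL\<lparr>carrier := G\<rparr>) \<and>
          homeomorphic_map (Euclidean_space m) (top_of_set G) f)"

definition Ab_hat :: "(real^'n^'n) set set" where
  "Ab_hat = {G. closed_subgroup_SL G \<and> isomorphic_to_euclidean (CARD('n) - 1) G}"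

definition Red_hat :: "(real^'n^'n) set set" where
  "Red_hat = {G. subgroup G SL \<and> conjugacy_limit pos_diag G}"

definition conj_rel :: "(real^'n^'n) set rel" where
  "conj_rel = {(G, H). subgroup G SL \<and> subgroup H SL \<and> (\<exists>P\<in>carrier SL. H = conjugate P G)}"

lemma equiv_conj_rel: "equiv {G :: (real^'n^'n) set. subgroup G SL} conj_rel"
proof -
  interpret group "SL :: (real^'n^'n) monoid" by (rule group_SL)
  have one: "conjugate \<one>\<^bsub>SL\<^esub> G = G" if "subgroup G SL" for G :: "(real^'n^'n) set"
  proof -
    have "\<one>\<^bsub>SL\<^esub> \<otimes>\<^bsub>SL\<^esub> A \<otimes>\<^bsub>SL\<^esub> inv\<^bsub>SL\<^esub> \<one>\<^bsub>SL\<^esub> = A" if "A \<in> G" for A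
      using subgroup.mem_carrier[OF \<open>subgroup G SL\<close> that] by simp
    then show ?thesis by (simp add: conjugate_def cong: image_cong_simp)
  qed
  have mult: "conjugate P (conjugate Q G) = conjugate (P \<otimes>\<^bsub>SL\<^esub> Q) G"
    if "subgroup G SL" and PQ: "P \<in> carrier SL" "Q \<in> carrier SL" for P Q and G :: "(real^'n^'n) set"
  proof -
    have "P \<otimes>\<^bsub>SL\<^esub> (Q \<otimes>\<^bsub>SL\<^esub> A \<otimes>\<^bsub>SL\<^esub> inv\<^bsub>SL\<^esub> Q) \<otimes>\<^bsub>SL\<^esub> inv\<^bsub>SL\<^esub> P =
        (P \<otimes>\<^bsub>SL\<^esub> Q) \<otimes>\<^bsub>SL\<^esub> A \<otimes>\<^bsub>SL\<^esub> inv\<^bsub>SL\<^esub> (P \<otimes>\<^bsub>SL\<^esub> Q)" if "A \<in> G" for A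
      using subgroup.mem_carrier[OF \<open>subgroup G SL\<close> that] PQ
      by (simp add: inv_mult_group m_assoc)
    then show ?thesis by (simp add: conjugate_def image_image cong: image_cong_simp)
  qed
  show ?thesis
  proof (rule equivI)
    show "conj_rel \<subseteq> {G. subgroup G SL} \<times> {G :: (real^'n^'n) set. subgroup G SL}"
      by (auto simp: conj_rel_def)
    show "refl_on {G :: (real^'n^'n) set. subgroup G SL} conj_rel"
    proof (rule refl_onI)
      fix G :: "(real^'n^'n) set"
      assume "G \<in> {G. subgroup G SL}"
      then have "subgroup G SL" by simp
      with one[OF this, symmetric] one_closed show "(G, G) \<in> conj_rel"
        unfolding conj_rel_def by blast
    qed
    show "sym (conj_rel :: (real^'n^'n) set rel)"
    proof (rule symI)
      fix G H :: "(real^'n^'n) set"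
      assume "(G, H) \<in> conj_rel"
      then obtain P where P: "subgroup G SL" "subgroup H SL" "P \<in> carrier SL" "H = conjugate P G"
        by (auto simp: conj_rel_def)
      have "G = conjugate (inv\<^bsub>SL\<^esub> P) H"
        by (simp only: P mult[OF P(1) inv_closed[OF P(3)] P(3)] l_inv[OF P(3)] one[OF P(1)])
      with P inv_closed[OF P(3)] show "(H, G) \<in> conj_rel" unfolding conj_rel_def by blast
    qed
    show "trans (conj_rel :: (real^'n^'n) set rel)"
    proof (rule transI)
      fix G H K :: "(real^'n^'n) set"
      assume "(G, H) \<in> conj_rel" "(H, K) \<in> conj_rel"
      then obtain P Q where PQ: "subgroup G SL" "subgroup K SL" "P \<in> carrier SL" "Q \<in> carrier SL"
          "K = conjugate Q (conjugate P G)"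
        unfolding conj_rel_def by blast
      then have "K = conjugate (Q \<otimes>\<^bsub>SL\<^esub> P) G" by (simp only: mult)
      with PQ m_closed[of Q P] show "(G, K) \<in> conj_rel" unfolding conj_rel_def by blast
    qed
  qed
qed

text \<open>
  For \<open>X\<close> a set of subgroups, \<open>X // conj_rel\<close> consists of the full conjugacy classes (among all
  subgroups) of the members of \<open>X\<close>, so that \<open>Red\<close> and \<open>Ab\<close> are comparable as sets.
\<close>

definition Ab :: "(real^'n^'n) set set set" where
  "Ab = Ab_hat // conj_rel"

definition Red :: "(real^'n^'n) set set set" where
  "Red = Red_hat // conj_rel"

end

theory Submission
  imports Defs "HOL-Computational_Algebra.Fundamental_Theorem_Algebra"
begin

text \<open>
  Conjugates of the diagonal group span the \<open>n\<close>-dimensional algebras \<open>P D P\<^sup>-\<^sup>1\<close> of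
  simultaneously diagonalizable matrices, so a conjugacy limit spans a space of dimension at most
  \<open>n\<close>. For \<open>n \<ge> 5\<close>, take matrices \<open>D + B\<close> of trace zero, where \<open>B\<close> is a
  square-zero \<open>2 \<times> 2\<close> block, \<open>D\<close> is diagonal and constant on the four coordinates of the
  block, and this constant is also an entry of \<open>B\<close>. The exponentials of these matrices form a
  closed group isomorphic to \<open>\<real>\<^sup>n\<^sup>-\<^sup>1\<close>. Its span contains the squares of the \<open>D + B\<close>,
  which separate \<open>D\<close> from \<open>B\<close>, so it has dimension larger than \<open>n\<close>.

  For \<open>n \<le> 4\<close> let \<open>A\<close> be the commutative algebra spanned by \<open>G \<cong> \<real>\<^sup>n\<^sup>-\<^sup>1\<close>. By invariance
  of domain, in a subspace of dimension at most \<open>n\<close> containing \<open>G\<close> every invertible element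
  joined to \<open>1\<close> by invertible elements is a positive multiple of an element of \<open>G\<close>. As
  \<open>G\<close> is torsion-free, such a path cannot end in an involution. This excludes non-real
  eigenvalues in \<open>A\<close>. Splitting the space into generalized eigenspaces leaves commuting nilpotent
  families on spaces of dimension at most 4, which are limits of diagonalizable ones unless they
  consist of four independent matrices with vanishing products. That case is impossible for the
  algebra \<open>A\<close>. Hence \<open>A\<close> has dimension \<open>n\<close> and is a limit of algebras
  \<open>P\<^sub>r D P\<^sub>r\<^sup>-\<^sup>1\<close>, and \<open>G\<close> is the limit of the groups of their positive elements.
\<close>

section \<open>Diagonalizable approximation of matrix families\<close>

text \<open>The approximation is an induction on dimension. Each local case changes the family by
  terms of order \<open>\<eta>\<close> so that a common eigenvector and an invariant complementary
  hyperplane appear, on which the changed family still commutes and is nilpotent. Vector and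
  hyperplane may contain terms in \<open>1 / \<eta>\<close>; only the matrices have to converge. The
  critical case in dimension four are maps from a two-dimensional quotient to a two-dimensional
  subspace, that is, 2-by-2 blocks. A proper subspace of the blocks satisfies a linear relation, and
  a nondegenerate relation makes the blocks symmetric in suitable bases. All blocks together with
  the identity span dimension five, too much for a limit of four-dimensional algebras. On the side
  of the groups the obstacle is that invariance of domain wants an algebra of dimension at most n,
  while the dimension of \<open>A\<close> is known only after its spectrum is known to be real.
  Non-real eigenvalues are therefore treated by first bounding \<open>A\<close>, or a substitute
  containing \<open>G\<close>, by linear algebra. Approximants of elements of \<open>G\<close> may
  have negative eigenvalues, so elements of \<open>G\<close> are written as squares.\<close>

lemma bounded_bilinear_matrix_mul: "bounded_bilinear ((**) :: real^'n^'n \<Rightarrow> real^'n^'n \<Rightarrow> real^'n^'n)"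
proof -
  have "bilinear ((**) :: real^'n^'n \<Rightarrow> real^'n^'n \<Rightarrow> real^'n^'n)"
    unfolding bilinear_def
    by (auto intro!: linearI simp: matrix_add_ldistrib vec_eq_iff matrix_matrix_mult_def
          algebra_simps sum.distrib sum_distrib_left)
  then show ?thesis by (simp add: bilinear_conv_bounded_bilinear)
qed

interpretation mm: bounded_bilinear "(**) :: real^'n^'n \<Rightarrow> real^'n^'n \<Rightarrow> real^'n^'n"
  by (rule bounded_bilinear_matrix_mul)

lemma bounded_bilinear_matrix_vector_mul:
  "bounded_bilinear ((*v) :: real^'n^'n \<Rightarrow> real^'n \<Rightarrow> real^'n)"
proof -
  have "bilinear ((*v) :: real^'n^'n \<Rightarrow> real^'n \<Rightarrow> real^'n)"
    unfolding bilinear_def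
    by (auto intro!: linearI simp: vec_eq_iff matrix_vector_mult_def
          algebra_simps sum.distrib sum_distrib_left)
  then show ?thesis by (simp add: bilinear_conv_bounded_bilinear)
qed

interpretation mv: bounded_bilinear "(*v) :: real^'n^'n \<Rightarrow> real^'n \<Rightarrow> real^'n"
  by (rule bounded_bilinear_matrix_vector_mul)

lemma continuous_det: "continuous_on UNIV (det :: real^'n^'n \<Rightarrow> real)"
  unfolding det_def by (intro continuous_intros)

lemma tendsto_det:
  "(f \<longlongrightarrow> A) F \<Longrightarrow> ((\<lambda>x. det (f x)) \<longlongrightarrow> det (A :: real^'n^'n)) F"
  using continuous_det continuous_on_eq_continuous_at isCont_tendsto_compose open_UNIV by blast

lemma continuous_on_det:
  "continuous_on T f \<Longrightarrow> continuous_on T (\<lambda>x. det (f x :: real^'n^'n))"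
  using continuous_on_compose2[OF continuous_det] by blast

lemma det_scaleR: "det (c *\<^sub>R (A :: real^'n^'n)) = c ^ CARD('n) * det A"
proof -
  have "c *\<^sub>R A = (\<chi> i. c *s A $ i)" by (simp add: vec_eq_iff)
  then show ?thesis by (simp add: det_rows_mul)
qed

lemma matrix_inv_mul: 
  assumes "det (P::real^'n^'n) \<noteq> 0"
  shows "P ** matrix_inv P = mat 1" "matrix_inv P ** P = mat 1"
proof -
  have "\<exists>A'. P ** A' = mat 1 \<and> A' ** P = mat 1"
    using assms by (simp add: invertible_det_nz[symmetric] invertible_def)
  then have "P ** matrix_inv P = mat 1 \<and> matrix_inv P ** P = mat 1"
    unfolding matrix_inv_def by (rule someI_ex)
  then show "P ** matrix_inv P = mat 1" "matrix_inv P ** P = mat 1" by auto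
qed

lemma inv_SL:
  assumes "(P::real^'n^'n) \<in> carrier SL"
  shows "inv\<^bsub>SL\<^esub> P = matrix_inv P"
proof -
  interpret group "SL :: (real^'n^'n) monoid" by (rule group_SL)
  have d: "det P = 1" using assms by (simp add: SL_def)
  have m: "P ** matrix_inv P = mat 1" "matrix_inv P ** P = mat 1"
    using matrix_inv_mul[of P] d by auto
  have "det (matrix_inv P) = 1" using arg_cong[OF m(1), of det] d by (simp add: det_mul)
  with m d show ?thesis
    by (intro inv_equality) (auto simp: SL_def)
qed

text \<open>Lower semicontinuity of dimension: the linear map that takes each \<open>b\<close> to
  \<open>y b\<close> moves a vector of \<open>span B\<close> by at most half its norm, so it is
  injective there.\<close>

lemma dim_ge_card_near_independent:
  fixes B :: "'a::euclidean_space set"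
  assumes B: "independent B"
  shows "\<exists>\<delta>>0. \<forall>y T. subspace (T::'a set) \<and> (\<forall>b\<in>B. y b \<in> T \<and> norm (y b - b) \<le> \<delta>) \<longrightarrow> card B \<le> dim T"
proof -
  have fin: "finite B" using B by (rule independent_imp_finite)
  have "\<forall>b. \<exists>g. linear g \<and> (\<forall>x\<in>B. g x = (if x = b then 1 else 0 :: real))"
    using linear_independent_extend[OF B, of "\<lambda>x. if x = b then 1 else 0" for b] by blast
  then obtain g where g: "\<And>b. linear (g b)" "\<And>b x. x \<in> B \<Longrightarrow> g b x = (if x = b then 1 else 0 :: real)"
    by metis
  have "\<exists>K>0. \<forall>v. \<bar>g b v\<bar> \<le> K * norm v" for b
    using linear_bounded_pos[OF g(1)[of b]] by (metis real_norm_def)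
  then obtain K where K: "\<And>b. K b > 0" "\<And>b v. \<bar>g b v\<bar> \<le> K b * norm v" by metis
  \<comment> \<open>The sum controls all coordinate functionals at once; the extra 1 keeps
    \<open>k\<close> positive for empty \<open>B\<close>.\<close>
  define k where "k = (\<Sum>b\<in>B. K b) + 1"
  have k: "k > 0" unfolding k_def by (simp add: add_nonneg_pos sum_nonneg K(1) less_imp_le)
  have repr: "v = (\<Sum>b\<in>B. g b v *\<^sub>R b)" if "v \<in> span B" for v
  proof -
    have "linear (\<lambda>v. \<Sum>b\<in>B. g b v *\<^sub>R b)"
      by (intro linear_compose_sum ballI linear_compose[OF g(1), unfolded o_def])
        (auto intro!: linearI simp: linear_add[OF g(1)] linear_scale[OF g(1)] scaleR_add_left)
    moreover have "x = (\<Sum>b\<in>B. g b x *\<^sub>R b)" if "x \<in> B" for x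
    proof -
      have "(\<Sum>b\<in>B. g b x *\<^sub>R b) = (\<Sum>b\<in>B. if b = x then b else 0)"
        using that by (intro sum.cong) (auto simp: g(2))
      then show ?thesis using that fin by simp
    qed
    ultimately show ?thesis
      using linear_eq_on_span[of "\<lambda>x. x" "\<lambda>v. \<Sum>b\<in>B. g b v *\<^sub>R b" B v] that linear_id[unfolded id_def]
      by blast
  qed
  show ?thesis
  proof (intro exI[of _ "1 / (2 * k)"] conjI allI impI)
    show "1 / (2 * k) > 0" using k by simp
    fix y and T :: "'a set"
    assume A: "subspace T \<and> (\<forall>b\<in>B. y b \<in> T \<and> norm (y b - b) \<le> 1 / (2 * k))"
    obtain Y where Y: "linear Y" "\<And>b. b \<in> B \<Longrightarrow> Y b = y b" using linear_independent_extend[OF B, of y] by auto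
    have "v = 0" if v: "v \<in> span B" "Y v = 0" for v
    proof -
      have "Y v = (\<Sum>b\<in>B. g b v *\<^sub>R y b)"
        by (subst repr[OF v(1)]) (simp add: linear_sum[OF Y(1)] linear_scale[OF Y(1)] Y(2))
      then have "v = (\<Sum>b\<in>B. g b v *\<^sub>R b) - (\<Sum>b\<in>B. g b v *\<^sub>R y b)"
        using repr[OF v(1)] v(2) by simp
      also have "\<dots> = (\<Sum>b\<in>B. g b v *\<^sub>R (b - y b))"
        by (simp add: sum_subtractf scaleR_diff_right)
      finally have "norm v \<le> (\<Sum>b\<in>B. norm (g b v *\<^sub>R (b - y b)))" using norm_sum by metis
      also have "\<dots> \<le> (\<Sum>b\<in>B. (K b * norm v) * (1 / (2 * k)))"
      proof (rule sum_mono)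
        fix b assume "b \<in> B"
        then have "norm (b - y b) \<le> 1 / (2 * k)" using A by (simp add: norm_minus_commute)
        then show "norm (g b v *\<^sub>R (b - y b)) \<le> K b * norm v * (1 / (2 * k))"
          unfolding norm_scaleR using K(2)[of b v] K(1)[of b]
          by (intro mult_mono) auto
      qed
      also have "\<dots> = (\<Sum>b\<in>B. K b) * norm v / (2 * k)"
        by (simp add: sum_distrib_right sum_divide_distrib)
      also have "\<dots> \<le> k * norm v / (2 * k)"
        using k by (intro divide_right_mono mult_right_mono) (auto simp: k_def)
      also have "\<dots> = norm v / 2" using k by simp
      finally show ?thesis by simp
    qed
    then have "inj_on Y (span B)"
      using linear_inj_on_iff_eq_0[OF Y(1) subspace_span] by blast
    then have "dim (Y ` span B) = dim (span B)"
      using eucl.dim_image_eq[OF Y(1), of "span B"] by (simp add: span_span)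
    moreover have "Y ` span B \<subseteq> T"
    proof -
      have "Y ` span B = span (Y ` B)" by (simp add: linear_span_image[OF Y(1)])
      also have "\<dots> \<subseteq> T" using A Y(2) by (intro span_minimal) auto
      finally show ?thesis .
    qed
    ultimately show "card B \<le> dim T"
      using dim_subset[of "Y ` span B" T] B by (simp add: dim_span dim_eq_card_independent)
  qed
qed

text \<open>\<open>w\<close> is the normalised component of \<open>v\<close> orthogonal to
  \<open>H\<close>. Separating functionals are represented by such vectors throughout.\<close>

lemma dual_vector:
  fixes v :: "'a::euclidean_space"
  assumes "subspace H" "v \<notin> H"
  shows "\<exists>w. w \<bullet> v = 1 \<and> (\<forall>h\<in>H. w \<bullet> h = 0)"
proof -
  obtain y z where y: "y \<in> span H" and z: "\<And>w. w \<in> span H \<Longrightarrow> orthogonal z w" and v: "v = y + z"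
    using orthogonal_subspace_decomp_exists[of H v] by metis
  have "z \<noteq> 0" using assms y v by (auto simp: span_eq_iff[THEN iffD2])
  moreover have "z \<bullet> v = z \<bullet> z" using z[OF y] v by (simp add: orthogonal_def inner_add_right)
  ultimately show ?thesis
    using z by (intro exI[of _ "z /\<^sub>R (z \<bullet> z)"]) (auto simp: orthogonal_def span_base)
qed

section \<open>The algebras of simultaneously diagonalizable matrices\<close>

definition diagm :: "real^'n \<Rightarrow> real^'n^'n" where
  "diagm v = (\<chi> i j. if i = j then v $ i else 0)"

definition cdiag :: "real^'n^'n \<Rightarrow> real^'n \<Rightarrow> real^'n^'n" where
  "cdiag P v = P ** diagm v ** matrix_inv P"

lemma diagm_mult: "diagm v ** diagm w = diagm (v * w)"
  by (simp add: diagm_def matrix_matrix_mult_def vec_eq_iff if_distrib[of "\<lambda>x. x * _"] 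
        if_distrib[of "\<lambda>x. _ * x"] cong: if_cong)

lemma diagm_vec: "diagm v *v u = v * u"
  by (simp add: diagm_def matrix_vector_mult_def vec_eq_iff if_distrib[of "\<lambda>x. x * _"] cong: if_cong)

lemma diagm_one: "diagm 1 = mat 1"
  by (simp add: diagm_def mat_def vec_eq_iff)

lemma det_diagm: "det (diagm v) = (\<Prod>i\<in>UNIV. v $ i)"
  by (subst det_diagonal) (auto simp: diagm_def)

lemma linear_diagm: "linear diagm"
  by (auto intro!: linearI simp: diagm_def vec_eq_iff)

lemma linear_cdiag: "linear (cdiag P)"
  by (auto intro!: linearI simp: cdiag_def linear_add[OF linear_diagm] linear_scale[OF linear_diagm]
      mm.add_left mm.add_right mm.scaleR_left mm.scaleR_right)

lemma cdiag_mult: "det P \<noteq> 0 \<Longrightarrow> cdiag P v ** cdiag P w = cdiag P (v * w)"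
proof -
  assume P: "det P \<noteq> 0"
  have "cdiag P v ** cdiag P w = P ** diagm v ** (matrix_inv P ** P) ** diagm w ** matrix_inv P"
    by (simp add: cdiag_def matrix_mul_assoc)
  then show ?thesis
    by (simp add: cdiag_def matrix_inv_mul[OF P] diagm_mult[symmetric] matrix_mul_assoc)
qed

lemma cdiag_one: "det P \<noteq> 0 \<Longrightarrow> cdiag P 1 = mat 1"
  by (simp add: cdiag_def diagm_one matrix_inv_mul)

lemma det_cdiag: "det P \<noteq> 0 \<Longrightarrow> det (cdiag P v) = (\<Prod>i\<in>UNIV. v $ i)"
proof -
  assume P: "det P \<noteq> 0"
  have "det P * det (matrix_inv P) = 1"
    using arg_cong[OF matrix_inv_mul(1)[OF P], of det] by (simp add: det_mul)
  then show ?thesis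
    by (simp add: cdiag_def det_mul det_diagm)
qed

lemma inj_cdiag: "det P \<noteq> 0 \<Longrightarrow> inj (cdiag P)"
proof (rule injI)
  fix v w assume P: "det P \<noteq> 0" and "cdiag P v = cdiag P w"
  then have "matrix_inv P ** cdiag P v ** P = matrix_inv P ** cdiag P w ** P" by simp
  moreover have "matrix_inv P ** cdiag P v ** P = diagm v" for v
  proof -
    have "matrix_inv P ** cdiag P v ** P = (matrix_inv P ** P) ** diagm v ** (matrix_inv P ** P)"
      by (simp add: cdiag_def matrix_mul_assoc)
    then show ?thesis by (simp add: matrix_inv_mul[OF P])
  qed
  ultimately have "diagm v = diagm w" by simp
  moreover have "diagm u $ i $ i = u $ i" for u :: "real^'n" and i by (simp add: diagm_def)
  ultimately show "v = w" by (metis vec_eq_iff)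
qed

lemma subspace_range_cdiag: "subspace (range (cdiag P))"
  by (intro linear_subspace_image linear_cdiag subspace_UNIV)

lemma dim_range_cdiag: "det (P::real^'n^'n) \<noteq> 0 \<Longrightarrow> dim (range (cdiag P)) = CARD('n)"
  using eucl.dim_image_eq[OF linear_cdiag[of P], of UNIV] inj_cdiag[of P] by simp

lemma conjugate_pos_diag:
  assumes "det (P::real^'n^'n) = 1"
  shows "conjugate P pos_diag = cdiag P ` {v. (\<forall>i. v $ i > 0) \<and> (\<Prod>i\<in>UNIV. v $ i) = 1}"
proof -
  have P: "P \<in> carrier SL" using assms by (simp add: SL_def)
  have 1: "pos_diag = diagm ` {v :: real^'n. (\<forall>i. v $ i > 0) \<and> (\<Prod>i\<in>UNIV. v $ i) = 1}" (is "_ = ?R")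
  proof
    show "pos_diag \<subseteq> ?R"
    proof
      fix A :: "real^'n^'n" assume A: "A \<in> pos_diag"
      have "A = diagm (\<chi> i. A $ i $ i)" using A by (auto simp: diagm_def vec_eq_iff pos_diag_def)
      moreover have "det A = 1" using A by (simp add: pos_diag_def SL_def)
      ultimately have "(\<Prod>i\<in>UNIV. A $ i $ i) = 1" using det_diagm[of "\<chi> i. A $ i $ i"] by simp
      with \<open>A = _\<close> A show "A \<in> ?R" by (auto simp: pos_diag_def)
    qed
    show "?R \<subseteq> pos_diag"
    proof clarsimp
      fix v :: "real^'n" assume v: "\<forall>i. v $ i > 0" "(\<Prod>i\<in>UNIV. v $ i) = 1"
      have "det (diagm v) = 1" using v by (simp add: det_diagm)
      with v show "diagm v \<in> pos_diag" by (auto simp: pos_diag_def SL_def) (auto simp: diagm_def)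
    qed
  qed
  have "conjugate P pos_diag = (\<lambda>A. P ** A ** matrix_inv P) ` pos_diag"
    by (simp add: conjugate_def inv_SL[OF P]) (simp add: SL_def)
  then show ?thesis unfolding 1 by (simp add: image_image cdiag_def)
qed

text \<open>On \<open>U\<close>, the matrices in \<open>S\<close> are limits of simultaneously diagonalizable ones.\<close>

definition approx_on :: "(real^'n) set \<Rightarrow> (real^'n^'n) set \<Rightarrow> bool" where
  "approx_on U S \<longleftrightarrow> (\<forall>\<epsilon>>0. \<exists>f B. independent B \<and> span B = U \<and>
     (\<forall>b\<in>S. norm (f b - b) \<le> \<epsilon> \<and> (\<forall>u\<in>B. \<exists>c. f b *v u = c *\<^sub>R u)))"

lemma approx_onE:
  assumes "approx_on U S" "\<epsilon> > 0"
  obtains f B where "independent B" "span B = U" "\<And>b. b \<in> S \<Longrightarrow> norm (f b - b) \<le> \<epsilon>"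
    "\<And>b u. b \<in> S \<Longrightarrow> u \<in> B \<Longrightarrow> \<exists>c. f b *v u = c *\<^sub>R u"
proof -
  obtain f B where "independent B \<and> span B = U \<and>
     (\<forall>b\<in>S. norm (f b - b) \<le> \<epsilon> \<and> (\<forall>u\<in>B. \<exists>c. f b *v u = c *\<^sub>R u))"
    using assms(1)[unfolded approx_on_def, rule_format, OF assms(2)] by (elim exE)
  then show thesis by (intro that[of B f]) auto
qed

section \<open>Closure properties of approximability\<close>

lemma approx_onI:
  assumes "\<And>\<epsilon>. \<epsilon> > 0 \<Longrightarrow> \<exists>f B. independent B \<and> span B = U \<and>
     (\<forall>b\<in>S. norm (f b - b) \<le> \<epsilon> \<and> (\<forall>u\<in>B. \<exists>c. f b *v u = c *\<^sub>R u))"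
  shows "approx_on U S"
  unfolding approx_on_def using assms by (intro allI impI)

lemma approx_on_mono:
  assumes "approx_on U S" "T \<subseteq> S"
  shows "approx_on U T"
proof (rule approx_onI)
  fix \<epsilon> :: real assume "\<epsilon> > 0"
  from approx_onE[OF assms(1) this] obtain f B where "independent B" "span B = U"
    "\<And>b. b \<in> S \<Longrightarrow> norm (f b - b) \<le> \<epsilon>" "\<And>b u. b \<in> S \<Longrightarrow> u \<in> B \<Longrightarrow> \<exists>c. f b *v u = c *\<^sub>R u"
    by metis
  then show "\<exists>f B. independent B \<and> span B = U \<and>
     (\<forall>b\<in>T. norm (f b - b) \<le> \<epsilon> \<and> (\<forall>u\<in>B. \<exists>c. f b *v u = c *\<^sub>R u))"
    using assms(2) by (intro exI[of _ f] exI[of _ B]) auto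
qed

text \<open>A limit of limits is a limit: half of \<open>\<epsilon>\<close> is spent on
  \<open>f\<close>, the other half on approximating the image of \<open>f\<close>.\<close>

lemma approx_on_perturb:
  assumes "\<And>\<epsilon>. \<epsilon> > 0 \<Longrightarrow> \<exists>f. (\<forall>b\<in>S. norm (f b - b) \<le> \<epsilon>) \<and> approx_on U (f ` S)"
  shows "approx_on U S"
proof (rule approx_onI)
  fix \<epsilon> :: real assume e: "\<epsilon> > 0"
  then obtain f where f: "\<forall>b\<in>S. norm (f b - b) \<le> \<epsilon>/2" "approx_on U (f ` S)"
    using assms[of "\<epsilon>/2"] by auto
  from e have e2: "\<epsilon>/2 > 0" by simp
  obtain g B where g: "independent B" "span B = U"
    "\<And>b. b\<in>f ` S \<Longrightarrow> norm (g b - b) \<le> \<epsilon>/2"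
    "\<And>b u. b\<in>f ` S \<Longrightarrow> u\<in>B \<Longrightarrow> \<exists>c. g b *v u = c *\<^sub>R u"
    by (rule approx_onE[OF f(2) e2]) blast
  have "norm (g (f b) - b) \<le> \<epsilon>" if "b \<in> S" for b
  proof -
    have "norm (g (f b) - b) \<le> norm (g (f b) - f b) + norm (f b - b)"
      using norm_triangle_ineq[of "g (f b) - f b" "f b - b"] by simp
    with f(1)[rule_format, OF that] g(3)[OF imageI, OF that] show ?thesis by simp
  qed
  with g show "\<exists>f B. independent B \<and> span B = U \<and>
     (\<forall>b\<in>S. norm (f b - b) \<le> \<epsilon> \<and> (\<forall>u\<in>B. \<exists>c. f b *v u = c *\<^sub>R u))"
    by (intro exI[of _ "g \<circ> f"] exI[of _ B]) auto
qed

text \<open>Common eigenvectors of the approximants are eigenvectors of their linear combinations,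
  and the identity is diagonal in every basis. So approximability depends only on the space spanned
  by the family and \<open>mat 1\<close>, which allows scalar shifts and changes of
  generators.\<close>

lemma approx_on_span:
  assumes "approx_on U S" "finite S" "finite T" "T \<subseteq> span (insert (mat 1) S)"
  shows "approx_on U T"
proof (rule approx_onI)
  fix \<epsilon> :: real assume e: "\<epsilon> > 0"
  define S' where "S' = insert (mat 1) S"
  have fin: "finite S'" using assms by (simp add: S'_def)
  have "\<forall>t\<in>T. \<exists>c. t = (\<Sum>s\<in>S'. c s *\<^sub>R s)"
    using assms(4) span_finite[OF fin] by (auto simp: S'_def)
  then obtain c where c: "\<And>t. t \<in> T \<Longrightarrow> t = (\<Sum>s\<in>S'. c t s *\<^sub>R s)" by metis
  define K where "K = (\<Sum>t\<in>T. \<Sum>s\<in>S'. \<bar>c t s\<bar>) + 1"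
  have K: "K > 0" unfolding K_def by (simp add: add_nonneg_pos sum_nonneg)
  obtain f B where f: "independent B" "span B = U"
    "\<And>b. b\<in>S \<Longrightarrow> norm (f b - b) \<le> \<epsilon> / K" "\<And>b u. b\<in>S \<Longrightarrow> u\<in>B \<Longrightarrow> \<exists>c. f b *v u = c *\<^sub>R u"
    by (rule approx_onE[OF assms(1) divide_pos_pos[OF e K]]) blast
  \<comment> \<open>\<open>mat 1\<close> is its own approximant, also when it already belongs to
    \<open>S\<close>.\<close>
  define g where "g = (\<lambda>s. if s = mat 1 then mat 1 else f s)"
  have g: "norm (g b - b) \<le> \<epsilon> / K" "\<exists>c. g b *v u = c *\<^sub>R u" if "b \<in> S'" "u \<in> B" for b u
    using f(3)[of b] f(4)[of b u] that e K by (auto simp: g_def S'_def intro: exI[of _ 1])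
  have gn: "norm (g b - b) \<le> \<epsilon> / K" if "b \<in> S'" for b
    using f(3)[of b] that e K by (auto simp: g_def S'_def)
  define h where "h t = (\<Sum>s\<in>S'. c t s *\<^sub>R g s)" for t
  have "norm (h t - t) \<le> \<epsilon>" if t: "t \<in> T" for t
  proof -
    have "h t - t = (\<Sum>s\<in>S'. c t s *\<^sub>R (g s - s))"
      by (subst (2) c[OF t]) (simp add: h_def sum_subtractf scaleR_diff_right)
    then have "norm (h t - t) \<le> (\<Sum>s\<in>S'. norm (c t s *\<^sub>R (g s - s)))" by (simp only: norm_sum)
    also have "\<dots> \<le> (\<Sum>s\<in>S'. \<bar>c t s\<bar> * (\<epsilon> / K))"
      unfolding norm_scaleR by (intro sum_mono mult_left_mono gn abs_ge_zero)
    also have "\<dots> = (\<Sum>s\<in>S'. \<bar>c t s\<bar>) * (\<epsilon> / K)" by (rule sum_distrib_right[symmetric])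
    also have "\<dots> \<le> K * (\<epsilon> / K)"
    proof (rule mult_right_mono)
      have "(\<Sum>s\<in>S'. \<bar>c t s\<bar>) \<le> (\<Sum>t\<in>T. \<Sum>s\<in>S'. \<bar>c t s\<bar>)"
        using t assms(3) by (intro member_le_sum) (auto simp: sum_nonneg)
      then show "(\<Sum>s\<in>S'. \<bar>c t s\<bar>) \<le> K" by (simp add: K_def)
    qed (use e K in simp)
    finally show ?thesis using K by simp
  qed
  moreover have "\<exists>d. h t *v u = d *\<^sub>R u" if "u \<in> B" for t u
  proof -
    have "\<forall>b\<in>S'. \<exists>d. g b *v u = d *\<^sub>R u" using g(2) \<open>u \<in> B\<close> by blast
    from bchoice[OF this] obtain d where d: "\<And>b. b \<in> S' \<Longrightarrow> g b *v u = d b *\<^sub>R u" by blast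
    have "h t *v u = (\<Sum>s\<in>S'. (c t s * d s) *\<^sub>R u)"
      unfolding h_def mv.sum_left mv.scaleR_left by (intro sum.cong) (auto simp: d)
    also have "\<dots> = (\<Sum>s\<in>S'. c t s * d s) *\<^sub>R u" by (rule scaleR_sum_left[symmetric])
    finally show ?thesis by blast
  qed
  ultimately show "\<exists>f B. independent B \<and> span B = U \<and>
     (\<forall>b\<in>T. norm (f b - b) \<le> \<epsilon> \<and> (\<forall>u\<in>B. \<exists>c. f b *v u = c *\<^sub>R u))"
    using f(1,2) by (intro exI[of _ h] exI[of _ B]) auto
qed

lemma approx_on_UNIV_cdiag:
  fixes S :: "(real^'n^'n) set"
  assumes "approx_on UNIV S" "\<epsilon> > 0"
  shows "\<exists>P. det P = 1 \<and> (\<forall>b\<in>S. \<exists>v. norm (cdiag P v - b) \<le> \<epsilon>)"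
proof -
  obtain f B where B: "independent B" "span B = UNIV"
    and f: "\<And>b. b \<in> S \<Longrightarrow> norm (f b - b) \<le> \<epsilon>" "\<And>b u. b \<in> S \<Longrightarrow> u \<in> B \<Longrightarrow> \<exists>c. f b *v u = c *\<^sub>R u"
    by (rule approx_onE[OF assms]) blast
  have finB: "finite B" using B(1) by (rule independent_imp_finite)
  have "card B = CARD('n)" using B dim_eq_card_independent[OF B(1)] dim_span[of B] by simp
  then obtain \<beta> where \<beta>: "bij_betw \<beta> (UNIV :: 'n set) B"
    using finite_same_card_bij[of "UNIV :: 'n set" B] finB by auto
  define Q :: "real^'n^'n" where "Q = (\<chi> i j. \<beta> j $ i)"
  have col: "column j Q = \<beta> j" for j by (simp add: Q_def column_def vec_eq_iff)
  have "c i = 0" if "(\<Sum>i\<in>UNIV. c i *s column i Q) = 0" for c i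
  proof -
    have "(\<Sum>b\<in>B. c (inv_into UNIV \<beta> b) *\<^sub>R b) = (\<Sum>i\<in>UNIV. c i *\<^sub>R \<beta> i)"
      using \<beta> by (subst sum.reindex_bij_betw[OF \<beta>, symmetric])
        (simp add: bij_betw_def inv_into_f_f)
    also have "\<dots> = 0" using that by (simp add: col scalar_mult_eq_scaleR)
    finally have "\<forall>b\<in>B. c (inv_into UNIV \<beta> b) = 0"
      using B(1) finB by (auto simp: independent_explicit)
    then show ?thesis using \<beta> by (metis UNIV_I bij_betw_def imageI inv_into_f_f)
  qed
  then have "\<exists>B. B ** Q = mat 1" unfolding matrix_left_invertible_independent_columns by blast
  then have Q: "det Q \<noteq> 0" by (metis invertible_det_nz invertible_left_inverse)
  \<comment> \<open>Scaling one column, at an arbitrary index, turns the determinant into 1 and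
    keeps all columns eigenvectors.\<close>
  define w :: "real^'n" where "w = (\<chi> i. if i = (SOME k. True) then 1 / det Q else 1)"
  define P where "P = Q ** diagm w"
  have "(\<Prod>i\<in>UNIV. w $ i) = 1 / det Q" by (simp add: w_def)
  then have P: "det P = 1" using Q by (simp add: P_def det_mul det_diagm)
  have "\<exists>v. norm (cdiag P v - b) \<le> \<epsilon>" if b: "b \<in> S" for b
  proof -
    have "\<forall>i. \<exists>c. f b *v \<beta> i = c *\<^sub>R \<beta> i" using f(2)[OF b] \<beta> by (auto simp: bij_betw_def)
    then obtain c where c: "\<And>i. f b *v \<beta> i = c i *\<^sub>R \<beta> i" by metis
    have "f b ** Q = Q ** diagm (\<chi> i. c i)"
    proof -
      have "(f b ** Q) $ i $ j = (Q ** diagm (\<chi> i. c i)) $ i $ j" for i j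
      proof -
        have "(f b ** Q) $ i $ j = (f b *v \<beta> j) $ i"
          by (simp add: matrix_matrix_mult_def matrix_vector_mult_def Q_def)
        also have "\<dots> = (Q ** diagm (\<chi> i. c i)) $ i $ j"
          by (simp add: c matrix_matrix_mult_def diagm_def Q_def if_distrib[of "\<lambda>x. _ * x"] cong: if_cong)
        finally show ?thesis .
      qed
      then show ?thesis by (simp add: vec_eq_iff)
    qed
    then have "f b ** P = Q ** (diagm (\<chi> i. c i) ** diagm w)" by (simp add: P_def matrix_mul_assoc)
    also have "\<dots> = P ** diagm (\<chi> i. c i)"
      by (simp add: P_def diagm_mult mult.commute matrix_mul_assoc[symmetric])
    finally have "f b ** P ** matrix_inv P = cdiag P (\<chi> i. c i)" by (simp add: cdiag_def)
    moreover have "f b ** P ** matrix_inv P = f b"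
      using P by (simp add: matrix_mul_assoc[symmetric] matrix_inv_mul)
    ultimately show ?thesis using f(1)[OF b] by metis
  qed
  with P show ?thesis by blast
qed

lemma independent_sum_span:
  fixes B1 B2 :: "'a::euclidean_space set"
  assumes B: "independent B1" "independent B2" and int: "span B1 \<inter> span B2 = {0}"
  shows "independent (B1 \<union> B2)" "B1 \<inter> B2 = {}"
    "span (B1 \<union> B2) = {x + y |x y. x \<in> span B1 \<and> y \<in> span B2}"
proof -
  have fin: "finite B1" "finite B2" using B independent_imp_finite by auto
  show "B1 \<inter> B2 = {}"
  proof -
    have "B1 \<inter> B2 \<subseteq> {0}" using int span_superset by blast
    moreover have "0 \<notin> B1" using B(1) dependent_zero by blast
    ultimately show ?thesis by blast
  qed
  then have card: "card (B1 \<union> B2) = card B1 + card B2" using fin by (simp add: card_Un_disjoint)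
  show sp: "span (B1 \<union> B2) = {x + y |x y. x \<in> span B1 \<and> y \<in> span B2}" by (simp add: span_Un)
  have "dim (span (B1 \<union> B2)) + dim (span B1 \<inter> span B2) = dim (span B1) + dim (span B2)"
    unfolding sp using dim_sums_Int[OF subspace_span subspace_span, of B1 B2] by simp
  then have "dim (span (B1 \<union> B2)) = card B1 + card B2"
    using B int by (simp add: dim_eq_card_independent)
  then show "independent (B1 \<union> B2)"
    using card fin by (intro card_le_dim_spanning[of _ "span (B1 \<union> B2)"]) (auto simp: span_superset)
qed

lemma projection_exists:
  fixes U1 U2 :: "(real^'n) set"
  assumes "subspace U1" "subspace U2" "U1 \<inter> U2 = {0}"
  shows "\<exists>E :: real^'n^'n. (\<forall>u\<in>U1. E *v u = u) \<and> (\<forall>u\<in>U2. E *v u = 0)"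
proof -
  obtain B1 where B1: "independent B1" "span B1 = U1" "B1 \<subseteq> U1"
    using basis_exists[of U1] assms(1) by (metis span_eq_iff span_subspace)
  obtain B2 where B2: "independent B2" "span B2 = U2" "B2 \<subseteq> U2"
    using basis_exists[of U2] assms(2) by (metis span_eq_iff span_subspace)
  note ind = independent_sum_span[OF B1(1) B2(1)]
  have "span B1 \<inter> span B2 = {0}" using assms B1 B2 by simp
  note ind = ind[OF this]
  obtain e where e: "linear e" "\<And>x. x \<in> B1 \<union> B2 \<Longrightarrow> e x = (if x \<in> B1 then x else 0)"
    using linear_independent_extend[OF ind(1), of "\<lambda>x. if x \<in> B1 then x else 0"] by auto
  have "e u = u" if "u \<in> U1" for u
    using linear_eq_on_span[OF e(1) linear_id[unfolded id_def], of B1 u] e(2) that B1 by auto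
  moreover have "e u = 0" if "u \<in> U2" for u
  proof (rule linear_eq_on_span[OF e(1), of "\<lambda>x. 0" B2])
    show "e x = 0" if "x \<in> B2" for x using e(2)[of x] ind(2) that by auto
  qed (use that B2 module_hom_zero in \<open>auto intro!: linearI\<close>)
  ultimately show ?thesis using e(1) by (intro exI[of _ "matrix e"]) (simp add: matrix_works)
qed

text \<open>Projections glue the two corrections: the resulting matrix agrees with
  \<open>f1 b\<close> on \<open>U1\<close> and with \<open>f2 b\<close> on
  \<open>U2\<close>.\<close>

lemma approx_on_direct_sum:
  fixes U1 U2 :: "(real^'n) set"
  assumes sub: "subspace U1" "subspace U2" and int: "U1 \<inter> U2 = {0}"
    and U: "U = {x + y |x y. x \<in> U1 \<and> y \<in> U2}"
    and a: "approx_on U1 S" "approx_on U2 S"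
  shows "approx_on U S"
proof (rule approx_onI)
  fix \<epsilon> :: real assume e: "\<epsilon> > 0"
  obtain E1 :: "real^'n^'n" where E1: "\<And>u. u\<in>U1 \<Longrightarrow> E1 *v u = u" "\<And>u. u\<in>U2 \<Longrightarrow> E1 *v u = 0"
    using projection_exists[OF sub int] by blast
  obtain E2 :: "real^'n^'n" where E2: "\<And>u. u\<in>U2 \<Longrightarrow> E2 *v u = u" "\<And>u. u\<in>U1 \<Longrightarrow> E2 *v u = 0"
    using projection_exists[OF sub(2,1)] int by (metis Int_commute)
  obtain K where K: "K > 0" "\<And>(x :: real^'n^'n) (y :: real^'n^'n). norm (x ** y) \<le> norm x * norm y * K"
    using mm.pos_bounded by blast
  define Q where "Q = K * (norm E1 + norm E2 + 1)"
  define \<delta> where "\<delta> = \<epsilon> / Q"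
  have pos: "Q > 0" using K(1) by (simp add: add_nonneg_pos Q_def)
  have d: "\<delta> > 0" using e pos by (simp add: \<delta>_def)
  obtain f1 B1 where 1: "independent B1" "span B1 = U1"
    "\<And>b. b\<in>S \<Longrightarrow> norm (f1 b - b) \<le> \<delta>" "\<And>b u. b\<in>S \<Longrightarrow> u\<in>B1 \<Longrightarrow> \<exists>c. f1 b *v u = c *\<^sub>R u"
    by (rule approx_onE[OF a(1) d]) blast
  obtain f2 B2 where 2: "independent B2" "span B2 = U2"
    "\<And>b. b\<in>S \<Longrightarrow> norm (f2 b - b) \<le> \<delta>" "\<And>b u. b\<in>S \<Longrightarrow> u\<in>B2 \<Longrightarrow> \<exists>c. f2 b *v u = c *\<^sub>R u"
    by (rule approx_onE[OF a(2) d]) blast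
  have ind: "independent (B1 \<union> B2)" "span (B1 \<union> B2) = U"
    using independent_sum_span[OF 1(1) 2(1)] 1(2) 2(2) int U by auto
  define f where "f b = b + (f1 b - b) ** E1 + (f2 b - b) ** E2" for b
  have "norm (f b - b) \<le> \<epsilon>" if b: "b \<in> S" for b
  proof -
    have "norm (f b - b) \<le> norm ((f1 b - b) ** E1) + norm ((f2 b - b) ** E2)"
      using norm_triangle_ineq[of "(f1 b - b) ** E1" "(f2 b - b) ** E2"] by (simp add: f_def add.assoc)
    also have "\<dots> \<le> norm (f1 b - b) * norm E1 * K + norm (f2 b - b) * norm E2 * K"
      by (intro add_mono K(2))
    also have "\<dots> \<le> \<delta> * norm E1 * K + \<delta> * norm E2 * K"
      using 1(3) 2(3) b K(1) by (intro add_mono mult_right_mono) auto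
    also have "\<dots> \<le> \<delta> * Q"
      using d K(1) by (simp add: algebra_simps Q_def)
    also have "\<dots> = \<epsilon>" using pos by (simp add: \<delta>_def)
    finally show ?thesis .
  qed
  moreover have "\<exists>c. f b *v u = c *\<^sub>R u" if "b \<in> S" "u \<in> B1 \<union> B2" for b u
  proof (cases "u \<in> B1")
    case True
    then have "u \<in> U1" using 1(2) span_base by blast
    then have "f b *v u = f1 b *v u"
      by (simp add: f_def mv.add_left matrix_vector_mul_assoc[symmetric] E1 E2 mv.diff_left)
    then show ?thesis using 1(4)[of b u] True that by auto
  next
    case False
    then have u: "u \<in> B2" using that by auto
    then have "u \<in> U2" using 2(2) span_base by blast
    then have "f b *v u = f2 b *v u"
      by (simp add: f_def mv.add_left matrix_vector_mul_assoc[symmetric] E1 E2 mv.diff_left)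
    then show ?thesis using 2(4)[of b u] u that by auto
  qed
  ultimately show "\<exists>f B. independent B \<and> span B = U \<and>
     (\<forall>b\<in>S. norm (f b - b) \<le> \<epsilon> \<and> (\<forall>u\<in>B. \<exists>c. f b *v u = c *\<^sub>R u))"
    using ind by (intro exI[of _ f] exI[of _ "B1 \<union> B2"]) auto
qed

lemma approx_on_line:
  assumes "v \<noteq> 0" "\<And>b. b \<in> S \<Longrightarrow> \<exists>c. b *v v = c *\<^sub>R v"
  shows "approx_on (span {v}) S"
  using assms by (intro approx_onI exI[of _ "\<lambda>b. b"] exI[of _ "{v}"]) (auto simp: independent_explicit)

text \<open>The induction step of the local constructions: a small perturbation has the common
  eigenvector \<open>v\<close>, and \<open>U2\<close> is approximable by itself. The dimension bound
  together with \<open>v \<notin> U2\<close> makes \<open>U\<close> the direct sum of the line of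
  \<open>v\<close> and \<open>U2\<close>.\<close>

lemma approx_on_split:
  assumes U: "subspace U"
    and *: "\<And>\<epsilon>. \<epsilon> > 0 \<Longrightarrow> \<exists>f v U2. (\<forall>b\<in>S. norm (f b - b) \<le> \<epsilon> \<and> (\<exists>c. f b *v v = c *\<^sub>R v)) \<and>
        v \<in> U \<and> subspace U2 \<and> v \<notin> U2 \<and> U2 \<subseteq> U \<and> dim U \<le> Suc (dim U2) \<and> approx_on U2 (f ` S)"
  shows "approx_on U S"
proof (rule approx_on_perturb)
  fix \<epsilon> :: real assume "\<epsilon> > 0"
  from *[OF this] obtain f v U2 where
    H: "(\<forall>b\<in>S. norm (f b - b) \<le> \<epsilon> \<and> (\<exists>c. f b *v v = c *\<^sub>R v)) \<and>
        v \<in> U \<and> subspace U2 \<and> v \<notin> U2 \<and> U2 \<subseteq> U \<and> dim U \<le> Suc (dim U2) \<and> approx_on U2 (f ` S)"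
    by (elim exE)
  then have f: "\<And>b. b\<in>S \<Longrightarrow> norm (f b - b) \<le> \<epsilon>" "\<And>b. b\<in>S \<Longrightarrow> \<exists>c. f b *v v = c *\<^sub>R v"
    and v: "v \<in> U" "subspace U2" "v \<notin> U2" "U2 \<subseteq> U" "dim U \<le> Suc (dim U2)" "approx_on U2 (f ` S)"
    by auto
  have v0: "v \<noteq> 0" using v(2,3) subspace_0 by blast
  have int: "span {v} \<inter> U2 = {0}"
  proof -
    have "c = 0" if "c *\<^sub>R v \<in> U2" for c
    proof (rule ccontr)
      assume "c \<noteq> 0"
      then have "v = (1 / c) *\<^sub>R (c *\<^sub>R v)" by simp
      then show False using subspace_scale[OF v(2) that, of "1/c"] v(3) by metis
    qed
    then show ?thesis using subspace_0[OF v(2)] by (auto simp: span_singleton)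
  qed
  define W where "W = {x + y |x y. x \<in> span {v} \<and> y \<in> U2}"
  have "dim W + dim (span {v} \<inter> U2) = dim (span {v}) + dim U2"
    unfolding W_def by (rule dim_sums_Int) (auto simp: v(2))
  then have dW: "dim W = Suc (dim U2)" using v0 int dim_eq_card_independent[of "{v}"] by (simp add: independent_explicit)
  have "W \<subseteq> U" unfolding W_def using v U span_minimal[of "{v}" U] by (auto intro!: subspace_add)
  moreover have "subspace W" unfolding W_def by (intro subspace_sums subspace_span v(2))
  ultimately have WU: "W = U" using dW v(5) U by (intro subspace_dim_equal) auto
  have "approx_on U (f ` S)"
  proof (rule approx_on_direct_sum[OF subspace_span v(2) int WU[unfolded W_def, symmetric] _ v(6)])
    show "approx_on (span {v}) (f ` S)"
      using v0
    proof (rule approx_on_line)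
      fix b assume "b \<in> f ` S"
      then obtain a where "a \<in> S" "b = f a" by (rule imageE)
      then show "\<exists>c. b *v v = c *\<^sub>R v" using f(2)[of a] by simp
    qed
  qed
  then show "\<exists>f. (\<forall>b\<in>S. norm (f b - b) \<le> \<epsilon>) \<and> approx_on U (f ` S)"
    by (intro exI[of _ f] conjI ballI f(1))
qed

section \<open>Commuting nilpotent families\<close>

text \<open>Indexed families, because chains \<open>x^i u\<close> come with an index and a repeated
  vector has to count as a dependence.\<close>

definition indep_fam :: "nat \<Rightarrow> (nat \<Rightarrow> 'a::euclidean_space) \<Rightarrow> bool" where
  "indep_fam m e \<longleftrightarrow> (\<forall>c. (\<Sum>i<m. c i *\<^sub>R e i) = 0 \<longrightarrow> (\<forall>i<m. c i = 0))"

lemma indep_famD: "indep_fam m e \<Longrightarrow> (\<Sum>i<m. c i *\<^sub>R e i) = 0 \<Longrightarrow> i < m \<Longrightarrow> c i = 0"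
  unfolding indep_fam_def by blast

lemma indep_fam_iff: "indep_fam m e \<longleftrightarrow> inj_on e {..<m} \<and> independent (e ` {..<m})"
proof
  assume L: "indep_fam m e"
  have inj: "inj_on e {..<m}"
  proof (rule inj_onI, rule ccontr)
    fix i j assume ij: "i \<in> {..<m}" "j \<in> {..<m}" "e i = e j" "i \<noteq> j"
    have "(\<Sum>k<m. ((if k = i then 1 else 0) - (if k = j then 1 else 0)) *\<^sub>R e k) = e i - e j"
      using ij by (simp add: scaleR_diff_left sum_subtractf if_distrib[of "\<lambda>c. c *\<^sub>R _"] cong: if_cong)
    then show False using indep_famD[OF L, of "\<lambda>k. (if k = i then 1 else 0) - (if k = j then 1 else 0)" i] ij by simp
  qed
  moreover have "independent (e ` {..<m})"
  proof -
    have "u b = 0" if u: "(\<Sum>b\<in>e ` {..<m}. u b *\<^sub>R b) = 0" "b \<in> e ` {..<m}" for u b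
      using u indep_famD[OF L, of "u \<circ> e"] by (auto simp: sum.reindex[OF inj])
    then show ?thesis by (auto simp: independent_explicit)
  qed
  ultimately show "inj_on e {..<m} \<and> independent (e ` {..<m})" by blast
next
  assume R: "inj_on e {..<m} \<and> independent (e ` {..<m})"
  show "indep_fam m e"
    unfolding indep_fam_def
  proof (intro allI impI)
    fix c i assume c: "(\<Sum>i<m. c i *\<^sub>R e i) = 0" "i < m"
    have "(\<Sum>b\<in>e ` {..<m}. c (inv_into {..<m} e b) *\<^sub>R b) = (\<Sum>i<m. c i *\<^sub>R e i)"
      using R by (simp add: sum.reindex)
    then have "c (inv_into {..<m} e (e i)) = 0" using R c by (auto simp: independent_explicit)
    then show "c i = 0" using R c(2) by simp
  qed
qed

lemma indep_fam_le_dim: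
  assumes "indep_fam m e" "\<And>i. i < m \<Longrightarrow> e i \<in> U" 
  shows "m \<le> dim U"
proof -
  have "card (e ` {..<m}) \<le> dim U"
    using assms by (intro independent_card_le_dim) (auto simp: indep_fam_iff)
  then show ?thesis using assms(1) by (simp add: indep_fam_iff card_image)
qed

lemma indep_fam_Suc:
  assumes "indep_fam m e" "e m \<notin> span (e ` {..<m})"
  shows "indep_fam (Suc m) e"
proof -
  have 1: "e m \<notin> e ` {..<m}" by (rule contrapos_nn[OF assms(2)]) (rule span_base)
  have 2: "inj_on e {..<m}" "independent (e ` {..<m})" using assms(1) unfolding indep_fam_iff by blast+
  have "inj_on e (insert m {..<m})" using 1 2(1) by auto
  moreover have "independent (insert (e m) (e ` {..<m}))" by (rule independent_insertI[OF assms(2) 2(2)])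
  ultimately show ?thesis unfolding indep_fam_iff lessThan_Suc image_insert by blast
qed

lemma indep_fam_extend:
  fixes U :: "'a::euclidean_space set"
  assumes "m < dim U" 
  shows "\<exists>g\<in>U. g \<notin> span (e ` {..<m})"
proof (rule ccontr)
  assume "\<not> ?thesis"
  then have "U \<subseteq> span (e ` {..<m})" by blast
  then have "dim U \<le> dim (e ` {..<m})" using dim_subset[of U] by (metis dim_span)
  also have "\<dots> \<le> card (e ` {..<m})" by (intro dim_le_card') simp
  also have "\<dots> \<le> m" using card_image_le[of "{..<m}" e] by simp
  finally show False using assms by simp
qed

lemma dual_family:
  assumes ind: "indep_fam m e" and U: "subspace U" "dim U = m" "\<And>i. i < m \<Longrightarrow> e i \<in> U"
  obtains d where "\<And>i j. i < m \<Longrightarrow> j < m \<Longrightarrow> d i \<bullet> e j = (if i = j then 1 else 0)"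
    "\<And>u. u \<in> U \<Longrightarrow> u = (\<Sum>i<m. (d i \<bullet> u) *\<^sub>R e i)"
proof -
  have inj: "inj_on e {..<m}" and indep: "independent (e ` {..<m})" using ind by (auto simp: indep_fam_iff)
  have ex: "\<exists>w. w \<bullet> e i = 1 \<and> (\<forall>h\<in>span (e ` ({..<m} - {i})). w \<bullet> h = 0)" if "i < m" for i
  proof (rule dual_vector[OF subspace_span])
    have 1: "e ` {..<m} - {e i} = e ` ({..<m} - {i})" using inj that by (auto simp: inj_on_def)
    have "e i \<in> e ` {..<m}" using that by simp
    then have "e i \<notin> span (e ` {..<m} - {e i})" using indep unfolding dependent_def by blast
    then show "e i \<notin> span (e ` ({..<m} - {i}))" unfolding 1 .
  qed
  define d where "d i = (SOME w. w \<bullet> e i = 1 \<and> (\<forall>h\<in>span (e ` ({..<m} - {i})). w \<bullet> h = 0))" for i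
  have d: "d i \<bullet> e i = 1" "\<And>h. h\<in>span (e ` ({..<m} - {i})) \<Longrightarrow> d i \<bullet> h = 0" if "i < m" for i
    using someI_ex[OF ex[OF that]] unfolding d_def by auto
  have de: "d i \<bullet> e j = (if i = j then 1 else 0)" if "i < m" "j < m" for i j
    using d(1)[OF that(1)] d(2)[OF that(1) span_base, of "e j"] that by auto
  have sp: "span (e ` {..<m}) = U"
  proof (rule subspace_dim_equal)
    show "dim U \<le> dim (span (e ` {..<m}))"
      using indep inj U(2) by (simp add: dim_eq_card_independent card_image)
    show "span (e ` {..<m}) \<subseteq> U" using U by (intro span_minimal) auto
  qed (use U in auto)
  have "u = (\<Sum>i<m. (d i \<bullet> u) *\<^sub>R e i)" if "u \<in> U" for u
  proof -
    have "u \<in> range (\<lambda>c. \<Sum>v\<in>e ` {..<m}. c v *\<^sub>R v)" using that sp span_finite[of "e ` {..<m}"] by auto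
    then obtain c where "u = (\<Sum>v\<in>e ` {..<m}. c v *\<^sub>R v)" by auto
    then have u: "u = (\<Sum>i<m. c (e i) *\<^sub>R e i)" by (simp add: sum.reindex[OF inj])
    have "d i \<bullet> u = c (e i)" if "i < m" for i
      using that by (subst u) (simp add: inner_sum_right de if_distrib[of "\<lambda>x. _ * x"] cong: if_cong)
    then show ?thesis using u by simp
  qed
  with de show thesis by (intro that)
qed

section \<open>Chains of a nilpotent matrix\<close>

lemma funpow_split: "i \<le> j \<Longrightarrow> (f ^^ j) u = (f ^^ (j - i)) ((f ^^ i) u)"
  using funpow_add[of "j - i" i f] by simp

lemma linear_funpow_mv: "linear (((*v) (b::real^'n^'n)) ^^ k)"
proof (induction k)
  case 0 then show ?case by (auto intro!: linearI)
next
  case (Suc k)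
  then show ?case unfolding funpow.simps(2) by (rule linear_compose[OF _ matrix_vector_mul_linear])
qed

lemma funpow_mv_0 [simp]: "((*v) (b::real^'n^'n) ^^ k) 0 = 0"
  by (induction k) auto

lemma funpow_mv_swap: "((*v) b ^^ k) (b *v u) = b *v (((*v) b ^^ k) u)"
  by (simp add: funpow_swap1)

lemma funpow_mv_Suc2: "((*v) b ^^ Suc k) u = ((*v) b ^^ k) (b *v u)"
  by (simp add: funpow_swap1)

text \<open>Apply \<open>x^(k - i)\<close> to a vanishing combination: terms above \<open>i\<close>
  are killed by nilpotency, terms below have coefficient 0 by induction, and \<open>c i\<close>
  times the nonzero vector \<open>x^k u\<close> remains.\<close>

lemma chain_indep_fam:
  assumes 1: "((*v) x ^^ k) u \<noteq> 0" and 2: "((*v) x ^^ Suc k) u = 0"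
  shows "indep_fam (Suc k) (\<lambda>i. ((*v) (x::real^'n^'n) ^^ i) u)"
  unfolding indep_fam_def
proof (intro allI impI)
  have z: "((*v) x ^^ j) u = 0" if "j \<ge> Suc k" for j
  proof -
    have "((*v) x ^^ j) u = ((*v) x ^^ (j - Suc k)) (((*v) x ^^ Suc k) u)"
      using that by (rule funpow_split)
    then show ?thesis using 2 by simp
  qed
  fix c i assume s: "(\<Sum>i<Suc k. c i *\<^sub>R ((*v) x ^^ i) u) = 0" and "i < Suc k"
  then show "c i = 0"
  proof (induction i rule: less_induct)
    case (less i)
    have "0 = ((*v) x ^^ (k - i)) (\<Sum>j<Suc k. c j *\<^sub>R ((*v) x ^^ j) u)"
      unfolding less.prems(1) by simp
    also have "\<dots> = (\<Sum>j<Suc k. c j *\<^sub>R ((*v) x ^^ (k - i + j)) u)"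
      by (simp only: linear_sum[OF linear_funpow_mv] linear_scale[OF linear_funpow_mv] funpow_add o_apply)
    also have "\<dots> = (\<Sum>j<Suc k. if j = i then c i *\<^sub>R ((*v) x ^^ k) u else 0)"
    proof (rule sum.cong)
      fix j assume j: "j \<in> {..<Suc k}"
      consider "j < i" | "j = i" | "j > i" by linarith
      then show "c j *\<^sub>R ((*v) x ^^ (k - i + j)) u = (if j = i then c i *\<^sub>R ((*v) x ^^ k) u else 0)"
      proof cases
        case 1 then show ?thesis using less.IH[of j] less.prems s by simp
      next
        case 2 then show ?thesis using less.prems by simp
      next
        case 3 then have "k - i + j \<ge> Suc k" using less.prems by simp
        then show ?thesis using 3 z by simp
      qed
    qed simp
    also have "\<dots> = c i *\<^sub>R ((*v) x ^^ k) u" using less.prems by simp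
    finally show ?case using 1 by simp
  qed
qed

lemma nilpotent_chain:
  assumes "\<exists>k. ((*v) (x::real^'n^'n) ^^ k) u = 0" "((*v) x ^^ j) u \<noteq> 0"
  obtains k where "k \<ge> j" "((*v) x ^^ k) u \<noteq> 0" "((*v) x ^^ Suc k) u = 0"
proof -
  define l where "l = (LEAST k. ((*v) x ^^ k) u = 0)"
  have l: "((*v) x ^^ l) u = 0" unfolding l_def using assms(1) by (rule LeastI_ex)
  have nl: "((*v) x ^^ i) u \<noteq> 0" if "i < l" for i using that not_less_Least unfolding l_def by blast
  have "j < l"
  proof (rule ccontr)
    assume "\<not> j < l"
    then have "((*v) x ^^ j) u = ((*v) x ^^ (j - l)) (((*v) x ^^ l) u)"
      by (intro funpow_split) simp
    then show False using l assms(2) by simp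
  qed
  then show thesis using that[of "l - 1"] l nl[of "l - 1"] by simp
qed

lemma funpow_invariant:
  assumes "\<And>u. u \<in> U \<Longrightarrow> (b::real^'n^'n) *v u \<in> U" "u \<in> U"
  shows "((*v) b ^^ k) u \<in> U"
  using assms by (induction k) auto

text \<open>Otherwise \<open>u\<close> would start a chain of more than \<open>dim U\<close>
  independent vectors in \<open>U\<close>.\<close>

lemma nilpotent_funpow_dim:
  assumes U: "subspace U" "\<And>u. u \<in> U \<Longrightarrow> (x::real^'n^'n) *v u \<in> U" "u \<in> U"
    and nil: "\<exists>k. ((*v) x ^^ k) u = 0"
  shows "((*v) x ^^ dim U) u = 0"
proof (rule ccontr)
  assume "\<not> ?thesis"
  from nilpotent_chain[OF nil this] obtain k where k: "k \<ge> dim U"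
    "((*v) x ^^ k) u \<noteq> 0" "((*v) x ^^ Suc k) u = 0" by blast
  from indep_fam_le_dim[OF chain_indep_fam[OF k(2,3)], of U]
  have "Suc k \<le> dim U" using funpow_invariant[of U x u] U by auto
  with k show False by simp
qed

text \<open>Commutation and nilpotency concern the restrictions to \<open>U\<close> only; outside
  \<open>U\<close> the matrices are arbitrary, so that the same matrices can be studied on smaller
  and smaller subspaces.\<close>

definition nil_on :: "(real^'n) set \<Rightarrow> (real^'n^'n) set \<Rightarrow> bool" where
  "nil_on U S \<longleftrightarrow> subspace U \<and> finite S \<and> (\<forall>b\<in>S. \<forall>u\<in>U. b *v u \<in> U) \<and>
     (\<forall>b\<in>S. \<forall>c\<in>S. \<forall>u\<in>U. b *v (c *v u) = c *v (b *v u)) \<and>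
     (\<forall>b\<in>S. \<exists>k. \<forall>u\<in>U. ((*v) b ^^ k) u = 0)"

lemma nil_onD:
  assumes "nil_on U S"
  shows "subspace U" "finite S" "\<And>b u. b \<in> S \<Longrightarrow> u \<in> U \<Longrightarrow> b *v u \<in> U"
    "\<And>b c u. b \<in> S \<Longrightarrow> c \<in> S \<Longrightarrow> u \<in> U \<Longrightarrow> b *v (c *v u) = c *v (b *v u)"
    "\<And>b. b \<in> S \<Longrightarrow> \<exists>k. \<forall>u\<in>U. ((*v) b ^^ k) u = 0"
  using assms unfolding nil_on_def by auto

text \<open>A Nakayama argument. \<open>H\<close> grows by one image \<open>b U\<close> at a time
  and stays invariant under all of \<open>S\<close>. If \<open>H + b U\<close> were all of
  \<open>U\<close>, iteration would give \<open>U = H + b^k U = H\<close>.\<close>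

lemma nil_on_proper_image:
  assumes "nil_on U S" "U \<noteq> {0}"
  shows "\<exists>H. subspace H \<and> H \<subseteq> U \<and> H \<noteq> U \<and> (\<forall>b\<in>S. \<forall>u\<in>U. b *v u \<in> H)"
proof -
  note N = nil_onD[OF assms(1)]
  have "\<exists>H. subspace H \<and> H \<subseteq> U \<and> H \<noteq> U \<and> (\<forall>b\<in>S'. \<forall>u\<in>U. b *v u \<in> H) \<and> (\<forall>c\<in>S. \<forall>h\<in>H. c *v h \<in> H)"
    if "finite S'" "S' \<subseteq> S" for S'
    using that
  proof (induction S' rule: finite_induct)
    case empty
    then show ?case using assms(2) subspace_0[OF N(1)] by (intro exI[of _ "{0}"]) auto
  next
    case (insert b S')
    from insert.prems have "S' \<subseteq> S" by simp
    from insert.IH[OF this] obtain H where H0: "subspace H \<and> H \<subseteq> U \<and> H \<noteq> U \<and>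
      (\<forall>b\<in>S'. \<forall>u\<in>U. b *v u \<in> H) \<and> (\<forall>c\<in>S. \<forall>h\<in>H. c *v h \<in> H)" by (elim exE)
    then have H: "subspace H" "H \<subseteq> U" "H \<noteq> U" "\<And>b u. b\<in>S' \<Longrightarrow> u \<in> U \<Longrightarrow> b *v u \<in> H"
      "\<And>c h. c\<in>S \<Longrightarrow> h \<in> H \<Longrightarrow> c *v h \<in> H" by simp_all
    have b: "b \<in> S" using insert.prems by auto
    define H' where "H' = {x + y |x y. x \<in> H \<and> y \<in> (*v) b ` U}"
    have sub: "subspace H'" unfolding H'_def
      by (intro subspace_sums H(1) linear_subspace_image matrix_vector_mul_linear N(1))
    have HU: "H' \<subseteq> U" unfolding H'_def using H(2) N(1,3) b by (auto intro!: subspace_add)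
    have ne: "H' \<noteq> U"
    proof
      assume eq: "H' = U"
      have claim: "\<exists>x\<in>H. \<exists>u'\<in>U. u = x + ((*v) b ^^ j) u'" if "u \<in> U" for u j
        using that
      proof (induction j arbitrary: u)
        case 0 then show ?case using subspace_0[OF H(1)] by (intro bexI[of _ 0] bexI[of _ u]) auto
      next
        case (Suc j)
        then obtain x u' where x: "x \<in> H" "u' \<in> U" "u = x + ((*v) b ^^ j) u'" by blast
        from x(2) eq obtain x' u'' where y: "x' \<in> H" "u'' \<in> U" "u' = x' + b *v u''" unfolding H'_def by blast
        have "u = (x + ((*v) b ^^ j) x') + ((*v) b ^^ Suc j) u''"
          by (simp add: x(3) y(3) linear_add[OF linear_funpow_mv] funpow_mv_swap)
        moreover have "x + ((*v) b ^^ j) x' \<in> H"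
          using x(1) y(1) funpow_invariant[of H b x' j] H(5)[OF b] H(1) by (auto intro: subspace_add)
        ultimately show ?case using y(2) by blast
      qed
      obtain k where k: "\<forall>u\<in>U. ((*v) b ^^ k) u = 0" using N(5)[OF b] by blast
      have "U \<subseteq> H"
      proof
        fix u assume "u \<in> U"
        from claim[OF this, of k] obtain x u' where "x \<in> H" "u' \<in> U" "u = x + ((*v) b ^^ k) u'" by blast
        with k show "u \<in> H" by simp
      qed
      with H show False by blast
    qed
    have "\<forall>b'\<in>insert b S'. \<forall>u\<in>U. b' *v u \<in> H'"
    proof (intro ballI)
      fix b' u assume *: "b' \<in> insert b S'" "u \<in> U"
      show "b' *v u \<in> H'"
      proof (cases "b' = b")
        case True
        have "b *v u = 0 + b *v u" by simp
        then show ?thesis using True subspace_0[OF H(1)] *(2) unfolding H'_def by blast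
      next
        case False
        have "b' *v u = b' *v u + b *v 0" by simp
        then show ?thesis using False * H(4)[of b' u] subspace_0[OF N(1)] unfolding H'_def by blast
      qed
    qed
    moreover have "\<forall>c\<in>S. \<forall>h\<in>H'. c *v h \<in> H'"
    proof (intro ballI)
      fix c h assume c: "c \<in> S" "h \<in> H'"
      then obtain x u where "x \<in> H" "u \<in> U" "h = x + b *v u" unfolding H'_def by blast
      moreover from this have "c *v h = c *v x + b *v (c *v u)" using N(4)[OF c(1) b] by (simp add: mv.add_right)
      ultimately show "c *v h \<in> H'" using H(5)[OF c(1)] N(3)[OF c(1)] unfolding H'_def by blast
    qed
    ultimately show ?case using sub HU ne by blast
  qed
  from this[OF N(2)] show ?thesis by blast
qed

section \<open>Splitting off a common eigenvector by a small perturbation\<close>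

definition outer :: "real^'n \<Rightarrow> real^'n \<Rightarrow> real^'n^'n" where
  "outer v w = (\<chi> i j. v $ i * w $ j)"

lemma outer_mv: "outer v w *v u = (w \<bullet> u) *\<^sub>R v"
  by (simp add: outer_def matrix_vector_mult_def vec_eq_iff inner_vec_def sum_distrib_left sum_distrib_right mult_ac)

lemma hyperplane_section:
  fixes w :: "'a::euclidean_space"
  assumes "subspace U" "v \<in> U" "w \<bullet> v \<noteq> 0"
  shows "subspace {u\<in>U. w \<bullet> u = 0}" "dim {u\<in>U. w \<bullet> u = 0} < dim U" "dim U \<le> Suc (dim {u\<in>U. w \<bullet> u = 0})"
proof -
  let ?H = "{u\<in>U. w \<bullet> u = 0}"
  have eq: "?H = U \<inter> {u. w \<bullet> u = 0}" by auto
  show sub: "subspace ?H" unfolding eq by (intro subspace_inter assms subspace_hyperplane)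
  have "?H \<subset> U" using assms by auto
  then show "dim ?H < dim U" using sub assms(1) by (intro dim_psubset) (simp add: span_eq_iff[THEN iffD2])
  have "U \<subseteq> span (insert v ?H)"
  proof
    fix u assume u: "u \<in> U"
    have "u - ((w \<bullet> u) / (w \<bullet> v)) *\<^sub>R v \<in> ?H"
      using u assms by (auto intro!: subspace_diff subspace_scale simp: inner_diff_right)
    then show "u \<in> span (insert v ?H)" by (auto simp: span_insert intro: span_base)
  qed
  then have "dim U \<le> dim (insert v ?H)" using dim_subset by (metis dim_span)
  then show "dim U \<le> Suc (dim ?H)" by (auto simp: dim_insert split: if_splits)
qed

lemma approx_on_zero:
  assumes "subspace U" "\<And>b u. b \<in> S \<Longrightarrow> u \<in> U \<Longrightarrow> b *v u = 0"
  shows "approx_on U S"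
proof (rule approx_onI)
  fix \<epsilon> :: real assume "\<epsilon> > 0"
  obtain B where B: "B \<subseteq> U" "independent B" "span B = U"
    using basis_exists[of U] assms(1) by (metis span_eq_iff span_subspace)
  have "b *v u = 0 *\<^sub>R u" if "b \<in> S" "u \<in> B" for b u using assms(2) B(1) that by auto
  then show "\<exists>f B. independent B \<and> span B = U \<and>
     (\<forall>b\<in>S. norm (f b - b) \<le> \<epsilon> \<and> (\<forall>u\<in>B. \<exists>c. f b *v u = c *\<^sub>R u))"
    using B \<open>\<epsilon> > 0\<close> by (intro exI[of _ "\<lambda>b. b"] exI[of _ B]) auto
qed

text \<open>The common frame of the local constructions: \<open>F \<eta>\<close> tends to the
  identity as \<open>\<eta>\<close> decreases to 0, \<open>v \<eta>\<close> is a common eigenvector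
  of the perturbed family, and the hyperplane annihilated by \<open>w \<eta>\<close> is left to the
  induction hypothesis.\<close>

lemma nil_on_split:
  fixes U :: "(real^'n) set"
  assumes N: "nil_on U S"
    and IH: "\<And>(U' :: (real^'n) set) S'. nil_on U' S' \<Longrightarrow> dim U' < dim U \<Longrightarrow> approx_on U' S'"
    and F: "\<And>b. b \<in> S \<Longrightarrow> ((\<lambda>\<eta>. F \<eta> b) \<longlongrightarrow> b) (at_right (0::real))"
    and v: "\<And>\<eta>. \<eta> > 0 \<Longrightarrow> v \<eta> \<in> U \<and> w \<eta> \<bullet> v \<eta> = 1"
    and Fv: "\<And>\<eta> b. \<eta> > 0 \<Longrightarrow> b \<in> S \<Longrightarrow> \<exists>c. F \<eta> b *v v \<eta> = c *\<^sub>R v \<eta>"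
    and nil: "\<And>\<eta>. \<eta> > 0 \<Longrightarrow> nil_on {u\<in>U. w \<eta> \<bullet> u = 0} (F \<eta> ` S)"
  shows "approx_on U S"
proof (rule approx_on_split)
  show U: "subspace U" using nil_onD[OF N] by blast
  fix \<epsilon> :: real assume e: "\<epsilon> > 0"
  have "\<forall>\<^sub>F \<eta> in at_right 0. dist (F \<eta> b) b < \<epsilon>" if "b \<in> S" for b
    using F[OF that] e by (rule tendstoD)
  then have "\<forall>\<^sub>F \<eta> in at_right 0. \<forall>b\<in>S. dist (F \<eta> b) b < \<epsilon>"
    using nil_onD(2)[OF N] by (intro eventually_ball_finite) auto
  moreover have "\<forall>\<^sub>F \<eta> in at_right 0. \<eta> > (0::real)" by (rule eventually_at_right_less)
  ultimately have "\<forall>\<^sub>F \<eta> in at_right 0. (\<forall>b\<in>S. dist (F \<eta> b) b < \<epsilon>) \<and> \<eta> > (0::real)"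
    by (rule eventually_conj)
  then obtain \<eta> where h: "\<And>b. b\<in>S \<Longrightarrow> dist (F \<eta> b) b < \<epsilon>" "\<eta> > 0"
    using eventually_happens'[OF trivial_limit_at_right_real[of 0]] by blast
  have wv: "v \<eta> \<in> U" "w \<eta> \<bullet> v \<eta> = 1" using v[OF h(2)] by auto
  then have wv0: "w \<eta> \<bullet> v \<eta> \<noteq> 0" by simp
  note H = hyperplane_section[OF U wv(1) wv0]
  have A: "approx_on {u\<in>U. w \<eta> \<bullet> u = 0} (F \<eta> ` S)" by (rule IH[OF nil[OF h(2)] H(2)])
  have 1: "norm (F \<eta> b - b) \<le> \<epsilon>" if "b \<in> S" for b using h(1)[OF that] by (simp add: dist_norm)
  have 2: "v \<eta> \<notin> {u\<in>U. w \<eta> \<bullet> u = 0}" using wv by simp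
  show "\<exists>f v U2. (\<forall>b\<in>S. norm (f b - b) \<le> \<epsilon> \<and> (\<exists>c. f b *v v = c *\<^sub>R v)) \<and>
        v \<in> U \<and> subspace U2 \<and> v \<notin> U2 \<and> U2 \<subseteq> U \<and> dim U \<le> Suc (dim U2) \<and> approx_on U2 (f ` S)"
    by (rule exI[of _ "F \<eta>"], rule exI[of _ "v \<eta>"], rule exI[of _ "{u\<in>U. w \<eta> \<bullet> u = 0}"])
      (intro conjI ballI 1 Fv[OF h(2)] wv(1) H(1) H(3) A 2 Collect_restrict)
qed

text \<open>The hypotheses are symmetric under transposition: \<open>S\<close> sends
  \<open>v\<close> to \<open>z\<close> and \<open>z\<close> to 0, and on \<open>U\<close> the
  transposes send \<open>w\<close> to \<open>\<zeta>\<close> and \<open>\<zeta>\<close> to 0, with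
  the same coefficient \<open>\<phi>\<close>. Adding \<open>\<eta> \<phi>(b) v w^T\<close> turns
  \<open>v + z / \<eta>\<close> into an eigenvector and \<open>w + \<zeta> / \<eta>\<close> into an
  eigencovector, both with eigenvalue \<open>\<eta> \<phi>(b)\<close>.\<close>

lemma nil_on_rank_one_perturbation:
  fixes U :: "(real^'n) set"
  assumes N: "nil_on U S"
    and IH: "\<And>(U' :: (real^'n) set) S'. nil_on U' S' \<Longrightarrow> dim U' < dim U \<Longrightarrow> approx_on U' S'"
    and v: "v \<in> U" "z \<in> U" and wv: "w \<bullet> v = 1" and wz: "w \<bullet> z = 0" and zv: "\<zeta> \<bullet> v = 0" and zz: "\<zeta> \<bullet> z = 0"
    and a1: "\<And>b. b \<in> S \<Longrightarrow> b *v v = \<phi> b *\<^sub>R z"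
    and a2: "\<And>b. b \<in> S \<Longrightarrow> b *v z = 0"
    and a3: "\<And>b u. b \<in> S \<Longrightarrow> u \<in> U \<Longrightarrow> w \<bullet> (b *v u) = \<phi> b * (\<zeta> \<bullet> u)"
    and a4: "\<And>b u. b \<in> S \<Longrightarrow> u \<in> U \<Longrightarrow> \<zeta> \<bullet> (b *v u) = 0"
  shows "approx_on U S"
proof -
  note ND = nil_onD[OF N]
  define F where "F \<eta> b = b + (\<eta> * \<phi> b) *\<^sub>R outer v w" for \<eta> b
  have Fmv: "F \<eta> b *v u = b *v u + (\<eta> * \<phi> b * (w \<bullet> u)) *\<^sub>R v" for \<eta> b u
    by (simp add: F_def mv.add_left mv.scaleR_left outer_mv)
  show ?thesis
  proof (rule nil_on_split[OF N IH, where F=F and v="\<lambda>\<eta>. v + (1/\<eta>) *\<^sub>R z" and w="\<lambda>\<eta>. w + (1/\<eta>) *\<^sub>R \<zeta>"])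
    fix b assume "b \<in> S"
    have "((\<lambda>\<eta>. b + (\<eta> * \<phi> b) *\<^sub>R outer v w) \<longlongrightarrow> b + (0 * \<phi> b) *\<^sub>R outer v w) (at_right 0)"
      by (intro tendsto_intros)
    then show "((\<lambda>\<eta>. F \<eta> b) \<longlongrightarrow> b) (at_right 0)" by (simp add: F_def)
  next
    fix \<eta> :: real assume "\<eta> > 0"
    show "v + (1/\<eta>) *\<^sub>R z \<in> U \<and> (w + (1/\<eta>) *\<^sub>R \<zeta>) \<bullet> (v + (1/\<eta>) *\<^sub>R z) = 1"
      using v ND(1) wv wz zv zz by (simp add: subspace_add subspace_scale inner_add_left inner_add_right)
  next
    fix \<eta> :: real and b assume "\<eta> > 0" and b: "b \<in> S"
    then have "F \<eta> b *v (v + (1/\<eta>) *\<^sub>R z) = (\<eta> * \<phi> b) *\<^sub>R (v + (1/\<eta>) *\<^sub>R z)"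
      using wv wz by (simp add: Fmv mv.add_right mv.scaleR_right a1[OF b] a2[OF b] inner_add_right scaleR_add_right)
    then show "\<exists>c. F \<eta> b *v (v + (1/\<eta>) *\<^sub>R z) = c *\<^sub>R (v + (1/\<eta>) *\<^sub>R z)" ..
  next
    fix \<eta> :: real assume h: "\<eta> > 0"
    define U2 where "U2 = {u\<in>U. (w + (1/\<eta>) *\<^sub>R \<zeta>) \<bullet> u = 0}"
    have U2: "u \<in> U" "\<eta> * (w \<bullet> u) = - (\<zeta> \<bullet> u)" if "u \<in> U2" for u
      using that h by (auto simp: U2_def inner_add_left field_simps)
    have Fu: "F \<eta> b *v u = b *v u - (\<phi> b * (\<zeta> \<bullet> u)) *\<^sub>R v" if "u \<in> U2" for u b
    proof -
      have "\<eta> * \<phi> b * (w \<bullet> u) = - (\<phi> b * (\<zeta> \<bullet> u))" using U2(2)[OF that] by (metis mult.assoc mult.commute mult_minus_right)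
      then show ?thesis by (simp add: Fmv)
    qed
    have inv: "F \<eta> b *v u \<in> U2" if b: "b \<in> S" and u: "u \<in> U2" for b u
    proof -
      have "(w + (1/\<eta>) *\<^sub>R \<zeta>) \<bullet> (F \<eta> b *v u) = 0"
        by (simp add: Fu[OF u] inner_diff_right inner_add_left a3[OF b U2(1)[OF u]] a4[OF b U2(1)[OF u]] wv zv)
      moreover have "F \<eta> b *v u \<in> U" using ND(1) v(1) ND(3)[OF b U2(1)[OF u]] by (simp add: Fu[OF u] subspace_diff subspace_scale)
      ultimately show ?thesis by (simp add: U2_def)
    qed
    have zF: "\<zeta> \<bullet> (F \<eta> b *v u) = 0" if b: "b \<in> S" and u: "u \<in> U2" for b u
      by (simp add: Fu[OF u] inner_diff_right a4[OF b U2(1)[OF u]] zv)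
    \<comment> \<open>The correction term is symmetric in \<open>b\<close> and \<open>c\<close>, so
      commutation survives on the hyperplane.\<close>
    have two: "F \<eta> b *v (F \<eta> c *v u) = b *v (c *v u) - (\<phi> b * \<phi> c * (\<zeta> \<bullet> u)) *\<^sub>R z"
      if b: "b \<in> S" and c: "c \<in> S" and u: "u \<in> U2" for b c u
    proof -
      have "F \<eta> b *v (F \<eta> c *v u) = b *v (F \<eta> c *v u)"
        by (simp only: Fu[OF inv[OF c u]] zF[OF c u]) simp
      then show ?thesis by (simp add: Fu[OF u] mv.diff_right mv.scaleR_right a1[OF b] mult_ac)
    qed
    have "nil_on U2 (F \<eta> ` S)"
      unfolding nil_on_def ball_simps
    proof (intro conjI ballI)
      have "U2 = U \<inter> {u. (w + (1/\<eta>) *\<^sub>R \<zeta>) \<bullet> u = 0}" by (auto simp: U2_def)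
      then show "subspace U2" by (simp only: subspace_inter[OF ND(1) subspace_hyperplane])
      show "finite (F \<eta> ` S)" using ND(2) by simp
      show "F \<eta> b *v u \<in> U2" if "b \<in> S" "u \<in> U2" for b u using inv that .
      show "F \<eta> b *v (F \<eta> c *v u) = F \<eta> c *v (F \<eta> b *v u)" if "b \<in> S" "c \<in> S" "u \<in> U2" for b c u
        using that ND(4)[OF that(1,2) U2(1)[OF that(3)]] by (simp add: two)
      fix b assume b: "b \<in> S"
      obtain k where k: "\<forall>u\<in>U. ((*v) b ^^ k) u = 0" using ND(5)[OF b] by (elim exE)
      \<comment> \<open>Values of \<open>F \<eta> b\<close> on the hyperplane are annihilated by
        \<open>\<zeta>\<close>, so only the first factor contributes a correction, a multiple of
        \<open>v\<close>. The next factor \<open>b\<close> moves it to a multiple of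
        \<open>z\<close> and the third one to 0.\<close>
      have three: "((*v) (F \<eta> b) ^^ (j + 3)) u = ((*v) b ^^ (j + 3)) u" if u: "u \<in> U2" for u j
      proof (induction j)
        case 0
        have "F \<eta> b *v (F \<eta> b *v (F \<eta> b *v u)) = b *v (F \<eta> b *v (F \<eta> b *v u))"
          by (subst Fu[OF inv[OF b inv[OF b u]]]) (simp add: zF[OF b inv[OF b u]])
        then show ?case by (simp add: two[OF b b u] mv.diff_right mv.scaleR_right a2[OF b] numeral_3_eq_3)
      next
        case (Suc j)
        let ?y = "((*v) (F \<eta> b) ^^ (j + 3)) u"
        have y: "?y \<in> U2" using funpow_invariant[of U2 "F \<eta> b" u] inv[OF b] u by auto
        have "?y = F \<eta> b *v (((*v) (F \<eta> b) ^^ (j + 2)) u)" by (simp add: numeral_3_eq_3 numeral_2_eq_2)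
        moreover have "((*v) (F \<eta> b) ^^ (j + 2)) u \<in> U2" using funpow_invariant[of U2 "F \<eta> b" u] inv[OF b] u by auto
        ultimately have "\<zeta> \<bullet> ?y = 0" using zF[OF b] by metis
        then have "F \<eta> b *v ?y = b *v ?y" by (simp add: Fu[OF y])
        then show ?case unfolding add_Suc funpow.simps o_apply using Suc by simp
      qed
      have "((*v) (F \<eta> b) ^^ (k + 3)) u = 0" if u: "u \<in> U2" for u
      proof -
        have "((*v) b ^^ (k + 3)) u = ((*v) b ^^ 3) (((*v) b ^^ k) u)"
          using funpow_split[of k "k + 3" "(*v) b" u] by simp
        then show ?thesis using k U2(1)[OF u] three[OF u] by simp
      qed
      then show "\<exists>k. \<forall>u\<in>U2. ((*v) (F \<eta> b) ^^ k) u = 0" by blast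
    qed
    then show "nil_on {u \<in> U. (w + (1/\<eta>) *\<^sub>R \<zeta>) \<bullet> u = 0} (F \<eta> ` S)" by (simp add: U2_def)
  qed
qed

lemma nil_eigenvalue_zero:
  fixes b :: "real^'n^'n"
  assumes "((*v) b ^^ k) u = 0" "b *v u = c *\<^sub>R u" "u \<noteq> 0"
  shows "c = 0"
proof -
  have "((*v) b ^^ j) u = c ^ j *\<^sub>R u" for j
    by (induction j) (simp_all add: assms(2) mv.scaleR_right)
  then show ?thesis using assms by simp
qed

text \<open>The case \<open>\<zeta> = 0\<close>: a covector that vanishes on \<open>H\<close> and is
  1 at \<open>v\<close> annihilates all images.\<close>

lemma nil_on_approx_line_image:
  fixes U :: "(real^'n) set"
  assumes N: "nil_on U S"
    and IH: "\<And>(U' :: (real^'n) set) S'. nil_on U' S' \<Longrightarrow> dim U' < dim U \<Longrightarrow> approx_on U' S'"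
    and H: "subspace H" "\<And>b u. b \<in> S \<Longrightarrow> u \<in> U \<Longrightarrow> b *v u \<in> H"
    and v: "v \<in> U" "v \<notin> H" and z: "z \<in> H" "z \<in> U"
    and bv: "\<And>b. b \<in> S \<Longrightarrow> \<exists>c. b *v v = c *\<^sub>R z" "\<And>b. b \<in> S \<Longrightarrow> b *v z = 0"
  shows "approx_on U S"
proof -
  obtain w where w: "w \<bullet> v = 1" "\<And>h. h \<in> H \<Longrightarrow> w \<bullet> h = 0" using dual_vector[OF H(1) v(2)] by auto
  define \<phi> where "\<phi> b = (SOME c. b *v v = c *\<^sub>R z)" for b
  have \<phi>: "b *v v = \<phi> b *\<^sub>R z" if "b \<in> S" for b
    unfolding \<phi>_def by (rule someI_ex[OF bv(1)[OF that]])
  show ?thesis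
    by (rule nil_on_rank_one_perturbation[OF N IH v(1) z(2) w(1) w(2)[OF z(1)], where \<zeta>=0 and \<phi>=\<phi>])
      (simp_all add: \<phi> bv(2) w(2) H(2))
qed

text \<open>The dual case \<open>z = 0\<close>: every \<open>b\<close> factors through
  \<open>\<zeta>\<close>, and a nonzero vector of the hyperplane \<open>\<zeta> = 0\<close>, which
  exists in dimension at least 2, serves as \<open>v\<close>.\<close>

lemma nil_on_approx_hyperplane_kernel:
  fixes U :: "(real^'n) set"
  assumes N: "nil_on U S"
    and IH: "\<And>(U' :: (real^'n) set) S'. nil_on U' S' \<Longrightarrow> dim U' < dim U \<Longrightarrow> approx_on U' S'"
    and ker: "\<And>b u. b \<in> S \<Longrightarrow> u \<in> U \<Longrightarrow> \<zeta> \<bullet> u = 0 \<Longrightarrow> b *v u = 0"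
    and d: "dim U \<ge> 2"
  shows "approx_on U S"
proof (cases "\<forall>u\<in>U. \<zeta> \<bullet> u = 0")
  case True
  then show ?thesis using ker nil_onD(1)[OF N] by (intro approx_on_zero) auto
next
  case False
  note ND = nil_onD[OF N]
  from False obtain u1 where u1: "u1 \<in> U" "\<zeta> \<bullet> u1 \<noteq> 0" by blast
  define u0 where "u0 = (1 / (\<zeta> \<bullet> u1)) *\<^sub>R u1"
  have u0: "u0 \<in> U" "\<zeta> \<bullet> u0 = 1" using u1 ND(1) by (simp_all add: u0_def subspace_scale)
  have bu: "b *v u = (\<zeta> \<bullet> u) *\<^sub>R (b *v u0)" if "b \<in> S" "u \<in> U" for b u
  proof -
    have "b *v (u - (\<zeta> \<bullet> u) *\<^sub>R u0) = 0"
      using that u0 ND(1) by (intro ker) (auto simp: subspace_diff subspace_scale inner_diff_right)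
    then show ?thesis by (simp add: mv.diff_right mv.scaleR_right)
  qed
  \<comment> \<open>If nonzero, \<open>b u0\<close> is an eigenvector of \<open>b\<close> with this
    number as eigenvalue, and nilpotency makes it 0.\<close>
  have z0: "\<zeta> \<bullet> (b *v u0) = 0" if b: "b \<in> S" for b
  proof (cases "b *v u0 = 0")
    case False
    obtain k where k: "\<forall>u\<in>U. ((*v) b ^^ k) u = 0" using ND(5)[OF b] by (elim exE)
    show ?thesis
      by (rule nil_eigenvalue_zero[OF k[rule_format] bu[OF b]]) (use False ND(3)[OF b u0(1)] in auto)
  qed simp
  have "dim {u\<in>U. \<zeta> \<bullet> u = 0} \<noteq> 0" using hyperplane_section(3)[OF ND(1) u1] d by linarith
  then have "\<not> {u\<in>U. \<zeta> \<bullet> u = 0} \<subseteq> {0}" using dim_eq_0 by metis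
  then obtain v where v: "v \<in> U" "\<zeta> \<bullet> v = 0" "v \<noteq> 0" by auto
  define w where "w = (1 / (v \<bullet> v)) *\<^sub>R v"
  have w: "w \<bullet> v = 1" using v by (simp add: w_def)
  show ?thesis
  proof (rule nil_on_rank_one_perturbation[OF N IH v(1) _ w, where z=0 and \<zeta>=\<zeta> and \<phi>="\<lambda>b. w \<bullet> (b *v u0)"])
    fix b u assume b: "b \<in> S" and u: "u \<in> U"
    show "w \<bullet> (b *v u) = w \<bullet> (b *v u0) * (\<zeta> \<bullet> u)" by (subst bu[OF b u]) simp
    show "\<zeta> \<bullet> (b *v u) = 0" by (subst bu[OF b u]) (simp add: z0[OF b])
  qed (use v ND(1) ker in \<open>auto simp: subspace_0\<close>)
qed

primrec mpow :: "real^'n^'n \<Rightarrow> nat \<Rightarrow> real^'n^'n" where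
  "mpow x 0 = mat 1"
| "mpow x (Suc i) = x ** mpow x i"

lemma mpow_mv: "mpow x i *v u = ((*v) x ^^ i) u"
  by (induction i) (simp_all add: matrix_vector_mul_assoc[symmetric])

lemma tendsto_mpow: "(f \<longlongrightarrow> x) F \<Longrightarrow> ((\<lambda>t. mpow (f t) i) \<longlongrightarrow> mpow x i) F"
  by (induction i) (auto intro: mm.tendsto)

lemma nil_on_restrict:
  fixes U :: "(real^'n) set" and F :: "real^'n^'n \<Rightarrow> real^'n^'n"
  assumes N: "nil_on U S" and U2: "subspace U2" "U2 \<subseteq> U"
    and F: "\<And>b u. b \<in> S \<Longrightarrow> u \<in> U2 \<Longrightarrow> F b *v u = b *v u"
    and inv: "\<And>b u. b \<in> S \<Longrightarrow> u \<in> U2 \<Longrightarrow> b *v u \<in> U2"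
  shows "nil_on U2 (F ` S)"
  unfolding nil_on_def ball_simps
proof (intro conjI ballI)
  note ND = nil_onD[OF N]
  show "subspace U2" by fact
  show "finite (F ` S)" using ND(2) by simp
  show "F b *v u \<in> U2" if "b \<in> S" "u \<in> U2" for b u using that by (simp add: F inv)
  show "F b *v (F c *v u) = F c *v (F b *v u)" if "b \<in> S" "c \<in> S" "u \<in> U2" for b c u
    using that U2 ND(4)[of b c u] by (auto simp: F inv)
  fix b assume b: "b \<in> S"
  obtain k where k: "\<forall>u\<in>U. ((*v) b ^^ k) u = 0" using ND(5)[OF b] by (elim exE)
  have "((*v) (F b) ^^ j) u = ((*v) b ^^ j) u \<and> ((*v) b ^^ j) u \<in> U2" if "u \<in> U2" for u j
    using that b by (induction j) (auto simp: F inv)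
  then have "\<forall>u\<in>U2. ((*v) (F b) ^^ k) u = 0" using k U2 by auto
  then show "\<exists>k. \<forall>u\<in>U2. ((*v) (F b) ^^ k) u = 0" ..
qed

text \<open>On \<open>U\<close>, \<open>x\<close> is a single Jordan block, so every
  \<open>b\<close> commuting with it is a polynomial in \<open>x\<close>. The change
  \<open>X \<eta> = x + \<eta> v w^T\<close> creates the eigenvalue \<open>\<eta>\<close> and agrees
  with \<open>x\<close> on the part \<open>x U\<close> of \<open>U\<close> annihilated by
  \<open>w\<close>. Replacing \<open>x\<close> by \<open>X \<eta>\<close> in the polynomials
  perturbs the whole family.\<close>

lemma nil_on_approx_regular:
  fixes U :: "(real^'n) set"
  assumes N: "nil_on U S"
    and IH: "\<And>(U' :: (real^'n) set) S'. nil_on U' S' \<Longrightarrow> dim U' < dim U \<Longrightarrow> approx_on U' S'"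
    and x: "x \<in> S" and v: "v \<in> U" "((*v) x ^^ m) v \<noteq> 0" and m: "dim U = Suc m"
  shows "approx_on U S"
proof -
  note ND = nil_onD[OF N]
  obtain k where k: "\<forall>u\<in>U. ((*v) x ^^ k) u = 0" using ND(5)[OF x] by (elim exE)
  have top: "((*v) x ^^ Suc m) u = 0" if "u \<in> U" for u
    using nilpotent_funpow_dim[OF ND(1) ND(3)[OF x] that] k that m by auto
  define e where "e i = ((*v) x ^^ i) v" for i
  have eU: "e i \<in> U" for i unfolding e_def using funpow_invariant[of U x v i] ND(3)[OF x] v(1) by auto
  have eS: "x *v e i = e (Suc i)" for i by (simp add: e_def)
  have ez: "e (Suc m) = 0" using top[OF v(1)] by (simp add: e_def)
  have ind: "indep_fam (Suc m) e"
    unfolding e_def[abs_def] by (rule chain_indep_fam[OF v(2) top[OF v(1)]])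
  obtain d where d: "\<And>i j. i < Suc m \<Longrightarrow> j < Suc m \<Longrightarrow> d i \<bullet> e j = (if i = j then 1 else 0)"
    and rep: "\<And>u. u \<in> U \<Longrightarrow> u = (\<Sum>i<Suc m. (d i \<bullet> u) *\<^sub>R e i)"
    by (rule dual_family[OF ind ND(1) m eU]) (rule that)
  define w where "w = d 0"
  have w0: "w \<bullet> v = 1" using d[of 0 0] by (simp add: w_def e_def)
  have wS: "w \<bullet> e (Suc i) = 0" if "i < Suc m" for i
    using d[of 0 "Suc i"] ez that by (cases "i = m") (auto simp: w_def)
  have wx: "w \<bullet> (x *v u) = 0" if "u \<in> U" for u
  proof -
    have "x *v u = (\<Sum>i<Suc m. (d i \<bullet> u) *\<^sub>R e (Suc i))"
      by (subst rep[OF that]) (simp add: mv.sum_right mv.scaleR_right eS del: sum.lessThan_Suc)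
    then show ?thesis using wS by (simp add: inner_sum_right del: sum.lessThan_Suc)
  qed
  define c where "c b i = d i \<bullet> (b *v v)" for b i
  \<comment> \<open>\<open>b v\<close> is a combination of the vectors \<open>x^i v\<close>, and
    commutation with \<open>x\<close> carries this expression from \<open>v\<close> to all of
    \<open>U\<close>.\<close>
  have bu: "b *v u = (\<Sum>i<Suc m. c b i *\<^sub>R ((*v) x ^^ i) u)" if b: "b \<in> S" and u: "u \<in> U" for b u
  proof -
    have comm: "b *v e j = ((*v) x ^^ j) (b *v v)" for j
    proof (induction j)
      case 0 then show ?case by (simp add: e_def)
    next
      case (Suc j)
      have "b *v e (Suc j) = x *v (b *v e j)" using ND(4)[OF b x eU[of j]] by (simp add: eS)
      then show ?case using Suc by simp
    qed
    have bv: "b *v v = (\<Sum>i<Suc m. c b i *\<^sub>R e i)"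
      unfolding c_def by (rule rep[OF ND(3)[OF b v(1)]])
    have "b *v e j = (\<Sum>i<Suc m. c b i *\<^sub>R ((*v) x ^^ i) (e j))" for j
    proof -
      have "((*v) x ^^ j) (e i) = ((*v) x ^^ i) (e j)" for i
        unfolding e_def by (metis add.commute comp_apply funpow_add)
      then show ?thesis
        unfolding comm bv linear_sum[OF linear_funpow_mv] linear_scale[OF linear_funpow_mv] by simp
    qed
    then have "b *v (\<Sum>j<Suc m. (d j \<bullet> u) *\<^sub>R e j)
        = (\<Sum>j<Suc m. (d j \<bullet> u) *\<^sub>R (\<Sum>i<Suc m. c b i *\<^sub>R ((*v) x ^^ i) (e j)))"
      by (simp only: mv.sum_right mv.scaleR_right)
    also have "\<dots> = (\<Sum>i<Suc m. \<Sum>j<Suc m. (d j \<bullet> u) *\<^sub>R c b i *\<^sub>R ((*v) x ^^ i) (e j))"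
      unfolding scaleR_sum_right by (rule sum.swap)
    also have "\<dots> = (\<Sum>i<Suc m. c b i *\<^sub>R ((*v) x ^^ i) (\<Sum>j<Suc m. (d j \<bullet> u) *\<^sub>R e j))"
      by (simp only: linear_sum[OF linear_funpow_mv] linear_scale[OF linear_funpow_mv] scaleR_sum_right
          scaleR_left_commute)
    finally show ?thesis using rep[OF u] by simp
  qed
  define X where "X \<eta> = x + \<eta> *\<^sub>R outer v w" for \<eta>
  have Xmv: "X \<eta> *v u = x *v u + (\<eta> * (w \<bullet> u)) *\<^sub>R v" for \<eta> u
    by (simp add: X_def mv.add_left mv.scaleR_left outer_mv)
  \<comment> \<open>\<open>b\<close> equals the polynomial in \<open>x\<close> only on
    \<open>U\<close>; therefore the difference of the two polynomials is added to
    \<open>b\<close>.\<close>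
  define F where "F \<eta> b = b + (\<Sum>i<Suc m. c b i *\<^sub>R (mpow (X \<eta>) i - mpow x i))" for \<eta> b
  have Fmv: "F \<eta> b *v u = (\<Sum>i<Suc m. c b i *\<^sub>R ((*v) (X \<eta>) ^^ i) u)" if "b \<in> S" "u \<in> U" for \<eta> b u
    unfolding F_def
    by (simp add: mv.add_left mv.sum_left mv.scaleR_left mv.diff_left mpow_mv bu[OF that] scaleR_diff_right sum_subtractf
        del: sum.lessThan_Suc)
  \<comment> \<open>The eigenvector of \<open>X \<eta>\<close> for \<open>\<eta>\<close>:
    \<open>x\<close> shifts the sum by one place, and the rank-one term restores the summand with
    index 0.\<close>
  define V where "V \<eta> = (\<Sum>i<Suc m. (1 / \<eta> ^ i) *\<^sub>R e i)" for \<eta> :: real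
  have VU: "V \<eta> \<in> U" for \<eta> unfolding V_def using eU ND(1) by (intro subspace_sum subspace_scale) auto
  have wV: "w \<bullet> V \<eta> = 1" for \<eta>
  proof -
    have "w \<bullet> V \<eta> = (\<Sum>i<Suc m. (1 / \<eta> ^ i) * (w \<bullet> e i))"
      by (simp add: V_def inner_sum_right del: sum.lessThan_Suc)
    also have "\<dots> = w \<bullet> e 0 + (\<Sum>i<m. (1 / \<eta> ^ Suc i) * (w \<bullet> e (Suc i)))"
      unfolding sum.lessThan_Suc_shift by simp
    also have "\<dots> = 1" using w0 wS by (simp add: e_def[of 0])
    finally show ?thesis .
  qed
  have XV: "X \<eta> *v V \<eta> = \<eta> *\<^sub>R V \<eta>" if h: "\<eta> > 0" for \<eta>
  proof -
    have "x *v V \<eta> = (\<Sum>i<Suc m. (1 / \<eta> ^ i) *\<^sub>R e (Suc i))"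
      by (simp add: V_def mv.sum_right mv.scaleR_right eS del: sum.lessThan_Suc)
    also have "\<dots> = (\<Sum>i<m. (1 / \<eta> ^ i) *\<^sub>R e (Suc i))" by (simp add: ez)
    also have "\<dots> = \<eta> *\<^sub>R (\<Sum>i<m. (1 / \<eta> ^ Suc i) *\<^sub>R e (Suc i))"
      using h by (simp add: scaleR_sum_right)
    finally have "X \<eta> *v V \<eta> = \<eta> *\<^sub>R ((\<Sum>i<m. (1 / \<eta> ^ Suc i) *\<^sub>R e (Suc i)) + v)"
      by (simp only: Xmv wV scaleR_add_right mult_1_right)
    also have "(\<Sum>i<m. (1 / \<eta> ^ Suc i) *\<^sub>R e (Suc i)) + v = V \<eta>"
      unfolding V_def sum.lessThan_Suc_shift by (simp add: e_def)
    finally show ?thesis .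
  qed
  have XU2: "((*v) (X \<eta>) ^^ i) u = ((*v) x ^^ i) u \<and> w \<bullet> (((*v) x ^^ i) u) = 0" if u: "u \<in> U" "w \<bullet> u = 0" for \<eta> u i
  proof (induction i)
    case (Suc i)
    moreover have "((*v) x ^^ i) u \<in> U" using funpow_invariant[of U x u i] ND(3)[OF x] u by auto
    ultimately show ?case by (simp add: Xmv wx)
  qed (use u in simp)
  show ?thesis
  proof (rule nil_on_split[OF N IH, where F=F and v=V and w="\<lambda>\<eta>. w"])
    fix b assume "b \<in> S"
    have "(X \<longlongrightarrow> x + 0 *\<^sub>R outer v w) (at_right 0)" unfolding X_def[abs_def] by (intro tendsto_intros)
    then have "(X \<longlongrightarrow> x) (at_right 0)" by simp
    then have "((\<lambda>\<eta>. F \<eta> b) \<longlongrightarrow> b + (\<Sum>i<Suc m. c b i *\<^sub>R (mpow x i - mpow x i))) (at_right 0)"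
      unfolding F_def by (intro tendsto_intros tendsto_mpow)
    then show "((\<lambda>\<eta>. F \<eta> b) \<longlongrightarrow> b) (at_right 0)" by simp
  next
    fix \<eta> :: real assume "\<eta> > 0" show "V \<eta> \<in> U \<and> w \<bullet> V \<eta> = 1" using VU wV by simp
  next
    fix \<eta> :: real and b assume h: "\<eta> > 0" and b: "b \<in> S"
    have "((*v) (X \<eta>) ^^ i) (V \<eta>) = \<eta> ^ i *\<^sub>R V \<eta>" for i
      by (induction i) (simp_all add: mv.scaleR_right XV[OF h])
    then have "F \<eta> b *v V \<eta> = (\<Sum>i<Suc m. c b i * \<eta> ^ i) *\<^sub>R V \<eta>"
      by (simp add: Fmv[OF b VU] scaleR_sum_left del: sum.lessThan_Suc)
    then show "\<exists>c. F \<eta> b *v V \<eta> = c *\<^sub>R V \<eta>" ..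
  next
    fix \<eta> :: real assume h: "\<eta> > 0"
    show "nil_on {u \<in> U. w \<bullet> u = 0} (F \<eta> ` S)"
    proof (rule nil_on_restrict[OF N])
      have "{u \<in> U. w \<bullet> u = 0} = U \<inter> {u. w \<bullet> u = 0}" by auto
      then show "subspace {u \<in> U. w \<bullet> u = 0}" by (simp only: subspace_inter[OF ND(1) subspace_hyperplane])
      show "F \<eta> b *v u = b *v u" if "b \<in> S" "u \<in> {u \<in> U. w \<bullet> u = 0}" for b u
        using that XU2 by (simp add: Fmv bu del: sum.lessThan_Suc)
      show "b *v u \<in> {u \<in> U. w \<bullet> u = 0}" if "b \<in> S" "u \<in> {u \<in> U. w \<bullet> u = 0}" for b u
      proof -
        have "w \<bullet> (b *v u) = 0" using that XU2 by (simp add: bu inner_sum_right del: sum.lessThan_Suc)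
        then show ?thesis using that ND(3)[of b u] by simp
      qed
    qed auto
  qed
qed

section \<open>Nilpotent families on four-dimensional spaces\<close>

lemma indep_fam_cong: "(\<And>i. i < m \<Longrightarrow> e i = e' i) \<Longrightarrow> indep_fam m e \<longleftrightarrow> indep_fam m e'"
  unfolding indep_fam_def by (simp cong: sum.cong_simp)

lemma indep_fam_extend_upto:
  fixes U :: "'a::euclidean_space set"
  assumes "indep_fam m e" "\<And>i. i < m \<Longrightarrow> e i \<in> U" "m \<le> k" "k \<le> dim U"
  shows "\<exists>e'. indep_fam k e' \<and> (\<forall>i<m. e' i = e i) \<and> (\<forall>i<k. e' i \<in> U)"
  using assms(3,4)
proof (induction k rule: dec_induct)
  case base
  then show ?case using assms by blast
next
  case (step k)
  then obtain e' where e': "indep_fam k e'" "\<forall>i<m. e' i = e i" "\<forall>i<k. e' i \<in> U" by auto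
  obtain g where g: "g \<in> U" "g \<notin> span (e' ` {..<k})"
    using indep_fam_extend[of k U e'] step by auto
  define h where "h = e'(k := g)"
  have "indep_fam (Suc k) h"
  proof (rule indep_fam_Suc)
    show "indep_fam k h" using e'(1) indep_fam_cong[of k h e'] by (simp add: h_def)
    have "h ` {..<k} = e' ` {..<k}" by (auto simp: h_def)
    then show "h k \<notin> span (h ` {..<k})" using g by (simp add: h_def)
  qed
  moreover have "(\<forall>i<m. h i = e i) \<and> (\<forall>i<Suc k. h i \<in> U)"
    using e' g step by (auto simp: h_def less_Suc_eq)
  ultimately show ?case by blast
qed

lemma sum4: "(\<Sum>i<4. f i) = f 0 + f 1 + f 2 + (f (3::nat) :: 'a::comm_monoid_add)"
  by (simp add: eval_nat_numeral add.assoc)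

declare One_nat_def [simp del]

text \<open>\<open>x\<close> has Jordan blocks of sizes 3 and 1. In a basis \<open>v\<close>,
  \<open>x v\<close>, \<open>x^2 v\<close>, \<open>f\<close> with \<open>x f = 0\<close>,
  commutation and nilpotency leave each \<open>b\<close> so few entries that the rank-one
  perturbation applies, with \<open>x v\<close> and \<open>x^2 v\<close> in the roles of
  \<open>v\<close> and \<open>z\<close>.\<close>

lemma nil_on_approx_4_square:
  fixes U :: "(real^'n) set"
  assumes N: "nil_on U S"
    and IH: "\<And>(U' :: (real^'n) set) S'. nil_on U' S' \<Longrightarrow> dim U' < dim U \<Longrightarrow> approx_on U' S'"
    and x: "x \<in> S" and v: "v \<in> U" "x *v (x *v v) \<noteq> 0" and x3: "\<And>u. u \<in> U \<Longrightarrow> x *v (x *v (x *v u)) = 0"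
    and d4: "dim U = 4"
  shows "approx_on U S"
proof -
  note ND = nil_onD[OF N]
  note sU = subspace_add[OF ND(1)] subspace_diff[OF ND(1)] subspace_scale[OF ND(1)]
  define e where "e i = ((*v) x ^^ i) v" for i
  have e: "e 0 = v" "e 1 = x *v v" "e 2 = x *v (x *v v)" by (simp_all add: e_def numeral_2_eq_2 One_nat_def)
  have eU: "v \<in> U" "x *v v \<in> U" "x *v (x *v v) \<in> U" using v ND(3)[OF x] by auto
  have ind3: "indep_fam 3 e"
    unfolding e_def[abs_def] numeral_3_eq_3 by (rule chain_indep_fam) (use v x3 in \<open>simp_all\<close>)
  have eU3: "e i \<in> U" if "i < 3" for i
  proof -
    have "i = 0 \<or> i = 1 \<or> i = 2" using that by arith
    then show ?thesis using eU e by auto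
  qed
  obtain E where E: "indep_fam 4 E" "\<forall>i<3. E i = e i" "\<forall>i<4. E i \<in> U"
    using indep_fam_extend_upto[OF ind3 eU3, of 4] d4 by auto
  define g where "g = E 3"
  have Ev: "E 0 = v" "E 1 = x *v v" "E 2 = x *v (x *v v)" using E(2) e by auto
  have gU: "g \<in> U" using E(3) by (simp add: g_def)
  obtain a where a: "\<And>i j. i < 4 \<Longrightarrow> j < 4 \<Longrightarrow> a i \<bullet> E j = (if i = j then 1 else 0)"
    and arep: "\<And>u. u \<in> U \<Longrightarrow> u = (\<Sum>i<4. (a i \<bullet> u) *\<^sub>R E i)"
    by (rule dual_family[OF E(1) ND(1) d4 E(3)[rule_format]], assumption, rule that)
  have arep': "u = (a 0 \<bullet> u) *\<^sub>R v + (a 1 \<bullet> u) *\<^sub>R (x *v v) + (a 2 \<bullet> u) *\<^sub>R (x *v (x *v v)) + (a 3 \<bullet> u) *\<^sub>R g"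
    if "u \<in> U" for u using arep[OF that] unfolding sum4 Ev g_def[symmetric] .
  obtain p q r s where xg: "x *v g = p *\<^sub>R v + q *\<^sub>R (x *v v) + r *\<^sub>R (x *v (x *v v)) + s *\<^sub>R g"
    by (rule that[OF arep'[OF ND(3)[OF x gU]]])
  have aE: "a 3 \<bullet> v = 0" "a 3 \<bullet> (x *v v) = 0" "a 3 \<bullet> (x *v (x *v v)) = 0" "a 3 \<bullet> g = 1"
    using a[of 3 0] a[of 3 1] a[of 3 2] a[of 3 3] Ev by (simp_all add: g_def)
  note lin = mv.add_right mv.scaleR_right mv.diff_right inner_add_right inner_diff_right
  have x3v: "x *v (x *v (x *v v)) = 0" using x3 v(1) by blast
  \<comment> \<open>\<open>s\<close> is the factor by which \<open>x\<close> acts modulo the chain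
    of \<open>v\<close>, so \<open>x^3 = 0\<close> kills it. Then \<open>x^3 g = p x^2 v\<close>
    kills \<open>p\<close>.\<close>
  have "a 3 \<bullet> (x *v (x *v (x *v g))) = s * s * s" by (simp add: xg lin x3v aE)
  then have s: "s = 0" using x3[OF gU] by simp
  have "x *v (x *v (x *v g)) = p *\<^sub>R (x *v (x *v v))" by (simp add: xg lin x3v s)
  then have p: "p = 0" using x3[OF gU] v(2) by simp
  \<comment> \<open>What remains of \<open>x g\<close> is the image under \<open>x\<close> of
    \<open>q v + r x v\<close>, which is subtracted.\<close>
  define f where "f = g - q *\<^sub>R v - r *\<^sub>R (x *v v)"
  have xf: "x *v f = 0" by (simp add: f_def lin xg p s)
  have fU: "f \<in> U" unfolding f_def using gU eU by (intro sU) auto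
  define G where "G = E(3 := f)"
  have G: "G 0 = v" "G 1 = x *v v" "G 2 = x *v (x *v v)" "G 3 = f" by (simp_all add: G_def Ev)
  have Gind: "indep_fam 4 G"
    unfolding indep_fam_def
  proof (intro allI impI)
    fix c :: "nat \<Rightarrow> real" and i :: nat
    assume z: "(\<Sum>i<4. c i *\<^sub>R G i) = 0" and i: "i < 4"
    \<comment> \<open>The coordinates, with respect to \<open>E\<close>, of a combination of
      \<open>G\<close>.\<close>
    define c' where "c' = c(0 := c 0 - q * c 3, 1 := c 1 - r * c 3)"
    have "(\<Sum>i<4. c' i *\<^sub>R E i) = (\<Sum>i<4. c i *\<^sub>R G i)"
      by (simp add: sum4 G Ev c'_def f_def g_def[symmetric] algebra_simps)
    then have "c' i = 0" if "i < 4" for i using indep_famD[OF E(1) _ that] z by metis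
    from this[of 0] this[of 1] this[of 2] this[of 3]
    have "c 0 = 0" "c 1 = 0" "c 2 = 0" "c 3 = 0" by (auto simp: c'_def)
    moreover have "i = 0 \<or> i = 1 \<or> i = 2 \<or> i = 3" using i by auto
    ultimately show "c i = 0" by auto
  qed
  have GU: "G i \<in> U" if "i < 4" for i using that E(3) fU by (auto simp: G_def)
  obtain d where d: "\<And>i j. i < 4 \<Longrightarrow> j < 4 \<Longrightarrow> d i \<bullet> G j = (if i = j then 1 else 0)"
    and rep0: "\<And>u. u \<in> U \<Longrightarrow> u = (\<Sum>i<4. (d i \<bullet> u) *\<^sub>R G i)"
    by (rule dual_family[OF Gind ND(1) d4 GU], assumption, rule that)
  have rep: "u = (d 0 \<bullet> u) *\<^sub>R v + (d 1 \<bullet> u) *\<^sub>R (x *v v) + (d 2 \<bullet> u) *\<^sub>R (x *v (x *v v)) + (d 3 \<bullet> u) *\<^sub>R f"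
    if "u \<in> U" for u using rep0[OF that] unfolding sum4 G .
  have dG: "d i \<bullet> v = (if i = 0 then 1 else 0)" "d i \<bullet> (x *v v) = (if i = 1 then 1 else 0)"
    "d i \<bullet> (x *v (x *v v)) = (if i = 2 then 1 else 0)" "d i \<bullet> f = (if i = 3 then 1 else 0)" if "i < 4" for i
    using d[OF that, of 0] d[OF that, of 1] d[OF that, of 2] d[OF that, of 3] by (simp_all add: G)
  have key: "d 0 \<bullet> (b *v v) = 0" "b *v (x *v (x *v v)) = 0" "b *v (x *v v) = (d 1 \<bullet> (b *v v)) *\<^sub>R (x *v (x *v v))"
    "\<exists>m. b *v f = m *\<^sub>R (x *v (x *v v))" if b: "b \<in> S" for b
  proof -
    obtain k where k: "\<forall>u\<in>U. ((*v) b ^^ k) u = 0" using ND(5)[OF b] by (elim exE)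
    note bv = rep[OF ND(3)[OF b v(1)]]
    have bxv: "b *v (x *v v) = (d 0 \<bullet> (b *v v)) *\<^sub>R (x *v v) + (d 1 \<bullet> (b *v v)) *\<^sub>R (x *v (x *v v))"
      by (subst ND(4)[OF b x v(1)], subst bv) (simp add: lin x3v xf)
    have bxxv: "b *v (x *v (x *v v)) = (d 0 \<bullet> (b *v v)) *\<^sub>R (x *v (x *v v))"
      by (subst ND(4)[OF b x eU(2)], subst bxv) (simp add: lin x3v)
    \<comment> \<open>By commutation \<open>x^2 v\<close> is an eigenvector of \<open>b\<close> with
      this eigenvalue.\<close>
    show 0: "d 0 \<bullet> (b *v v) = 0"
      by (rule nil_eigenvalue_zero[OF k[rule_format] bxxv v(2)]) (rule eU)
    show bz: "b *v (x *v (x *v v)) = 0" using bxxv 0 by simp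
    show "b *v (x *v v) = (d 1 \<bullet> (b *v v)) *\<^sub>R (x *v (x *v v))" using bxv 0 by simp
    obtain m0 m1 m2 m3 where m: "b *v f = m0 *\<^sub>R v + m1 *\<^sub>R (x *v v) + m2 *\<^sub>R (x *v (x *v v)) + m3 *\<^sub>R f"
      by (rule that[OF rep[OF ND(3)[OF b fU]]])
    \<comment> \<open>\<open>b f\<close> lies in the kernel of \<open>x\<close>, which is spanned by
      \<open>x^2 v\<close> and \<open>f\<close>.\<close>
    have "x *v (b *v f) = 0" using ND(4)[OF x b fU] by (simp add: xf)
    then have "m0 *\<^sub>R (x *v v) + m1 *\<^sub>R (x *v (x *v v)) = 0" by (simp add: m lin x3v xf)
    from arg_cong[OF this, of "\<lambda>u. d 1 \<bullet> u"] arg_cong[OF this, of "\<lambda>u. d 2 \<bullet> u"]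
    have m01: "m0 = 0" "m1 = 0" by (simp_all add: lin dG)
    have "m3 = 0"
    proof (rule ccontr)
      assume m3: "m3 \<noteq> 0"
      \<comment> \<open>Chosen as the eigenvector that \<open>b\<close> would have for the
        eigenvalue \<open>m3\<close>.\<close>
      define h where "h = f + (m2 / m3) *\<^sub>R (x *v (x *v v))"
      have "b *v h = m3 *\<^sub>R h" using m3 by (simp add: h_def lin m m01 bz scaleR_add_right)
      moreover have hU: "h \<in> U" unfolding h_def using fU eU by (intro sU) auto
      moreover have "d 3 \<bullet> h = 1" by (simp add: h_def lin dG)
      then have "h \<noteq> 0" by auto
      ultimately show False using nil_eigenvalue_zero[OF k[rule_format, OF hU]] m3 by simp
    qed
    then show "\<exists>m. b *v f = m *\<^sub>R (x *v (x *v v))" using m m01 by auto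
  qed
  show ?thesis
  proof (rule nil_on_rank_one_perturbation[OF N IH eU(2,3), where w="d 1" and \<zeta>="d 0" and \<phi>="\<lambda>b. d 1 \<bullet> (b *v v)"])
    fix b u assume b: "b \<in> S" and u: "u \<in> U"
    obtain m where m: "b *v f = m *\<^sub>R (x *v (x *v v))" using key(4)[OF b] by blast
    have bu: "b *v u = (d 0 \<bullet> u) *\<^sub>R (b *v v) + ((d 1 \<bullet> u) * (d 1 \<bullet> (b *v v)) + (d 3 \<bullet> u) * m) *\<^sub>R (x *v (x *v v))"
      by (subst rep[OF u]) (simp add: lin key(2,3)[OF b] m scaleR_add_left)
    show "d 1 \<bullet> (b *v u) = d 1 \<bullet> (b *v v) * (d 0 \<bullet> u)" unfolding bu by (simp add: lin dG)
    show "d 0 \<bullet> (b *v u) = 0" unfolding bu by (simp add: lin dG key(1)[OF b])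
  qed (use key dG in auto)
qed

text \<open>On \<open>U\<close> the matrices amount to maps from \<open>U / H\<close> to
  \<open>H\<close>, that is, 2-by-2 blocks. At most three of them leave a nonzero linear form, with
  coefficients \<open>q1\<close> to \<open>q4\<close>, that vanishes on all blocks. If the form is
  degenerate, some vector outside \<open>H\<close> is mapped into one line. If not, a suitable basis
  of a complement of \<open>H\<close> makes all blocks symmetric, with entries
  \<open>\<alpha>\<close>, \<open>\<beta>\<close>, \<open>\<gamma>\<close>.\<close>

lemma nil_on_approx_4_zero:
  fixes U :: "(real^'n) set"
  assumes N: "nil_on U S"
    and IH: "\<And>(U' :: (real^'n) set) S'. nil_on U' S' \<Longrightarrow> dim U' < dim U \<Longrightarrow> approx_on U' S'"
    and H: "subspace H" "H \<subseteq> U" "dim H = 2" "\<And>b u. b \<in> S \<Longrightarrow> u \<in> U \<Longrightarrow> b *v u \<in> H"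
      "\<And>b u. b \<in> S \<Longrightarrow> u \<in> H \<Longrightarrow> b *v u = 0"
    and d4: "dim U = 4" and card: "card S \<le> 3"
  shows "approx_on U S"
proof -
  note ND = nil_onD[OF N]
  note sU = subspace_add[OF ND(1)] subspace_diff[OF ND(1)] subspace_scale[OF ND(1)] subspace_neg[OF ND(1)]
  note lin = mv.add_right mv.scaleR_right mv.diff_right mv.minus_right inner_add_right inner_diff_right inner_minus_right
     inner_add_left inner_diff_left inner_minus_left
  have "indep_fam 0 (\<lambda>i. 0 :: real^'n)" by (simp add: indep_fam_def)
  from indep_fam_extend_upto[OF this, of H 2] H(3)
  obtain e0 where e0: "indep_fam 2 e0" "\<forall>i<2. e0 i \<in> H" by auto
  obtain e where e: "indep_fam 4 e" "\<forall>i<2. e i = e0 i" "\<forall>i<4. e i \<in> U"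
    using indep_fam_extend_upto[OF e0(1), of U 4] e0(2) H(2) d4 by auto
  have ind2: "indep_fam 2 e" using indep_fam_cong[of 2 e e0] e(2) e0(1) by simp
  have eH: "e i \<in> H" if "i < 2" for i using that e(2) e0(2) by simp
  obtain d' where Hrep: "\<And>u. u \<in> H \<Longrightarrow> u = (\<Sum>i<2. (d' i \<bullet> u) *\<^sub>R e i)"
    by (rule dual_family[OF ind2 H(1,3) eH], assumption, rule that)
  obtain d where d: "\<And>i j. i < 4 \<Longrightarrow> j < 4 \<Longrightarrow> d i \<bullet> e j = (if i = j then 1 else 0)"
    and rep0: "\<And>u. u \<in> U \<Longrightarrow> u = (\<Sum>i<4. (d i \<bullet> u) *\<^sub>R e i)"
    by (rule dual_family[OF e(1) ND(1) d4 e(3)[rule_format]], assumption, rule that)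
  have de: "d 0 \<bullet> e j = (if j = 0 then 1 else 0)" "d 1 \<bullet> e j = (if j = 1 then 1 else 0)"
    "d 2 \<bullet> e j = (if j = 2 then 1 else 0)" "d 3 \<bullet> e j = (if j = 3 then 1 else 0)" if "j < 4" for j
    using d[of 0 j] d[of 1 j] d[of 2 j] d[of 3 j] that by auto
  have dH: "d 2 \<bullet> u = 0" "d 3 \<bullet> u = 0" if "u \<in> H" for u
  proof -
    have u: "u = (d' 0 \<bullet> u) *\<^sub>R e 0 + (d' 1 \<bullet> u) *\<^sub>R e 1"
      using Hrep[OF that] by (simp only: numeral_2_eq_2 sum.lessThan_Suc lessThan_0 sum.empty add_0_left One_nat_def)
    show "d 2 \<bullet> u = 0" "d 3 \<bullet> u = 0" by (subst u, simp add: lin de)+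
  qed
  have rep: "u = (d 0 \<bullet> u) *\<^sub>R e 0 + (d 1 \<bullet> u) *\<^sub>R e 1 + (d 2 \<bullet> u) *\<^sub>R e 2 + (d 3 \<bullet> u) *\<^sub>R e 3"
    if "u \<in> U" for u using rep0[OF that] unfolding sum4 .
  have repH: "u = (d 0 \<bullet> u) *\<^sub>R e 0 + (d 1 \<bullet> u) *\<^sub>R e 1" if "u \<in> H" for u
    using rep[of u] H(2) that dH[OF that] by auto
  have eU: "e 0 \<in> U" "e 1 \<in> U" "e 2 \<in> U" "e 3 \<in> U" using e(3) by auto
  have eH': "e 0 \<in> H" "e 1 \<in> H" using eH by auto
  define A where "A b = (d 0 \<bullet> (b *v e 2), d 1 \<bullet> (b *v e 2), d 0 \<bullet> (b *v e 3), d 1 \<bullet> (b *v e 3))" for b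
  have "dim (A ` S) \<le> 3" using dim_le_card'[of "A ` S"] card_image_le[of S A] ND(2) card by simp
  moreover have "DIM(real \<times> real \<times> real \<times> real) = 4" by simp
  ultimately have "dim (span (A ` S)) < DIM(real \<times> real \<times> real \<times> real)" unfolding dim_span by linarith
  then have "span (A ` S) \<noteq> UNIV" by (metis dim_UNIV less_irrefl)
  then obtain y where y: "y \<notin> span (A ` S)" by blast
  obtain w where "w \<bullet> y = 1 \<and> (\<forall>h \<in> span (A ` S). w \<bullet> h = 0)" using dual_vector[OF subspace_span y] by (elim exE)
  then have w: "w \<bullet> y = 1" "\<And>h. h \<in> span (A ` S) \<Longrightarrow> w \<bullet> h = 0" by blast+
  obtain q1 q2 q3 q4 where q: "w = (q1, q2, q3, q4)" by (metis prod.collapse)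
  have q0: "q1 \<noteq> 0 \<or> q2 \<noteq> 0 \<or> q3 \<noteq> 0 \<or> q4 \<noteq> 0" using w(1) q by (auto simp: zero_prod_def[symmetric])
  have rel: "q1 * (d 0 \<bullet> (b *v e 2)) + q2 * (d 1 \<bullet> (b *v e 2)) + q3 * (d 0 \<bullet> (b *v e 3)) + q4 * (d 1 \<bullet> (b *v e 3)) = 0"
    if "b \<in> S" for b
    using w(2)[OF span_base, of "A b"] that by (simp add: q A_def)
  have rank1: ?thesis if u: "u \<in> U" "u \<notin> H" and z: "z \<in> H" and "\<And>b. b \<in> S \<Longrightarrow> \<exists>c. b *v u = c *\<^sub>R z" for u z
    by (rule nil_on_approx_line_image[OF N IH H(1,4) u z subsetD[OF H(2) z] that(4) H(5)[OF _ z]])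
  show ?thesis
  proof (cases "q1 * q4 - q2 * q3 = 0")
    case D: True
    show ?thesis
    proof (cases "q1 = 0 \<and> q3 = 0")
      case True
      \<comment> \<open>For this vector the relation says that \<open>b u\<close> has no component
        along \<open>e 1\<close>.\<close>
      define u where "u = q2 *\<^sub>R e 2 + q4 *\<^sub>R e 3"
      have uU: "u \<in> U" unfolding u_def using eU by (intro sU)
      have "d 2 \<bullet> u = q2" "d 3 \<bullet> u = q4" by (simp_all add: u_def lin de)
      then have "u \<notin> H" using dH[of u] q0 True by auto
      moreover have "b *v u = (d 0 \<bullet> (b *v u)) *\<^sub>R e 0" if b: "b \<in> S" for b
      proof -
        have "d 1 \<bullet> (b *v u) = 0" using rel[OF b] True by (simp add: u_def lin)
        then show ?thesis using repH[OF H(4)[OF b uU]] by simp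
      qed
      ultimately show ?thesis using rank1[OF uU _ eH'(1)] by blast
    next
      case False
      obtain l where l: "q2 = l * q1" "q4 = l * q3"
      proof (cases "q1 = 0")
        case True
        then show thesis using D False that[of "q4 / q3"] by auto
      next
        case False
        then show thesis using D that[of "q2 / q1"] by (simp add: field_simps)
      qed
      \<comment> \<open>With \<open>q2 = l q1\<close> and \<open>q4 = l q3\<close> the relation says
        that \<open>b u\<close> is a multiple of \<open>e 1 - l e 0\<close>.\<close>
      define u where "u = q1 *\<^sub>R e 2 + q3 *\<^sub>R e 3"
      have uU: "u \<in> U" unfolding u_def using eU by (intro sU)
      have "d 2 \<bullet> u = q1" "d 3 \<bullet> u = q3" by (simp_all add: u_def lin de)
      then have "u \<notin> H" using dH[of u] False by auto
      moreover have "b *v u = (d 1 \<bullet> (b *v u)) *\<^sub>R (e 1 - l *\<^sub>R e 0)" if b: "b \<in> S" for b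
      proof -
        have "d 0 \<bullet> (b *v u) = - l * (d 1 \<bullet> (b *v u))" using rel[OF b] l by (simp add: u_def lin algebra_simps)
        then show ?thesis using repH[OF H(4)[OF b uU]] by (simp add: algebra_simps)
      qed
      moreover have "e 1 - l *\<^sub>R e 0 \<in> H" using eH' H(1) by (intro subspace_diff subspace_scale)
      ultimately show ?thesis using rank1[OF uU] by blast
    qed
  next
    case D: False
    define \<Delta> where "\<Delta> = q1 * q4 - q2 * q3"
    have D0: "\<Delta> \<noteq> 0" using D by (simp add: \<Delta>_def)
    \<comment> \<open>The relation becomes: the \<open>e 1\<close> component of \<open>b E2\<close>
      equals the \<open>e 0\<close> component of \<open>b E3\<close>. This is the symmetry of the
      block.\<close>
    define E2 where "E2 = - (q2 *\<^sub>R e 2 + q4 *\<^sub>R e 3)"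
    define E3 where "E3 = q1 *\<^sub>R e 2 + q3 *\<^sub>R e 3"
    \<comment> \<open>\<open>T2\<close> and \<open>T3\<close> are the coordinates along
      \<open>E2\<close> and \<open>E3\<close> modulo \<open>H\<close>, by Cramer's rule.\<close>
    define T2 where "T2 = (1 / \<Delta>) *\<^sub>R (q3 *\<^sub>R d 2 - q1 *\<^sub>R d 3)"
    define T3 where "T3 = (1 / \<Delta>) *\<^sub>R (q4 *\<^sub>R d 2 - q2 *\<^sub>R d 3)"
    have EU: "E2 \<in> U" "E3 \<in> U" unfolding E2_def E3_def using eU by (intro sU; simp)+
    have T2: "T2 \<bullet> E2 = 1" "T2 \<bullet> e 0 = 0" "T2 \<bullet> e 1 = 0" and T3: "T3 \<bullet> E2 = 0" "T3 \<bullet> e 0 = 0" "T3 \<bullet> e 1 = 0"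
    proof -
      have "T2 \<bullet> E2 = (q1 * q4 - q2 * q3) / \<Delta>" by (simp add: T2_def E2_def lin de divide_inverse algebra_simps)
      then show "T2 \<bullet> E2 = 1" using D0 by (simp add: \<Delta>_def[symmetric])
    qed (simp_all add: T2_def T3_def E2_def lin de)
    have d0: "d 0 \<bullet> E2 = 0" "d 0 \<bullet> e 0 = 1" "d 0 \<bullet> e 1 = 0" by (simp_all add: E2_def lin de)
    have EE: "(d 2 \<bullet> u) *\<^sub>R e 2 + (d 3 \<bullet> u) *\<^sub>R e 3 = (T2 \<bullet> u) *\<^sub>R E2 + (T3 \<bullet> u) *\<^sub>R E3" for u
    proof -
      have "- (T2 \<bullet> u) * q2 + (T3 \<bullet> u) * q1 = ((q1 * q4 - q2 * q3) * (d 2 \<bullet> u)) / \<Delta>"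
        "- (T2 \<bullet> u) * q4 + (T3 \<bullet> u) * q3 = ((q1 * q4 - q2 * q3) * (d 3 \<bullet> u)) / \<Delta>"
        by (simp_all add: T2_def T3_def lin divide_inverse algebra_simps)
      then have "- (T2 \<bullet> u) * q2 + (T3 \<bullet> u) * q1 = d 2 \<bullet> u" "- (T2 \<bullet> u) * q4 + (T3 \<bullet> u) * q3 = d 3 \<bullet> u"
        using D0 by (simp_all add: \<Delta>_def[symmetric])
      then have "(d 2 \<bullet> u) *\<^sub>R e 2 + (d 3 \<bullet> u) *\<^sub>R e 3 = (- (T2 \<bullet> u) * q2 + (T3 \<bullet> u) * q1) *\<^sub>R e 2
          + (- (T2 \<bullet> u) * q4 + (T3 \<bullet> u) * q3) *\<^sub>R e 3" by simp
      then show ?thesis by (simp add: E2_def E3_def algebra_simps)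
    qed
    define \<alpha> \<beta> \<gamma> where "\<alpha> b = d 0 \<bullet> (b *v E2)" and "\<beta> b = d 1 \<bullet> (b *v E2)" and "\<gamma> b = d 1 \<bullet> (b *v E3)" for b
    have bE2: "b *v E2 = \<alpha> b *\<^sub>R e 0 + \<beta> b *\<^sub>R e 1" if "b \<in> S" for b
      using repH[OF H(4)[OF that EU(1)]] by (simp add: \<alpha>_def \<beta>_def)
    have bE3: "b *v E3 = \<beta> b *\<^sub>R e 0 + \<gamma> b *\<^sub>R e 1" if "b \<in> S" for b
    proof -
      have "d 0 \<bullet> (b *v E3) = \<beta> b" using rel[OF that] by (simp add: \<beta>_def E2_def E3_def lin algebra_simps)
      then show ?thesis using repH[OF H(4)[OF that EU(2)]] by (simp add: \<gamma>_def)
    qed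
    have bu: "b *v u = (\<alpha> b * (T2 \<bullet> u) + \<beta> b * (T3 \<bullet> u)) *\<^sub>R e 0 + (\<beta> b * (T2 \<bullet> u) + \<gamma> b * (T3 \<bullet> u)) *\<^sub>R e 1"
      if b: "b \<in> S" and u: "u \<in> U" for b u
    proof -
      have "u = (d 0 \<bullet> u) *\<^sub>R e 0 + (d 1 \<bullet> u) *\<^sub>R e 1 + ((T2 \<bullet> u) *\<^sub>R E2 + (T3 \<bullet> u) *\<^sub>R E3)"
        using rep[OF u] unfolding EE[symmetric] by (simp add: add.assoc)
      then have "b *v u = b *v ((d 0 \<bullet> u) *\<^sub>R e 0 + (d 1 \<bullet> u) *\<^sub>R e 1 + ((T2 \<bullet> u) *\<^sub>R E2 + (T3 \<bullet> u) *\<^sub>R E3))" by simp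
      also have "\<dots> = (T2 \<bullet> u) *\<^sub>R (b *v E2) + (T3 \<bullet> u) *\<^sub>R (b *v E3)"
        by (simp only: mv.add_right mv.scaleR_right H(5)[OF b eH'(1)] H(5)[OF b eH'(2)] scaleR_zero_right add_0_left)
      finally show ?thesis by (simp add: bE2[OF b] bE3[OF b] algebra_simps)
    qed
    \<comment> \<open>The term with \<open>d 0\<close> makes \<open>e 0\<close> an eigenvector with
      eigenvalue \<open>\<eta> \<alpha> b\<close>. The term with \<open>T3\<close> is chosen so that
      the hyperplane annihilated by \<open>d 0 + T2 / \<eta>\<close> becomes invariant: there the
      \<open>e 0\<close> component of a value is cancelled by its \<open>E2\<close>
      component.\<close>
    define F where "F \<eta> b = b + \<eta> *\<^sub>R (\<alpha> b *\<^sub>R outer (e 0) (d 0) - \<beta> b *\<^sub>R outer E2 T3)" for \<eta> b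
    have Fu: "F \<eta> b *v u = (\<alpha> b * (T2 \<bullet> u) + \<beta> b * (T3 \<bullet> u) + \<eta> * \<alpha> b * (d 0 \<bullet> u)) *\<^sub>R e 0
        + (\<beta> b * (T2 \<bullet> u) + \<gamma> b * (T3 \<bullet> u)) *\<^sub>R e 1 - (\<eta> * \<beta> b * (T3 \<bullet> u)) *\<^sub>R E2"
      if "b \<in> S" "u \<in> U" for \<eta> b u
      by (simp add: F_def mv.add_left mv.diff_left mv.scaleR_left outer_mv bu[OF that] algebra_simps)
    show ?thesis
    proof (rule nil_on_split[OF N IH, where F=F and v="\<lambda>\<eta>. e 0" and w="\<lambda>\<eta>. d 0 + (1/\<eta>) *\<^sub>R T2"])
      fix b assume "b \<in> S"
      have "((\<lambda>\<eta>. b + \<eta> *\<^sub>R (\<alpha> b *\<^sub>R outer (e 0) (d 0) - \<beta> b *\<^sub>R outer E2 T3))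
        \<longlongrightarrow> b + 0 *\<^sub>R (\<alpha> b *\<^sub>R outer (e 0) (d 0) - \<beta> b *\<^sub>R outer E2 T3)) (at_right 0)"
        by (intro tendsto_intros)
      then show "((\<lambda>\<eta>. F \<eta> b) \<longlongrightarrow> b) (at_right 0)" by (simp add: F_def)
    next
      fix \<eta> :: real assume "\<eta> > 0"
      show "e 0 \<in> U \<and> (d 0 + (1/\<eta>) *\<^sub>R T2) \<bullet> e 0 = 1" using eU by (simp add: lin T2 d0)
    next
      fix \<eta> :: real and b assume "\<eta> > 0" and b: "b \<in> S"
      then have "F \<eta> b *v e 0 = (\<eta> * \<alpha> b) *\<^sub>R e 0" by (simp add: Fu[OF b eU(1)] T2 T3 d0)
      then show "\<exists>c. F \<eta> b *v e 0 = c *\<^sub>R e 0" ..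
    next
      fix \<eta> :: real assume h: "\<eta> > 0"
      define U2 where "U2 = {u\<in>U. (d 0 + (1/\<eta>) *\<^sub>R T2) \<bullet> u = 0}"
      have U2: "u \<in> U" "T2 \<bullet> u = - (\<eta> * (d 0 \<bullet> u))" if "u \<in> U2" for u
        using that h by (auto simp: U2_def inner_add_left field_simps)
      have Fu2: "F \<eta> b *v u = (\<beta> b * (T3 \<bullet> u)) *\<^sub>R e 0 + (\<beta> b * (T2 \<bullet> u) + \<gamma> b * (T3 \<bullet> u)) *\<^sub>R e 1 - (\<eta> * \<beta> b * (T3 \<bullet> u)) *\<^sub>R E2"
        if "b \<in> S" "u \<in> U2" for b u
        by (simp add: Fu[OF that(1) U2(1)[OF that(2)]] U2(2)[OF that(2)])
      have T3F: "T3 \<bullet> (F \<eta> b *v u) = 0" and T2F: "T2 \<bullet> (F \<eta> b *v u) = - (\<eta> * \<beta> b * (T3 \<bullet> u))"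
        if "b \<in> S" "u \<in> U2" for b u by (simp_all add: Fu2[OF that] lin T2 T3)
      have inv: "F \<eta> b *v u \<in> U2" if b: "b \<in> S" and u: "u \<in> U2" for b u
      proof -
        have "F \<eta> b *v u \<in> U" unfolding Fu2[OF b u] using eU EU by (intro sU)
        moreover have "(d 0 + (1/\<eta>) *\<^sub>R T2) \<bullet> (F \<eta> b *v u) = 0"
          using h unfolding inner_add_left inner_scaleR_left T2F[OF b u] by (simp add: Fu2[OF b u] lin d0)
        ultimately show ?thesis by (simp add: U2_def)
      qed
      \<comment> \<open>The product is symmetric in \<open>b\<close> and \<open>c\<close>, and a
        third factor gives 0 because \<open>T3\<close> annihilates all values on the
        hyperplane.\<close>
      have two: "F \<eta> b *v (F \<eta> c *v u) = - (\<eta> * \<beta> b * \<beta> c * (T3 \<bullet> u)) *\<^sub>R e 1"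
        if "b \<in> S" "c \<in> S" "u \<in> U2" for b c u
        unfolding Fu2[OF that(1) inv[OF that(2,3)]] T3F[OF that(2,3)] T2F[OF that(2,3)] by simp
      have "nil_on U2 (F \<eta> ` S)"
        unfolding nil_on_def ball_simps
      proof (intro conjI ballI)
        have "U2 = U \<inter> {u. (d 0 + (1/\<eta>) *\<^sub>R T2) \<bullet> u = 0}" by (auto simp: U2_def)
        then show "subspace U2" by (simp only: subspace_inter[OF ND(1) subspace_hyperplane])
        show "finite (F \<eta> ` S)" using ND(2) by simp
        show "F \<eta> b *v u \<in> U2" if "b \<in> S" "u \<in> U2" for b u using inv that .
        show "F \<eta> b *v (F \<eta> c *v u) = F \<eta> c *v (F \<eta> b *v u)" if "b \<in> S" "c \<in> S" "u \<in> U2" for b c u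
          using that by (simp add: two)
        fix b assume b: "b \<in> S"
        have "((*v) (F \<eta> b) ^^ 3) u = 0" if u: "u \<in> U2" for u
          using two[OF b b inv[OF b u]] T3F[OF b u] by (simp add: numeral_3_eq_3)
        then show "\<exists>k. \<forall>u\<in>U2. ((*v) (F \<eta> b) ^^ k) u = 0" by blast
      qed
      then show "nil_on {u \<in> U. (d 0 + (1/\<eta>) *\<^sub>R T2) \<bullet> u = 0} (F \<eta> ` S)" by (simp add: U2_def)
    qed
  qed
qed


declare One_nat_def [simp]

section \<open>Commuting families with real spectrum\<close>

text \<open>A nonzero square leaves two Jordan types: one full block, or blocks of sizes 3 and 1 in
  dimension four.\<close>

lemma nil_on_approx_square:
  fixes U :: "(real^'n) set"
  assumes N: "nil_on U S"
    and IH: "\<And>(U' :: (real^'n) set) S'. nil_on U' S' \<Longrightarrow> dim U' < dim U \<Longrightarrow> approx_on U' S'"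
    and x: "x \<in> S" and v: "v \<in> U" "x *v (x *v v) \<noteq> 0" and d: "dim U = 3 \<or> dim U = 4"
  shows "approx_on U S"
proof (cases "dim U = 3")
  case True
  show ?thesis
    by (rule nil_on_approx_regular[OF N IH x v(1), of 2]) (use v True in \<open>simp_all add: numeral_2_eq_2\<close>)
next
  case False
  then have d4: "dim U = 4" using d by simp
  show ?thesis
  proof (cases "\<exists>u\<in>U. x *v (x *v (x *v u)) \<noteq> 0")
    case True
    then obtain u where "u \<in> U" "x *v (x *v (x *v u)) \<noteq> 0" by blast
    then show ?thesis
      by (intro nil_on_approx_regular[OF N IH x, of u 3]) (use d4 in \<open>simp_all add: numeral_3_eq_3\<close>)
  next
    case False
    show ?thesis by (rule nil_on_approx_4_square[OF N IH x v _ d4]) (use False in blast)+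
  qed
qed

text \<open>Polarization: if all squares vanish, \<open>(x + y)^2 = 2 x y\<close> does not vanish at
  \<open>v\<close>, and adding \<open>x + y\<close> to the family reduces to the case of a nonzero
  square.\<close>

lemma nil_on_approx_product:
  fixes U :: "(real^'n) set"
  assumes N: "nil_on U S"
    and IH: "\<And>(U' :: (real^'n) set) S'. nil_on U' S' \<Longrightarrow> dim U' < dim U \<Longrightarrow> approx_on U' S'"
    and xy: "x \<in> S" "y \<in> S" and v: "v \<in> U" "x *v (y *v v) \<noteq> 0" and d: "dim U = 3 \<or> dim U = 4"
  shows "approx_on U S"
proof (cases "\<exists>b\<in>S. \<exists>u\<in>U. b *v (b *v u) \<noteq> 0")
  case True
  then obtain b u where b: "b \<in> S" "u \<in> U" "b *v (b *v u) \<noteq> 0" by blast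
  show ?thesis by (rule nil_on_approx_square[OF N IH b d])
next
  case False
  note ND = nil_onD[OF N]
  have sq: "b *v (b *v u) = 0" if "b \<in> S" "u \<in> U" for b u using False that by blast
  note lin = mv.add_left mv.add_right
  have xyU: "x *v u \<in> U" "y *v u \<in> U" if "u \<in> U" for u using ND(3) xy that by auto
  have s2: "(x + y) *v ((x + y) *v u) = 2 *\<^sub>R (x *v (y *v u))" if "u \<in> U" for u
    using sq[OF xy(1) that] sq[OF xy(2) that] ND(4)[OF xy that] by (simp add: lin scaleR_2)
  have s3: "(x + y) *v ((x + y) *v ((x + y) *v u)) = 0" if u: "u \<in> U" for u
  proof -
    have "(x + y) *v u \<in> U" using xyU[OF u] ND(1) by (simp add: lin subspace_add)
    from s2[OF this] have "(x + y) *v ((x + y) *v ((x + y) *v u)) = 2 *\<^sub>R (x *v (y *v (x *v u)) + x *v (y *v (y *v u)))"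
      by (simp add: lin)
    also have "x *v (y *v (y *v u)) = 0" using sq[OF xy(2) u] by simp
    also have "x *v (y *v (x *v u)) = x *v (x *v (y *v u))" using ND(4)[OF xy u] by simp
    also have "\<dots> = 0" using sq[OF xy(1) xyU(2)[OF u]] .
    finally show ?thesis by simp
  qed
  have N': "nil_on U (insert (x + y) S)"
    unfolding nil_on_def
  proof (intro conjI ballI)
    show "subspace U" "finite (insert (x + y) S)" using ND by auto
    show "b *v u \<in> U" if "b \<in> insert (x + y) S" "u \<in> U" for b u
      using that xyU ND by (auto simp: lin subspace_add)
    show "b *v (c *v u) = c *v (b *v u)" if "b \<in> insert (x + y) S" "c \<in> insert (x + y) S" "u \<in> U" for b c u
      using that ND(4)[of b x u] ND(4)[of b y u] ND(4)[of c x u] ND(4)[of c y u] ND(4)[of b c u] xy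
      by (auto simp: lin)
    fix b assume "b \<in> insert (x + y) S"
    then show "\<exists>k. \<forall>u\<in>U. ((*v) b ^^ k) u = 0"
    proof
      assume "b = x + y"
      then show ?thesis using s3 by (intro exI[of _ 3]) (simp add: numeral_3_eq_3)
    qed (rule ND(5))
  qed
  have "approx_on U (insert (x + y) S)"
    by (rule nil_on_approx_square[OF N' IH insertI1 v(1) _ d]) (use s2[OF v(1)] v(2) in simp_all)
  then show ?thesis by (rule approx_on_mono) blast
qed

text \<open>The cases are sorted by the span \<open>H\<close> of all images, a proper subspace. A
  line, a nonzero product, and a hyperplane killed by \<open>S\<close> have been treated. What
  remains is \<open>dim H = 2\<close> in dimension four with vanishing products, where the
  cardinality bound prevents the blocks from filling the four-dimensional space of all
  blocks.\<close>

theorem nil_on_approx: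
  fixes U :: "(real^'n) set"
  assumes "nil_on U S"
    and "dim U \<le> 3 \<or> (dim U = 4 \<and> ((\<exists>x\<in>S. \<exists>y\<in>S. \<exists>u\<in>U. x *v (y *v u) \<noteq> 0) \<or> card S \<le> 3))"
  shows "approx_on U S"
  using assms
proof (induction "dim U" arbitrary: U S rule: less_induct)
  case less
  note N = less.prems(1) and cond = less.prems(2)
  have IH: "approx_on U' S'" if "nil_on U' S'" "dim U' < dim U" for U' :: "(real^'n) set" and S'
    using less.hyps[OF that(2,1)] that(2) cond by auto
  note ND = nil_onD[OF N]
  define H where "H = span ((\<lambda>(b, u). b *v u) ` (S \<times> U))"
  have sH: "subspace H" by (simp add: H_def)
  have bH: "b *v u \<in> H" if "b \<in> S" "u \<in> U" for b u
    unfolding H_def using that by (intro span_base) (auto intro!: image_eqI[of _ _ "(b, u)"])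
  have HU: "H \<subseteq> U" unfolding H_def using ND(1,3) by (intro span_minimal) auto
  show ?case
  proof (cases "\<forall>b\<in>S. \<forall>u\<in>U. b *v u = 0")
    case True
    then show ?thesis using ND(1) by (intro approx_on_zero) auto
  next
    case False
    then obtain b0 u0 where bu0: "b0 \<in> S" "u0 \<in> U" "b0 *v u0 \<noteq> 0" by blast
    then have "U \<noteq> {0}" by auto
    from nil_on_proper_image[OF N this] obtain H' where H': "subspace H' \<and> H' \<subseteq> U \<and> H' \<noteq> U \<and> (\<forall>b\<in>S. \<forall>u\<in>U. b *v u \<in> H')"
      by (elim exE)
    have "H \<subseteq> H'" unfolding H_def using H' by (intro span_minimal) auto
    then have HnU: "H \<noteq> U" using H' by blast
    have dHU: "dim H < dim U" using HU HnU sH ND(1) by (intro dim_psubset) (simp add: span_eq_iff[THEN iffD2] psubset_eq)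
    obtain v where v: "v \<in> U" "v \<notin> H" using HU HnU by blast
    have z0: "b0 *v u0 \<in> H" by (rule bH[OF bu0(1,2)])
    have dH1: "dim H \<noteq> 0" using z0 bu0(3) by (auto simp: dim_eq_0)
    show ?thesis
    proof (cases "dim H = 1")
      case True
      define z where "z = b0 *v u0"
      have "span {z} = H"
        using z0 bu0(3) True sH by (intro subspace_dim_equal) (auto simp: z_def span_minimal dim_insert)
      then have Hz: "\<exists>c. h = c *\<^sub>R z" if "h \<in> H" for h using that by (auto simp: span_singleton)
      have zH: "z \<in> H" using z0 by (simp add: z_def)
      show ?thesis
      proof (rule nil_on_approx_line_image[OF N IH sH bH v zH subsetD[OF HU zH]])
        fix b assume b: "b \<in> S"
        show "\<exists>c. b *v v = c *\<^sub>R z" by (rule Hz[OF bH[OF b v(1)]])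
        obtain c where c: "b *v z = c *\<^sub>R z" using Hz[OF bH[OF b subsetD[OF HU zH]]] by (elim exE)
        obtain k where k: "\<forall>u\<in>U. ((*v) b ^^ k) u = 0" using ND(5)[OF b] by (elim exE)
        have "c = 0"
          by (rule nil_eigenvalue_zero[OF k[rule_format, OF subsetD[OF HU zH]] c]) (simp add: z_def bu0)
        then show "b *v z = 0" using c by simp
      qed
    next
      case False
      have "dim U \<le> 4" using cond by linarith
      then have d: "dim U = 3 \<or> dim U = 4" using False dH1 dHU by linarith
      show ?thesis
      proof (cases "\<exists>x\<in>S. \<exists>y\<in>S. \<exists>u\<in>U. x *v (y *v u) \<noteq> 0")
        case True
        then obtain x y u where x: "x \<in> S" "y \<in> S" "u \<in> U" "x *v (y *v u) \<noteq> 0" by blast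
        show ?thesis by (rule nil_on_approx_product[OF N IH x d])
      next
        case np: False
        have bz: "b *v h = 0" if b: "b \<in> S" and h: "h \<in> H" for b h
        proof -
          have "H \<subseteq> {h. b *v h = 0}"
            unfolding H_def
          proof (rule span_minimal)
            show "subspace {h. b *v h = 0}" by (auto simp: subspace_def mv.add_right mv.scaleR_right)
          qed (use np b in auto)
          then show ?thesis using h by blast
        qed
        show ?thesis
        proof (cases "Suc (dim H) = dim U")
          case True
          obtain \<zeta> where z: "\<zeta> \<bullet> v = 1 \<and> (\<forall>h\<in>H. \<zeta> \<bullet> h = 0)" using dual_vector[OF sH v(2)] by (elim exE)
          have zv: "\<zeta> \<bullet> v \<noteq> 0" using z by simp
          note hs = hyperplane_section[OF ND(1) v(1) zv]
          have eq: "H = {u \<in> U. \<zeta> \<bullet> u = 0}"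
            using hs(1,2) sH True z HU by (intro subspace_dim_equal) auto
          show ?thesis
            by (rule nil_on_approx_hyperplane_kernel[OF N IH, of \<zeta>]) (use eq bz d in auto)
        next
          case False
          then have "dim H = 2" "dim U = 4" using d dHU dH1 \<open>dim H \<noteq> 1\<close> by linarith+
          moreover from this have "card S \<le> 3" using cond np by linarith
          ultimately show ?thesis by (intro nil_on_approx_4_zero[OF N IH sH HU _ bH bz])
        qed
      qed
    qed
  qed
qed

text \<open>Real spectrum, phrased by eigenvectors in invariant subspaces because this form is
  inherited by the parts of a decomposition.\<close>

definition real_on :: "(real^'n) set \<Rightarrow> real^'n^'n \<Rightarrow> bool" where
  "real_on U b \<longleftrightarrow> (\<forall>W. subspace W \<and> W \<subseteq> U \<and> W \<noteq> {0} \<and> (\<forall>u\<in>W. b *v u \<in> W) \<longrightarrow>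
     (\<exists>u\<in>W. u \<noteq> 0 \<and> (\<exists>c. b *v u = c *\<^sub>R u)))"

lemma real_on_subset: "real_on U b \<Longrightarrow> W \<subseteq> U \<Longrightarrow> real_on W b"
  unfolding real_on_def by (meson order_trans)

text \<open>Fitting's lemma. The exponent \<open>dim U\<close> suffices: by
  \<open>nilpotent_funpow_dim\<close> a vector killed by some power of \<open>y\<close> is killed by
  this one, so \<open>y^m\<close> is injective on its own image.\<close>

lemma fitting_decomposition:
  fixes y :: "real^'n^'n"
  assumes U: "subspace U" and inv: "\<And>u. u \<in> U \<Longrightarrow> y *v u \<in> U"
  defines "m \<equiv> dim U"
  defines "U1 \<equiv> {u\<in>U. ((*v) y ^^ m) u = 0}" and "U2 \<equiv> ((*v) y ^^ m) ` U"
  shows "subspace U1" "subspace U2" "U1 \<inter> U2 = {0}" "U = {a + b |a b. a \<in> U1 \<and> b \<in> U2}" "dim U1 + dim U2 = dim U" "U2 \<subseteq> U"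
proof -
  have lin: "linear ((*v) y ^^ m)" by (rule linear_funpow_mv)
  have "subspace {u. ((*v) y ^^ m) u = 0}" by (rule linear_subspace_kernel[OF lin])
  moreover have "U1 = U \<inter> {u. ((*v) y ^^ m) u = 0}" by (auto simp: U1_def)
  ultimately show s1: "subspace U1" using subspace_inter[OF U] by simp
  show s2: "subspace U2" unfolding U2_def by (rule linear_subspace_image[OF lin U])
  show U2U: "U2 \<subseteq> U" unfolding U2_def using funpow_invariant[of U y] inv by auto
  have inj: "((*v) y ^^ m) (((*v) y ^^ m) u) = 0 \<Longrightarrow> ((*v) y ^^ m) u = 0" if "u \<in> U" for u
  proof -
    assume "((*v) y ^^ m) (((*v) y ^^ m) u) = 0"
    then have "((*v) y ^^ (m + m)) u = 0" by (simp add: funpow_add)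
    then show "((*v) y ^^ m) u = 0" unfolding m_def using nilpotent_funpow_dim[OF U inv that] by blast
  qed
  show int: "U1 \<inter> U2 = {0}"
    using inj subspace_0[OF s1] subspace_0[OF s2] by (auto simp: U1_def U2_def)
  have "inj_on ((*v) y ^^ m) U2"
  proof -
    have "\<forall>v\<in>U2. ((*v) y ^^ m) v = 0 \<longrightarrow> v = 0" using inj by (auto simp: U2_def)
    then show ?thesis using linear_inj_on_iff_eq_0[OF lin s2] by blast
  qed
  then have "dim (((*v) y ^^ m) ` U2) = dim U2"
    using eucl.dim_image_eq[OF lin, of U2] s2 by (simp add: span_eq_iff[THEN iffD2])
  moreover have "((*v) y ^^ m) ` U2 \<subseteq> U2" using U2U by (auto simp: U2_def)
  ultimately have onto: "((*v) y ^^ m) ` U2 = U2"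
    using linear_subspace_image[OF lin s2] s2 by (intro subspace_dim_equal) auto
  show sum: "U = {a + b |a b. a \<in> U1 \<and> b \<in> U2}"
  proof
    show "{a + b |a b. a \<in> U1 \<and> b \<in> U2} \<subseteq> U" using U2U U by (auto simp: U1_def subspace_add)
    show "U \<subseteq> {a + b |a b. a \<in> U1 \<and> b \<in> U2}"
    proof
      fix u assume u: "u \<in> U"
      then have "((*v) y ^^ m) u \<in> ((*v) y ^^ m) ` U2" using onto by (auto simp: U2_def)
      then obtain t where t: "t \<in> U2" "((*v) y ^^ m) u = ((*v) y ^^ m) t" by blast
      have "u - t \<in> U1" using t u U2U U by (auto simp: U1_def subspace_diff linear_diff[OF lin])
      moreover have "u = (u - t) + t" by simp
      ultimately show "u \<in> {a + b |a b. a \<in> U1 \<and> b \<in> U2}" using t(1) by blast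
    qed
  qed
  show "dim U1 + dim U2 = dim U"
    using dim_sums_Int[OF s1 s2] int sum by simp
qed

text \<open>Fitting decompositions split \<open>U\<close> until each \<open>b\<close> has a single
  eigenvalue \<open>l b\<close>, and then \<open>b - l b\<close> is nilpotent. In dimension four an
  unsplit family is deferred to the last hypothesis, stated for all \<open>l\<close> because the
  eigenvalues are found only in the proof. After a split all parts have dimension at most
  three.\<close>

theorem real_commuting_approx:
  fixes U :: "(real^'n) set"
  assumes "subspace U" "finite S" "\<And>b u. b \<in> S \<Longrightarrow> u \<in> U \<Longrightarrow> b *v u \<in> U"
    "\<And>b c u. b \<in> S \<Longrightarrow> c \<in> S \<Longrightarrow> u \<in> U \<Longrightarrow> b *v (c *v u) = c *v (b *v u)"
    "\<And>b. b \<in> S \<Longrightarrow> real_on U b"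
    "dim U \<le> 3 \<or> (dim U = 4 \<and> (\<forall>l. nil_on U ((\<lambda>b. b - l b *\<^sub>R mat 1) ` S) \<longrightarrow> approx_on U ((\<lambda>b. b - l b *\<^sub>R mat 1) ` S)))"
  shows "approx_on U S"
  using assms
proof (induction "dim U" arbitrary: U rule: less_induct)
  case less
  note U = less.prems(1) and inv = less.prems(3) and comm = less.prems(4) and re = less.prems(5) and cond = less.prems(6)
  have shift: "(b - c *\<^sub>R mat 1) *v u = b *v u - c *\<^sub>R u" for b :: "real^'n^'n" and c u
    by (simp add: mv.diff_left mv.scaleR_left)
  show ?case
  proof (cases "\<forall>b\<in>S. \<exists>l. \<exists>k. \<forall>u\<in>U. ((*v) (b - l *\<^sub>R mat 1) ^^ k) u = 0")
    case True
    from bchoice[OF this] obtain l where l: "\<forall>b\<in>S. \<exists>k. \<forall>u\<in>U. ((*v) (b - l b *\<^sub>R mat 1) ^^ k) u = 0" by (elim exE)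
    let ?S = "(\<lambda>b. b - l b *\<^sub>R mat 1) ` S"
    have N: "nil_on U ?S"
      unfolding nil_on_def ball_simps
    proof (intro conjI ballI)
      show "(b - l b *\<^sub>R mat 1) *v u \<in> U" if "b \<in> S" "u \<in> U" for b u
        using that U inv by (simp add: shift subspace_diff subspace_scale)
      show "(b - l b *\<^sub>R mat 1) *v ((c - l c *\<^sub>R mat 1) *v u) = (c - l c *\<^sub>R mat 1) *v ((b - l b *\<^sub>R mat 1) *v u)"
        if "b \<in> S" "c \<in> S" "u \<in> U" for b c u
        unfolding shift mv.diff_right mv.scaleR_right using comm[OF that] by (simp add: algebra_simps)
    qed (use U less.prems(2) l in auto)
    have "approx_on U ?S"
    proof (cases "dim U \<le> 3")
      case True then show ?thesis using nil_on_approx[OF N] by blast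
    next
      case False then show ?thesis using cond N by blast
    qed
    then show ?thesis
    proof (rule approx_on_span)
      show "S \<subseteq> span (insert (mat 1) ?S)"
      proof
        fix b assume b: "b \<in> S"
        have "b = (b - l b *\<^sub>R mat 1) + l b *\<^sub>R mat 1" by simp
        moreover have "(b - l b *\<^sub>R mat 1) + l b *\<^sub>R mat 1 \<in> span (insert (mat 1) ?S)"
          using b by (intro span_add span_scale span_base) auto
        ultimately show "b \<in> span (insert (mat 1) ?S)" by simp
      qed
    qed (use less.prems(2) in auto)
  next
    case False
    \<comment> \<open>This \<open>b\<close> has more than one eigenvalue on \<open>U\<close>; the
      generalized eigenspace of one of them and its Fitting complement are both nonzero.\<close>
    then obtain b where b: "b \<in> S" "\<And>l. \<not> (\<exists>k. \<forall>u\<in>U. ((*v) (b - l *\<^sub>R mat 1) ^^ k) u = 0)" by blast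
    have "U \<noteq> {0}" using b(2)[of 0] by auto
    then obtain u0 c where u0: "u0 \<in> U" "u0 \<noteq> 0" "b *v u0 = c *\<^sub>R u0"
      using re[OF b(1)] U inv[OF b(1)] unfolding real_on_def by blast
    define y where "y = b - c *\<^sub>R mat 1"
    have yU: "y *v u \<in> U" if "u \<in> U" for u unfolding y_def shift using that U inv[OF b(1)] by (simp add: subspace_diff subspace_scale)
    define U1 where "U1 = {u\<in>U. ((*v) y ^^ dim U) u = 0}"
    define U2 where "U2 = ((*v) y ^^ dim U) ` U"
    note F = fitting_decomposition[OF U yU, folded U1_def U2_def]
    have "dim U \<noteq> 0" using u0 by (auto simp: dim_eq_0)
    then obtain k where k: "dim U = Suc k" using not0_implies_Suc by blast
    have "y *v u0 = 0" using u0 by (simp add: y_def shift)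
    then have "((*v) y ^^ dim U) u0 = 0" unfolding k funpow_mv_Suc2 by simp
    then have "dim U1 \<noteq> 0" using u0 by (auto simp: dim_eq_0 U1_def)
    moreover have "dim U2 \<noteq> 0"
    proof
      assume "dim U2 = 0"
      then have "\<forall>u\<in>U. ((*v) y ^^ dim U) u = 0" by (auto simp: dim_eq_0 U2_def)
      then show False using b(2)[of c] unfolding y_def by blast
    qed
    ultimately have dims: "dim U1 < dim U" "dim U2 < dim U" using F(5) by linarith+
    have cy: "a *v (((*v) y ^^ k) u) = ((*v) y ^^ k) (a *v u)" if "a \<in> S" "u \<in> U" for a u k
    proof (induction k)
      case (Suc k)
      have "((*v) y ^^ k) u \<in> U" using funpow_invariant[of U y u k] yU that(2) by auto
      then have "a *v (y *v (((*v) y ^^ k) u)) = y *v (a *v (((*v) y ^^ k) u))"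
        using comm[OF that(1) b(1)] by (simp add: y_def shift mv.diff_right mv.scaleR_right)
      then show ?case using Suc by simp
    qed simp
    have inv1: "a *v u \<in> U1" if "a \<in> S" "u \<in> U1" for a u
      using that inv[OF that(1)] cy[OF that(1), of u "dim U"] by (auto simp: U1_def)
    have inv2: "a *v u \<in> U2" if "a \<in> S" "u \<in> U2" for a u
      using that inv[OF that(1)] cy[OF that(1)] by (auto simp: U2_def)
    have U1U: "U1 \<subseteq> U" by (auto simp: U1_def)
    have "approx_on U1 S"
    proof (rule less.hyps[OF dims(1) F(1) less.prems(2)])
      show "b *v u \<in> U1" if "b \<in> S" "u \<in> U1" for b u using inv1 that .
      show "b *v (c *v u) = c *v (b *v u)" if "b \<in> S" "c \<in> S" "u \<in> U1" for b c u
        using comm[OF that(1,2)] that(3) U1U by blast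
      show "real_on U1 b" if "b \<in> S" for b by (rule real_on_subset[OF re[OF that] U1U])
      show "dim U1 \<le> 3 \<or> (dim U1 = 4 \<and> (\<forall>l. nil_on U1 ((\<lambda>b. b - l b *\<^sub>R mat 1) ` S) \<longrightarrow> approx_on U1 ((\<lambda>b. b - l b *\<^sub>R mat 1) ` S)))"
        using cond dims by auto
    qed
    moreover have "approx_on U2 S"
    proof (rule less.hyps[OF dims(2) F(2) less.prems(2)])
      show "b *v u \<in> U2" if "b \<in> S" "u \<in> U2" for b u using inv2 that .
      show "b *v (c *v u) = c *v (b *v u)" if "b \<in> S" "c \<in> S" "u \<in> U2" for b c u
        using comm[OF that(1,2)] that(3) F(6) by blast
      show "real_on U2 b" if "b \<in> S" for b by (rule real_on_subset[OF re[OF that] F(6)])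
      show "dim U2 \<le> 3 \<or> (dim U2 = 4 \<and> (\<forall>l. nil_on U2 ((\<lambda>b. b - l b *\<^sub>R mat 1) ` S) \<longrightarrow> approx_on U2 ((\<lambda>b. b - l b *\<^sub>R mat 1) ` S)))"
        using cond dims by auto
    qed
    ultimately show ?thesis using approx_on_direct_sum[OF F(1) F(2) F(3) F(4), of S] by simp
  qed
qed

text \<open>\<open>real_spec b\<close>: all complex eigenvalues of \<open>b\<close> are real.\<close>

definition real_spec :: "real^'n^'n \<Rightarrow> bool" where
  "real_spec b \<longleftrightarrow> (\<forall>a \<beta> u. \<beta> \<noteq> 0 \<longrightarrow>
     (b - a *\<^sub>R mat 1) *v ((b - a *\<^sub>R mat 1) *v u) + (\<beta> * \<beta>) *\<^sub>R u = 0 \<longrightarrow> u = 0)"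

text \<open>\<open>pev b w p\<close> is the vector \<open>p(b) w\<close>.\<close>

definition pev :: "real^'n^'n \<Rightarrow> real^'n \<Rightarrow> real poly \<Rightarrow> real^'n" where
  "pev b w p = fold_coeffs (\<lambda>a v. a *\<^sub>R w + b *v v) p 0"

lemma pev_pCons: "pev b w (pCons a p) = a *\<^sub>R w + b *v (pev b w p)"
  by (cases "p = 0 \<and> a = 0") (auto simp: pev_def)

lemma pev_0 [simp]: "pev b w 0 = 0"
  by (simp add: pev_def)

lemma pev_add: "pev b w (p + q) = pev b w p + pev b w q"
  by (induction p q rule: poly_induct2) (simp_all add: pev_pCons mv.add_right scaleR_add_left)

lemma pev_smult: "pev b w (smult c p) = c *\<^sub>R pev b w p"
  by (induction p) (simp_all add: pev_pCons mv.scaleR_right scaleR_add_right)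

lemma pev_monom: "pev b w (monom c i) = c *\<^sub>R ((*v) b ^^ i) w"
  by (induction i) (simp_all add: pev_pCons monom_0 monom_Suc mv.scaleR_right)

lemma pev_sum: "pev b w (\<Sum>i\<in>I. f i) = (\<Sum>i\<in>I. pev b w (f i))"
  by (induction I rule: infinite_finite_induct) (simp_all add: pev_add)

lemma pev_mult_linear: "pev b w ([:c, 1:] * q) = b *v pev b w q + c *\<^sub>R pev b w q"
  by (simp add: pev_add pev_smult pev_pCons)

lemma pev_in:
  assumes "subspace W" "w \<in> W" "\<And>u. u \<in> W \<Longrightarrow> b *v u \<in> W"
  shows "pev b w p \<in> W"
  using assms by (induction p) (auto simp: pev_pCons subspace_0 subspace_add subspace_scale)

definition cpoly :: "real poly \<Rightarrow> complex \<Rightarrow> complex" where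
  "cpoly p z = poly (map_poly complex_of_real p) z"

lemma cpoly_pCons: "cpoly (pCons a p) z = of_real a + z * cpoly p z"
  by (simp add: cpoly_def map_poly_pCons)

lemma cpoly_0 [simp]: "cpoly 0 z = 0"
  by (simp add: cpoly_def)

lemma cpoly_add: "cpoly (p + q) z = cpoly p z + cpoly q z"
  by (induction p q rule: poly_induct2) (simp_all add: cpoly_pCons algebra_simps)

lemma cpoly_smult: "cpoly (smult c p) z = of_real c * cpoly p z"
  by (induction p) (simp_all add: cpoly_pCons algebra_simps)

lemma cpoly_mult: "cpoly (p * q) z = cpoly p z * cpoly q z"
  by (induction p) (simp_all add: cpoly_pCons cpoly_add cpoly_smult algebra_simps)

lemma cpoly_of_real: "cpoly p (of_real x) = of_real (poly p x)"
  by (induction p) (simp_all add: cpoly_pCons)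

text \<open>Let \<open>p\<close> be a polynomial of least degree with \<open>p(b) w = 0\<close>, and
  \<open>z\<close> a complex root. If \<open>z\<close> is real and \<open>p = (X - z) q\<close>,
  then \<open>q(b) w\<close> is an eigenvector. If not, the real quadratic \<open>r\<close> with
  roots \<open>z\<close> and its conjugate divides \<open>p\<close>, and \<open>real_spec\<close>
  makes \<open>q(b) w = 0\<close> for the quotient \<open>q\<close>, against minimality.\<close>

lemma real_on_if_real_spec:
  fixes b :: "real^'n^'n"
  assumes rs: "real_spec b"
  shows "real_on UNIV b"
  unfolding real_on_def
proof (intro allI impI)
  fix W :: "(real^'n) set"
  assume W: "subspace W \<and> W \<subseteq> UNIV \<and> W \<noteq> {0} \<and> (\<forall>u\<in>W. b *v u \<in> W)"
  then obtain w where w: "w \<in> W" "w \<noteq> 0" using subspace_0 by blast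
  have "\<exists>p. p \<noteq> 0 \<and> pev b w p = 0"
  proof -
    have "\<not> indep_fam (Suc CARD('n)) (\<lambda>i. ((*v) b ^^ i) w)"
      using indep_fam_le_dim[of "Suc CARD('n)" _ "UNIV :: (real^'n) set"] by auto
    then obtain c i where c: "(\<Sum>i<Suc CARD('n). c i *\<^sub>R ((*v) b ^^ i) w) = 0" "i < Suc CARD('n)" "c i \<noteq> 0"
      unfolding indep_fam_def by blast
    define p where "p = (\<Sum>i<Suc CARD('n). monom (c i) i)"
    have "coeff p i = c i" using c(2) by (simp add: p_def coeff_sum coeff_monom del: sum.lessThan_Suc)
    then have "p \<noteq> 0" using c(3) by auto
    moreover have "pev b w p = 0" using c(1) by (simp add: p_def pev_sum pev_monom del: sum.lessThan_Suc)
    ultimately show ?thesis by blast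
  qed
  then obtain p where p: "p \<noteq> 0" "pev b w p = 0" and min: "\<And>q. q \<noteq> 0 \<Longrightarrow> pev b w q = 0 \<Longrightarrow> degree p \<le> degree q"
    using ex_has_least_nat[of "\<lambda>p. p \<noteq> 0 \<and> pev b w p = 0" _ degree] by metis
  have deg: "degree p \<noteq> 0"
  proof
    assume "degree p = 0"
    then obtain a where "p = [:a:]" by (rule degree_eq_zeroE)
    then show False using p w by (simp add: pev_pCons)
  qed
  let ?P = "map_poly complex_of_real p"
  have "\<not> constant (poly ?P)" using deg by (simp add: constant_degree degree_map_poly)
  then obtain z where z: "poly ?P z = 0" using fundamental_theorem_of_algebra by blast
  show "\<exists>u\<in>W. u \<noteq> 0 \<and> (\<exists>c. b *v u = c *\<^sub>R u)"
  proof (cases "Im z = 0")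
    case True
    then have "z = of_real (Re z)" by (simp add: complex_eq_iff)
    then have "poly p (Re z) = 0" using z by (metis cpoly_def cpoly_of_real of_real_eq_0_iff)
    then obtain q where q: "p = [:- Re z, 1:] * q" by (auto simp: poly_eq_0_iff_dvd)
    have "q \<noteq> 0" using p q by auto
    then have "degree p = Suc (degree q)" unfolding q by (subst degree_mult_eq) auto
    then have "pev b w q \<noteq> 0" using min[of q] \<open>q \<noteq> 0\<close> by auto
    moreover have "b *v pev b w q = Re z *\<^sub>R pev b w q" using p(2) unfolding q pev_mult_linear by simp
    ultimately show ?thesis using pev_in[of W w b q] W w by blast
  next
    case False
    define r where "r = [:(Re z)\<^sup>2 + (Im z)\<^sup>2, - 2 * Re z, 1:]"
    define q s where "q = p div r" and "s = p mod r"
    have r0: "r \<noteq> 0" "degree r = 2" by (simp_all add: r_def)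
    have ps: "p = r * q + s" by (simp add: q_def s_def)
    have "degree s < 2 \<or> s = 0" using degree_mod_less[OF r0(1), of p] r0(2) by (auto simp: s_def)
    then have "degree s \<le> 1" by auto
    then have s: "s = [:coeff s 0, coeff s 1:]"
      by (intro poly_eqI) (auto simp: coeff_pCons coeff_eq_0 split: nat.splits)
    \<comment> \<open>A remainder of degree at most 1 with a non-real root is 0, so \<open>r\<close>
      divides \<open>p\<close>.\<close>
    have "cpoly r z = 0" by (simp add: r_def cpoly_pCons complex_eq_iff power2_eq_square algebra_simps)
    then have "cpoly s z = 0" using z ps by (simp add: cpoly_def[symmetric] cpoly_add cpoly_mult)
    then have "complex_of_real (coeff s 0) + z * complex_of_real (coeff s 1) = 0"
      by (subst (asm) s) (simp add: cpoly_pCons)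
    then have "coeff s 1 = 0" "coeff s 0 = 0" using False by (auto simp: complex_eq_iff)
    then have "p = r * q" using ps s by simp
    also have "r = [:- Re z, 1:] * [:- Re z, 1:] + [:(Im z)\<^sup>2:]"
      by (simp add: r_def power2_eq_square)
    also have "\<dots> * q = [:- Re z, 1:] * ([:- Re z, 1:] * q) + [:(Im z)\<^sup>2:] * q"
      by (simp only: distrib_right mult.assoc)
    also have "[:(Im z)\<^sup>2:] * q = smult ((Im z)\<^sup>2) q" by simp
    finally have pq: "p = [:- Re z, 1:] * ([:- Re z, 1:] * q) + smult ((Im z)\<^sup>2) q" .
    have "(b - Re z *\<^sub>R mat 1) *v ((b - Re z *\<^sub>R mat 1) *v pev b w q) + (Im z * Im z) *\<^sub>R pev b w q = pev b w p"
      unfolding pq pev_add pev_mult_linear pev_smult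
      by (simp add: mv.diff_left mv.scaleR_left power2_eq_square)
    then have "pev b w q = 0" using p(2) rs False unfolding real_spec_def by metis
    moreover have "q \<noteq> 0" using p(1) \<open>p = r * q\<close> by auto
    moreover have "degree p = 2 + degree q" using \<open>p = r * q\<close> r0 \<open>q \<noteq> 0\<close> by (simp add: degree_mult_eq)
    ultimately show ?thesis using min[of q] by simp
  qed
qed

section \<open>The matrix exponential\<close>

text \<open>Matrices with their operator norm form a Banach algebra, in which \<open>exp\<close> is available.\<close>

typedef 'n endo = "UNIV :: ((real^'n::finite) \<Rightarrow>\<^sub>L (real^'n)) set" morphisms blin Endo ..

setup_lifting type_definition_endo

instantiation endo :: (finite) real_normed_algebra_1
begin
lift_definition zero_endo :: "'a endo" is 0 .
lift_definition one_endo :: "'a endo" is id_blinfun .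
lift_definition plus_endo :: "'a endo \<Rightarrow> 'a endo \<Rightarrow> 'a endo" is "(+)" .
lift_definition minus_endo :: "'a endo \<Rightarrow> 'a endo \<Rightarrow> 'a endo" is "(-)" .
lift_definition uminus_endo :: "'a endo \<Rightarrow> 'a endo" is uminus .
lift_definition times_endo :: "'a endo \<Rightarrow> 'a endo \<Rightarrow> 'a endo" is "(o\<^sub>L)" .
lift_definition scaleR_endo :: "real \<Rightarrow> 'a endo \<Rightarrow> 'a endo" is "scaleR" .
lift_definition norm_endo :: "'a endo \<Rightarrow> real" is norm .
definition dist_endo :: "'a endo \<Rightarrow> 'a endo \<Rightarrow> real" where "dist_endo x y = norm (x - y)"
definition sgn_endo :: "'a endo \<Rightarrow> 'a endo" where "sgn_endo x = inverse (norm x) *\<^sub>R x"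
definition uniformity_endo :: "('a endo \<times> 'a endo) filter" where
  "uniformity_endo = (INF e\<in>{0 <..}. principal {(x, y). dist x y < e})"
definition open_endo :: "'a endo set \<Rightarrow> bool" where
  "open_endo U \<longleftrightarrow> (\<forall>x\<in>U. eventually (\<lambda>(x', y). x' = x \<longrightarrow> y \<in> U) uniformity)"
instance
proof
  fix x y z :: "'a endo" and a b :: real and U :: "'a endo set"
  show "x + y + z = x + (y + z)" by transfer (simp add: add.assoc)
  show "x + y = y + x" by transfer (simp add: add.commute)
  show "0 + x = x" by transfer simp
  show "- x + x = 0" by transfer simp
  show "x - y = x + - y" by transfer simp
  show "a *\<^sub>R (x + y) = a *\<^sub>R x + a *\<^sub>R y" by transfer (simp add: scaleR_add_right)
  show "(a + b) *\<^sub>R x = a *\<^sub>R x + b *\<^sub>R x" by transfer (simp add: scaleR_add_left)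
  show "a *\<^sub>R b *\<^sub>R x = (a * b) *\<^sub>R x" by transfer simp
  show "1 *\<^sub>R x = x" by transfer simp
  show "x * y * z = x * (y * z)" by transfer (auto intro!: blinfun_eqI)
  show "(x + y) * z = x * z + y * z" by transfer (auto intro!: blinfun_eqI simp: blinfun.add_left)
  show "x * (y + z) = x * y + x * z" by transfer (auto intro!: blinfun_eqI simp: blinfun.add_left blinfun.add_right)
  show "1 * x = x" by transfer (auto intro!: blinfun_eqI)
  show "x * 1 = x" by transfer (auto intro!: blinfun_eqI)
  show "a *\<^sub>R x * y = a *\<^sub>R (x * y)" by transfer (auto intro!: blinfun_eqI simp: blinfun.scaleR_left)
  show "x * a *\<^sub>R y = a *\<^sub>R (x * y)" by transfer (auto intro!: blinfun_eqI simp: blinfun.scaleR_left blinfun.scaleR_right)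
  show "(0::'a endo) \<noteq> 1"
  proof transfer
    have "norm (id_blinfun :: (real^'a) \<Rightarrow>\<^sub>L (real^'a)) = 1" by simp
    then show "(0 :: (real^'a) \<Rightarrow>\<^sub>L (real^'a)) \<noteq> id_blinfun" by (metis norm_zero zero_neq_one)
  qed
  show "dist x y = norm (x - y)" by (rule dist_endo_def)
  show "sgn x = inverse (norm x) *\<^sub>R x" by (rule sgn_endo_def)
  show "uniformity = (INF e\<in>{0 <..}. principal {(x :: 'a endo, y). dist x y < e})" by (rule uniformity_endo_def)
  show "open U = (\<forall>x\<in>U. \<forall>\<^sub>F (x', y) in uniformity. x' = x \<longrightarrow> y \<in> U)" by (rule open_endo_def)
  show "norm x = 0 \<longleftrightarrow> x = 0" by transfer simp
  show "norm (x + y) \<le> norm x + norm y" by transfer (rule norm_triangle_ineq)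
  show "norm (a *\<^sub>R x) = \<bar>a\<bar> * norm x" by transfer simp
  show "norm (x * y) \<le> norm x * norm y" by transfer (rule norm_blinfun_compose)
  show "norm (1 :: 'a endo) = 1" by transfer simp
qed
end

lemma dist_blin: "dist (blin x) (blin y) = dist x y"
  by (simp add: dist_norm) (transfer, simp)

instance endo :: (finite) banach
proof
  fix X :: "nat \<Rightarrow> 'a endo" assume X: "Cauchy X"
  have "Cauchy (\<lambda>n. blin (X n))" using X by (simp add: Cauchy_def dist_blin)
  then obtain l where l: "(\<lambda>n. blin (X n)) \<longlonglongrightarrow> l" using Cauchy_convergent_iff convergent_def by blast
  have "X \<longlonglongrightarrow> Endo l"
    unfolding tendsto_iff using l by (simp add: tendsto_iff dist_blin[symmetric] Endo_inverse)
  then show "convergent X" by (rule convergentI)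
qed

definition mat_of :: "'n::finite endo \<Rightarrow> real^'n^'n" where
  "mat_of x = matrix (blinfun_apply (blin x))"

definition endo_of :: "real^'n^'n \<Rightarrow> 'n::finite endo" where
  "endo_of A = Endo (Blinfun ((*v) A))"

lemma blin_endo_of: "blinfun_apply (blin (endo_of A)) u = A *v u"
  by (simp add: endo_of_def Endo_inverse bounded_linear_Blinfun_apply linear_conv_bounded_linear[symmetric])

lemma mat_of_mv: "mat_of x *v u = blinfun_apply (blin x) u"
proof -
  have "linear (blinfun_apply (blin x))" by (intro blinfun.bounded_linear_right bounded_linear.linear)
  then show ?thesis unfolding mat_of_def by (simp add: matrix_works)
qed

lemma endo_eqI: "(\<And>u. blinfun_apply (blin x) u = blinfun_apply (blin y) u) \<Longrightarrow> x = y"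
  by (metis blin_inject blinfun_eqI)

lemma endo_of_mat_of [simp]: "endo_of (mat_of x) = x"
  by (rule endo_eqI) (simp add: blin_endo_of mat_of_mv)

lemma mat_of_endo_of [simp]: "mat_of (endo_of A) = A"
  by (simp add: matrix_eq mat_of_mv blin_endo_of)

lemma endo_of_mult: "endo_of (A ** B) = endo_of A * endo_of B"
  by (rule endo_eqI) (simp add: blin_endo_of times_endo.rep_eq matrix_vector_mul_assoc)

lemma endo_of_add: "endo_of (A + B) = endo_of A + endo_of B"
  by (rule endo_eqI) (simp add: blin_endo_of plus_endo.rep_eq blinfun.add_left mv.add_left)

lemma endo_of_scaleR: "endo_of (c *\<^sub>R A) = c *\<^sub>R endo_of A"
  by (rule endo_eqI) (simp add: blin_endo_of scaleR_endo.rep_eq blinfun.scaleR_left mv.scaleR_left)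

lemma mat_of_mult: "mat_of (x * y) = mat_of x ** mat_of y"
  by (metis endo_of_mult endo_of_mat_of mat_of_endo_of)

lemma mat_of_one: "mat_of 1 = mat 1"
  by (simp add: matrix_eq mat_of_mv one_endo.rep_eq)

lemma linear_endo_of: "linear endo_of"
  by (intro linearI) (simp_all add: endo_of_add endo_of_scaleR)

lemma bounded_linear_endo_of: "bounded_linear endo_of"
  using linear_endo_of by (simp add: linear_conv_bounded_linear)

lemma norm_matrix_le_sum: "norm (A :: real^'n^'n) \<le> (\<Sum>i\<in>UNIV. \<Sum>j\<in>UNIV. \<bar>A $ i $ j\<bar>)"
proof -
  have "norm A \<le> (\<Sum>i\<in>UNIV. norm (A $ i))" unfolding norm_vec_def by (rule L2_set_le_sum) simp
  also have "\<dots> \<le> (\<Sum>i\<in>UNIV. \<Sum>j\<in>UNIV. \<bar>A $ i $ j\<bar>)" by (intro sum_mono norm_le_l1_cart)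
  finally show ?thesis .
qed

lemma bounded_linear_mat_of: "bounded_linear (mat_of :: 'n::finite endo \<Rightarrow> real^'n^'n)"
proof (rule bounded_linear_intro)
  fix x y :: "'n endo" and r :: real
  show "mat_of (x + y) = mat_of x + mat_of y" by (metis endo_of_add endo_of_mat_of mat_of_endo_of)
  show "mat_of (r *\<^sub>R x) = r *\<^sub>R mat_of x" by (metis endo_of_scaleR endo_of_mat_of mat_of_endo_of)
  have "\<bar>mat_of x $ i $ j\<bar> \<le> norm x" for i j
  proof -
    have "mat_of x $ i $ j = blinfun_apply (blin x) (axis j 1) $ i"
      by (simp add: mat_of_mv[symmetric] matrix_vector_mult_basis column_def)
    also have "\<bar>\<dots>\<bar> \<le> norm (blinfun_apply (blin x) (axis j 1))" by (rule component_le_norm_cart)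
    also have "\<dots> \<le> norm (blin x) * norm (axis j 1 :: real^'n)" by (rule norm_blinfun)
    finally show ?thesis by (simp add: norm_endo.rep_eq)
  qed
  then have "(\<Sum>i\<in>UNIV. \<Sum>j\<in>UNIV. \<bar>mat_of x $ i $ j\<bar>) \<le> (\<Sum>i\<in>(UNIV::'n set). \<Sum>j\<in>(UNIV::'n set). norm x)"
    by (intro sum_mono)
  then show "norm (mat_of x) \<le> norm x * (real CARD('n) * real CARD('n))"
    using norm_matrix_le_sum[of "mat_of x"] by (simp add: mult_ac)
qed

definition mexp :: "real^'n^'n \<Rightarrow> real^'n^'n" where
  "mexp A = mat_of (exp (endo_of A))"

lemma mexp_add: "A ** B = B ** A \<Longrightarrow> mexp (A + B) = mexp A ** mexp B"
  by (simp add: mexp_def endo_of_add exp_add_commuting endo_of_mult[symmetric] mat_of_mult[symmetric])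

lemma mexp_0: "mexp (0 :: real^'n^'n) = mat 1"
proof -
  have "endo_of (0 :: real^'n^'n) = 0" by (rule linear_0[OF linear_endo_of])
  then show ?thesis by (simp add: mexp_def mat_of_one)
qed

lemma mexp_sums: "(\<lambda>k. mpow A k /\<^sub>R fact k) sums mexp A"
proof -
  have p: "mat_of (endo_of A ^ k) = mpow A k" for k
    by (induction k) (simp_all add: mat_of_one mat_of_mult)
  have "(\<lambda>k. mat_of (endo_of A ^ k /\<^sub>R fact k)) sums mat_of (exp (endo_of A))"
    by (rule bounded_linear.sums[OF bounded_linear_mat_of exp_converges])
  then show ?thesis
    by (simp add: mexp_def p linear_scale[OF bounded_linear.linear[OF bounded_linear_mat_of]])
qed

text \<open>On each closed ball the exponential series converges uniformly, by comparison with the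
  series of \<open>exp R\<close>.\<close>

lemma continuous_on_mexp: "continuous_on UNIV (mexp :: real^'n^'n \<Rightarrow> real^'n^'n)"
proof -
  have "continuous_on (cball 0 R) (exp :: 'n endo \<Rightarrow> 'n endo)" for R
  proof (cases "R \<ge> 0")
    case True
    have "uniform_limit (cball 0 R) (\<lambda>n x :: 'n endo. \<Sum>i<n. x ^ i /\<^sub>R fact i) (\<lambda>x. \<Sum>i. x ^ i /\<^sub>R fact i) sequentially"
    proof (rule Weierstrass_m_test)
      fix i and x :: "'n endo" assume x: "x \<in> cball 0 R"
      have "norm (x ^ i /\<^sub>R fact i) \<le> norm x ^ i / fact i"
        by (simp add: divide_inverse mult.commute mult_right_mono norm_power_ineq)
      also have "\<dots> \<le> R ^ i / fact i" using x by (intro divide_right_mono power_mono) auto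
      finally show "norm (x ^ i /\<^sub>R fact i) \<le> R ^ i /\<^sub>R fact i" by (simp add: divide_inverse mult.commute)
    qed (rule summable_exp_generic)
    then have "continuous_on (cball 0 R) (\<lambda>x :: 'n endo. \<Sum>i. x ^ i /\<^sub>R fact i)"
      by (rule uniform_limit_theorem[rotated]) (auto intro!: always_eventually continuous_intros)
    then show ?thesis by (simp add: exp_def)
  qed simp
  then have "continuous_on (ball 0 R) (exp :: 'n endo \<Rightarrow> 'n endo)" for R
    using continuous_on_subset ball_subset_cball by blast
  then have "continuous_on (\<Union>R. ball (0 :: 'n endo) R) (exp :: 'n endo \<Rightarrow> 'n endo)"
    by (intro continuous_on_open_UN) auto
  moreover have "(\<Union>R. ball (0 :: 'n endo) R) = UNIV"
  proof -
    have "x \<in> ball 0 (norm x + 1)" for x :: "'n endo" by simp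
    then show ?thesis by blast
  qed
  ultimately have "continuous_on UNIV (exp :: 'n endo \<Rightarrow> 'n endo)" by simp
  then show ?thesis
    unfolding mexp_def[abs_def]
    by (intro bounded_linear.continuous_on[OF bounded_linear_mat_of]
        continuous_on_compose2[where f=endo_of and g=exp] bounded_linear.continuous_on[OF bounded_linear_endo_of]) auto
qed

lemma mexp_uminus: "mexp A ** mexp (- A) = mat 1"
proof -
  have "A ** (- A) = (- A) ** A" by (simp add: mm.minus_left mm.minus_right)
  from mexp_add[OF this] show ?thesis by (simp add: mexp_0)
qed

lemma mexp_mv_sums: "(\<lambda>k. (((*v) A ^^ k) u) /\<^sub>R fact k) sums (mexp A *v u)"
proof -
  have "(\<lambda>k. (mpow A k /\<^sub>R fact k) *v u) sums (mexp A *v u)"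
    by (rule bounded_linear.sums[OF mv.bounded_linear_left mexp_sums])
  then show ?thesis by (simp add: mv.scaleR_left mpow_mv)
qed

lemma mexp_eigen: 
  assumes "A *v u = \<mu> *\<^sub>R u"
  shows "mexp A *v u = exp \<mu> *\<^sub>R u"
proof -
  have "((*v) A ^^ k) u = \<mu> ^ k *\<^sub>R u" for k
    by (induction k) (simp_all add: assms mv.scaleR_right)
  then have "(\<lambda>k. (((*v) A ^^ k) u) /\<^sub>R fact k) = (\<lambda>k. (\<mu> ^ k /\<^sub>R fact k) *\<^sub>R u)" by simp
  then have 1: "(\<lambda>k. (\<mu> ^ k /\<^sub>R fact k) *\<^sub>R u) sums (mexp A *v u)" using mexp_mv_sums[of A u] by simp
  have "(\<lambda>k. (\<mu> ^ k /\<^sub>R fact k) *\<^sub>R u) sums (exp \<mu> *\<^sub>R u)"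
    by (rule bounded_linear.sums[OF bounded_linear_scaleR_left exp_converges])
  from sums_unique2[OF 1 this] show ?thesis .
qed

lemma mexp_square_zero:
  assumes "A *v (A *v u) = 0"
  shows "mexp A *v u = u + A *v u"
proof -
  have z: "((*v) A ^^ k) u /\<^sub>R fact k = 0" if "k \<notin> {0, 1}" for k
  proof -
    from that have "2 \<le> k" by auto
    then have "((*v) A ^^ k) u = ((*v) A ^^ (k - 2)) (((*v) A ^^ 2) u)" by (rule funpow_split)
    then show ?thesis using assms by (simp add: numeral_2_eq_2)
  qed
  have "(\<lambda>k. (((*v) A ^^ k) u) /\<^sub>R fact k) sums (\<Sum>k\<in>{0, 1}. (((*v) A ^^ k) u) /\<^sub>R fact k)"
    by (rule sums_finite) (use z in auto)
  from sums_unique2[OF this mexp_mv_sums[of A u]] show ?thesis by simp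
qed

text \<open>The partial sums lie in \<open>T\<close>, which is closed as a subspace.\<close>

lemma mexp_in:
  assumes "subspace T" "mat 1 \<in> T" "\<And>X Y. X \<in> T \<Longrightarrow> Y \<in> T \<Longrightarrow> X ** Y \<in> T" "A \<in> T"
  shows "mexp A \<in> T"
proof -
  have "mpow A k \<in> T" for k using assms by (induction k) auto
  then have 1: "(\<Sum>k<n. mpow A k /\<^sub>R fact k) \<in> T" for n
    using assms(1) by (intro subspace_sum subspace_scale) auto
  have "(\<lambda>n. \<Sum>k<n. mpow A k /\<^sub>R fact k) \<longlonglongrightarrow> mexp A" using mexp_sums[of A] unfolding sums_def .
  from closed_sequentially[OF closed_subspace[OF assms(1)] 1 this] show ?thesis .
qed

lemma mexp_conj:
  fixes Q R A :: "real^'n^'n"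
  assumes "Q ** R = mat 1" "R ** Q = mat 1"
  shows "mexp (Q ** A ** R) = Q ** mexp A ** R"
proof -
  have p: "mpow (Q ** A ** R) k = Q ** mpow A k ** R" for k
  proof (induction k)
    case (Suc k)
    have "mpow (Q ** A ** R) (Suc k) = Q ** A ** (R ** Q) ** mpow A k ** R" by (simp add: Suc matrix_mul_assoc)
    then show ?case by (simp add: assms matrix_mul_assoc)
  qed (simp add: assms)
  have "bounded_linear (\<lambda>M. Q ** M ** R)"
    by (rule bounded_linear_compose[OF mm.bounded_linear_left mm.bounded_linear_right])
  from bounded_linear.sums[OF this mexp_sums[of A]]
  have 1: "(\<lambda>k. mpow (Q ** A ** R) k /\<^sub>R fact k) sums (Q ** mexp A ** R)"
    by (simp add: p mm.scaleR_left mm.scaleR_right)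
  from sums_unique2[OF mexp_sums[of "Q ** A ** R"] this] show ?thesis .
qed

text \<open>The columns of \<open>P\<close> are eigenvectors of both sides with equal
  eigenvalues.\<close>

lemma mexp_cdiag:
  assumes P: "det P \<noteq> 0"
  shows "mexp (cdiag P v) = cdiag P (\<chi> i. exp (v $ i))"
proof -
  have ax: "cdiag P v *v (P *v axis i 1) = v $ i *\<^sub>R (P *v axis i 1)" for v i
  proof -
    have "cdiag P v *v (P *v axis i 1) = P *v (diagm v *v ((matrix_inv P ** P) *v axis i 1))"
      by (simp add: cdiag_def matrix_vector_mul_assoc matrix_mul_assoc)
    also have "diagm v *v ((matrix_inv P ** P) *v axis i 1) = v $ i *\<^sub>R axis i 1"
      by (simp add: matrix_inv_mul[OF P] diagm_vec vec_eq_iff axis_def)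
    finally show ?thesis by (simp add: mv.scaleR_right)
  qed
  have "mexp (cdiag P v) ** P = cdiag P (\<chi> i. exp (v $ i)) ** P"
  proof -
    have "column i (mexp (cdiag P v) ** P) = column i (cdiag P (\<chi> i. exp (v $ i)) ** P)" for i
      unfolding matrix_vector_mult_basis[symmetric] matrix_vector_mul_assoc[symmetric]
      using mexp_eigen[OF ax[of v i]] ax[of "\<chi> i. exp (v $ i)" i] by simp
    then show ?thesis by (simp add: vec_eq_iff column_def)
  qed
  then have "mexp (cdiag P v) ** (P ** matrix_inv P) = cdiag P (\<chi> i. exp (v $ i)) ** (P ** matrix_inv P)"
    by (simp add: matrix_mul_assoc)
  then show ?thesis by (simp add: matrix_inv_mul[OF P])
qed

lemma vector_derivative_in_subspace:
  fixes \<gamma> :: "real \<Rightarrow> 'a::euclidean_space"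
  assumes W: "subspace W" and g: "\<And>t. \<gamma> t \<in> W" and d: "(\<gamma> has_vector_derivative y) (at s)"
  shows "y \<in> W"
proof (rule ccontr)
  assume "y \<notin> W"
  then obtain w where w: "w \<bullet> y = 1 \<and> (\<forall>h\<in>W. w \<bullet> h = 0)" using dual_vector[OF W] by blast
  have "((\<lambda>t. w \<bullet> \<gamma> t) has_vector_derivative w \<bullet> y) (at s)"
    by (rule bounded_linear.has_vector_derivative[OF bounded_linear_inner_right d])
  then have "((\<lambda>t. 0) has_vector_derivative w \<bullet> y) (at s)" using w g by simp
  from vector_derivative_unique_at[OF this has_vector_derivative_const] have "w \<bullet> y = 0" .
  then show False using w by simp
qed

lemma mexp_line_derivative:
  "((\<lambda>t. mexp (t *\<^sub>R A)) has_vector_derivative mexp (t *\<^sub>R A) ** A) (at t)"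
proof -
  have "((\<lambda>t. mat_of (exp (t *\<^sub>R endo_of A))) has_vector_derivative mat_of (exp (t *\<^sub>R endo_of A) * endo_of A)) (at t)"
    by (rule bounded_linear.has_vector_derivative[OF bounded_linear_mat_of exp_scaleR_has_vector_derivative_right])
  then show ?thesis by (simp add: mexp_def endo_of_scaleR mat_of_mult)
qed

text \<open>These are the first two derivatives at 0 of a curve in \<open>W\<close>. They recover
  generators and their squares from the span of a group of exponentials.\<close>

lemma mexp_line_in_subspace:
  assumes W: "subspace W" and g: "\<And>t. mexp (t *\<^sub>R A) \<in> W"
  shows "A \<in> W" "A ** A \<in> W"
proof -
  have 1: "mexp (t *\<^sub>R A) ** A \<in> W" for t by (rule vector_derivative_in_subspace[OF W g mexp_line_derivative])
  from 1[of 0] show "A \<in> W" by (simp add: mexp_0)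
  have "((\<lambda>t. mexp (t *\<^sub>R A) ** A) has_vector_derivative (mexp (0 *\<^sub>R A) ** A) ** A) (at 0)"
    by (rule bounded_linear.has_vector_derivative[OF mm.bounded_linear_left mexp_line_derivative])
  from vector_derivative_in_subspace[OF W 1 this] show "A ** A \<in> W" by (simp add: mexp_0)
qed

section \<open>Vector groups modelled on arbitrary subspaces\<close>

lemma continuous_map_Euclidean_component: "continuous_map (Euclidean_space m) euclideanreal (\<lambda>c. c i)"
  unfolding Euclidean_space_def
  by (rule continuous_map_from_subtopology[OF continuous_map_product_projection]) simp

lemma subspace_coordinates:
  fixes T :: "'a::euclidean_space set"
  assumes T: "subspace T" "dim T = m"
  obtains \<phi> \<psi> where "homeomorphic_maps (Euclidean_space m) (top_of_set T) \<psi> \<phi>"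
    "\<And>x y. \<psi> (\<lambda>i. x i + y i) = \<psi> x + \<psi> y" "\<And>x y. \<phi> (x + y) = (\<lambda>i. \<phi> x i + \<phi> y i)"
proof -
  have "indep_fam 0 (\<lambda>i. 0 :: 'a)" by (simp add: indep_fam_def)
  from indep_fam_extend_upto[OF this, of T m] T(2)
  obtain \<beta> where \<beta>: "indep_fam m \<beta>" "\<forall>i<m. \<beta> i \<in> T" by auto
  obtain d where d: "\<And>i j. i < m \<Longrightarrow> j < m \<Longrightarrow> d i \<bullet> \<beta> j = (if i = j then 1 else 0)"
    and rep: "\<And>u. u \<in> T \<Longrightarrow> u = (\<Sum>i<m. (d i \<bullet> u) *\<^sub>R \<beta> i)"
    by (rule dual_family[OF \<beta>(1) T \<beta>(2)[rule_format]], assumption, rule that)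
  define \<psi> where "\<psi> c = (\<Sum>i<m. c i *\<^sub>R \<beta> i)" for c :: "nat \<Rightarrow> real"
  define \<phi> where "\<phi> x = (\<lambda>i. if i < m then d i \<bullet> x else 0)" for x
  have \<psi>T: "\<psi> c \<in> T" for c unfolding \<psi>_def using \<beta>(2) T(1) by (intro subspace_sum subspace_scale) auto
  have "continuous_map (Euclidean_space m) euclidean (\<lambda>c. c i *\<^sub>R \<beta> i)" for i
  proof -
    have "continuous_map euclideanreal euclidean (\<lambda>r. r *\<^sub>R \<beta> i)"
      by (simp add: continuous_intros)
    from continuous_map_compose[OF continuous_map_Euclidean_component this] show ?thesis by (simp add: o_def)
  qed
  then have "continuous_map (Euclidean_space m) euclidean \<psi>"
    unfolding \<psi>_def[abs_def] by (intro continuous_map_sum) auto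
  then have 1: "continuous_map (Euclidean_space m) (top_of_set T) \<psi>"
    using \<psi>T by (auto simp: continuous_map_in_subtopology)
  have 2: "continuous_map (top_of_set T) (Euclidean_space m) \<phi>"
  proof -
    have "continuous_map (top_of_set T) euclideanreal (\<lambda>x. \<phi> x i)" for i
      by (cases "i < m") (auto simp: \<phi>_def intro!: continuous_intros)
    then show ?thesis
      unfolding Euclidean_space_def continuous_map_in_subtopology continuous_map_componentwise_UNIV
      by (auto simp: \<phi>_def)
  qed
  have 3: "\<phi> (\<psi> c) = c" if "c \<in> topspace (Euclidean_space m)" for c
  proof
    fix i
    show "\<phi> (\<psi> c) i = c i"
    proof (cases "i < m")
      case True
      have "d i \<bullet> \<psi> c = (\<Sum>j<m. c j * (if i = j then 1 else 0))"
        unfolding \<psi>_def inner_sum_right inner_scaleR_right using d True by (intro sum.cong) auto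
      then show ?thesis using True by (simp add: \<phi>_def if_distrib[of "\<lambda>x. _ * x"] cong: if_cong)
    next
      case False
      then show ?thesis using that by (simp add: \<phi>_def topspace_Euclidean_space)
    qed
  qed
  have 4: "\<psi> (\<phi> x) = x" if "x \<in> T" for x
    unfolding \<psi>_def \<phi>_def using rep[OF that] by simp
  have "homeomorphic_maps (Euclidean_space m) (top_of_set T) \<psi> \<phi>"
    unfolding homeomorphic_maps_def using 1 2 3 4 by simp
  moreover have "\<psi> (\<lambda>i. x i + y i) = \<psi> x + \<psi> y" for x y by (simp add: \<psi>_def scaleR_add_left sum.distrib)
  moreover have "\<phi> (x + y) = (\<lambda>i. \<phi> x i + \<phi> y i)" for x y by (auto simp: \<phi>_def inner_add_right)
  ultimately show thesis by (rule that)
qed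

text \<open>This and its converse below let any \<open>m\<close>-dimensional subspace
  \<open>T\<close> play the role of \<open>Euclidean_space m\<close>, whose points are infinite
  sequences and to which invariance of domain for subspaces does not speak directly.\<close>

lemma isomorphic_to_euclideanI:
  fixes T :: "'a::euclidean_space set" and G :: "(real^'n^'n) set"
  assumes T: "subspace T" "dim T = m"
    and gh: "homeomorphic_maps (top_of_set T) (top_of_set G) g h"
    and mult: "\<And>x y. x \<in> T \<Longrightarrow> y \<in> T \<Longrightarrow> g (x + y) = g x ** g y"
  shows "isomorphic_to_euclidean m G"
proof -
  obtain \<phi> \<psi> where \<phi>: "homeomorphic_maps (Euclidean_space m) (top_of_set T) \<psi> \<phi>"
    "\<And>x y. \<psi> (\<lambda>i. x i + y i) = \<psi> x + \<psi> y" by (rule subspace_coordinates[OF T]) (rule that)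
  have H: "homeomorphic_maps (Euclidean_space m) (top_of_set G) (g \<circ> \<psi>) (\<phi> \<circ> h)"
    using homeomorphic_maps_compose \<phi>(1) gh by blast
  have \<psi>T: "\<psi> c \<in> T" if "c \<in> topspace (Euclidean_space m)" for c
    using \<phi>(1) that unfolding homeomorphic_maps_def continuous_map_def by auto
  have in1: "(g \<circ> \<psi>) c \<in> G" if "c \<in> topspace (Euclidean_space m)" for c
    using H that unfolding homeomorphic_maps_def continuous_map_def by auto
  have in2: "(\<phi> \<circ> h) y \<in> topspace (Euclidean_space m)" if "y \<in> G" for y
    using H that unfolding homeomorphic_maps_def continuous_map_def by auto
  have inv: "(\<phi> \<circ> h) ((g \<circ> \<psi>) c) = c" if "c \<in> topspace (Euclidean_space m)" for c
    using H that unfolding homeomorphic_maps_def by auto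
  have inv2: "(g \<circ> \<psi>) ((\<phi> \<circ> h) y) = y" if "y \<in> G" for y
    using H that unfolding homeomorphic_maps_def by auto
  have "bij_betw (g \<circ> \<psi>) (topspace (Euclidean_space m)) G"
    by (rule bij_betw_byWitness[where f'="\<phi> \<circ> h"]) (use in1 in2 inv inv2 in auto)
  moreover have "g \<circ> \<psi> \<in> hom (euclidean_group m) (SL\<lparr>carrier := G\<rparr>)"
  proof (rule homI)
    fix x assume "x \<in> carrier (euclidean_group m)"
    then show "(g \<circ> \<psi>) x \<in> carrier (SL\<lparr>carrier := G\<rparr>)" using in1 by (simp add: euclidean_group_def)
  next
    fix x y assume "x \<in> carrier (euclidean_group m)" "y \<in> carrier (euclidean_group m)"
    then show "(g \<circ> \<psi>) (x \<otimes>\<^bsub>euclidean_group m\<^esub> y) = (g \<circ> \<psi>) x \<otimes>\<^bsub>SL\<lparr>carrier := G\<rparr>\<^esub> (g \<circ> \<psi>) y"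
      using \<psi>T by (simp add: euclidean_group_def \<phi>(2) mult SL_def)
  qed
  ultimately have "g \<circ> \<psi> \<in> iso (euclidean_group m) (SL\<lparr>carrier := G\<rparr>)"
    by (simp add: iso_def euclidean_group_def)
  moreover have "homeomorphic_map (Euclidean_space m) (top_of_set G) (g \<circ> \<psi>)"
    using H homeomorphic_map_maps by blast
  ultimately show ?thesis unfolding isomorphic_to_euclidean_def by blast
qed

lemma isomorphic_to_euclideanE:
  fixes T :: "'a::euclidean_space set" and G :: "(real^'n^'n) set"
  assumes iso: "isomorphic_to_euclidean m G" and T: "subspace T" "dim T = m"
  obtains g where "continuous_on T g" "inj_on g T" "g ` T = G"
    "\<And>x y. x \<in> T \<Longrightarrow> y \<in> T \<Longrightarrow> g (x + y) = g x ** g y"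
proof -
  obtain f where f: "f \<in> iso (euclidean_group m) (SL\<lparr>carrier := G\<rparr>)"
    "homeomorphic_map (Euclidean_space m) (top_of_set G) f"
    using iso unfolding isomorphic_to_euclidean_def by blast
  obtain \<phi> \<psi> where \<phi>: "homeomorphic_maps (Euclidean_space m) (top_of_set T) \<psi> \<phi>"
    "\<And>x y. \<phi> (x + y) = (\<lambda>i. \<phi> x i + \<phi> y i)" by (rule subspace_coordinates[OF T]) (rule that)
  have \<phi>c: "continuous_map (top_of_set T) (Euclidean_space m) \<phi>"
    and \<psi>c: "continuous_map (Euclidean_space m) (top_of_set T) \<psi>"
    and \<psi>\<phi>: "\<And>x. x \<in> T \<Longrightarrow> \<psi> (\<phi> x) = x" and \<phi>\<psi>: "\<And>c. c \<in> topspace (Euclidean_space m) \<Longrightarrow> \<phi> (\<psi> c) = c"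
    using \<phi>(1) unfolding homeomorphic_maps_def by auto
  have \<phi>T: "\<phi> x \<in> topspace (Euclidean_space m)" if "x \<in> T" for x
    using \<phi>c that unfolding continuous_map_def by auto
  have \<psi>T: "\<psi> c \<in> T" if "c \<in> topspace (Euclidean_space m)" for c
    using \<psi>c that unfolding continuous_map_def by auto
  have bij: "bij_betw f (topspace (Euclidean_space m)) G"
    using f(1) by (simp add: iso_def euclidean_group_def)
  have hom: "f (\<lambda>i. x i + y i) = f x ** f y" if "x \<in> topspace (Euclidean_space m)" "y \<in> topspace (Euclidean_space m)" for x y
    using f(1) that by (auto simp: iso_def hom_def euclidean_group_def SL_def)
  have "continuous_map (top_of_set T) (top_of_set G) (f \<circ> \<phi>)"
    using continuous_map_compose[OF \<phi>c] f(2) homeomorphic_imp_continuous_map by blast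
  then have "continuous_on T (f \<circ> \<phi>)" by (simp add: continuous_map_in_subtopology)
  moreover have "inj_on (f \<circ> \<phi>) T"
  proof (rule comp_inj_on)
    show "inj_on \<phi> T" by (rule inj_on_inverseI[where g=\<psi>]) (rule \<psi>\<phi>)
    show "inj_on f (\<phi> ` T)"
      by (rule inj_on_subset[OF bij_betw_imp_inj_on[OF bij]]) (rule image_subsetI, rule \<phi>T)
  qed
  moreover have "(f \<circ> \<phi>) ` T = G"
  proof -
    have "\<phi> ` T = topspace (Euclidean_space m)"
    proof (intro equalityI subsetI)
      fix c assume "c \<in> topspace (Euclidean_space m)"
      then show "c \<in> \<phi> ` T" using image_eqI[of c \<phi> "\<psi> c" T] \<phi>\<psi> \<psi>T by simp
    qed (use \<phi>T in \<open>elim imageE, simp\<close>)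
    then show ?thesis unfolding image_comp[symmetric] using bij by (simp add: bij_betw_def)
  qed
  moreover have "(f \<circ> \<phi>) (x + y) = (f \<circ> \<phi>) x ** (f \<circ> \<phi>) y" if "x \<in> T" "y \<in> T" for x y
    using that \<phi>T by (simp add: \<phi>(2) hom)
  ultimately show thesis by (rule that)
qed

text \<open>The algebras on which the exponential behaves as on diagonal matrices: commutativity
  makes it a homomorphism, real spectrum makes it injective.\<close>

definition comm_alg :: "(real^'n^'n) set \<Rightarrow> bool" where
  "comm_alg A \<longleftrightarrow> subspace A \<and> mat 1 \<in> A \<and> (\<forall>X\<in>A. \<forall>Y\<in>A. X ** Y \<in> A \<and> X ** Y = Y ** X) \<and> (\<forall>X\<in>A. real_spec X)"

lemma det_nonzero_mv_eq_0: "det (Y :: real^'n^'n) \<noteq> 0 \<Longrightarrow> Y *v u = 0 \<Longrightarrow> u = 0"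
  by (metis matrix_inv_mul(2) matrix_vector_mul_assoc matrix_vector_mul_lid matrix_vector_mult_0_right)

text \<open>A nonzero \<open>Z\<close> has an eigenvector \<open>w = Z u\<close> in its image. From
  \<open>exp c = 1\<close> its eigenvalue is 0, so \<open>Z (Z u) = 0\<close> and
  \<open>exp Z\<close> maps \<open>u\<close> to \<open>u + w\<close>, which differs from
  \<open>u\<close>.\<close>

lemma mexp_eq_one:
  fixes Z :: "real^'n^'n"
  assumes "real_spec Z" "mexp Z = mat 1"
  shows "Z = 0"
proof (rule ccontr)
  assume "Z \<noteq> 0"
  define W where "W = range ((*v) Z)"
  have "subspace W" unfolding W_def by (intro linear_subspace_image matrix_vector_mul_linear subspace_UNIV)
  moreover have "W \<noteq> {0}"
  proof
    assume "W = {0}"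
    then have "Z *v u = 0" for u unfolding W_def by blast
    then have "Z = 0" by (simp add: matrix_eq)
    then show False using \<open>Z \<noteq> 0\<close> by simp
  qed
  moreover have "\<forall>u\<in>W. Z *v u \<in> W" by (auto simp: W_def)
  ultimately obtain w c where w: "w \<in> W" "w \<noteq> 0" "Z *v w = c *\<^sub>R w"
    using real_on_if_real_spec[OF assms(1)] unfolding real_on_def by blast
  have "exp c *\<^sub>R w = w" using mexp_eigen[OF w(3)] assms(2) by simp
  then have "(exp c - 1) *\<^sub>R w = 0" by (simp add: scaleR_diff_left)
  then have "c = 0" using w(2) by simp
  obtain u where u: "w = Z *v u" using w(1) by (auto simp: W_def)
  have "Z *v (Z *v u) = 0" using w(3) \<open>c = 0\<close> u by simp
  from mexp_square_zero[OF this] have "Z *v u = 0" using assms(2) by simp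
  then show False using u w(2) by simp
qed

lemma comm_algD:
  assumes "comm_alg A"
  shows "subspace A" "mat 1 \<in> A" "\<And>X Y. X \<in> A \<Longrightarrow> Y \<in> A \<Longrightarrow> X ** Y \<in> A"
    "\<And>X Y. X \<in> A \<Longrightarrow> Y \<in> A \<Longrightarrow> X ** Y = Y ** X" "\<And>X. X \<in> A \<Longrightarrow> real_spec X"
  using assms unfolding comm_alg_def by blast+

lemma comm_alg_mexp:
  assumes A: "comm_alg A"
  shows "\<And>X. X \<in> A \<Longrightarrow> mexp X \<in> A" "\<And>X Y. X \<in> A \<Longrightarrow> Y \<in> A \<Longrightarrow> mexp (X + Y) = mexp X ** mexp Y"
    "inj_on mexp A"
proof -
  note D = comm_algD[OF A]
  show "mexp X \<in> A" if "X \<in> A" for X by (rule mexp_in[OF D(1,2) D(3) that])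
  show add: "mexp (X + Y) = mexp X ** mexp Y" if "X \<in> A" "Y \<in> A" for X Y by (rule mexp_add[OF D(4)[OF that]])
  show "inj_on mexp A"
  proof (rule inj_onI)
    fix X Y assume X: "X \<in> A" "Y \<in> A" "mexp X = mexp Y"
    have "- Y \<in> A" using X(2) D(1) by (simp add: subspace_neg)
    from add[OF X(1) this] have "mexp (X - Y) = mexp Y ** mexp (- Y)" using X(3) by simp
    then have "mexp (X - Y) = mat 1" by (simp add: mexp_uminus)
    moreover have "real_spec (X - Y)" using X D(1,5) by (simp add: subspace_diff)
    ultimately have "X - Y = 0" by (intro mexp_eq_one)
    then show "X = Y" by simp
  qed
qed

text \<open>Invariance of domain for the injective map \<open>X \<mapsto> h exp X\<close> from
  \<open>A\<close> to itself. In particular all cosets of \<open>exp A\<close> by invertible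
  elements are open in \<open>A\<close>.\<close>

lemma comm_alg_translate_open:
  assumes A: "comm_alg A" and h: "h \<in> A" "det h \<noteq> 0" and U: "openin (top_of_set A) U"
  shows "openin (top_of_set A) ((\<lambda>X. h ** mexp X) ` U)"
proof -
  note D = comm_algD[OF A]
  have UA: "U \<subseteq> A" using U openin_imp_subset by blast
  show ?thesis
  proof (rule invariance_of_domain_subspaces[OF U D(1) D(1) order_refl])
    show "continuous_on U (\<lambda>X. h ** mexp X)"
      by (intro mm.continuous_on continuous_on_const continuous_on_subset[OF continuous_on_mexp]) simp
    show "(\<lambda>X. h ** mexp X) \<in> U \<rightarrow> A" using UA D(3)[OF h(1)] comm_alg_mexp(1)[OF A] by auto
    show "inj_on (\<lambda>X. h ** mexp X) U"
    proof (rule inj_onI)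
      fix X Y assume X: "X \<in> U" "Y \<in> U" "h ** mexp X = h ** mexp Y"
      then have "matrix_inv h ** h ** mexp X = matrix_inv h ** h ** mexp Y" by (metis matrix_mul_assoc)
      then have "mexp X = mexp Y" using matrix_inv_mul(2)[OF h(2)] by simp
      then show "X = Y" using comm_alg_mexp(3)[OF A] X(1,2) UA by (auto dest: inj_onD)
    qed
  qed
qed

lemma comm_alg_mexp_open:
  assumes A: "comm_alg A" and U: "openin (top_of_set A) U"
  shows "openin (top_of_set A) (mexp ` U)"
  using comm_alg_translate_open[OF A comm_algD(2)[OF A] _ U] by simp

text \<open>The open coset of \<open>h\<close> is disjoint from the group \<open>exp A\<close>,
  since \<open>h\<close> lies outside.\<close>

lemma comm_alg_mexp_complement_open:
  assumes A: "comm_alg A" and h: "h \<in> A" "det h \<noteq> 0" "h \<notin> mexp ` A"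
  shows "\<exists>U. openin (top_of_set A) U \<and> h \<in> U \<and> U \<inter> mexp ` A = {}"
proof (intro exI conjI)
  note D = comm_algD[OF A]
  show "openin (top_of_set A) ((\<lambda>X. h ** mexp X) ` A)"
    by (rule comm_alg_translate_open[OF A h(1,2)]) simp
  show "h \<in> (\<lambda>X. h ** mexp X) ` A"
    by (rule image_eqI[of _ _ 0]) (simp_all add: mexp_0 subspace_0[OF D(1)])
  show "(\<lambda>X. h ** mexp X) ` A \<inter> mexp ` A = {}"
  proof (rule ccontr)
    assume "\<not> ?thesis"
    then obtain X Y where X: "X \<in> A" "Y \<in> A" "h ** mexp X = mexp Y" by auto
    have nX: "- X \<in> A" using X(1) D(1) by (simp add: subspace_neg)
    have "h = h ** (mexp X ** mexp (- X))" by (simp add: mexp_uminus)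
    also have "\<dots> = mexp Y ** mexp (- X)" by (simp add: matrix_mul_assoc X(3))
    also have "\<dots> = mexp (Y + - X)" using comm_alg_mexp(2)[OF A X(2) nX] by simp
    finally have "h = mexp (Y + - X)" .
    then show False using h(3) subspace_add[OF D(1) X(2) nX] by blast
  qed
qed

text \<open>Open cosets make \<open>exp A\<close> clopen among the invertible elements of
  \<open>A\<close>, so a connected set of them through the identity cannot leave it. This provides
  logarithms without constructing them.\<close>

lemma connected_subset_mexp:
  assumes A: "comm_alg A" and C: "connected C" "C \<subseteq> A" "mat 1 \<in> C" "\<And>x. x \<in> C \<Longrightarrow> det x \<noteq> 0"
  shows "C \<subseteq> mexp ` A"
proof -
  note D = comm_algD[OF A]
  have o: "openin (top_of_set C) (C \<inter> U)" if "openin (top_of_set A) U" for U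
    using that C(2) by (auto simp: openin_open)
  have "openin (top_of_set A) (mexp ` A)" by (rule comm_alg_mexp_open[OF A]) simp
  then have 1: "openin (top_of_set C) (C \<inter> mexp ` A)" by (rule o)
  have "openin (top_of_set C) (C - mexp ` A)"
  proof (subst openin_subopen, intro ballI)
    fix h assume h: "h \<in> C - mexp ` A"
    then obtain U where U: "openin (top_of_set A) U \<and> h \<in> U \<and> U \<inter> mexp ` A = {}"
      using comm_alg_mexp_complement_open[OF A, of h] C by blast
    then show "\<exists>T. openin (top_of_set C) T \<and> h \<in> T \<and> T \<subseteq> C - mexp ` A"
      using o[of U] h by (intro exI[of _ "C \<inter> U"]) auto
  qed
  then have 2: "closedin (top_of_set C) (C \<inter> mexp ` A)"
    by (simp add: closedin_def Diff_Int_distrib2 Diff_Int)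
  have "mat 1 \<in> mexp ` A" by (rule image_eqI[of _ _ 0]) (simp_all add: mexp_0 subspace_0[OF D(1)])
  then have "C \<inter> mexp ` A \<noteq> {}" using C(3) by blast
  then have "C \<inter> mexp ` A = C" using C(1) 1 2 unfolding connected_clopen by blast
  then show ?thesis by blast
qed

lemma comm_alg_mexp_inverse:
  assumes A: "comm_alg A"
  obtains g where "continuous_on (mexp ` A) g" "\<And>X. X \<in> A \<Longrightarrow> g (mexp X) = X"
proof -
  define g where "g = inv_into A mexp"
  have g: "g (mexp X) = X" if "X \<in> A" for X
    unfolding g_def using comm_alg_mexp(3)[OF A] that by (rule inv_into_f_f)
  have "continuous_on (mexp ` A) g"
  proof (rule continuous_on_inverse_open_map[where S=A and f=mexp])
    show "mexp ` A = mexp ` A" ..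
    show "g (mexp X) = X" if "X \<in> A" for X using g that .
    show "continuous_on A mexp" by (rule continuous_on_subset[OF continuous_on_mexp]) simp
    fix U assume U: "openin (top_of_set A) U"
    show "openin (top_of_set (mexp ` A)) (mexp ` U)"
      using comm_alg_mexp_open[OF A U] openin_imp_subset[OF U] comm_alg_mexp(1)[OF A]
      by (intro openin_subset_trans[of A "mexp ` U" "mexp ` A"]) auto
  qed
  then show thesis using g by (rule that)
qed

text \<open>For closedness: a limit in \<open>SL\<close> is an invertible element of
  \<open>A\<close>, hence lies in \<open>exp A\<close> by openness of the complement. The continuous
  inverse of the exponential then takes the sequence to one in the closed set
  \<open>T\<close>.\<close>

lemma mexp_closed_subgroup:
  fixes A :: "(real^'n^'n) set"
  assumes A: "comm_alg A" and T: "subspace T" "T \<subseteq> A" and SL: "mexp ` T \<subseteq> carrier SL"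
  shows "closed_subgroup_SL (mexp ` T)" "isomorphic_to_euclidean (dim T) (mexp ` T)"
proof -
  interpret group "SL :: (real^'n^'n) monoid" by (rule group_SL)
  note D = comm_algD[OF A]
  obtain g where g: "continuous_on (mexp ` A) g" "\<And>X. X \<in> A \<Longrightarrow> g (mexp X) = X"
    by (rule comm_alg_mexp_inverse[OF A]) (rule that)
  have add: "mexp (X + Y) = mexp X ** mexp Y" if "X \<in> T" "Y \<in> T" for X Y
    using comm_alg_mexp(2)[OF A] T(2) that by blast
  have "homeomorphic_maps (top_of_set T) (top_of_set (mexp ` T)) mexp g"
    unfolding homeomorphic_maps_def
  proof (intro conjI ballI)
    show "continuous_map (top_of_set T) (top_of_set (mexp ` T)) mexp"
      by (auto simp: continuous_map_in_subtopology intro: continuous_on_subset[OF continuous_on_mexp])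
    have "continuous_on (mexp ` T) g" by (rule continuous_on_subset[OF g(1)]) (use T in auto)
    then show "continuous_map (top_of_set (mexp ` T)) (top_of_set T) g"
      using g(2) T(2) by (auto simp: continuous_map_in_subtopology)
  qed (use g(2) T(2) in auto)
  then show "isomorphic_to_euclidean (dim T) (mexp ` T)"
    by (rule isomorphic_to_euclideanI[OF T(1) refl _ add])
  have "subgroup (mexp ` T) SL"
  proof (rule subgroupI)
    show "mexp ` T \<subseteq> carrier SL" by (rule SL)
    show "mexp ` T \<noteq> {}" using subspace_0[OF T(1)] by blast
    fix a assume "a \<in> mexp ` T"
    then obtain X where X: "X \<in> T" "a = mexp X" by blast
    have nX: "- X \<in> T" using X T(1) by (simp add: subspace_neg)
    have "mexp (- X) \<otimes>\<^bsub>SL\<^esub> mexp X = \<one>\<^bsub>SL\<^esub>" using mexp_uminus[of "- X"] by (simp add: SL_def)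
    then have "inv\<^bsub>SL\<^esub> a = mexp (- X)" using X nX SL by (intro inv_equality) auto
    then show "inv\<^bsub>SL\<^esub> a \<in> mexp ` T" using nX by blast
    fix b assume "b \<in> mexp ` T"
    then obtain Y where Y: "Y \<in> T" "b = mexp Y" by blast
    then have "a \<otimes>\<^bsub>SL\<^esub> b = mexp (X + Y)" using X add by (simp add: SL_def)
    then show "a \<otimes>\<^bsub>SL\<^esub> b \<in> mexp ` T" using X Y T(1) by (simp add: subspace_add)
  qed
  moreover have "closedin (top_of_set (carrier SL)) (mexp ` T)"
  proof -
    have cl: "h \<in> mexp ` T" if h: "h \<in> carrier SL" "h \<in> closure (mexp ` T)" for h
    proof -
      obtain x where x0: "(\<forall>n. x n \<in> mexp ` T) \<and> x \<longlonglongrightarrow> h" using h(2) unfolding closure_sequential by (elim exE)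
      then have x: "\<And>n. x n \<in> mexp ` T" "x \<longlonglongrightarrow> h" by auto
      have xA: "x n \<in> A" for n using x(1)[of n] T(2) comm_alg_mexp(1)[OF A] by auto
      have hA: "h \<in> A" by (rule closed_sequentially[OF closed_subspace[OF D(1)] xA x(2)])
      have hE: "h \<in> mexp ` A"
      proof (rule ccontr)
        assume "h \<notin> mexp ` A"
        moreover have "det h \<noteq> 0" using h(1) by (simp add: SL_def)
        ultimately obtain U where U: "openin (top_of_set A) U" "h \<in> U" "U \<inter> mexp ` A = {}"
          using comm_alg_mexp_complement_open[OF A hA] by blast
        then obtain O' where O: "open O'" "U = A \<inter> O'" by (auto simp: openin_open)
        have "\<forall>\<^sub>F n in sequentially. x n \<in> O'" using x(2) O U by (intro topological_tendstoD) auto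
        then obtain n where "x n \<in> O'" using eventually_happens'[OF sequentially_bot] by blast
        then show False using U(3) O(2) xA[of n] x(1)[of n] T(2) by blast
      qed
      have lim: "(\<lambda>n. g (x n)) \<longlonglongrightarrow> g h"
        by (rule continuous_on_tendsto_compose[OF g(1) x(2) hE]) (use x(1) T(2) in \<open>auto intro!: always_eventually\<close>)
      have gT: "g (x n) \<in> T" for n using x(1)[of n] g(2) T(2) by auto
      have "g h \<in> T" by (rule closed_sequentially[OF closed_subspace[OF T(1)] gT lim])
      moreover have "h = mexp (g h)" using hE g(2) by auto
      ultimately show ?thesis by blast
    qed
    have eq: "mexp ` T = carrier SL \<inter> closure (mexp ` T)"
    proof (rule equalityI)
      show "mexp ` T \<subseteq> carrier SL \<inter> closure (mexp ` T)" using SL closure_subset by (rule Int_greatest)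
      show "carrier SL \<inter> closure (mexp ` T) \<subseteq> mexp ` T" by (rule subsetI, elim IntE, rule cl)
    qed
    show ?thesis unfolding closedin_closed
      by (rule exI[of _ "closure (mexp ` T)"], rule conjI[OF closed_closure eq])
  qed
  ultimately show "closed_subgroup_SL (mexp ` T)" by (simp add: closed_subgroup_SL_def)
qed

section \<open>Conjugacy limits of the diagonal group\<close>

lemma common_convergent_subsequence:
  fixes e :: "nat \<Rightarrow> nat \<Rightarrow> 'a::euclidean_space"
  assumes "\<And>r i. i < m \<Longrightarrow> norm (e r i) \<le> K"
  shows "\<exists>s. strict_mono (s :: nat \<Rightarrow> nat) \<and> (\<exists>l. \<forall>i<m. (\<lambda>r. e (s r) i) \<longlonglongrightarrow> l i)"
  using assms
proof (induction m)
  case 0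
  then show ?case by (intro exI[of _ id]) (simp add: strict_mono_def)
next
  case (Suc m)
  then obtain s l where s: "strict_mono (s :: nat \<Rightarrow> nat)" "\<And>i. i < m \<Longrightarrow> (\<lambda>r. e (s r) i) \<longlonglongrightarrow> l i"
    by auto
  have "e (s r) m \<in> cball 0 K" for r using Suc.prems by simp
  from compact_cball[of 0 K, unfolded compact_def, rule_format, of "\<lambda>r. e (s r) m", OF this]
  obtain x t where t: "strict_mono (t :: nat \<Rightarrow> nat)" "((\<lambda>r. e (s r) m) \<circ> t) \<longlonglongrightarrow> x"
    by (elim bexE exE conjE) (rule that)
  have "strict_mono (s \<circ> t)" using s(1) t(1) by (rule strict_mono_o)
  moreover have "\<forall>i<Suc m. (\<lambda>r. e ((s \<circ> t) r) i) \<longlonglongrightarrow> (l(m := x)) i"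
  proof (intro allI impI)
    fix i assume "i < Suc m"
    then consider "i < m" | "i = m" by linarith
    then show "(\<lambda>r. e ((s \<circ> t) r) i) \<longlonglongrightarrow> (l(m := x)) i"
    proof cases
      case 1
      from LIMSEQ_subseq_LIMSEQ[OF s(2)[OF 1] t(1)] show ?thesis using 1 by (simp add: o_def)
    next
      case 2
      then show ?thesis using t(2) by (simp add: o_def)
    qed
  qed
  ultimately show ?case by blast
qed

text \<open>Compactness of the Grassmannian. Orthonormal bases converge along a common subsequence,
  their limit is orthonormal, and expanding convergent sequences in these bases shows that it spans
  all limits.\<close>

lemma subspace_limit:
  fixes D :: "nat \<Rightarrow> 'a::euclidean_space set"
  assumes D: "\<And>r. subspace (D r)" "\<And>r. dim (D r) = m"
  obtains s where "strict_mono (s :: nat \<Rightarrow> nat)"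
    "subspace {x. \<exists>y. (\<forall>r. y r \<in> D (s r)) \<and> y \<longlonglongrightarrow> x}"
    "dim {x. \<exists>y. (\<forall>r. y r \<in> D (s r)) \<and> y \<longlonglongrightarrow> x} = m"
proof -
  have ex: "\<exists>e. (\<forall>i<m. e i \<in> D r \<and> norm (e i) = 1) \<and> (\<forall>i<m. \<forall>j<m. i \<noteq> j \<longrightarrow> e i \<bullet> e j = 0) \<and>
      (\<forall>y\<in>D r. y = (\<Sum>i<m. (y \<bullet> e i) *\<^sub>R e i))" (is "\<exists>e. ?Q r e") for r
  proof -
    obtain B where B: "B \<subseteq> D r" "pairwise orthogonal B" "\<And>x. x \<in> B \<Longrightarrow> norm x = 1" "independent B"
      "card B = dim (D r)" "span B = D r" using orthonormal_basis_subspace[OF D(1)[of r]] by auto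
    have finB: "finite B" using B(4) by (rule independent_imp_finite)
    obtain e where e: "bij_betw e {0..<m} B" using ex_bij_betw_nat_finite[OF finB] B(5) D(2) by auto
    then have inj: "inj_on e {..<m}" and im: "e ` {..<m} = B" by (auto simp: bij_betw_def atLeast0LessThan)
    have eB: "e i \<in> B" if "i < m" for i using im that by auto
    have 1: "\<forall>i<m. e i \<in> D r \<and> norm (e i) = 1" using eB B(1,3) by auto
    have 2: "\<forall>i<m. \<forall>j<m. i \<noteq> j \<longrightarrow> e i \<bullet> e j = 0"
    proof (intro allI impI)
      fix i j assume "i < m" "j < m" "i \<noteq> j"
      moreover from this have "e i \<noteq> e j" using inj by (auto dest: inj_onD)
      ultimately show "e i \<bullet> e j = 0" using B(2) eB by (auto simp: pairwise_def orthogonal_def)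
    qed
    have "y = (\<Sum>i<m. (y \<bullet> e i) *\<^sub>R e i)" if y: "y \<in> D r" for y
    proof -
      have "(\<Sum>v\<in>B. (v \<bullet> y) *\<^sub>R v) = y"
        using orthonormal_basis_expand[OF B(2,3) _ finB, of y] y B(6) by (simp add: inner_commute)
      moreover have "(\<Sum>v\<in>B. (v \<bullet> y) *\<^sub>R v) = (\<Sum>i<m. (y \<bullet> e i) *\<^sub>R e i)"
        unfolding im[symmetric] sum.reindex[OF inj] by (simp add: inner_commute)
      ultimately show ?thesis by simp
    qed
    with 1 2 show ?thesis by blast
  qed
  define e where "e r = (SOME e. ?Q r e)" for r
  have e0: "?Q r (e r)" for r unfolding e_def by (rule someI_ex[OF ex])
  have e: "\<And>r i. i < m \<Longrightarrow> e r i \<in> D r" "\<And>r i. i < m \<Longrightarrow> norm (e r i) = 1"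
    "\<And>r i j. i < m \<Longrightarrow> j < m \<Longrightarrow> i \<noteq> j \<Longrightarrow> e r i \<bullet> e r j = 0"
    "\<And>r y. y \<in> D r \<Longrightarrow> y = (\<Sum>i<m. (y \<bullet> e r i) *\<^sub>R e r i)"
    using e0 by auto
  obtain s l where s: "strict_mono (s :: nat \<Rightarrow> nat)" and l: "\<And>i. i < m \<Longrightarrow> (\<lambda>r. e (s r) i) \<longlonglongrightarrow> l i"
    using common_convergent_subsequence[of m e 1] e(2) by auto
  define A where "A = {x. \<exists>y. (\<forall>r. y r \<in> D (s r)) \<and> y \<longlonglongrightarrow> x}"
  have AI: "x \<in> A" if "\<And>r. y r \<in> D (s r)" "y \<longlonglongrightarrow> x" for x y unfolding A_def using that by blast
  have sub: "subspace A"
  proof (rule subspaceI)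
    show "0 \<in> A" by (rule AI[of "\<lambda>r. 0"]) (auto simp: subspace_0[OF D(1)])
    fix x y assume "x \<in> A" "y \<in> A"
    then obtain x' y' where "\<And>r. x' r \<in> D (s r)" "x' \<longlonglongrightarrow> x" "\<And>r. y' r \<in> D (s r)" "y' \<longlonglongrightarrow> y"
      unfolding A_def by blast
    then show "x + y \<in> A" by (intro AI[of "\<lambda>r. x' r + y' r"] tendsto_add subspace_add[OF D(1)])
  next
    fix c x assume "x \<in> A"
    then obtain x' where "\<And>r. x' r \<in> D (s r)" "x' \<longlonglongrightarrow> x" unfolding A_def by blast
    then show "c *\<^sub>R x \<in> A" by (intro AI[of "\<lambda>r. c *\<^sub>R x' r"] tendsto_scaleR tendsto_const subspace_scale[OF D(1)])
  qed
  have lA: "l i \<in> A" if "i < m" for i by (rule AI[OF e(1)[OF that] l[OF that]])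
  have ll: "l i \<bullet> l j = (if i = j then 1 else 0)" if "i < m" "j < m" for i j
  proof -
    have "(\<lambda>r. e (s r) i \<bullet> e (s r) j) \<longlonglongrightarrow> l i \<bullet> l j" by (intro tendsto_inner l that)
    moreover have "e (s r) i \<bullet> e (s r) j = (if i = j then 1 else 0)" for r
      using e(2,3)[of i] e(3)[OF that] that by (auto simp: norm_eq_1)
    ultimately show ?thesis by (simp add: LIMSEQ_const_iff)
  qed
  have ind: "indep_fam m l"
    unfolding indep_fam_def
  proof (intro allI impI)
    fix c i assume c: "(\<Sum>i<m. c i *\<^sub>R l i) = 0" and i: "i < m"
    have "l i \<bullet> (\<Sum>j<m. c j *\<^sub>R l j) = (\<Sum>j<m. c j * (if i = j then 1 else 0))"
      unfolding inner_sum_right inner_scaleR_right using ll i by (intro sum.cong) auto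
    also have "\<dots> = c i" using i by (simp add: if_distrib[of "\<lambda>x. _ * x"] cong: if_cong)
    finally show "c i = 0" using c by simp
  qed
  have ge: "m \<le> dim A" by (rule indep_fam_le_dim[OF ind lA])
  have "A \<subseteq> span (l ` {..<m})"
  proof
    fix x assume "x \<in> A"
    then obtain y where y: "\<And>r. y r \<in> D (s r)" "y \<longlonglongrightarrow> x" unfolding A_def by blast
    have "(\<lambda>r. \<Sum>i<m. (y r \<bullet> e (s r) i) *\<^sub>R e (s r) i) \<longlonglongrightarrow> (\<Sum>i<m. (x \<bullet> l i) *\<^sub>R l i)"
      by (intro tendsto_sum tendsto_scaleR tendsto_inner l y(2)) auto
    moreover have "(\<lambda>r. \<Sum>i<m. (y r \<bullet> e (s r) i) *\<^sub>R e (s r) i) = y" using e(4)[OF y(1)] by auto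
    ultimately have "x = (\<Sum>i<m. (x \<bullet> l i) *\<^sub>R l i)" using y(2) LIMSEQ_unique by metis
    moreover have "(\<Sum>i<m. (x \<bullet> l i) *\<^sub>R l i) \<in> span (l ` {..<m})"
      by (intro span_sum span_scale span_base) auto
    ultimately show "x \<in> span (l ` {..<m})" by simp
  qed
  then have "dim A \<le> dim (l ` {..<m})" using dim_subset[of A "span (l ` {..<m})"] by simp
  also have "\<dots> \<le> card (l ` {..<m})" by (intro dim_le_card') simp
  also have "\<dots> \<le> m" using card_image_le[of "{..<m}" l] by simp
  finally have "dim A = m" using ge by simp
  with s sub show thesis unfolding A_def by (rule that)
qed

section \<open>Bounds on determinants that survive in limits\<close>

lemma trace_cdiag:
  assumes "det P \<noteq> 0"
  shows "trace (cdiag P v) = (\<Sum>i\<in>UNIV. v $ i)"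
proof -
  have "trace (cdiag P v) = trace (matrix_inv P ** (P ** diagm v))"
    unfolding cdiag_def by (rule trace_mul_sym)
  also have "\<dots> = trace (diagm v)" by (simp add: matrix_mul_assoc matrix_inv_mul[OF assms])
  finally show ?thesis by (simp add: trace_def diagm_def)
qed

lemma inner_mat_one: "mat 1 \<bullet> (X :: real^'n^'n) = trace X"
  by (simp add: inner_vec_def trace_def mat_def if_distrib[of "\<lambda>x. x * _"] cong: if_cong)

lemma one_in_cdiag: "det (P::real^'n^'n) = 1 \<Longrightarrow> mat 1 \<in> conjugate P pos_diag"
  unfolding conjugate_pos_diag by (rule image_eqI[of _ _ 1]) (simp_all add: cdiag_one)

text \<open>The eigenvalues along the segment are at least \<open>1 - t\<close>. The bound does not
  involve \<open>P\<close>.\<close>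

lemma det_cdiag_segment:
  assumes P: "det (P::real^'n^'n) \<noteq> 0" and v: "\<And>i. v $ i > 0" and t: "0 \<le> t" "t \<le> 1"
  shows "det ((1 - t) *\<^sub>R mat 1 + t *\<^sub>R cdiag P v) \<ge> (1 - t) ^ CARD('n)"
proof -
  have "(1 - t) *\<^sub>R mat 1 + t *\<^sub>R cdiag P v = cdiag P ((1 - t) *\<^sub>R 1 + t *\<^sub>R v)"
    by (simp add: linear_add[OF linear_cdiag] linear_scale[OF linear_cdiag] cdiag_one[OF P])
  then have "det ((1 - t) *\<^sub>R mat 1 + t *\<^sub>R cdiag P v) = (\<Prod>i\<in>UNIV. (1 - t) + t * v $ i)"
    by (simp add: det_cdiag[OF P])
  also have "\<dots> \<ge> (\<Prod>i\<in>(UNIV::'n set). (1 - t))"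
    using t v by (intro prod_mono) (simp add: less_imp_le)
  finally show ?thesis by simp
qed

text \<open>For \<open>t < 1\<close> the uniform bound passes to the limit, and at
  \<open>t = 1\<close> the determinant is 1. So a limit of elements of the conjugated groups is
  joined to the identity by invertible matrices.\<close>

lemma det_segment_limit:
  fixes h :: "real^'n^'n"
  assumes P: "\<And>r. det (P r :: real^'n^'n) = 1" and g: "\<And>r. g r \<in> conjugate (P r) pos_diag" and lim: "g \<longlonglongrightarrow> h"
    and t: "0 \<le> t" "t \<le> 1"
  shows "det ((1 - t) *\<^sub>R mat 1 + t *\<^sub>R h) > 0" "det h = 1"
proof -
  have gr: "\<exists>v. (\<forall>i. v $ i > 0) \<and> (\<Prod>i\<in>UNIV. v $ i) = 1 \<and> g r = cdiag (P r) v" for r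
    using g[of r] unfolding conjugate_pos_diag[OF P] by blast
  have d1: "det (g r) = 1" for r using gr[of r] P by (auto simp: det_cdiag)
  have "(\<lambda>r. det (g r)) \<longlonglongrightarrow> det h" by (rule tendsto_det[OF lim])
  then show d: "det h = 1" by (simp add: d1 LIMSEQ_const_iff)
  show "det ((1 - t) *\<^sub>R mat 1 + t *\<^sub>R h) > 0"
  proof (cases "t = 1")
    case False
    have "(\<lambda>r. det ((1 - t) *\<^sub>R mat 1 + t *\<^sub>R g r)) \<longlonglongrightarrow> det ((1 - t) *\<^sub>R mat 1 + t *\<^sub>R h)"
      by (intro tendsto_det tendsto_intros lim)
    moreover have "(1 - t) ^ CARD('n) \<le> det ((1 - t) *\<^sub>R mat 1 + t *\<^sub>R g r)" for r
    proof -
      obtain v where "\<forall>i. v $ i > 0" "g r = cdiag (P r) v" using gr[of r] by blast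
      then show ?thesis using det_cdiag_segment[of "P r" v t] P[of r] t by simp
    qed
    ultimately have "(1 - t) ^ CARD('n) \<le> det ((1 - t) *\<^sub>R mat 1 + t *\<^sub>R h)"
      by (intro LIMSEQ_le_const) auto
    moreover have "(1 - t) ^ CARD('n) > 0" using False t by simp
    ultimately show ?thesis by linarith
  qed (simp add: d)
qed

text \<open>On diagonalizable matrices \<open>(X - a)^2 + \<beta>^2\<close> has determinant at least
  \<open>\<beta>^(2 n)\<close>. This uniform bound keeps it invertible in the limit.\<close>

lemma real_spec_limit_cdiag:
  fixes X :: "real^'n^'n"
  assumes P: "\<And>r. det (P r :: real^'n^'n) = 1" and g: "\<And>r. g r \<in> range (cdiag (P r))" and lim: "g \<longlonglongrightarrow> X"
  shows "real_spec X"
  unfolding real_spec_def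
proof (intro allI impI)
  fix a \<beta> :: real and u :: "real^'n"
  assume b: "\<beta> \<noteq> 0" and 0: "(X - a *\<^sub>R mat 1) *v ((X - a *\<^sub>R mat 1) *v u) + (\<beta> * \<beta>) *\<^sub>R u = 0"
  define Y where "Y Z = (Z - a *\<^sub>R mat 1) ** (Z - a *\<^sub>R mat 1) + (\<beta> * \<beta>) *\<^sub>R mat 1" for Z :: "real^'n^'n"
  have "(\<lambda>r. det (Y (g r))) \<longlonglongrightarrow> det (Y X)"
    unfolding Y_def by (intro tendsto_det tendsto_intros mm.tendsto lim)
  moreover have "(\<beta> * \<beta>) ^ CARD('n) \<le> det (Y (g r))" for r
  proof -
    obtain v where v: "g r = cdiag (P r) v" using g by blast
    have P0: "det (P r) \<noteq> 0" using P by simp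
    have "Y (g r) = cdiag (P r) ((v - a *\<^sub>R 1) * (v - a *\<^sub>R 1) + (\<beta> * \<beta>) *\<^sub>R 1)"
      unfolding Y_def v
      by (simp add: linear_add[OF linear_cdiag] linear_diff[OF linear_cdiag] linear_scale[OF linear_cdiag]
          cdiag_one[OF P0] cdiag_mult[OF P0, symmetric])
    then have "det (Y (g r)) = (\<Prod>i\<in>UNIV. (v $ i - a) * (v $ i - a) + \<beta> * \<beta>)"
      by (simp add: det_cdiag[OF P0])
    also have "\<dots> \<ge> (\<Prod>i\<in>(UNIV::'n set). \<beta> * \<beta>)" by (intro prod_mono) simp
    finally show ?thesis by simp
  qed
  ultimately have "(\<beta> * \<beta>) ^ CARD('n) \<le> det (Y X)" by (intro LIMSEQ_le_const) auto
  moreover have "\<beta> * \<beta> > 0" using b by (metis not_real_square_gt_zero)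
  then have "(\<beta> * \<beta>) ^ CARD('n) > 0" by (rule zero_less_power)
  ultimately have "det (Y X) \<noteq> 0" by linarith
  moreover have "Y X *v u = 0" using 0 by (simp add: Y_def mv.add_left mv.scaleR_left matrix_vector_mul_assoc[symmetric])
  ultimately show "u = 0" by (rule det_nonzero_mv_eq_0)
qed

text \<open>A subsequence of the algebras \<open>P D P^-1\<close> converges to a commutative algebra
  \<open>A\<close> of dimension n, and \<open>L\<close> turns out to be the exponential of the
  trace-zero part of \<open>A\<close>. A subsequence is enough because the second Chabauty condition
  is about subsequences.\<close>

lemma conjugacy_limit_isomorphic:
  fixes L :: "(real^'n^'n) set"
  assumes "conjugacy_limit pos_diag L"
  shows "isomorphic_to_euclidean (CARD('n) - 1) L"
proof -
  obtain P where P0: "\<forall>r. P r \<in> carrier SL" and ch: "chabauty_limit (\<lambda>r. conjugate (P r) pos_diag) L"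
    using assms unfolding conjugacy_limit_def by blast
  have P: "det (P r) = 1" for r using P0 by (simp add: SL_def)
  then have Pn: "det (P r) \<noteq> 0" for r by simp
  have a: "\<exists>g. (\<forall>r. g r \<in> conjugate (P r) pos_diag) \<and> g \<longlonglongrightarrow> h" if "h \<in> L" for h
    using ch that unfolding chabauty_limit_def by blast
  have b: "h \<in> L" if "\<And>r. g r \<in> conjugate (P r) pos_diag" "strict_mono (s :: nat \<Rightarrow> nat)" "(g \<circ> s) \<longlonglongrightarrow> h" for g s h
    using ch that unfolding chabauty_limit_def by blast
  obtain s where s: "strict_mono (s :: nat \<Rightarrow> nat)"
    "subspace {x. \<exists>y. (\<forall>r. y r \<in> range (cdiag (P (s r)))) \<and> y \<longlonglongrightarrow> x}"
    "dim {x. \<exists>y. (\<forall>r. y r \<in> range (cdiag (P (s r)))) \<and> y \<longlonglongrightarrow> x} = CARD('n)"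
    by (rule subspace_limit[of "\<lambda>r. range (cdiag (P r))", OF subspace_range_cdiag dim_range_cdiag[OF Pn]]) (rule that)
  define A where "A = {x. \<exists>y. (\<forall>r. y r \<in> range (cdiag (P (s r)))) \<and> y \<longlonglongrightarrow> x}"
  have AI: "x \<in> A" if "\<And>r. y r \<in> range (cdiag (P (s r)))" "y \<longlonglongrightarrow> x" for x y unfolding A_def using that by blast
  have AE: "\<exists>v. (\<lambda>r. cdiag (P (s r)) (v r)) \<longlonglongrightarrow> x" if xA: "x \<in> A" for x
  proof -
    obtain y where y: "\<forall>r. y r \<in> range (cdiag (P (s r)))" "y \<longlonglongrightarrow> x" using xA unfolding A_def by blast
    have "\<forall>r. \<exists>v. y r = cdiag (P (s r)) v" using y(1) by blast
    from choice[OF this] obtain v where v: "\<forall>r. y r = cdiag (P (s r)) (v r)" by (elim exE)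
    have "y = (\<lambda>r. cdiag (P (s r)) (v r))" using v by (intro ext) simp
    then show ?thesis using y(2) by auto
  qed
  have alg: "comm_alg A"
    unfolding comm_alg_def
  proof (intro conjI ballI)
    show "subspace A" unfolding A_def by (rule s(2))
    show "mat 1 \<in> A"
    proof (rule AI)
      show "mat 1 \<in> range (cdiag (P (s r)))" for r by (rule image_eqI[of _ _ 1]) (simp_all add: cdiag_one[OF Pn])
    qed simp
    fix X assume X: "X \<in> A"
    then obtain v where v: "(\<lambda>r. cdiag (P (s r)) (v r)) \<longlonglongrightarrow> X" using AE by blast
    show "real_spec X"
      by (rule real_spec_limit_cdiag[of "\<lambda>r. P (s r)", OF P _ v]) simp
    fix Y assume Y: "Y \<in> A"
    then obtain w where w: "(\<lambda>r. cdiag (P (s r)) (w r)) \<longlonglongrightarrow> Y" using AE by blast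
    have 1: "(\<lambda>r. cdiag (P (s r)) (v r * w r)) \<longlonglongrightarrow> X ** Y"
      using mm.tendsto[OF v w] by (simp add: cdiag_mult[OF Pn])
    show "X ** Y \<in> A" by (rule AI[OF _ 1]) simp
    have 2: "(\<lambda>r. cdiag (P (s r)) (v r * w r)) \<longlonglongrightarrow> Y ** X"
      using mm.tendsto[OF w v] by (simp add: cdiag_mult[OF Pn] mult.commute)
    show "X ** Y = Y ** X" by (rule LIMSEQ_unique[OF 1 2])
  qed
  note AD = comm_algD[OF alg]
  \<comment> \<open>The inner product with the identity is the trace.\<close>
  define T where "T = {X\<in>A. mat 1 \<bullet> X = 0}"
  have "trace (mat 1 :: real^'n^'n) = real CARD('n)" by (simp add: trace_def mat_def)
  then have one: "mat 1 \<bullet> (mat 1 :: real^'n^'n) \<noteq> 0" unfolding inner_mat_one by simp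
  note hs = hyperplane_section[OF AD(1) AD(2) one, folded T_def]
  have dT: "dim T = CARD('n) - 1" using hs(2,3) s(3) by (simp add: A_def[symmetric])
  \<comment> \<open>The identity holds for diagonalizable matrices, and both sides are
    continuous.\<close>
  have det_mexp: "det (mexp X) = exp (trace X)" if X: "X \<in> A" for X
  proof -
    obtain v where v: "(\<lambda>r. cdiag (P (s r)) (v r)) \<longlonglongrightarrow> X" using AE[OF X] by blast
    have "(\<lambda>r. mexp (cdiag (P (s r)) (v r))) \<longlonglongrightarrow> mexp X"
      by (rule continuous_on_tendsto_compose[OF continuous_on_mexp v]) auto
    then have "(\<lambda>r. det (mexp (cdiag (P (s r)) (v r)))) \<longlonglongrightarrow> det (mexp X)" by (rule tendsto_det)
    moreover have "det (mexp (cdiag (P (s r)) (v r))) = exp (mat 1 \<bullet> cdiag (P (s r)) (v r))" for r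
      by (simp add: mexp_cdiag[OF Pn] det_cdiag[OF Pn] inner_mat_one trace_cdiag[OF Pn] exp_sum)
    moreover have "(\<lambda>r. exp (mat 1 \<bullet> cdiag (P (s r)) (v r))) \<longlonglongrightarrow> exp (mat 1 \<bullet> X)"
      by (intro tendsto_exp tendsto_inner tendsto_const v)
    ultimately have "det (mexp X) = exp (mat 1 \<bullet> X)" using LIMSEQ_unique by simp
    then show ?thesis by (simp add: inner_mat_one)
  qed
  have SL: "mexp ` T \<subseteq> carrier SL"
    using det_mexp by (auto simp: T_def SL_def inner_mat_one)
  have "L = mexp ` T"
  proof (intro equalityI subsetI)
    fix h assume "h \<in> L"
    then obtain g where g: "\<And>r. g r \<in> conjugate (P r) pos_diag" "g \<longlonglongrightarrow> h" using a by blast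
    have hA: "h \<in> A"
    proof (rule AI)
      show "(g \<circ> s) r \<in> range (cdiag (P (s r)))" for r using g(1)[of "s r"] conjugate_pos_diag[OF P] by auto
      show "(g \<circ> s) \<longlonglongrightarrow> h" by (rule LIMSEQ_subseq_LIMSEQ[OF g(2) s(1)])
    qed
    note seg = det_segment_limit[OF P g]
    \<comment> \<open>Membership in the exponential image comes from the path to the identity
      through invertible elements of \<open>A\<close>.\<close>
    have "closed_segment (mat 1) h \<subseteq> mexp ` A"
    proof (rule connected_subset_mexp[OF alg])
      show "connected (closed_segment (mat 1) h)" by simp
      show "closed_segment (mat 1) h \<subseteq> A"
        using AD(1,2) hA by (auto simp: closed_segment_def intro!: subspace_add subspace_scale)
      show "mat 1 \<in> closed_segment (mat 1) h" by simp
      fix x assume "x \<in> closed_segment (mat 1) h"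
      then obtain t where "0 \<le> t" "t \<le> 1" "x = (1 - t) *\<^sub>R mat 1 + t *\<^sub>R h" by (auto simp: closed_segment_def)
      then show "det x \<noteq> 0" using seg(1)[of t] by simp
    qed
    then have "h \<in> mexp ` A" by auto
    then obtain X where X: "X \<in> A" "h = mexp X" by blast
    have "exp (trace X) = 1" using det_mexp[OF X(1)] X(2) seg(2)[of 0] by simp
    then have "X \<in> T" using X(1) by (simp add: T_def inner_mat_one)
    then show "h \<in> mexp ` T" using X(2) by blast
  next
    fix h assume "h \<in> mexp ` T"
    then obtain X where X: "X \<in> A" "trace X = 0" "h = mexp X" by (auto simp: T_def inner_mat_one)
    obtain v where v: "(\<lambda>r. cdiag (P (s r)) (v r)) \<longlonglongrightarrow> X" using AE[OF X(1)] by blast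
    \<comment> \<open>Subtracting the mean of the entries makes the approximants trace-free, so
      their exponentials have determinant 1. The correction tends to 0 because \<open>X\<close> has
      trace 0.\<close>
    define w where "w r = v r - (((\<Sum>i\<in>UNIV. v r $ i)) / real CARD('n)) *\<^sub>R 1" for r
    have tw: "(\<Sum>i\<in>UNIV. w r $ i) = 0" for r by (simp add: w_def sum_subtractf)
    have "(\<lambda>r. cdiag (P (s r)) (v r) - ((mat 1 \<bullet> cdiag (P (s r)) (v r)) / real CARD('n)) *\<^sub>R mat 1) \<longlonglongrightarrow>
      X - ((mat 1 \<bullet> X) / real CARD('n)) *\<^sub>R mat 1"
      by (intro tendsto_diff tendsto_scaleR tendsto_divide tendsto_inner tendsto_const v) simp
    moreover have "cdiag (P (s r)) (v r) - ((mat 1 \<bullet> cdiag (P (s r)) (v r)) / real CARD('n)) *\<^sub>R mat 1 = cdiag (P (s r)) (w r)" for r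
      by (simp add: w_def inner_mat_one trace_cdiag[OF Pn] linear_diff[OF linear_cdiag] linear_scale[OF linear_cdiag] cdiag_one[OF Pn])
    ultimately have "(\<lambda>r. cdiag (P (s r)) (w r)) \<longlonglongrightarrow> X" using X(2) by (simp add: inner_mat_one)
    then have "(\<lambda>r. mexp (cdiag (P (s r)) (w r))) \<longlonglongrightarrow> mexp X"
      by (intro continuous_on_tendsto_compose[OF continuous_on_mexp]) auto
    then have lim: "(\<lambda>r. cdiag (P (s r)) (\<chi> i. exp (w r $ i))) \<longlonglongrightarrow> h" by (simp add: mexp_cdiag[OF Pn] X(3))
    have mem: "cdiag (P (s r)) (\<chi> i. exp (w r $ i)) \<in> conjugate (P (s r)) pos_diag" for r
      unfolding conjugate_pos_diag[OF P]
      by (rule imageI) (simp add: exp_sum[symmetric] tw)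
    \<comment> \<open>The Chabauty condition asks for a sequence over all indices; the identity
      fills those outside the subsequence.\<close>
    define g where "g r = (if r \<in> range s then cdiag (P r) (\<chi> i. exp (w (inv_into UNIV s r) $ i)) else mat 1)" for r
    have injs: "inj s" using s(1) by (rule strict_mono_imp_inj_on)
    have gs: "g (s r) = cdiag (P (s r)) (\<chi> i. exp (w r $ i))" for r
      by (simp add: g_def inv_into_f_f[OF injs])
    show "h \<in> L"
    proof (rule b[OF _ s(1)])
      show "g r \<in> conjugate (P r) pos_diag" for r
      proof (cases "r \<in> range s")
        case True
        then obtain k where "r = s k" by blast
        then show ?thesis using gs[of k] mem[of k] by simp
      next
        case False
        then show ?thesis by (simp add: g_def one_in_cdiag[OF P])
      qed
      have "g \<circ> s = (\<lambda>r. cdiag (P (s r)) (\<chi> i. exp (w r $ i)))" by (rule ext) (simp add: gs)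
      then show "(g \<circ> s) \<longlonglongrightarrow> h" using lim by simp
    qed
  qed
  then show ?thesis using mexp_closed_subgroup(2)[OF alg hs(1) _ SL] dT by (auto simp: T_def)
qed

lemma Red_hat_subset_Ab_hat: "(Red_hat :: (real^'n^'n) set set) \<subseteq> Ab_hat"
proof
  fix L :: "(real^'n^'n) set" assume L: "L \<in> Red_hat"
  then have "conjugacy_limit pos_diag L" by (simp add: Red_hat_def)
  moreover from this have "closed_subgroup_SL L" by (auto simp: conjugacy_limit_def chabauty_limit_def)
  ultimately show "L \<in> Ab_hat" using conjugacy_limit_isomorphic by (simp add: Ab_hat_def)
qed

text \<open>A basis of \<open>L\<close> is approximated by elements of a single n-dimensional space,
  the range of \<open>cdiag (P r)\<close>, and independence survives small changes.\<close>

lemma dim_conjugacy_limit_le: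
  fixes L :: "(real^'n^'n) set"
  assumes "conjugacy_limit pos_diag L"
  shows "dim L \<le> CARD('n)"
proof -
  obtain P where P0: "\<forall>r. P r \<in> carrier SL" and ch: "chabauty_limit (\<lambda>r. conjugate (P r) pos_diag) L"
    using assms unfolding conjugacy_limit_def by blast
  have P: "det (P r) = 1" for r using P0 by (simp add: SL_def)
  obtain B where B: "B \<subseteq> L" "independent B" "card B = dim L" using basis_exists[of L] by metis
  have finB: "finite B" using B(2) by (rule independent_imp_finite)
  have "\<forall>b\<in>B. \<exists>g. (\<forall>r. g r \<in> conjugate (P r) pos_diag) \<and> g \<longlonglongrightarrow> b"
    using ch B(1) unfolding chabauty_limit_def by blast
  from bchoice[OF this] obtain g where g: "\<forall>b\<in>B. (\<forall>r. g b r \<in> conjugate (P r) pos_diag) \<and> g b \<longlonglongrightarrow> b" by (elim exE)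
  obtain \<delta> where d: "\<delta> > 0" "\<forall>y T. subspace T \<and> (\<forall>b\<in>B. y b \<in> T \<and> norm (y b - b) \<le> \<delta>) \<longrightarrow> card B \<le> dim T"
    using dim_ge_card_near_independent[OF B(2)] by (elim exE conjE)
  have "\<forall>\<^sub>F r in sequentially. \<forall>b\<in>B. dist (g b r) b < \<delta>"
    using g d(1) finB by (intro eventually_ball_finite ballI tendstoD) auto
  then obtain r where r: "\<forall>b\<in>B. dist (g b r) b < \<delta>" using eventually_happens'[OF sequentially_bot] by blast
  have "subspace (range (cdiag (P r))) \<and> (\<forall>b\<in>B. g b r \<in> range (cdiag (P r)) \<and> norm (g b r - b) \<le> \<delta>)"
  proof (intro conjI ballI subspace_range_cdiag)
    fix b assume b: "b \<in> B"
    have "g b r \<in> conjugate (P r) pos_diag" using g b by blast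
    then show "g b r \<in> range (cdiag (P r))" unfolding conjugate_pos_diag[OF P] by blast
    show "norm (g b r - b) \<le> \<delta>" using r b by (simp add: dist_norm less_imp_le)
  qed
  from d(2)[rule_format, OF this] show ?thesis using dim_range_cdiag[of "P r"] P B(3) by simp
qed

section \<open>Abelian subgroups with a large linear span\<close>

text \<open>The block with rows \<open>p\<close>, \<open>q\<close> and columns \<open>u\<close>,
  \<open>v\<close>, whose rows are \<open>y_p, y_q\<close> and \<open>y_u, y_v\<close>. Taking the
  four entries from a vector of length n at the four indices themselves lets one vector describe
  block and diagonal together.\<close>

definition block :: "'n \<Rightarrow> 'n \<Rightarrow> 'n \<Rightarrow> 'n \<Rightarrow> real^'n \<Rightarrow> real^'n^'n" where
  "block p q u v y = outer (axis p 1) (y $ p *\<^sub>R axis u 1 + y $ q *\<^sub>R axis v 1) +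
     outer (axis q 1) (y $ u *\<^sub>R axis u 1 + y $ v *\<^sub>R axis v 1)"

lemma block_mv: "block p q u v y *v t =
    (y $ p * t $ u + y $ q * t $ v) *\<^sub>R axis p 1 + (y $ u * t $ u + y $ v * t $ v) *\<^sub>R axis q 1"
  by (simp add: block_def mv.add_left outer_mv inner_add_left inner_axis inner_commute[of "axis _ _"])

lemma linear_block: "linear (block p q u v)"
  by (intro linearI) (simp_all add: block_def outer_def vec_eq_iff algebra_simps)

lemma diagm_0 [simp]: "diagm 0 = 0"
  by (rule linear_0[OF linear_diagm])

lemma block_0 [simp]: "block p q u v 0 = 0"
  by (rule linear_0[OF linear_block])

definition block_alg :: "'n \<Rightarrow> 'n \<Rightarrow> 'n \<Rightarrow> 'n \<Rightarrow> (real^'n^'n) set" where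
  "block_alg p q u v = {diagm d + block p q u v y |d y. d $ q = d $ p \<and> d $ u = d $ p \<and> d $ v = d $ p}"

lemma block_algI: "d $ q = d $ p \<Longrightarrow> d $ u = d $ p \<Longrightarrow> d $ v = d $ p \<Longrightarrow> diagm d + block p q u v y \<in> block_alg p q u v"
  unfolding block_alg_def by blast

context
  fixes p q u v :: "'n::finite"
  assumes dist: "distinct [p, q, u, v]"
begin

lemma ne: "p \<noteq> q" "q \<noteq> p" "p \<noteq> u" "u \<noteq> p" "p \<noteq> v" "v \<noteq> p" "q \<noteq> u" "u \<noteq> q" "q \<noteq> v" "v \<noteq> q" "u \<noteq> v" "v \<noteq> u"
  using dist by auto

lemma block_block: "block p q u v y ** block p q u v z = 0"
  by (simp add: matrix_eq matrix_vector_mul_assoc[symmetric] block_mv axis_def ne)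

lemma diagm_block: 
  assumes "d $ q = d $ p"
  shows "diagm d ** block p q u v y = d $ p *\<^sub>R block p q u v y"
  unfolding matrix_eq
proof
  fix t
  show "(diagm d ** block p q u v y) *v t = (d $ p *\<^sub>R block p q u v y) *v t"
    using assms by (simp add: matrix_vector_mul_assoc[symmetric] block_mv diagm_vec mv.scaleR_left vec_eq_iff axis_def)
qed

lemma block_diagm: 
  assumes "d $ u = d $ p" "d $ v = d $ p"
  shows "block p q u v y ** diagm d = d $ p *\<^sub>R block p q u v y"
  unfolding matrix_eq
proof
  fix t
  show "(block p q u v y ** diagm d) *v t = (d $ p *\<^sub>R block p q u v y) *v t"
    using assms by (simp add: matrix_vector_mul_assoc[symmetric] block_mv diagm_vec mv.scaleR_left algebra_simps)
qed

lemma block_alg_mult: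
  assumes "d $ q = d $ p" "d $ u = d $ p" "d $ v = d $ p" "d' $ q = d' $ p" "d' $ u = d' $ p" "d' $ v = d' $ p"
  shows "(diagm d + block p q u v y) ** (diagm d' + block p q u v z) =
    diagm (d * d') + block p q u v (d' $ p *\<^sub>R y + d $ p *\<^sub>R z)"
  by (simp add: mm.add_left mm.add_right diagm_mult diagm_block[OF assms(1)] block_diagm[OF assms(5,6)] block_block
      linear_add[OF linear_block] linear_scale[OF linear_block])

text \<open>The block maps coordinates \<open>u\<close>, \<open>v\<close> to coordinates
  \<open>p\<close>, \<open>q\<close>. A kernel vector vanishes outside \<open>p\<close>,
  \<open>q\<close>, in particular at \<open>u\<close> and \<open>v\<close>, so the block adds
  nothing at \<open>p\<close> and \<open>q\<close> either.\<close>

lemma block_alg_pos_inj: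
  assumes e: "\<And>i. e $ i > 0" and 0: "(diagm e + block p q u v y) *v t = 0"
  shows "t = 0"
proof -
  have c: "e $ i * t $ i + ((y $ p * t $ u + y $ q * t $ v) * axis p 1 $ i + (y $ u * t $ u + y $ v * t $ v) * axis q 1 $ i) = 0" for i
    using arg_cong[OF 0, of "\<lambda>x. x $ i"] by (simp add: mv.add_left diagm_vec block_mv)
  have 1: "t $ i = 0" if "i \<noteq> p" "i \<noteq> q" for i
    using c[of i] that e[of i] by (simp add: axis_def)
  have uv: "t $ u = 0" "t $ v = 0" using 1 dist by auto
  have "t $ i = 0" for i using c[of i] e[of i] uv by simp
  then show ?thesis by (simp add: vec_eq_iff)
qed

text \<open>For the spectrum: \<open>(X - a)^2 + \<beta>^2\<close> lies again in the algebra, its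
  diagonal part is positive, and \<open>block_alg_pos_inj\<close> makes it injective.\<close>

lemma comm_alg_block_alg: "comm_alg (block_alg p q u v)"
  unfolding comm_alg_def
proof (intro conjI ballI)
  show "subspace (block_alg p q u v)"
  proof (rule subspaceI)
    have "0 = diagm 0 + block p q u v 0" by simp
    then show "0 \<in> block_alg p q u v" using block_algI[of 0 q p u v 0] by simp
    fix X Y assume "X \<in> block_alg p q u v" "Y \<in> block_alg p q u v"
    then obtain d y d' z where 1: "X = diagm d + block p q u v y" "d $ q = d $ p" "d $ u = d $ p" "d $ v = d $ p"
      "Y = diagm d' + block p q u v z" "d' $ q = d' $ p" "d' $ u = d' $ p" "d' $ v = d' $ p"
      unfolding block_alg_def by blast
    have "X + Y = diagm (d + d') + block p q u v (y + z)"
      by (simp add: 1(1,5) linear_add[OF linear_block] linear_add[OF linear_diagm])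
    then show "X + Y \<in> block_alg p q u v" using block_algI[of "d + d'" q p u v "y + z"] 1 by simp
  next
    fix c X assume "X \<in> block_alg p q u v"
    then obtain d y where 1: "X = diagm d + block p q u v y" "d $ q = d $ p" "d $ u = d $ p" "d $ v = d $ p"
      unfolding block_alg_def by blast
    have "c *\<^sub>R X = diagm (c *\<^sub>R d) + block p q u v (c *\<^sub>R y)"
      by (simp add: 1(1) linear_scale[OF linear_block] linear_scale[OF linear_diagm] scaleR_add_right)
    then show "c *\<^sub>R X \<in> block_alg p q u v" using block_algI[of "c *\<^sub>R d" q p u v "c *\<^sub>R y"] 1 by simp
  qed
  have "mat 1 = diagm 1 + block p q u v 0" by (simp add: diagm_one)
  then show "mat 1 \<in> block_alg p q u v" using block_algI[of 1 q p u v 0] by simp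
  fix X assume "X \<in> block_alg p q u v"
  then obtain d y where X: "X = diagm d + block p q u v y" "d $ q = d $ p" "d $ u = d $ p" "d $ v = d $ p"
    unfolding block_alg_def by blast
  show "real_spec X"
    unfolding real_spec_def
  proof (intro allI impI)
    fix a \<beta> :: real and t
    assume b: "\<beta> \<noteq> 0" and 0: "(X - a *\<^sub>R mat 1) *v ((X - a *\<^sub>R mat 1) *v t) + (\<beta> * \<beta>) *\<^sub>R t = 0"
    define d' where "d' = d - a *\<^sub>R 1"
    have d': "d' $ q = d' $ p" "d' $ u = d' $ p" "d' $ v = d' $ p" using X by (simp_all add: d'_def)
    have "X - a *\<^sub>R mat 1 = diagm d' + block p q u v y"
      by (simp add: X(1) d'_def linear_diff[OF linear_diagm] linear_scale[OF linear_diagm] diagm_one)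
    then have "(X - a *\<^sub>R mat 1) ** (X - a *\<^sub>R mat 1) = diagm (d' * d') + block p q u v (d' $ p *\<^sub>R y + d' $ p *\<^sub>R y)"
      using block_alg_mult[OF d' d', of y y] by simp
    then have "(X - a *\<^sub>R mat 1) ** (X - a *\<^sub>R mat 1) + (\<beta> * \<beta>) *\<^sub>R mat 1 =
        diagm (d' * d' + (\<beta> * \<beta>) *\<^sub>R 1) + block p q u v (d' $ p *\<^sub>R y + d' $ p *\<^sub>R y)"
      by (simp add: linear_add[OF linear_diagm] linear_scale[OF linear_diagm] diagm_one)
    moreover have "((X - a *\<^sub>R mat 1) ** (X - a *\<^sub>R mat 1) + (\<beta> * \<beta>) *\<^sub>R mat 1) *v t = 0"
      using 0 by (simp add: mv.add_left mv.scaleR_left matrix_vector_mul_assoc)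
    ultimately have "(diagm (d' * d' + (\<beta> * \<beta>) *\<^sub>R 1) + block p q u v (d' $ p *\<^sub>R y + d' $ p *\<^sub>R y)) *v t = 0" by simp
    moreover have "(d' * d' + (\<beta> * \<beta>) *\<^sub>R 1) $ i > 0" for i
    proof -
      have "\<beta> * \<beta> > 0" using b by (metis not_real_square_gt_zero)
      moreover have "d' $ i * d' $ i \<ge> 0" by simp
      ultimately have "d' $ i * d' $ i + \<beta> * \<beta> > 0" by linarith
      then show ?thesis by simp
    qed
    ultimately show "t = 0" using block_alg_pos_inj by blast
  qed
  fix Y assume "Y \<in> block_alg p q u v"
  then obtain d' z where Y: "Y = diagm d' + block p q u v z" "d' $ q = d' $ p" "d' $ u = d' $ p" "d' $ v = d' $ p"
    unfolding block_alg_def by blast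
  have 1: "X ** Y = diagm (d * d') + block p q u v (d' $ p *\<^sub>R y + d $ p *\<^sub>R z)"
    unfolding X(1) Y(1) by (rule block_alg_mult[OF X(2-4) Y(2-4)])
  have 2: "Y ** X = diagm (d' * d) + block p q u v (d $ p *\<^sub>R z + d' $ p *\<^sub>R y)"
    unfolding X(1) Y(1) by (rule block_alg_mult[OF Y(2-4) X(2-4)])
  show "X ** Y = Y ** X" unfolding 1 2 by (simp add: mult.commute add.commute)
  show "X ** Y \<in> block_alg p q u v" unfolding 1 by (rule block_algI) (use X Y in simp_all)
qed

text \<open>Conjugation by a diagonal matrix turns the nilpotent block \<open>B\<close> into \<open>2 B\<close>, so that
  \<open>det (exp B) = det (exp B)\<^sup>2\<close>.\<close>

lemma det_mexp_block: "det (mexp (block p q u v y)) = 1"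
proof -
  let ?B = "block p q u v y"
  define c :: "real^'n" where "c = (\<chi> i. if i = p \<or> i = q then 2 else 1)"
  define c' :: "real^'n" where "c' = (\<chi> i. if i = p \<or> i = q then 1/2 else 1)"
  have "c * c' = 1" "c' * c = 1" by (simp_all add: c_def c'_def vec_eq_iff)
  then have cc: "diagm c ** diagm c' = mat 1" "diagm c' ** diagm c = mat 1" by (simp_all add: diagm_mult diagm_one)
  have 1: "diagm c ** ?B = 2 *\<^sub>R ?B" using diagm_block[of c y] by (simp add: c_def)
  have 2: "?B ** diagm c' = ?B"
    unfolding matrix_eq using dist by (simp add: matrix_vector_mul_assoc[symmetric] block_mv diagm_vec c'_def ne)
  have "mexp (diagm c ** ?B ** diagm c') = diagm c ** mexp ?B ** diagm c'" by (rule mexp_conj[OF cc])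
  then have "det (mexp (2 *\<^sub>R ?B)) = det (diagm c) * det (mexp ?B) * det (diagm c')"
    by (simp add: 1 mm.scaleR_left 2 det_mul)
  moreover have "det (diagm c) * det (diagm c') = 1" using arg_cong[OF cc(1), of det] by (simp add: det_mul)
  ultimately have "det (mexp (2 *\<^sub>R ?B)) = det (mexp ?B)" by (simp add: mult_ac)
  moreover have "mexp (2 *\<^sub>R ?B) = mexp ?B ** mexp ?B" using mexp_add[of ?B ?B] by (simp add: scaleR_2)
  ultimately have "det (mexp ?B) * det (mexp ?B) = det (mexp ?B)" by (simp add: det_mul)
  moreover have "det (mexp ?B) * det (mexp (- ?B)) = 1"
    using arg_cong[OF mexp_uminus[of ?B], of det] by (simp add: det_mul)
  ultimately show ?thesis by auto
qed

lemma det_mexp_block_alg: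
  assumes "d $ q = d $ p" "d $ u = d $ p" "d $ v = d $ p"
  shows "det (mexp (diagm d + block p q u v y)) = exp (\<Sum>i\<in>UNIV. d $ i)"
proof -
  have "mat 1 ** matrix_inv (mat 1) = (mat 1 :: real^'n^'n)" by (rule matrix_inv_mul) simp
  then have cd: "cdiag (mat 1) d = diagm d" by (simp add: cdiag_def)
  have "mexp (diagm d + block p q u v y) = mexp (diagm d) ** mexp (block p q u v y)"
    by (rule mexp_add) (simp add: diagm_block block_diagm assms)
  then have "det (mexp (diagm d + block p q u v y)) = det (mexp (cdiag (mat 1) d))"
    by (simp add: det_mul det_mexp_block cd)
  then show ?thesis by (simp add: mexp_cdiag det_cdiag exp_sum)
qed

lemma block_entries: "block p q u v y $ p $ u = y $ p" "block p q u v y $ p $ v = y $ q"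
    "block p q u v y $ q $ u = y $ u" "block p q u v y $ q $ v = y $ v" "block p q u v y $ i $ i = 0"
  by (simp_all add: block_def outer_def axis_def ne)

text \<open>In \<open>M x\<close> the number \<open>x_p\<close> is both a block entry and the common
  diagonal value at the four indices. In the square it becomes \<open>2 x_p^2\<close> in the block
  but \<open>x_p^2\<close> on the diagonal, so the square leaves the space of all
  \<open>M x\<close>. With the identity this adds two dimensions to the n - 1 of
  \<open>T\<close>.\<close>

lemma Ab_hat_large_span:
  assumes w: "w \<notin> {p, q, u, v}"
  shows "\<exists>G \<in> (Ab_hat :: (real^'n^'n) set set). dim G > CARD('n)"
proof -
  define dg :: "real^'n \<Rightarrow> real^'n" where "dg x = (\<chi> i. if i \<in> {p, q, u, v} then x $ p else x $ i)" for x
  define M where "M x = diagm (dg x) + block p q u v x" for x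
  \<comment> \<open>\<open>a\<close> represents the trace of \<open>M x\<close>: \<open>x_p\<close>
    stands at four diagonal places, while \<open>x_q\<close>, \<open>x_u\<close>, \<open>x_v\<close>
    occur only in the block.\<close>
  define a :: "real^'n" where "a = (\<chi> i. if i = p then 4 else if i \<in> {q, u, v} then 0 else 1)"
  define H where "H = {x. a \<bullet> x = 0}"
  have dg: "dg x $ q = dg x $ p" "dg x $ u = dg x $ p" "dg x $ v = dg x $ p" "dg x $ p = x $ p" for x by (simp_all add: dg_def)
  have "linear dg" by (intro linearI) (simp_all add: dg_def vec_eq_iff)
  then have linM: "linear M" unfolding M_def[abs_def]
    by (intro linear_compose_add linear_block linear_compose[OF _ linear_diagm, unfolded o_def])
  have sum_dg: "(\<Sum>i\<in>UNIV. dg x $ i) = a \<bullet> x" for x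
  proof -
    have "(\<Sum>i\<in>UNIV. f i) = f p + f q + f u + f v + (\<Sum>i\<in>UNIV - {p, q, u, v}. f i)" for f :: "'n \<Rightarrow> real"
    proof -
      have "(\<Sum>i\<in>UNIV. f i) = (\<Sum>i\<in>UNIV - {p, q, u, v}. f i) + (\<Sum>i\<in>{p, q, u, v}. f i)"
        by (rule sum.subset_diff) auto
      then show ?thesis by (simp add: ne)
    qed
    then show ?thesis unfolding inner_vec_def by (simp add: dg_def a_def ne)
  qed
  have traceM: "trace (M x) = (\<Sum>i\<in>UNIV. dg x $ i)" for x
  proof -
    have "M x $ i $ i = dg x $ i" for i by (simp add: M_def block_entries diagm_def)
    then show ?thesis by (simp add: trace_def)
  qed
  have trH: "trace (M x) = 0" if "x \<in> H" for x using that by (simp add: traceM sum_dg H_def)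
  have injM: "inj M"
  proof (rule injI)
    fix x y assume eq: "M x = M y"
    have "M x $ p $ u = x $ p" "M x $ p $ v = x $ q" "M x $ q $ u = x $ u" "M x $ q $ v = x $ v" for x
      by (simp_all add: M_def block_entries diagm_def ne)
    with eq have 1: "x $ p = y $ p" "x $ q = y $ q" "x $ u = y $ u" "x $ v = y $ v" by metis+
    have "M x $ i $ i = dg x $ i" for x i by (simp add: M_def block_entries diagm_def)
    with eq have "dg x $ i = dg y $ i" for i by metis
    then have "x $ i = y $ i" if "i \<notin> {p, q, u, v}" for i using that by (simp add: dg_def split: if_splits) (metis that insertCI)
    with 1 have "x $ i = y $ i" for i by (cases "i \<in> {p, q, u, v}") auto
    then show "x = y" by (simp add: vec_eq_iff)
  qed
  define T where "T = M ` H"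
  have sH: "subspace H" unfolding H_def by (rule subspace_hyperplane)
  have sT: "subspace T" unfolding T_def by (rule linear_subspace_image[OF linM sH])
  have "a $ p \<noteq> 0" by (simp add: a_def)
  then have "a \<noteq> 0" by auto
  then have "dim H = CARD('n) - 1" unfolding H_def by (simp add: dim_hyperplane)
  then have dT: "dim T = CARD('n) - 1"
    unfolding T_def using eucl.dim_image_eq[OF linM, of H] injM by (auto intro: inj_on_subset)
  have TA: "T \<subseteq> block_alg p q u v" unfolding T_def M_def using dg by (auto intro!: block_algI)
  have SL: "mexp ` T \<subseteq> carrier SL"
  proof -
    have "det (mexp (M x)) = 1" if "x \<in> H" for x
      using det_mexp_block_alg[OF dg(1-3)[of x], of x] trH[OF that] traceM[of x] by (simp add: M_def)
    then show ?thesis by (auto simp: T_def SL_def)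
  qed
  have Ab: "mexp ` T \<in> Ab_hat"
    using mexp_closed_subgroup[OF comm_alg_block_alg sT TA SL] dT by (simp add: Ab_hat_def)
  define W where "W = span (mexp ` T)"
  have sW: "subspace W" by (simp add: W_def)
  have line: "X \<in> W" "X ** X \<in> W" if "X \<in> T" for X
  proof -
    have "mexp (t *\<^sub>R X) \<in> W" for t unfolding W_def using that sT by (intro span_base imageI subspace_scale)
    from mexp_line_in_subspace[OF sW this] show "X \<in> W" "X ** X \<in> W" .
  qed
  have oneW: "mat 1 \<in> W"
    unfolding W_def using subspace_0[OF sT] by (intro span_base) (auto simp: mexp_0[symmetric])
  \<comment> \<open>The fifth index \<open>w\<close> compensates the trace 4 of the other
    four.\<close>
  define x0 :: "real^'n" where "x0 = (\<chi> i. if i = p then 1 else if i = w then - 4 else 0)"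
  have wd: "w \<noteq> p" "w \<noteq> q" "w \<noteq> u" "w \<noteq> v" using w by auto
  have x0p: "x0 $ p = 1" by (simp add: x0_def)
  have dg0: "dg x0 = (\<chi> i. if i \<in> {p, q, u, v} then 1 else if i = w then - 4 else 0)"
    using wd by (auto simp: dg_def x0_def vec_eq_iff ne)
  have sum5: "(\<Sum>i\<in>UNIV. f i) = f p + f q + f u + f v + f w" if "\<And>i. i \<notin> {p, q, u, v, w} \<Longrightarrow> f i = 0" for f :: "'n \<Rightarrow> real"
  proof -
    have "(\<Sum>i\<in>UNIV. f i) = (\<Sum>i\<in>{p, q, u, v, w}. f i)" using that by (intro sum.mono_neutral_right) auto
    then show ?thesis using wd by (simp add: add.assoc ne)
  qed
  have x0H: "x0 \<in> H"
  proof -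
    have "(\<Sum>i\<in>UNIV. dg x0 $ i) = 0" using dist wd by (subst sum5) (auto simp: dg0)
    then show ?thesis by (simp add: sum_dg H_def)
  qed
  define X2 where "X2 = M x0 ** M x0"
  have X2: "X2 = diagm (dg x0 * dg x0) + block p q u v (x0 $ p *\<^sub>R x0 + x0 $ p *\<^sub>R x0)"
    unfolding X2_def M_def using block_alg_mult[OF dg(1-3) dg(1-3), of x0 x0 x0 x0] dg(4) by simp
  have one_nT: "mat 1 \<notin> span T"
  proof -
    have "trace (mat 1 :: real^'n^'n) = real CARD('n)" by (simp add: trace_def mat_def)
    then have "mat 1 \<notin> T" using trH by (auto simp: T_def)
    then show ?thesis using sT by (simp add: span_eq_iff[THEN iffD2])
  qed
  \<comment> \<open>If \<open>X2 - k = M y\<close>, the entry at row \<open>p\<close>, column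
    \<open>u\<close> gives \<open>y_p = 2\<close>, and the diagonal entry at \<open>p\<close> gives
    \<open>1 - k = 2\<close>. With \<open>k = -1\<close> the trace of \<open>X2 - k\<close> is
    \<open>4 + 16 + n\<close> instead of 0.\<close>
  have X2_n: "X2 \<notin> span (insert (mat 1) T)"
  proof
    assume "X2 \<in> span (insert (mat 1) T)"
    then obtain k where "X2 - k *\<^sub>R mat 1 \<in> span T" by (auto simp: span_insert)
    then have "X2 - k *\<^sub>R mat 1 \<in> T" using sT by (simp add: span_eq_iff[THEN iffD2])
    then obtain y where y: "y \<in> H" "X2 - k *\<^sub>R mat 1 = M y" by (auto simp: T_def)
    have "(X2 - k *\<^sub>R mat 1) $ p $ u = 2" "(X2 - k *\<^sub>R mat 1) $ p $ p = 1 - k"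
      by (simp_all add: X2 block_entries diagm_def mat_def dg0 x0p ne)
    moreover have "M y $ p $ u = y $ p" "M y $ p $ p = y $ p"
      by (simp_all add: M_def block_entries diagm_def dg ne)
    ultimately have k: "k = - 1" using y(2) by auto
    have "trace (X2 - k *\<^sub>R mat 1) = (\<Sum>i\<in>UNIV. dg x0 $ i * dg x0 $ i - k)"
      by (simp add: trace_def X2 block_entries diagm_def mat_def)
    also have "\<dots> = (\<Sum>i\<in>UNIV. dg x0 $ i * dg x0 $ i) + real CARD('n)" by (simp add: sum.distrib k)
    also have "(\<Sum>i\<in>UNIV. dg x0 $ i * dg x0 $ i) = 20"
      using dist wd by (subst sum5) (auto simp: dg0)
    finally show False using trH[OF y(1)] y(2) by simp
  qed
  have "dim (insert X2 (insert (mat 1) T)) = Suc (Suc (dim T))"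
    using one_nT X2_n by (simp add: dim_insert)
  moreover have "insert X2 (insert (mat 1) T) \<subseteq> W" using line oneW x0H by (auto simp: X2_def T_def)
  ultimately have "Suc (Suc (dim T)) \<le> dim W" using dim_subset by metis
  then have "dim (mexp ` T) > CARD('n)" using dT by (simp add: W_def)
  with Ab show ?thesis by blast
qed

end

section \<open>Strict inclusion for size at least five\<close>

lemma exists_Ab_hat_large_span:
  assumes "CARD('n::finite) \<ge> 5"
  shows "\<exists>G \<in> (Ab_hat :: (real^'n^'n) set set). dim G > CARD('n)"
proof -
  obtain S where S: "S \<subseteq> (UNIV :: 'n set)" "card S = 5" "finite S" using obtain_subset_with_card_n[OF assms] by auto
  obtain f where f: "bij_betw f {0..<5::nat} S" using ex_bij_betw_nat_finite[OF S(3)] S(2) by auto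
  have inj: "f i = f j \<longleftrightarrow> i = j" if "i < 5" "j < 5" for i j
    using f that by (auto simp: bij_betw_def dest: inj_onD)
  show ?thesis
    by (rule Ab_hat_large_span[of "f 0" "f 1" "f 2" "f 3" "f 4"]) (simp_all add: inj)
qed

lemma Red_subset_Ab: "(Red :: (real^'n^'n) set set set) \<subseteq> Ab"
  unfolding Red_def Ab_def quotient_def using Red_hat_subset_Ab_hat by blast

lemma Red_strict_subset_Ab:
  assumes "CARD('n::finite) \<ge> 5"
  shows "(Red :: (real^'n^'n) set set set) \<subset> Ab"
proof -
  obtain G :: "(real^'n^'n) set" where G: "G \<in> Ab_hat" "dim G > CARD('n)"
    using exists_Ab_hat_large_span[OF assms] by blast
  have sG: "subgroup G SL" using G(1) by (simp add: Ab_hat_def closed_subgroup_SL_def)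
  have "conj_rel `` {G} \<in> Ab" unfolding Ab_def using G(1) by (rule quotientI)
  moreover have "conj_rel `` {G} \<notin> Red"
  proof
    assume "conj_rel `` {G} \<in> Red"
    then obtain L where L: "L \<in> Red_hat" "conj_rel `` {G} = conj_rel `` {L}"
      unfolding Red_def by (auto elim!: quotientE)
    have "(G, G) \<in> conj_rel" using equiv_conj_rel sG by (auto simp: equiv_def refl_on_def)
    then have "(L, G) \<in> conj_rel" using L(2) by blast
    then obtain P where P: "P \<in> carrier SL" "G = conjugate P L" by (auto simp: conj_rel_def)
    \<comment> \<open>Conjugation is linear, so the bound on the dimension of the span holds on a
      whole conjugacy class.\<close>
    have "G = (\<lambda>A. P ** A ** matrix_inv P) ` L" unfolding P(2) conjugate_def inv_SL[OF P(1)] by (simp add: SL_def)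
    moreover have "linear (\<lambda>A. P ** A ** matrix_inv P)"
      by (intro linearI) (simp_all add: mm.add_left mm.add_right mm.scaleR_left mm.scaleR_right)
    ultimately have "dim G \<le> dim L" using eucl.dim_image_le by blast
    also have "\<dots> \<le> CARD('n)" using L(1) by (intro dim_conjugacy_limit_le) (simp add: Red_hat_def)
    finally show False using G(2) by simp
  qed
  ultimately show ?thesis using Red_subset_Ab by blast
qed

section \<open>Abelian subgroups isomorphic to the standard vector group\<close>

text \<open>The scalar factor adds one parameter to the n - 1 parameters of \<open>G\<close>, so
  that the cone can be open in an algebra of dimension n.\<close>

definition cone :: "(real^'n^'n) set \<Rightarrow> (real^'n^'n) set" where
  "cone G = {c *\<^sub>R X |c X. c > 0 \<and> X \<in> G}"

lemma coneI: "c > 0 \<Longrightarrow> X \<in> G \<Longrightarrow> c *\<^sub>R X \<in> cone G"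
  unfolding cone_def by blast

text \<open>The model of the (n - 1)-dimensional vector group is a coordinate hyperplane in
  dimension n; the missing coordinate \<open>k\<close> is free to carry the scalar factor of the
  cone.\<close>

lemma Ab_hat_parametrization:
  fixes G :: "(real^'n^'n) set"
  assumes G: "G \<in> Ab_hat"
  obtains T :: "(real^'n) set" and g k where "T = {x. x $ k = 0}" "subspace T" "dim T = CARD('n) - 1"
    "continuous_on T g" "inj_on g T" "g ` T = G"
    "\<And>x y. x \<in> T \<Longrightarrow> y \<in> T \<Longrightarrow> g (x + y) = g x ** g y" "g 0 = mat 1"
proof -
  define k :: 'n where "k = (SOME k. True)"
  define T where "T = {x :: real^'n. x $ k = 0}"
  have T': "T = {x. axis k 1 \<bullet> x = 0}" by (simp add: T_def inner_axis' )
  have sT: "subspace T" unfolding T' by (rule subspace_hyperplane)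
  have "axis k (1::real) \<noteq> 0" by (simp add: axis_eq_0_iff)
  then have dT: "dim T = CARD('n) - 1" unfolding T' by (simp add: dim_hyperplane)
  have iso: "isomorphic_to_euclidean (CARD('n) - 1) G" using G by (simp add: Ab_hat_def)
  obtain g where g: "continuous_on T g" "inj_on g T" "g ` T = G"
    "\<And>x y. x \<in> T \<Longrightarrow> y \<in> T \<Longrightarrow> g (x + y) = g x ** g y"
    by (rule isomorphic_to_euclideanE[OF iso sT dT]) (rule that)
  have 0: "0 \<in> T" by (rule subspace_0[OF sT])
  have "g 0 \<in> carrier SL"
    using G g(3) 0 by (auto simp: Ab_hat_def closed_subgroup_SL_def dest: subgroup.subset)
  then have d: "det (g 0) \<noteq> 0" by (simp add: SL_def)
  have "g 0 ** g 0 = g 0" using g(4)[OF 0 0] by simp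
  then have "matrix_inv (g 0) ** (g 0 ** g 0) = matrix_inv (g 0) ** g 0" by simp
  then have "g 0 = mat 1" by (simp add: matrix_mul_assoc matrix_inv_mul[OF d])
  with sT dT g show thesis by (intro that[OF T_def])
qed

lemma Ab_hat_props:
  fixes G :: "(real^'n^'n) set"
  assumes G: "G \<in> Ab_hat"
  shows "mat 1 \<in> G" "\<And>X. X \<in> G \<Longrightarrow> det X = 1" "\<And>X Y. X \<in> G \<Longrightarrow> Y \<in> G \<Longrightarrow> X ** Y \<in> G"
    "\<And>X Y. X \<in> G \<Longrightarrow> Y \<in> G \<Longrightarrow> X ** Y = Y ** X" "\<And>X. X \<in> G \<Longrightarrow> \<exists>Y\<in>G. X = Y ** Y"
    "\<And>X. X \<in> G \<Longrightarrow> X ** X = mat 1 \<Longrightarrow> X = mat 1"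
    "closedin (top_of_set (carrier SL)) G"
proof -
  obtain T :: "(real^'n) set" and g k where T: "T = {x. x $ k = 0}" "subspace T" "dim T = CARD('n) - 1"
    "continuous_on T g" "inj_on g T" "g ` T = G"
    "\<And>x y. x \<in> T \<Longrightarrow> y \<in> T \<Longrightarrow> g (x + y) = g x ** g y" "g 0 = mat 1"
    by (rule Ab_hat_parametrization[OF G]) (rule that)
  have 0: "0 \<in> T" by (rule subspace_0[OF T(2)])
  have sub: "subgroup G SL" using G by (simp add: Ab_hat_def closed_subgroup_SL_def)
  show "mat 1 \<in> G" using T(6,8) 0 by (metis imageI)
  show "det X = 1" if "X \<in> G" for X using subgroup.subset[OF sub] that by (auto simp: SL_def)
  show "closedin (top_of_set (carrier SL)) G" using G by (simp add: Ab_hat_def closed_subgroup_SL_def)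
  have G_T: "\<exists>x\<in>T. X = g x" if "X \<in> G" for X using T(6) that by blast
  have gG: "g x \<in> G" if "x \<in> T" for x using T(6) that by blast
  show "X ** Y \<in> G" if XY: "X \<in> G" "Y \<in> G" for X Y
  proof -
    obtain x y where "x \<in> T" "y \<in> T" "X = g x" "Y = g y" using G_T XY by metis
    then show ?thesis using T(7)[of x y] gG[of "x + y"] subspace_add[OF T(2)] by simp
  qed
  show "X ** Y = Y ** X" if XY: "X \<in> G" "Y \<in> G" for X Y
  proof -
    obtain x y where "x \<in> T" "y \<in> T" "X = g x" "Y = g y" using G_T XY by metis
    then show ?thesis using T(7)[of x y] T(7)[of y x] by (simp add: add.commute)
  qed
  show "\<exists>Y\<in>G. X = Y ** Y" if X: "X \<in> G" for X
  proof -
    obtain x where x: "x \<in> T" "X = g x" using G_T[OF X] by blast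
    have h: "(1/2) *\<^sub>R x \<in> T" using x(1) T(2) by (simp add: subspace_scale)
    have "X = g ((1/2) *\<^sub>R x) ** g ((1/2) *\<^sub>R x)"
      using T(7)[OF h h] x(2) by (simp flip: scaleR_add_left)
    then show ?thesis using gG[OF h] by blast
  qed
  show "X = mat 1" if X: "X \<in> G" "X ** X = mat 1" for X
  proof -
    obtain x where x: "x \<in> T" "X = g x" using G_T[OF X(1)] by blast
    have "g (x + x) = g 0" using T(7)[OF x(1) x(1)] x(2) X(2) T(8) by simp
    moreover have "x + x \<in> T" by (rule subspace_add[OF T(2) x(1) x(1)])
    ultimately have "x + x = 0" using T(5) 0 by (auto dest: inj_onD)
    then have "2 *\<^sub>R x = 0" by (simp add: scaleR_2)
    then have "x = 0" by simp
    then show ?thesis using x(2) T(8) by simp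
  qed
qed

text \<open>Coordinate \<open>k\<close> enters through the factor \<open>exp (x $ k)\<close>, which
  the determinant recovers since \<open>G\<close> has determinant 1. This gives injectivity.\<close>

lemma cone_parametrization:
  fixes G :: "(real^'n^'n) set"
  assumes G: "G \<in> Ab_hat"
  obtains F :: "real^'n \<Rightarrow> real^'n^'n" where "continuous_on UNIV F" "inj F" "range F = cone G"
proof -
  obtain T :: "(real^'n) set" and g k where T: "T = {x. x $ k = 0}" "subspace T" "dim T = CARD('n) - 1"
    "continuous_on T g" "inj_on g T" "g ` T = G"
    "\<And>x y. x \<in> T \<Longrightarrow> y \<in> T \<Longrightarrow> g (x + y) = g x ** g y" "g 0 = mat 1"
    by (rule Ab_hat_parametrization[OF G]) (rule that)
  define \<pi> where "\<pi> x = x - x $ k *\<^sub>R axis k 1" for x :: "real^'n"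
  define F where "F x = exp (x $ k) *\<^sub>R g (\<pi> x)" for x
  have \<pi>T: "\<pi> x \<in> T" for x by (simp add: \<pi>_def T(1))
  have c\<pi>: "continuous_on UNIV \<pi>" unfolding \<pi>_def[abs_def] by (intro continuous_intros)
  have "continuous_on UNIV (\<lambda>x. g (\<pi> x))"
    by (rule continuous_on_compose2[OF T(4) c\<pi>]) (use \<pi>T in auto)
  then have "continuous_on UNIV F" unfolding F_def[abs_def] by (intro continuous_intros)
  moreover have "inj F"
  proof (rule injI)
    fix x y assume eq: "F x = F y"
    have "det (F x) = exp (x $ k) ^ CARD('n)" for x
      using Ab_hat_props(2)[OF G, of "g (\<pi> x)"] \<pi>T[of x] T(6) by (auto simp: F_def det_scaleR)
    then have "exp (x $ k) ^ CARD('n) = exp (y $ k) ^ CARD('n)" using eq by metis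
    then have "exp (x $ k) = exp (y $ k)" by (rule power_eq_imp_eq_base) auto
    then have k: "x $ k = y $ k" by simp
    then have "g (\<pi> x) = g (\<pi> y)" using eq by (simp add: F_def)
    then have "\<pi> x = \<pi> y" using T(5) \<pi>T by (auto dest: inj_onD)
    then show "x = y" using k by (simp add: \<pi>_def)
  qed
  moreover have "range F = cone G"
  proof (intro equalityI subsetI)
    fix X assume "X \<in> range F"
    then show "X \<in> cone G" using \<pi>T T(6) by (auto simp: F_def intro!: coneI)
  next
    fix X assume "X \<in> cone G"
    then obtain c x where c: "c > 0" "x \<in> T" "X = c *\<^sub>R g x" using T(6) by (auto simp: cone_def)
    define y where "y = x + ln c *\<^sub>R axis k 1"
    have "y $ k = ln c" using c(2) by (simp add: y_def T(1))
    moreover from this have "\<pi> y = x" by (simp add: \<pi>_def y_def)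
    ultimately have "F y = X" using c by (simp add: F_def)
    then show "X \<in> range F" by blast
  qed
  ultimately show thesis by (rule that)
qed

lemma cone_subset_subspace: "subspace A \<Longrightarrow> G \<subseteq> A \<Longrightarrow> cone G \<subseteq> A"
  by (auto simp: cone_def subspace_scale)

lemma Ab_hat_dim_ge:
  fixes G :: "(real^'n^'n) set"
  assumes G: "G \<in> Ab_hat" and A: "subspace A" "G \<subseteq> A"
  shows "CARD('n) \<le> dim A"
proof -
  obtain F :: "real^'n \<Rightarrow> real^'n^'n" where F: "continuous_on UNIV F" "inj F" "range F = cone G"
    by (rule cone_parametrization[OF G]) (rule that)
  have "dim (UNIV :: (real^'n) set) \<le> dim A"
    using invariance_of_dimension_subspaces[of UNIV UNIV A F] F cone_subset_subspace[OF A] A by auto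
  then show ?thesis by simp
qed

text \<open>Invariance of domain for the injective parametrization of the cone.\<close>

lemma cone_open:
  fixes G :: "(real^'n^'n) set"
  assumes G: "G \<in> Ab_hat" and A: "subspace A" "G \<subseteq> A" "dim A \<le> CARD('n)"
  shows "openin (top_of_set A) (cone G)"
proof -
  obtain F :: "real^'n \<Rightarrow> real^'n^'n" where F: "continuous_on UNIV F" "inj F" "range F = cone G"
    by (rule cone_parametrization[OF G]) (rule that)
  have "openin (top_of_set A) (range F)"
    using invariance_of_domain_subspaces[of UNIV UNIV A F] F cone_subset_subspace[OF A(1,2)] A by auto
  then show ?thesis by (simp add: F(3))
qed

lemma det_pos_connected:
  fixes C :: "(real^'n^'n) set"
  assumes C: "connected C" "mat 1 \<in> C" "\<And>x. x \<in> C \<Longrightarrow> det x \<noteq> 0" and x: "x \<in> C"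
  shows "det x > 0"
proof (rule ccontr)
  assume "\<not> det x > 0"
  then have "det x \<le> 0" by simp
  have "connected (det ` C)"
    by (rule connected_continuous_image[OF continuous_on_subset[OF continuous_det] C(1)]) simp
  then have "is_interval (det ` C)" by (simp add: is_interval_connected_1)
  moreover have "det x \<in> det ` C" "1 \<in> det ` C" using x C(2) by (auto intro: image_eqI[of _ _ "mat 1"])
  ultimately have "0 \<in> det ` C" using \<open>det x \<le> 0\<close> by (auto simp: is_interval_1)
  then show False using C(3) by auto
qed

text \<open>Scaling to determinant 1 by \<open>\<rho>\<close> exhibits the cone within
  \<open>C\<close> as preimage of the closed set \<open>G\<close>, so it is closed there, and it is
  open by \<open>cone_open\<close>. The determinant is positive on \<open>C\<close>, so the root in
  \<open>\<rho>\<close> is positive.\<close>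

lemma connected_subset_cone:
  fixes G :: "(real^'n^'n) set"
  assumes G: "G \<in> Ab_hat" and A: "subspace A" "G \<subseteq> A" "dim A \<le> CARD('n)"
    and C: "connected C" "C \<subseteq> A" "mat 1 \<in> C" "\<And>x. x \<in> C \<Longrightarrow> det x \<noteq> 0"
  shows "C \<subseteq> cone G"
proof -
  note GP = Ab_hat_props[OF G]
  define \<rho> where "\<rho> x = inverse (root CARD('n) (det x)) *\<^sub>R x" for x :: "real^'n^'n"
  have pos: "det x > 0" if "x \<in> C" for x by (rule det_pos_connected[OF C(1,3,4) that])
  have rpos: "root CARD('n) (det x) > 0" if "x \<in> C" for x using pos[OF that] by simp
  have cont: "continuous_on C \<rho>" unfolding \<rho>_def[abs_def]
    by (intro continuous_intros continuous_on_det) (use rpos in force)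
  have \<rho>SL: "\<rho> x \<in> carrier SL" if "x \<in> C" for x
    using pos[OF that] by (simp add: \<rho>_def SL_def det_scaleR power_inverse)
  have "C \<inter> \<rho> -` G = C \<inter> cone G"
  proof (intro equalityI subsetI IntI)
    fix x assume x: "x \<in> C \<inter> \<rho> -` G"
    have "x = root CARD('n) (det x) *\<^sub>R \<rho> x" using rpos[of x] x by (simp add: \<rho>_def)
    moreover have "root CARD('n) (det x) *\<^sub>R \<rho> x \<in> cone G" using rpos[of x] x by (intro coneI) auto
    ultimately show "x \<in> cone G" by simp
  next
    fix x assume x: "x \<in> C \<inter> cone G"
    then obtain c X where c: "c > 0" "X \<in> G" "x = c *\<^sub>R X" by (auto simp: cone_def)
    have "det x = c ^ CARD('n)" using GP(2)[OF c(2)] by (simp add: c(3) det_scaleR)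
    then have "root CARD('n) (det x) = c" using c(1) by (simp add: real_root_power_cancel)
    then have "\<rho> x = X" using c by (simp add: \<rho>_def)
    then show "x \<in> \<rho> -` G" using c(2) by simp
  qed auto
  moreover have "closedin (top_of_set C) (C \<inter> \<rho> -` G)"
    by (rule continuous_closedin_preimage_gen[OF cont _ GP(7)]) (use \<rho>SL in auto)
  ultimately have cl: "closedin (top_of_set C) (C \<inter> cone G)" by simp
  have op: "openin (top_of_set C) (C \<inter> cone G)"
    using cone_open[OF G A] C(2) by (auto simp: openin_open)
  have "mat 1 \<in> C \<inter> cone G" using C(3) coneI[of 1 "mat 1" G] GP(1) by simp
  then have "C \<inter> cone G = C" using C(1) op cl unfolding connected_clopen by blast
  then show ?thesis by blast
qed

lemma cone_det_one:
  fixes G :: "(real^'n^'n) set"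
  assumes G: "G \<in> Ab_hat" and x: "x \<in> cone G" "det x = 1"
  shows "x \<in> G"
proof -
  obtain c X where c: "c > 0" "X \<in> G" "x = c *\<^sub>R X" using x(1) by (auto simp: cone_def)
  have "c ^ CARD('n) = 1 ^ CARD('n)" using x(2) Ab_hat_props(2)[OF G c(2)] by (simp add: c(3) det_scaleR)
  then have "c = 1" by (rule power_eq_imp_eq_base) (use c in auto)
  then show ?thesis using c by simp
qed

text \<open>Positive determinant with square 1 means determinant 1, which puts the involution into
  \<open>G\<close> itself.\<close>

lemma cone_involution:
  fixes G :: "(real^'n^'n) set"
  assumes G: "G \<in> Ab_hat" and x: "x \<in> cone G" "x ** x = mat 1"
  shows "x = mat 1"
proof -
  obtain c X where c: "c > 0" "X \<in> G" "x = c *\<^sub>R X" using x(1) by (auto simp: cone_def)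
  have "det x > 0" using c Ab_hat_props(2)[OF G c(2)] by (simp add: det_scaleR)
  moreover have "det x * det x = 1" using arg_cong[OF x(2), of det] by (simp add: det_mul)
  ultimately have "det x = 1" by (metis less_asym mult_cancel_left1 mult_less_cancel_left_pos mult.right_neutral not_less_iff_gr_or_eq less_trans zero_less_one)
  then have "x \<in> G" by (rule cone_det_one[OF G x(1)])
  then show ?thesis using Ab_hat_props(6)[OF G] x(2) by blast
qed

section \<open>The algebra spanned by the group, and the exclusion of non-real eigenvalues\<close>

lemma span_Ab_hat:
  fixes G :: "(real^'n^'n) set"
  assumes G: "G \<in> Ab_hat"
  shows "\<And>X Y. X \<in> span G \<Longrightarrow> Y \<in> span G \<Longrightarrow> X ** Y = Y ** X"
    "\<And>X Y. X \<in> span G \<Longrightarrow> Y \<in> span G \<Longrightarrow> X ** Y \<in> span G" "mat 1 \<in> span G"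
proof -
  note GP = Ab_hat_props[OF G]
  show "mat 1 \<in> span G" using GP(1) by (rule span_base)
  have s1: "subspace {X. X ** Y = Y ** X}" for Y :: "real^'n^'n"
    by (auto simp: subspace_def mm.add_left mm.add_right mm.scaleR_left mm.scaleR_right)
  have s2: "subspace {X. X ** Y \<in> span G}" for Y :: "real^'n^'n"
    by (auto simp: subspace_def mm.add_left mm.scaleR_left span_add span_scale span_zero)
  have s3: "subspace {Y. X ** Y \<in> span G}" for X :: "real^'n^'n"
    by (auto simp: subspace_def mm.add_right mm.scaleR_right span_add span_scale span_zero)
  have 1: "span G \<subseteq> {X. X ** Y = Y ** X}" if "Y \<in> G" for Y
    by (rule span_minimal[OF _ s1]) (use GP(4) that in auto)
  show "X ** Y = Y ** X" if XY: "X \<in> span G" "Y \<in> span G" for X Y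
  proof -
    have "span G \<subseteq> {Y. Y ** X = X ** Y}"
      by (rule span_minimal[OF _ s1]) (use 1 XY(1) in fastforce)
    then show ?thesis using XY(2) by auto
  qed
  have 2: "span G \<subseteq> {X. X ** Y \<in> span G}" if "Y \<in> G" for Y
    by (rule span_minimal[OF _ s2]) (use GP(3) that span_base in auto)
  show "X ** Y \<in> span G" if XY: "X \<in> span G" "Y \<in> span G" for X Y
  proof -
    have "span G \<subseteq> {Y. X ** Y \<in> span G}"
      by (rule span_minimal[OF _ s3]) (use 2 XY(1) in auto)
    then show ?thesis using XY(2) by auto
  qed
qed

text \<open>\<open>v\<close> is a cyclic vector. By commutativity an element that kills
  \<open>v\<close> kills every \<open>b v\<close>, hence is 0, so evaluation at \<open>v\<close>
  embeds \<open>A\<close> into a space of dimension n.\<close>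

lemma cyclic_dim_le:
  fixes A :: "(real^'n^'n) set"
  assumes A: "subspace A" and comm: "\<And>X Y. X \<in> A \<Longrightarrow> Y \<in> A \<Longrightarrow> X ** Y = Y ** X"
    and d: "CARD('n) \<le> dim ((\<lambda>a. a *v v) ` A)"
  shows "dim A \<le> CARD('n)"
proof -
  let ?ev = "\<lambda>a :: real^'n^'n. a *v v"
  have lin: "linear ?ev" by (rule bounded_linear.linear[OF mv.bounded_linear_left])
  have "?ev ` A = UNIV"
    using linear_subspace_image[OF lin A] d by (intro subspace_dim_equal) auto
  have "inj_on ?ev A"
    unfolding linear_inj_on_iff_eq_0[OF lin A]
  proof (intro ballI impI)
    fix a assume a: "a \<in> A" "a *v v = 0"
    have "a *v u = 0" for u
    proof -
      have "u \<in> ?ev ` A" using \<open>?ev ` A = UNIV\<close> by simp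
      then obtain b where b: "b \<in> A" "u = b *v v" by blast
      have "a *v u = (b ** a) *v v" using comm[OF a(1) b(1)] b(2) by (simp add: matrix_vector_mul_assoc)
      then show ?thesis using a(2) by (simp add: matrix_vector_mul_assoc[symmetric])
    qed
    then show "a = 0" by (simp add: matrix_eq)
  qed
  then have "dim (?ev ` A) = dim A"
    using eucl.dim_image_eq[OF lin, of A] A by (simp add: span_eq_iff[THEN iffD2])
  then show ?thesis using dim_subset_UNIV[of "?ev ` A"] by simp
qed

text \<open>\<open>x\<close> acts on \<open>z\<close> as the imaginary unit, so multiplying by the
  conjugate leaves \<open>(\<alpha>^2 + \<beta>^2) z = 0\<close>.\<close>

lemma complex_independent:
  fixes x :: "real^'n^'n"
  assumes z: "x *v (x *v z) = - z" "z \<noteq> 0" and 0: "\<alpha> *\<^sub>R z + \<beta> *\<^sub>R (x *v z) = 0"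
  shows "\<alpha> = 0" "\<beta> = 0"
proof -
  have "x *v (\<alpha> *\<^sub>R z + \<beta> *\<^sub>R (x *v z)) = 0" by (simp only: 0 matrix_vector_mult_0_right)
  then have 1: "\<alpha> *\<^sub>R (x *v z) = \<beta> *\<^sub>R z" by (simp add: mv.add_right mv.scaleR_right z(1))
  have "\<alpha> *\<^sub>R (\<alpha> *\<^sub>R z + \<beta> *\<^sub>R (x *v z)) = 0" by (simp only: 0 scaleR_zero_right)
  then have "(\<alpha> * \<alpha>) *\<^sub>R z + \<beta> *\<^sub>R (\<alpha> *\<^sub>R (x *v z)) = 0" by (simp add: scaleR_add_right mult.commute)
  then have "(\<alpha> * \<alpha> + \<beta> * \<beta>) *\<^sub>R z = 0" by (simp only: 1 scaleR_scaleR scaleR_add_left)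
  then have "\<alpha> * \<alpha> + \<beta> * \<beta> = 0" using z(2) by simp
  then show "\<alpha> = 0" "\<beta> = 0" by (simp_all add: sum_squares_eq_zero_iff)
qed

lemma indep_fam_2: "(\<And>\<alpha> \<beta>. \<alpha> *\<^sub>R a + \<beta> *\<^sub>R b = 0 \<Longrightarrow> \<alpha> = 0 \<and> \<beta> = 0) \<Longrightarrow> indep_fam 2 (\<lambda>i. if i = 0 then a else b)"
  unfolding indep_fam_def by (auto simp: numeral_2_eq_2 less_Suc_eq)

lemma complex_line_dim:
  fixes x :: "real^'n^'n"
  assumes z: "x *v (x *v z) = - z" "z \<noteq> 0" and U: "z \<in> U" "x *v z \<in> U"
  shows "2 \<le> dim U"
proof (rule indep_fam_le_dim[OF indep_fam_2[of z "x *v z"]])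
  show "\<alpha> = 0 \<and> \<beta> = 0" if "\<alpha> *\<^sub>R z + \<beta> *\<^sub>R (x *v z) = 0" for \<alpha> \<beta>
    using complex_independent[OF z that] by simp
qed (use U in auto)

declare One_nat_def [simp del]

lemma indep_fam_4:
  assumes "\<And>\<alpha> \<beta> \<gamma> \<delta>. \<alpha> *\<^sub>R a + \<beta> *\<^sub>R b + \<gamma> *\<^sub>R c + \<delta> *\<^sub>R d = 0 \<Longrightarrow> \<alpha> = 0 \<and> \<beta> = 0 \<and> \<gamma> = 0 \<and> \<delta> = 0"
  shows "indep_fam 4 (\<lambda>i. if i = 0 then a else if i = 1 then b else if i = 2 then c else d)"
  unfolding indep_fam_def
proof (intro allI impI)
  fix k :: "nat \<Rightarrow> real" and i :: nat
  assume z: "(\<Sum>i<4. k i *\<^sub>R (if i = 0 then a else if i = 1 then b else if i = 2 then c else d)) = 0" and i: "i < 4"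
  have "k 0 *\<^sub>R a + k 1 *\<^sub>R b + k 2 *\<^sub>R c + k 3 *\<^sub>R d = 0" using z by (simp add: sum4)
  from assms[OF this] have "k 0 = 0" "k 1 = 0" "k 2 = 0" "k 3 = 0" by auto
  moreover have "i = 0 \<or> i = 1 \<or> i = 2 \<or> i = 3" using i by arith
  ultimately show "k i = 0" by auto
qed

lemma dim_ge_4:
  fixes a b c d :: "'a::euclidean_space"
  assumes "\<And>\<alpha> \<beta> \<gamma> \<delta>. \<alpha> *\<^sub>R a + \<beta> *\<^sub>R b + \<gamma> *\<^sub>R c + \<delta> *\<^sub>R d = 0 \<Longrightarrow> \<alpha> = 0 \<and> \<beta> = 0 \<and> \<gamma> = 0 \<and> \<delta> = 0"
    and "a \<in> U" "b \<in> U" "c \<in> U" "d \<in> U"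
  shows "4 \<le> dim U"
  by (rule indep_fam_le_dim[OF indep_fam_4[of a b c d]]) (use assms in auto)

declare One_nat_def [simp]

text \<open>The eigenvalues of \<open>x\<close> are \<open>i\<close> and \<open>-i\<close>. In
  dimension four, if \<open>x^2 + 1\<close> is nonzero, a vector outside its kernel is cyclic. If
  \<open>x^2 = -1\<close>, the space is two-dimensional over the complex numbers: either some
  \<open>a v\<close> leaves the complex line of \<open>v\<close> and \<open>v\<close> is cyclic, or
  every vector is a complex eigenvector of every element and \<open>A\<close> is spanned by 1 and
  \<open>x\<close>.\<close>

lemma complex_algebra_dim_le:
  fixes A :: "(real^'n^'n) set"
  assumes A: "subspace A" "mat 1 \<in> A" and mult: "\<And>X Y. X \<in> A \<Longrightarrow> Y \<in> A \<Longrightarrow> X ** Y \<in> A"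
    and comm: "\<And>X Y. X \<in> A \<Longrightarrow> Y \<in> A \<Longrightarrow> X ** Y = Y ** X"
    and x: "x \<in> A" and nil: "\<And>v. \<exists>k. ((*v) (x ** x + mat 1) ^^ k) v = 0"
    and u: "x *v (x *v u) = - u" "u \<noteq> 0"
    and n: "CARD('n) \<le> 2 \<or> CARD('n) = 4"
  shows "dim A \<le> CARD('n)"
proof (rule disjE[OF n])
  assume n2: "CARD('n) \<le> 2"
  have "2 \<le> dim ((\<lambda>a. a *v u) ` A)"
    by (rule complex_line_dim[OF u]) (use x A(2) in \<open>auto intro: image_eqI[of _ _ "mat 1"]\<close>)
  then show ?thesis using n2 by (intro cyclic_dim_le[OF A(1) comm, of u]) auto
next
  assume n4: "CARD('n) = 4"
  let ?y = "x ** x + mat 1"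
  have yv: "?y *v v = x *v (x *v v) + v" for v by (simp add: mv.add_left matrix_vector_mul_assoc)
  have yA: "?y \<in> A" using A mult x by (simp add: subspace_add)
  have cyc: ?thesis if v: "a \<in> A" "\<And>\<alpha> \<beta> \<gamma> \<delta>. \<alpha> *\<^sub>R v + \<beta> *\<^sub>R (x *v v) + \<gamma> *\<^sub>R (a *v v) + \<delta> *\<^sub>R (x *v (a *v v)) = 0 \<Longrightarrow> \<alpha> = 0 \<and> \<beta> = 0 \<and> \<gamma> = 0 \<and> \<delta> = 0"
    for a v
  proof -
    have "4 \<le> dim ((\<lambda>a. a *v v) ` A)"
    proof (rule dim_ge_4[OF v(2)])
      show "v \<in> (\<lambda>a. a *v v) ` A" using A(2) by (intro image_eqI[of _ _ "mat 1"]) simp_all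
      show "x *v v \<in> (\<lambda>a. a *v v) ` A" using x by blast
      show "a *v v \<in> (\<lambda>a. a *v v) ` A" using v(1) by blast
      show "x *v (a *v v) \<in> (\<lambda>a. a *v v) ` A" using mult[OF x v(1)]
        by (intro image_eqI[of _ _ "x ** a"]) (simp_all add: matrix_vector_mul_assoc)
    qed
    then show ?thesis using n4 by (intro cyclic_dim_le[OF A(1) comm]) auto
  qed
  show ?thesis
  proof (cases "\<exists>v. ?y *v v \<noteq> 0")
    case True
    then obtain v where v: "?y *v v \<noteq> 0" by blast
    have v1: "((*v) ?y ^^ 1) v \<noteq> 0" using v by simp
    obtain k where k: "k \<ge> 1" "((*v) ?y ^^ k) v \<noteq> 0" "((*v) ?y ^^ Suc k) v = 0"
      by (rule nilpotent_chain[OF nil v1]) (rule that)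
    define N where "N j = ((*v) ?y ^^ j)" for j
    have N: "linear (N j)" for j unfolding N_def by (rule linear_funpow_mv)
    have Nx: "N j (x *v w) = x *v N j w" for j w
    proof (induction j)
      case (Suc j)
      have "?y *v (x *v t) = x *v (?y *v t)" for t by (simp add: yv mv.add_right)
      then show ?case using Suc by (simp add: N_def)
    qed (simp add: N_def)
    have NS: "N (Suc j) w = N j (?y *v w)" for j w unfolding N_def by (rule funpow_mv_Suc2)
    obtain k' where k': "k = Suc k'" using k(1) by (cases k) auto
    define z where "z = N k v"
    have z0: "z \<noteq> 0" using k(2) by (simp add: z_def N_def)
    have "?y *v z = 0" using k(3) by (simp add: z_def N_def)
    then have "x *v (x *v z) + z = 0" by (simp only: yv)
    then have xz: "x *v (x *v z) = - z" by (simp add: eq_neg_iff_add_eq_0)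
    show ?thesis
    proof (rule cyc[OF yA, of v])
      fix \<alpha> \<beta> \<gamma> \<delta>
      assume 0: "\<alpha> *\<^sub>R v + \<beta> *\<^sub>R (x *v v) + \<gamma> *\<^sub>R (?y *v v) + \<delta> *\<^sub>R (x *v (?y *v v)) = 0"
      have Nk: "N k (?y *v v) = 0" using k(3) NS[of k v] by (simp add: N_def)
      \<comment> \<open>The top power \<open>N k\<close> isolates \<open>\<alpha>\<close> and
        \<open>\<beta>\<close>; one power less then isolates \<open>\<gamma>\<close> and
        \<open>\<delta>\<close>.\<close>
      have "N k (\<alpha> *\<^sub>R v + \<beta> *\<^sub>R (x *v v) + \<gamma> *\<^sub>R (?y *v v) + \<delta> *\<^sub>R (x *v (?y *v v))) = 0"
        unfolding 0 by (rule linear_0[OF N])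
      then have "\<alpha> *\<^sub>R z + \<beta> *\<^sub>R (x *v z) = 0"
        by (simp only: linear_add[OF N] linear_scale[OF N] Nx Nk z_def[symmetric] scaleR_zero_right matrix_vector_mult_0_right add_0_right)
      from complex_independent[OF xz z0 this] have ab: "\<alpha> = 0" "\<beta> = 0" by auto
      have "N k' (\<gamma> *\<^sub>R (?y *v v) + \<delta> *\<^sub>R (x *v (?y *v v))) = 0"
        using 0 ab linear_0[OF N] by simp
      moreover have "N k' (?y *v v) = z" using NS[of k' v] by (simp add: z_def k')
      ultimately have "\<gamma> *\<^sub>R z + \<delta> *\<^sub>R (x *v z) = 0"
        by (simp only: linear_add[OF N] linear_scale[OF N] Nx)
      from complex_independent[OF xz z0 this] ab show "\<alpha> = 0 \<and> \<beta> = 0 \<and> \<gamma> = 0 \<and> \<delta> = 0" by auto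
    qed
  next
    case False
    then have xx: "x *v (x *v v) = - v" for v using yv[of v] by (simp add: eq_neg_iff_add_eq_0)
    \<comment> \<open>The inverse of \<open>\<alpha> + \<beta> i\<close> is its conjugate divided by
      the squared norm \<open>s\<close>.\<close>
    have inv: "\<exists>\<gamma> \<delta>. \<gamma> *\<^sub>R (\<alpha> *\<^sub>R v + \<beta> *\<^sub>R (x *v v)) + \<delta> *\<^sub>R (x *v (\<alpha> *\<^sub>R v + \<beta> *\<^sub>R (x *v v))) = v"
      if "\<alpha> \<noteq> 0 \<or> \<beta> \<noteq> 0" for \<alpha> \<beta> v
    proof -
      define s where "s = \<alpha> * \<alpha> + \<beta> * \<beta>"
      have s: "s \<noteq> 0" using that by (simp add: s_def sum_squares_eq_zero_iff)
      have "(\<alpha> / s) *\<^sub>R (\<alpha> *\<^sub>R v + \<beta> *\<^sub>R (x *v v)) + (- \<beta> / s) *\<^sub>R (x *v (\<alpha> *\<^sub>R v + \<beta> *\<^sub>R (x *v v)))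
        = ((\<alpha> * \<alpha> + \<beta> * \<beta>) / s) *\<^sub>R v"
        by (simp add: mv.add_right mv.scaleR_right xx scaleR_add_right scaleR_diff_right add_divide_distrib scaleR_add_left mult.commute)
      also have "\<dots> = v" using s by (simp add: s_def[symmetric])
      finally show ?thesis by blast
    qed
    show ?thesis
    proof (cases "\<exists>a\<in>A. \<exists>v. a *v v \<notin> span {v, x *v v}")
      case True
      then obtain a v where a: "a \<in> A" "a *v v \<notin> span {v, x *v v}" by blast
      have v0: "v \<noteq> 0" using a(2) span_zero by auto
      let ?L = "span {v, x *v v}"
      have xL: "x *v w \<in> ?L" if "w \<in> ?L" for w
      proof -
        have "?L \<subseteq> {w. x *v w \<in> ?L}"
        proof (rule span_minimal)
          show "subspace {w. x *v w \<in> ?L}"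
            by (auto simp: subspace_def mv.add_right mv.scaleR_right span_add span_scale span_zero)
          show "{v, x *v v} \<subseteq> {w. x *v w \<in> ?L}" using xx by (auto intro: span_base span_neg)
        qed
        then show ?thesis using that by blast
      qed
      show ?thesis
      proof (rule cyc[OF a(1), of v])
        fix \<alpha> \<beta> \<gamma> \<delta>
        assume 0: "\<alpha> *\<^sub>R v + \<beta> *\<^sub>R (x *v v) + \<gamma> *\<^sub>R (a *v v) + \<delta> *\<^sub>R (x *v (a *v v)) = 0"
        let ?w = "\<gamma> *\<^sub>R (a *v v) + \<delta> *\<^sub>R (x *v (a *v v))"
        have "?w = - (\<alpha> *\<^sub>R v + \<beta> *\<^sub>R (x *v v))" unfolding eq_neg_iff_add_eq_0 using 0 by (simp only: add_ac)
        moreover have "- (\<alpha> *\<^sub>R v + \<beta> *\<^sub>R (x *v v)) \<in> ?L"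
          by (intro span_neg span_add span_scale span_base) auto
        ultimately have wL: "?w \<in> ?L" by simp
        have gd: "\<gamma> = 0 \<and> \<delta> = 0"
        proof (rule ccontr)
          assume "\<not> ?thesis"
          then have "\<gamma> \<noteq> 0 \<or> \<delta> \<noteq> 0" by blast
          from inv[OF this, of "a *v v"] obtain g d where "g *\<^sub>R ?w + d *\<^sub>R (x *v ?w) = a *v v" by (elim exE)
          moreover have "g *\<^sub>R ?w + d *\<^sub>R (x *v ?w) \<in> ?L" by (rule span_add[OF span_scale[OF wL] span_scale[OF xL[OF wL]]])
          ultimately show False using a(2) by simp
        qed
        then have "\<alpha> *\<^sub>R v + \<beta> *\<^sub>R (x *v v) = 0" using 0 by simp
        from complex_independent[OF xx v0 this] gd show "\<alpha> = 0 \<and> \<beta> = 0 \<and> \<gamma> = 0 \<and> \<delta> = 0" by blast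
      qed
    next
      case False
      have ev: "\<exists>\<gamma> \<delta>. a *v v = \<gamma> *\<^sub>R v + \<delta> *\<^sub>R (x *v v)" if a: "a \<in> A" for a v
      proof -
        have "a *v v \<in> span {v, x *v v}" using False a by blast
        then obtain \<gamma> where "a *v v - \<gamma> *\<^sub>R v \<in> span {x *v v}" by (auto simp: span_insert)
        then obtain \<delta> where "a *v v - \<gamma> *\<^sub>R v = \<delta> *\<^sub>R (x *v v)" by (auto simp: span_singleton)
        then have "a *v v = \<gamma> *\<^sub>R v + \<delta> *\<^sub>R (x *v v)" by (simp add: algebra_simps)
        then show ?thesis by blast
      qed
      let ?W = "span {u, x *v u}"
      have "A \<subseteq> span {mat 1, x}"
      proof
        fix a assume a: "a \<in> A"
        obtain \<alpha> \<beta> where au: "a *v u = \<alpha> *\<^sub>R u + \<beta> *\<^sub>R (x *v u)" using ev[OF a, of u] by (elim exE)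
        \<comment> \<open>Subtracting a complex scalar puts \<open>u\<close> into the kernel; the
          difference will vanish everywhere.\<close>
        define a' where "a' = a - \<alpha> *\<^sub>R mat 1 - \<beta> *\<^sub>R x"
        have a'A: "a' \<in> A" unfolding a'_def using a A x by (intro subspace_diff subspace_scale)
        have a'u: "a' *v u = 0" by (simp add: a'_def mv.diff_left mv.scaleR_left au)
        have "a' *v v = 0" for v
        proof (cases "v \<in> ?W")
          case True
          have "?W \<subseteq> {w. a' *v w = 0}"
          proof (rule span_minimal)
            show "subspace {w. a' *v w = 0}" by (auto simp: subspace_def mv.add_right mv.scaleR_right)
            have "a' *v (x *v u) = x *v (a' *v u)"
              using comm[OF a'A x] by (simp add: matrix_vector_mul_assoc)
            then show "{u, x *v u} \<subseteq> {w. a' *v w = 0}" using a'u by simp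
          qed
          then show ?thesis using True by blast
        next
          case vW: False
          obtain \<gamma> \<delta> where 1: "a' *v v = \<gamma> *\<^sub>R v + \<delta> *\<^sub>R (x *v v)" using ev[OF a'A, of v] by (elim exE)
          \<comment> \<open>The complex eigenvalues at \<open>u + v\<close> and \<open>v\<close> are
            compared. Since \<open>v\<close> is outside the complex line of \<open>u\<close>, they
            agree, and then agree with the eigenvalue 0 at \<open>u\<close>.\<close>
          obtain \<epsilon> \<zeta> where 2: "a' *v (u + v) = \<epsilon> *\<^sub>R (u + v) + \<zeta> *\<^sub>R (x *v (u + v))" using ev[OF a'A, of "u + v"] by (elim exE)
          have 3: "(\<gamma> - \<epsilon>) *\<^sub>R v + (\<delta> - \<zeta>) *\<^sub>R (x *v v) = \<epsilon> *\<^sub>R u + \<zeta> *\<^sub>R (x *v u)"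
            using 2 1 a'u by (simp add: mv.add_right scaleR_add_right scaleR_diff_left algebra_simps)
          have xW: "x *v w \<in> ?W" if "w \<in> ?W" for w
          proof -
            have "?W \<subseteq> {w. x *v w \<in> ?W}"
            proof (rule span_minimal)
              show "subspace {w. x *v w \<in> ?W}"
                by (auto simp: subspace_def mv.add_right mv.scaleR_right span_add span_scale span_zero)
              show "{u, x *v u} \<subseteq> {w. x *v w \<in> ?W}" using xx by (auto intro: span_base span_neg)
            qed
            then show ?thesis using that by blast
          qed
          have "\<gamma> = \<epsilon> \<and> \<delta> = \<zeta>"
          proof (rule ccontr)
            assume "\<not> ?thesis"
            then have "\<gamma> - \<epsilon> \<noteq> 0 \<or> \<delta> - \<zeta> \<noteq> 0" by auto
            from inv[OF this, of v] obtain g d where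
              "g *\<^sub>R (\<epsilon> *\<^sub>R u + \<zeta> *\<^sub>R (x *v u)) + d *\<^sub>R (x *v (\<epsilon> *\<^sub>R u + \<zeta> *\<^sub>R (x *v u))) = v"
              unfolding 3 by (elim exE)
            moreover have "\<epsilon> *\<^sub>R u + \<zeta> *\<^sub>R (x *v u) \<in> ?W" by (intro span_add span_scale span_base) auto
            ultimately have "v \<in> ?W" using xW by (metis span_add span_scale)
            then show False using vW by simp
          qed
          then have "\<epsilon> *\<^sub>R u + \<zeta> *\<^sub>R (x *v u) = 0" using 3 by simp
          from complex_independent[OF xx u(2) this] \<open>\<gamma> = \<epsilon> \<and> \<delta> = \<zeta>\<close> show ?thesis using 1 by simp
        qed
        then have "a' = 0" by (simp add: matrix_eq)
        then have "a = \<alpha> *\<^sub>R mat 1 + \<beta> *\<^sub>R x" by (simp add: a'_def algebra_simps)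
        then show "a \<in> span {mat 1, x}" by (auto intro!: span_add span_scale intro: span_base)
      qed
      then have "dim A \<le> dim {mat 1, x}" using dim_subset[of A "span {mat 1, x}"] by simp
      also have "\<dots> \<le> card {mat 1, x}" by (intro dim_le_card') simp
      also have "\<dots> \<le> 2" by (simp add: card_insert_if)
      finally show ?thesis using n4 by simp
    qed
  qed
qed

lemma inj_imp_det_nonzero:
  fixes Y :: "real^'n^'n"
  assumes "\<And>v. Y *v v = 0 \<Longrightarrow> v = 0"
  shows "det Y \<noteq> 0"
proof -
  have "\<exists>B. B ** Y = mat 1" unfolding matrix_left_invertible_ker using assms by blast
  then show ?thesis by (metis invertible_det_nz invertible_left_inverse)
qed

text \<open>Composition with \<open>f\<close>, whose values lie in \<open>V\<close>, encodes
  restriction to \<open>V\<close>. If some \<open>a\<close> has a vector \<open>t\<close> in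
  \<open>V\<close> that is not an eigenvector, \<open>t\<close> is cyclic for \<open>V\<close> and
  each element acts there as a combination of 1 and \<open>a\<close>. Otherwise every element is
  scalar on \<open>V\<close>.\<close>

lemma commuting_restriction_dim_le:
  fixes A :: "(real^'n^'n) set" and f :: "real^'n^'n"
  assumes A: "subspace A" and comm: "\<And>X Y. X \<in> A \<Longrightarrow> Y \<in> A \<Longrightarrow> X ** Y = Y ** X"
    and V: "subspace V" "\<And>a v. a \<in> A \<Longrightarrow> v \<in> V \<Longrightarrow> a *v v \<in> V" "1 \<le> dim V" "dim V \<le> 2"
    and f: "\<And>v. f *v v \<in> V"
  shows "dim ((\<lambda>a. a ** f) ` A) \<le> dim V"
proof (cases "\<exists>a\<in>A. \<exists>t\<in>V. a *v t \<notin> span {t}")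
  case True
  then obtain a t where a: "a \<in> A" "t \<in> V" "a *v t \<notin> span {t}" by blast
  have t0: "t \<noteq> 0" using a(3) span_zero by auto
  have ind: "independent {a *v t, t}" using a(3) t0 by (simp add: independent_insert)
  have ne: "a *v t \<noteq> t" using a(3) span_base[of t "{t}"] by auto
  have sub: "span {a *v t, t} \<subseteq> V" using a V by (intro span_minimal) auto
  have d2: "dim (span {a *v t, t}) = 2" using ind ne by (simp add: dim_eq_card_independent)
  then have d: "dim V = 2" using V(4) dim_subset[OF sub] by simp
  have eq: "span {a *v t, t} = V" using sub d d2 V(1) by (intro subspace_dim_equal) auto
  have "(\<lambda>a. a ** f) ` A \<subseteq> span {f, a ** f}"
  proof (rule image_subsetI)
    fix c assume c: "c \<in> A"
    have "c *v t \<in> span {a *v t, t}" using V(2)[OF c a(2)] eq by simp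
    then obtain \<beta> where "c *v t - \<beta> *\<^sub>R (a *v t) \<in> span {t}" by (auto simp: span_insert)
    then obtain \<alpha> where "c *v t - \<beta> *\<^sub>R (a *v t) = \<alpha> *\<^sub>R t" by (auto simp: span_singleton)
    then have ct: "c *v t = \<alpha> *\<^sub>R t + \<beta> *\<^sub>R (a *v t)" by (simp add: algebra_simps)
    have ca: "c *v (a *v t) = a *v (c *v t)" using comm[OF c a(1)] by (simp add: matrix_vector_mul_assoc)
    have "V \<subseteq> {w. c *v w = \<alpha> *\<^sub>R w + \<beta> *\<^sub>R (a *v w)}"
      unfolding eq[symmetric]
    proof (rule span_minimal)
      show "subspace {w. c *v w = \<alpha> *\<^sub>R w + \<beta> *\<^sub>R (a *v w)}"
        by (auto simp: subspace_def mv.add_right mv.scaleR_right scaleR_add_right mult.commute)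
      show "{a *v t, t} \<subseteq> {w. c *v w = \<alpha> *\<^sub>R w + \<beta> *\<^sub>R (a *v w)}"
        using ct by (simp add: ca mv.add_right mv.scaleR_right)
    qed
    then have "c *v (f *v v) = \<alpha> *\<^sub>R (f *v v) + \<beta> *\<^sub>R (a *v (f *v v))" for v using f by blast
    then have "c ** f = \<alpha> *\<^sub>R f + \<beta> *\<^sub>R (a ** f)"
      by (simp add: matrix_eq mv.add_left mv.scaleR_left matrix_vector_mul_assoc[symmetric])
    then show "c ** f \<in> span {f, a ** f}" by (auto intro!: span_add span_scale intro: span_base)
  qed
  then have "dim ((\<lambda>a. a ** f) ` A) \<le> dim {f, a ** f}" using dim_subset[of _ "span {f, a ** f}"] by simp
  also have "\<dots> \<le> card {f, a ** f}" by (intro dim_le_card') simp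
  also have "\<dots> \<le> 2" by (simp add: card_insert_if)
  finally show ?thesis using d by simp
next
  case False
  then have eig: "\<exists>l. a *v t = l *\<^sub>R t" if "a \<in> A" "t \<in> V" for a t
    using that by (auto simp: span_singleton)
  obtain t where t: "t \<in> V" "t \<noteq> 0" using V(3) dim_eq_0[of V] by (metis not_one_le_zero singletonI subsetI)
  have "(\<lambda>a. a ** f) ` A \<subseteq> span {f}"
  proof (rule image_subsetI)
    fix a assume a: "a \<in> A"
    obtain l where l: "a *v t = l *\<^sub>R t" using eig[OF a t(1)] by blast
    have "a *v s = l *\<^sub>R s" if s: "s \<in> V" for s
    proof (cases "s \<in> span {t}")
      case True
      then show ?thesis using l by (auto simp: span_singleton mv.scaleR_right)
    next
      case ns: False
      obtain l' where l': "a *v s = l' *\<^sub>R s" using eig[OF a s] by blast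
      obtain l'' where l'': "a *v (s + t) = l'' *\<^sub>R (s + t)" using eig[OF a subspace_add[OF V(1) s t(1)]] by blast
      have e: "(l' - l'') *\<^sub>R s = (l'' - l) *\<^sub>R t"
        using l'' l l' by (simp add: mv.add_right algebra_simps)
      have "l' = l''"
      proof (rule ccontr)
        assume "l' \<noteq> l''"
        then have "s = (1 / (l' - l'')) *\<^sub>R ((l' - l'') *\<^sub>R s)" by simp
        also have "\<dots> \<in> span {t}" unfolding e by (intro span_scale span_base) simp
        finally show False using ns by simp
      qed
      then show ?thesis using e t(2) l' by simp
    qed
    then have "a *v (f *v v) = l *\<^sub>R (f *v v)" for v using f by blast
    then have "a ** f = l *\<^sub>R f" by (simp add: matrix_eq mv.scaleR_left matrix_vector_mul_assoc[symmetric])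
    then show "a ** f \<in> span {f}" by (auto intro!: span_scale intro: span_base)
  qed
  then have "dim ((\<lambda>a. a ** f) ` A) \<le> dim {f}" using dim_subset[of _ "span {f}"] by simp
  also have "\<dots> \<le> 1" using dim_le_card'[of "{f}"] by simp
  finally show ?thesis using V(3) by simp
qed

text \<open>A half turn: for \<open>\<theta>\<close> from 0 to \<open>pi\<close> the path runs from
  the identity to \<open>1 - 2 e\<close>, an involution since \<open>e\<close> is idempotent. The
  path stays in the cone, where the only involution is the identity.\<close>

lemma no_rotation_in_Ab_hat:
  fixes G :: "(real^'n^'n) set"
  assumes G: "G \<in> Ab_hat" and A: "subspace A" "G \<subseteq> A" "dim A \<le> CARD('n)"
    and e: "mat 1 - e \<in> A" "e \<in> A" "f \<in> A" "e ** e = e"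
    and det: "\<And>\<theta>. det (mat 1 - e + cos \<theta> *\<^sub>R e + sin \<theta> *\<^sub>R f) \<noteq> 0"
  shows "e = 0"
proof -
  define p where "p \<theta> = mat 1 - e + cos \<theta> *\<^sub>R e + sin \<theta> *\<^sub>R f" for \<theta> :: real
  have "p ` {0..pi} \<subseteq> cone G"
  proof (rule connected_subset_cone[OF G A])
    show "connected (p ` {0..pi})" unfolding p_def[abs_def]
      by (intro connected_continuous_image continuous_intros) simp
    show "p ` {0..pi} \<subseteq> A" unfolding p_def[abs_def] using e A(1)
      by (intro image_subsetI subspace_add subspace_scale)
    show "mat 1 \<in> p ` {0..pi}" by (rule image_eqI[of _ _ 0]) (simp_all add: p_def)
  qed (use det in \<open>auto simp: p_def\<close>)
  then have "p pi \<in> cone G" by auto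
  moreover have pp: "p pi = mat 1 - e - e" by (simp add: p_def)
  moreover have "p pi ** p pi = mat 1" unfolding pp
    by (simp only: mm.diff_left mm.diff_right matrix_mul_lid matrix_mul_rid e(4)) simp
  ultimately have "mat 1 - e - e = mat 1" using cone_involution[OF G] by metis
  then have "e + e = 0" by (simp add: algebra_simps)
  then show ?thesis by (simp add: vec_eq_iff)
qed

text \<open>Modulo the plane of \<open>u\<close> and \<open>x u\<close>, \<open>x\<close> would act
  on a line by a real number \<open>\<mu>\<close>, so \<open>x^2 + 1\<close> would act by
  \<open>\<mu>^2 + 1 > 0\<close> and not be nilpotent.\<close>

lemma complex_plane_codim_one:
  fixes x :: "real^'n^'n"
  assumes V: "subspace V" "\<And>v. v \<in> V \<Longrightarrow> x *v v \<in> V"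
    and nil: "\<And>v. v \<in> V \<Longrightarrow> ((*v) (x ** x + mat 1) ^^ n) v = 0"
    and u: "x *v (x *v u) = - u" "u \<noteq> 0" "u \<in> V"
  shows "dim V \<noteq> 3"
proof
  assume d3: "dim V = 3"
  let ?y = "x ** x + mat 1" and ?W = "span {u, x *v u}"
  have yv: "?y *v v = x *v (x *v v) + v" for v by (simp add: mv.add_left matrix_vector_mul_assoc)
  have "dim ?W \<le> card {u, x *v u}" unfolding dim_span by (rule dim_le_card') simp
  also have "\<dots> \<le> 2" by (simp add: card_insert_if)
  finally have dW: "dim ?W \<le> 2" .
  moreover have "2 \<le> dim ?W" by (rule complex_line_dim[OF u(1,2)]) (auto intro: span_base)
  ultimately have dW2: "dim ?W = 2" by simp
  have WV: "?W \<subseteq> V" using u V by (intro span_minimal) auto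
  have "\<not> V \<subseteq> ?W" using dim_subset[of V ?W] d3 dW2 by auto
  then obtain t where t: "t \<in> V" "t \<notin> ?W" by blast
  have xW: "x *v w \<in> ?W" if "w \<in> ?W" for w
  proof -
    have "?W \<subseteq> {w. x *v w \<in> ?W}"
    proof (rule span_minimal)
      show "subspace {w. x *v w \<in> ?W}"
        by (auto simp: subspace_def mv.add_right mv.scaleR_right span_add span_scale span_zero)
      show "{u, x *v u} \<subseteq> {w. x *v w \<in> ?W}" using u(1) by (auto intro: span_base span_neg)
    qed
    then show ?thesis using that by blast
  qed
  have "dim (insert t {u, x *v u}) = 3" using dim_insert[of t "{u, x *v u}"] t(2) dW2 by simp
  then have "span (insert t {u, x *v u}) = V"
    using d3 V(1) t(1) u V(2) by (intro subspace_dim_equal span_minimal) auto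
  then have "x *v t \<in> span (insert t {u, x *v u})" using V(2)[OF t(1)] by simp
  then obtain \<mu> where \<mu>: "x *v t - \<mu> *\<^sub>R t \<in> ?W" unfolding span_insert by auto
  define w where "w = x *v t - \<mu> *\<^sub>R t"
  have w: "w \<in> ?W" using \<mu> by (simp add: w_def)
  have xt: "x *v t = \<mu> *\<^sub>R t + w" by (simp add: w_def)
  \<comment> \<open>Modulo the plane, each factor multiplies \<open>t\<close> by
    \<open>\<mu>^2 + 1\<close>.\<close>
  have y: "((*v) ?y ^^ k) t - (\<mu> * \<mu> + 1) ^ k *\<^sub>R t \<in> ?W" for k
  proof (induction k)
    case (Suc k)
    define z where "z = ((*v) ?y ^^ k) t - (\<mu> * \<mu> + 1) ^ k *\<^sub>R t"
    have z: "z \<in> ?W" using Suc by (simp add: z_def)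
    have yt: "?y *v t = (\<mu> * \<mu> + 1) *\<^sub>R t + (\<mu> *\<^sub>R w + x *v w)"
      by (simp add: yv xt mv.add_right mv.scaleR_right scaleR_add_right scaleR_add_left)
    have "((*v) ?y ^^ Suc k) t = ?y *v (z + (\<mu> * \<mu> + 1) ^ k *\<^sub>R t)" by (simp add: z_def)
    also have "\<dots> = x *v (x *v z) + z + (\<mu> * \<mu> + 1) ^ k *\<^sub>R (\<mu> *\<^sub>R w + x *v w) + (\<mu> * \<mu> + 1) ^ Suc k *\<^sub>R t"
      unfolding mv.add_right[of _ z] mv.scaleR_right[of _ "(\<mu> * \<mu> + 1) ^ k"] yt yv[of z] scaleR_add_right[of _ "(\<mu> * \<mu> + 1) *\<^sub>R t"] scaleR_scaleR power_Suc2
      by (simp only: add_ac)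
    finally have 1: "((*v) ?y ^^ Suc k) t - (\<mu> * \<mu> + 1) ^ Suc k *\<^sub>R t
      = x *v (x *v z) + z + (\<mu> * \<mu> + 1) ^ k *\<^sub>R (\<mu> *\<^sub>R w + x *v w)" by (simp only: add_diff_cancel_right')
    show ?case unfolding 1
      by (intro span_add[OF span_add[OF xW[OF xW[OF z]] z] span_scale[OF span_add[OF span_scale[OF w] xW[OF w]]]])
  qed (simp add: span_zero)
  have "- ((\<mu> * \<mu> + 1) ^ n *\<^sub>R t) \<in> ?W" using y[of n] nil[OF t(1)] by simp
  then have "(\<mu> * \<mu> + 1) ^ n *\<^sub>R t \<in> ?W" using span_neg by fastforce
  moreover have "\<mu> * \<mu> + 1 > 0" using zero_le_square[of \<mu>] by linarith
  then have "(\<mu> * \<mu> + 1) ^ n > 0" by (rule zero_less_power)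
  moreover have "t \<in> ?W" if "c *\<^sub>R t \<in> ?W" "c > 0" for c
    using span_scale[OF that(1), of "1 / c"] that(2) by simp
  ultimately have "t \<in> ?W" by blast
  then show False using t by simp
qed

text \<open>A non-real eigenvalue is normalised to \<open>i\<close>, with
  \<open>x (x u) = - u\<close>. \<open>V1\<close> is the part where \<open>x^2 + 1\<close> is
  nilpotent, \<open>V2\<close> its Fitting complement. \<open>dim V1\<close> is at least 2 and not
  3. If \<open>V2 = 0\<close>, \<open>A\<close> has dimension at most n. Otherwise
  \<open>dim V1 = 2\<close>, and \<open>A\<close> is replaced by a space \<open>A'\<close> of
  dimension at most n that contains \<open>G\<close>. Either way there is a forbidden half
  turn.\<close>

lemma real_spec_span:
  fixes G :: "(real^'n^'n) set"
  assumes G: "G \<in> Ab_hat" and n: "CARD('n) \<le> 4" and X: "X \<in> span G"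
  shows "real_spec X"
  unfolding real_spec_def
proof (intro allI impI, rule ccontr)
  fix a \<beta> u
  assume b: "\<beta> \<noteq> 0" and eq: "(X - a *\<^sub>R mat 1) *v ((X - a *\<^sub>R mat 1) *v u) + (\<beta> * \<beta>) *\<^sub>R u = 0"
    and u0: "u \<noteq> 0"
  define A where "A = span G"
  note comm = span_Ab_hat(1)[OF G, folded A_def] and mult = span_Ab_hat(2)[OF G, folded A_def]
    and one = span_Ab_hat(3)[OF G, folded A_def]
  have sA: "subspace A" and GA: "G \<subseteq> A" by (auto simp: A_def span_base)
  define x where "x = (1 / \<beta>) *\<^sub>R (X - a *\<^sub>R mat 1)"
  have xA: "x \<in> A" unfolding x_def using sA one X by (intro subspace_scale subspace_diff) (auto simp: A_def)
  have "x *v (x *v u) = (1 / (\<beta> * \<beta>)) *\<^sub>R ((X - a *\<^sub>R mat 1) *v ((X - a *\<^sub>R mat 1) *v u))"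
    by (simp only: x_def mv.scaleR_left mv.scaleR_right scaleR_scaleR) simp
  also have "(X - a *\<^sub>R mat 1) *v ((X - a *\<^sub>R mat 1) *v u) = - ((\<beta> * \<beta>) *\<^sub>R u)"
    unfolding eq_neg_iff_add_eq_0 by (rule eq)
  finally have xu: "x *v (x *v u) = - u" using b by simp
  define y where "y = x ** x + mat 1"
  have yv: "y *v v = x *v (x *v v) + v" for v by (simp add: y_def mv.add_left matrix_vector_mul_assoc)
  have yA: "y \<in> A" unfolding y_def by (intro subspace_add sA mult xA one)
  let ?n = "dim (UNIV :: (real^'n) set)"
  define N where "N = ((*v) y ^^ ?n)"
  define V1 where "V1 = {v \<in> UNIV. ((*v) y ^^ ?n) v = 0}"
  define V2 where "V2 = ((*v) y ^^ ?n) ` UNIV"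
  note F = fitting_decomposition[OF subspace_UNIV, of y, folded V1_def V2_def, OF UNIV_I]
  have V1I: "v \<in> V1 \<longleftrightarrow> N v = 0" for v by (simp add: V1_def N_def)
  have Nlin: "linear N" unfolding N_def by (rule linear_funpow_mv)
  have Nc: "N (c *v v) = c *v N v" if c: "c \<in> A" for c v
  proof -
    have "((*v) y ^^ j) (c *v v) = c *v (((*v) y ^^ j) v)" for j
      by (induction j) (simp_all add: matrix_vector_mul_assoc comm[OF yA c])
    then show ?thesis by (simp add: N_def)
  qed
  have V1c: "c *v v \<in> V1" if "c \<in> A" "v \<in> V1" for c v
    using that by (simp add: V1I Nc)
  have V2c: "c *v v \<in> V2" if c: "c \<in> A" and v: "v \<in> V2" for c v
    proof -
    obtain w where "v = N w" using v unfolding V2_def N_def by (elim imageE)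
    then have "c *v v = N (c *v w)" by (simp only: Nc[OF c])
    then show ?thesis by (simp add: V2_def N_def)
  qed
  have "y *v u = 0" by (simp add: yv xu)
  then have "((*v) y ^^ Suc k) u = 0" for k unfolding funpow_mv_Suc2
    by (induction k) simp_all
  moreover obtain k where "?n = Suc k" using not0_implies_Suc[of "?n"] by auto
  ultimately have uV: "u \<in> V1" by (simp add: V1_def)
  \<comment> \<open>A relation would make \<open>v\<close> a real eigenvector of \<open>x\<close>,
    and \<open>x^2 + 1\<close> would act on it by a positive number, although it is nilpotent on
    \<open>V1\<close>.\<close>
  have inj: "v = 0" if v: "v \<in> V1" "c *\<^sub>R v + s *\<^sub>R (x *v v) = 0" and cs: "c \<noteq> 0 \<or> s \<noteq> 0" for c s v
  proof (rule ccontr)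
    assume v0: "v \<noteq> 0"
    have s: "s \<noteq> 0" using v(2) v0 cs by auto
    define \<mu> where "\<mu> = - (c / s)"
    have "s *\<^sub>R (x *v v) = - (c *\<^sub>R v)" using v(2) by (simp add: eq_neg_iff_add_eq_0 add.commute)
    then have "(1 / s) *\<^sub>R (s *\<^sub>R (x *v v)) = (1 / s) *\<^sub>R (- (c *\<^sub>R v))" by simp
    then have xv: "x *v v = \<mu> *\<^sub>R v" using s by (simp add: \<mu>_def)
    have "y *v v = (\<mu> * \<mu> + 1) *\<^sub>R v" by (simp add: yv xv mv.scaleR_right scaleR_add_left)
    moreover have "((*v) y ^^ ?n) v = 0" using v(1) by (simp add: V1_def)
    ultimately have "\<mu> * \<mu> + 1 = 0" using nil_eigenvalue_zero v0 by blast
    then show False using zero_le_square[of \<mu>] by linarith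
  qed
  have cs: "cos \<theta> \<noteq> 0 \<or> sin \<theta> \<noteq> (0::real)" for \<theta>
    using sin_cos_squared_add[of \<theta>] by fastforce
  have d2: "2 \<le> dim V1" by (rule complex_line_dim[OF xu u0 uV V1c[OF xA uV]])
  have d3: "dim V1 \<noteq> 3"
    by (rule complex_plane_codim_one[of _ x ?n, OF F(1) V1c[OF xA] _ xu u0 uV])
      (simp_all add: V1_def y_def)
  have dd: "dim V1 + dim V2 = CARD('n)" using F(5) by simp
  show False
  proof (cases "dim V2 = 0")
    case True
    then have n4: "CARD('n) \<le> 2 \<or> CARD('n) = 4" using n d2 d3 dd by linarith
    have "dim V1 = CARD('n)" using True dd by linarith
    then have V1: "V1 = UNIV" by (intro subspace_dim_equal F(1)) (auto simp only: subset_UNIV subspace_UNIV dim_UNIV DIM_cart DIM_real)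
    have "dim A \<le> CARD('n)"
    proof (rule complex_algebra_dim_le[OF sA one mult comm xA _ xu u0 n4])
      fix v show "\<exists>k. ((*v) (x ** x + mat 1) ^^ k) v = 0"
        using V1 by (auto simp: V1_def y_def)
    qed
    then have "mat 1 = (0 :: real^'n^'n)"
    proof (rule no_rotation_in_Ab_hat[OF G sA GA, of "mat 1" x])
      fix \<theta> :: real
      show "det (mat 1 - mat 1 + cos \<theta> *\<^sub>R mat 1 + sin \<theta> *\<^sub>R x) \<noteq> 0"
      proof (rule inj_imp_det_nonzero)
        fix v assume "(mat 1 - mat 1 + cos \<theta> *\<^sub>R mat 1 + sin \<theta> *\<^sub>R x) *v v = 0"
        then have "cos \<theta> *\<^sub>R v + sin \<theta> *\<^sub>R (x *v v) = 0" by (simp add: mv.add_left mv.scaleR_left)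
        then show "v = 0" using inj[OF _ _ cs] V1 by blast
      qed
    qed (use one xA sA in \<open>auto simp: subspace_0\<close>)
    then have "mat 1 *v u = 0" by simp
    then show False using u0 by simp
  next
    case False
    have dV1: "dim V1 = 2" using False n d2 d3 dd by linarith
    have dV2: "1 \<le> dim V2" "dim V2 \<le> 2" "dim V2 + 2 = CARD('n)" using False n dV1 dd by linarith+
    let ?W = "span {u, x *v u}"
    have "2 \<le> dim ?W" by (rule complex_line_dim[OF xu u0]) (auto intro: span_base)
    then have W: "?W = V1" using dV1 uV V1c[OF xA uV] F(1)
      by (intro subspace_dim_equal span_minimal) auto
    obtain e :: "real^'n^'n" where e: "\<And>v. v \<in> V1 \<Longrightarrow> e *v v = v" "\<And>v. v \<in> V2 \<Longrightarrow> e *v v = 0"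
      using projection_exists[OF F(1-3)] by blast
    have split: "\<exists>p q. p \<in> V1 \<and> q \<in> V2 \<and> v = p + q" for v
    proof -
      have "v \<in> {a + b |a b. a \<in> V1 \<and> b \<in> V2}" unfolding F(4)[symmetric] by simp
      then show ?thesis by blast
    qed
    have eV1: "e *v v \<in> V1" for v using split[of v] F(1) by (auto simp: mv.add_right e)
    have fV2: "(mat 1 - e) *v v \<in> V2" for v
      using split[of v] by (auto simp: mv.add_right mv.diff_left e)
    have ee: "e ** e = e" using e(1)[OF eV1] by (simp add: matrix_eq matrix_vector_mul_assoc[symmetric])
    \<comment> \<open>\<open>A1\<close> acts as the complex numbers on \<open>V1\<close> and as 0 on
      \<open>V2\<close>; \<open>A2\<close> consists of the restrictions of \<open>A\<close> to
      \<open>V2\<close>. Their sum contains the projection \<open>e\<close> by construction, and its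
      dimension is at most \<open>2 + dim V2 = n\<close>.\<close>
    define A1 where "A1 = span {e, x ** e}"
    define A2 where "A2 = (\<lambda>a. a ** (mat 1 - e)) ` A"
    define A' where "A' = {p + q |p q. p \<in> A1 \<and> q \<in> A2}"
    have sA1: "subspace A1" by (simp add: A1_def)
    have sA2: "subspace A2" unfolding A2_def
      by (rule linear_subspace_image[OF bounded_linear.linear[OF mm.bounded_linear_left] sA])
    have sA': "subspace A'" unfolding A'_def by (rule subspace_sums[OF sA1 sA2])
    have "dim A1 \<le> card {e, x ** e}" unfolding A1_def dim_span by (rule dim_le_card') simp
    also have "\<dots> \<le> 2" by (simp add: card_insert_if)
    finally have "dim A1 \<le> 2" .
    moreover have "dim A2 \<le> dim V2" unfolding A2_def
      by (rule commuting_restriction_dim_le[OF sA comm F(2) V2c dV2(1,2) fV2])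
    moreover have "dim A' + dim (A1 \<inter> A2) = dim A1 + dim A2"
      unfolding A'_def by (rule dim_sums_Int[OF sA1 sA2])
    ultimately have dA': "dim A' \<le> CARD('n)" using dV2(3) by linarith
    have 0: "0 \<in> A1" "0 \<in> A2" using sA1 sA2 by (simp_all add: subspace_0)
    have A1': "p \<in> A'" if "p \<in> A1" for p unfolding A'_def using that 0(2) by force
    have A2': "p \<in> A'" if "p \<in> A2" for p unfolding A'_def using that 0(1) by force
    have GA': "G \<subseteq> A'"
    proof
      fix g assume g: "g \<in> G"
      then have gA: "g \<in> A" using GA by blast
      have "g *v u \<in> ?W" unfolding W by (rule V1c[OF gA uV])
      then obtain \<beta> where "g *v u - \<beta> *\<^sub>R u \<in> span {x *v u}" by (auto simp: span_insert)
      then obtain \<alpha> where "g *v u - \<beta> *\<^sub>R u = \<alpha> *\<^sub>R (x *v u)" by (auto simp: span_singleton)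
      then have gu: "g *v u = \<beta> *\<^sub>R u + \<alpha> *\<^sub>R (x *v u)" by (simp add: algebra_simps)
      have gx: "g *v (x *v v) = x *v (g *v v)" for v using comm[OF gA xA] by (simp add: matrix_vector_mul_assoc)
      have "?W \<subseteq> {v. g *v v = \<beta> *\<^sub>R v + \<alpha> *\<^sub>R (x *v v)}"
      proof (rule span_minimal)
        show "subspace {v. g *v v = \<beta> *\<^sub>R v + \<alpha> *\<^sub>R (x *v v)}"
          by (auto simp: subspace_def mv.add_right mv.scaleR_right scaleR_add_right mult.commute)
        show "{u, x *v u} \<subseteq> {v. g *v v = \<beta> *\<^sub>R v + \<alpha> *\<^sub>R (x *v v)}"
          by (simp add: gx gu mv.add_right mv.scaleR_right)
      qed
      then have "g *v (e *v v) = \<beta> *\<^sub>R (e *v v) + \<alpha> *\<^sub>R (x *v (e *v v))" for v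
        using eV1 W by blast
      then have "g ** e = \<beta> *\<^sub>R e + \<alpha> *\<^sub>R (x ** e)"
        by (simp add: matrix_eq mv.add_left mv.scaleR_left matrix_vector_mul_assoc[symmetric])
      then have "g ** e \<in> A1" unfolding A1_def by (auto intro!: span_add span_scale intro: span_base)
      moreover have "g ** (mat 1 - e) \<in> A2" unfolding A2_def using gA by blast
      moreover have "g = g ** e + g ** (mat 1 - e)" by (simp add: mm.diff_right)
      ultimately show "g \<in> A'" unfolding A'_def by blast
    qed
    have "e = 0"
    proof (rule no_rotation_in_Ab_hat[OF G sA' GA' dA', of e "x ** e"])
      have "mat 1 ** (mat 1 - e) \<in> A2" unfolding A2_def using one by blast
      then show "mat 1 - e \<in> A'" using A2' by simp
      show "e \<in> A'" "x ** e \<in> A'" by (auto intro!: A1' simp: A1_def intro: span_base)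
      show "e ** e = e" by (rule ee)
      fix \<theta> :: real
      show "det (mat 1 - e + cos \<theta> *\<^sub>R e + sin \<theta> *\<^sub>R (x ** e)) \<noteq> 0"
      proof (rule inj_imp_det_nonzero)
        fix v assume v0: "(mat 1 - e + cos \<theta> *\<^sub>R e + sin \<theta> *\<^sub>R (x ** e)) *v v = 0"
        obtain p q where pq: "p \<in> V1" "q \<in> V2" "v = p + q" using split[of v] by blast
        have ev: "e *v v = p" using pq by (simp add: mv.add_right e)
        let ?r = "cos \<theta> *\<^sub>R p + sin \<theta> *\<^sub>R (x *v p)"
        have "q + ?r = 0"
          using v0 by (simp add: mv.add_left mv.diff_left mv.scaleR_left matrix_vector_mul_assoc[symmetric] ev)
            (simp add: pq(3) add.assoc)
        then have q: "q = - ?r" by (simp only: eq_neg_iff_add_eq_0)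
        have "?r \<in> V1" by (intro subspace_add subspace_scale F(1) pq(1) V1c[OF xA pq(1)])
        then have "q \<in> V1" unfolding q by (intro subspace_neg F(1))
        then have "q \<in> V1 \<inter> V2" using pq(2) by blast
        then have q0: "q = 0" unfolding F(3) by simp
        then have "?r = 0" using \<open>q + ?r = 0\<close> by simp
        then have "p = 0" by (rule inj[OF pq(1) _ cs])
        then show "v = 0" using q0 pq(3) by simp
      qed
    qed
    then show False using e(1)[OF uV] u0 by simp
  qed
qed

lemma det_zero_matrix: "det (0 :: real^'n^'n) = 0"
  using det_scaleR[of 0 "mat 1 :: real^'n^'n"] by simp

section \<open>Matrices of size at most four\<close>

lemma additive_continuous_linear:
  fixes f :: "'a::euclidean_space \<Rightarrow> 'b::euclidean_space"
  assumes add: "\<And>x y. f (x + y) = f x + f y" and cont: "continuous_on UNIV f"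
  shows "linear f"
proof (rule linearI)
  fix c :: real and x :: 'a
  interpret f: additive f by (unfold_locales) (rule add)
  define h where "h c = f (c *\<^sub>R x) - c *\<^sub>R f x" for c :: real
  have ch: "continuous_on (closure \<rat>) h"
    unfolding h_def[abs_def] by (intro continuous_intros continuous_on_compose2[OF cont]) auto
  have nat: "f (of_nat n *\<^sub>R y) = of_nat n *\<^sub>R f y" for n y
  proof (induction n)
    case (Suc n)
    have "of_nat (Suc n) *\<^sub>R y = y + of_nat n *\<^sub>R y" by (simp add: scaleR_add_left)
    then show ?case using Suc by (simp add: add[of y] scaleR_add_left)
  qed (simp add: f.zero)
  have int: "f (of_int i *\<^sub>R y) = of_int i *\<^sub>R f y" for i y
  proof (cases i rule: int_cases2)
    case (nonneg n)
    then show ?thesis by (simp only: of_int_of_nat_eq nat)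
  next
    case (nonpos n)
    have "of_int i = - (of_nat n :: real)" by (simp only: nonpos of_int_minus of_int_of_nat_eq)
    then show ?thesis by (simp only: scaleR_minus_left f.minus nat)
  qed
  have rat: "h q = 0" if hq: "q \<in> \<rat>" for q
  proof -
    obtain a b :: int where b: "b \<noteq> 0" and q: "q = of_int a / of_int b"
      by (rule Rats_cases'[OF hq]) (rule that, simp_all)
    have "of_int b *\<^sub>R f (q *\<^sub>R x) = f (of_int b *\<^sub>R (q *\<^sub>R x))" by (rule int[symmetric])
    also have "of_int b *\<^sub>R (q *\<^sub>R x) = of_int a *\<^sub>R x" using b by (simp add: q)
    also have "f \<dots> = of_int b *\<^sub>R (q *\<^sub>R f x)" using b by (simp add: q int)
    finally have "f (q *\<^sub>R x) = q *\<^sub>R f x" using b by (simp only: scaleR_cancel_left of_int_eq_0_iff) simp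
    then show ?thesis by (simp add: h_def)
  qed
  have "h c = 0"
    by (rule continuous_constant_on_closure[OF ch rat]) (auto simp: Rats_closure_real)
  then show "f (c *\<^sub>R x) = c *\<^sub>R f x" by (simp add: h_def)
qed (rule add)

text \<open>The functional \<open>a \<mapsto> c\<close> for \<open>a = c 1 + b\<close>, \<open>b \<in> N\<close>, is multiplicative, so
  \<open>a \<mapsto> b / c\<close> is an additive, hence linear, map on \<open>G \<cong> \<real>\<^sup>n\<^sup>-\<^sup>1\<close>.\<close>

lemma square_zero_dim_less:
  fixes G :: "(real^'n^'n) set"
  assumes G: "G \<in> Ab_hat"
    and N: "subspace N" "N \<subseteq> span G" "mat 1 \<notin> N" "\<And>X Y. X \<in> N \<Longrightarrow> Y \<in> N \<Longrightarrow> X ** Y = 0"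
    and AN: "\<And>X. X \<in> G \<Longrightarrow> \<exists>c. X - c *\<^sub>R mat 1 \<in> N"
  shows "dim N < CARD('n)"
proof -
  note GP = Ab_hat_props[OF G]
  obtain w where w: "w \<bullet> mat 1 = 1" "\<And>X. X \<in> N \<Longrightarrow> w \<bullet> X = 0"
    using dual_vector[OF N(1,3)] by blast
  have B: "X - (w \<bullet> X) *\<^sub>R mat 1 \<in> N" if X: "X \<in> G" for X
  proof -
    obtain c where c: "X - c *\<^sub>R mat 1 \<in> N" using AN[OF X] by blast
    have "w \<bullet> (X - c *\<^sub>R mat 1) = 0" by (rule w(2)[OF c])
    then have "w \<bullet> X = c" by (simp add: inner_diff_right w(1))
    then show ?thesis using c by simp
  qed
  \<comment> \<open>Otherwise \<open>X\<close> would lie in \<open>N\<close> and have square 0, but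
    elements of \<open>G\<close> have determinant 1.\<close>
  have nz: "w \<bullet> X \<noteq> 0" if X: "X \<in> G" for X
  proof
    assume "w \<bullet> X = 0"
    then have "X - (w \<bullet> X) *\<^sub>R mat 1 = X" by (simp only: scaleR_zero_left diff_zero)
    then have "X \<in> N" by (rule subst[where P = "\<lambda>Y. Y \<in> N", OF _ B[OF X]])
    from N(4)[OF this this] have "X ** X = 0" .
    then show False using GP(2)[OF GP(3)[OF X X]] by (simp add: det_zero_matrix)
  qed
  \<comment> \<open>As products in \<open>N\<close> vanish,
    \<open>(1 + \<psi> X) (1 + \<psi> Y) = 1 + \<psi> X + \<psi> Y\<close>.\<close>
  define \<psi> where "\<psi> X = (1 / (w \<bullet> X)) *\<^sub>R (X - (w \<bullet> X) *\<^sub>R mat 1)" for X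
  have \<psi>N: "\<psi> X \<in> N" if "X \<in> G" for X unfolding \<psi>_def by (rule subspace_scale[OF N(1) B[OF that]])
  have dec: "X = (w \<bullet> X) *\<^sub>R (mat 1 + \<psi> X)" if "X \<in> G" for X
    using nz[OF that] by (simp add: \<psi>_def scaleR_add_right)
  have \<psi>mult: "\<psi> (X ** Y) = \<psi> X + \<psi> Y" if XY: "X \<in> G" "Y \<in> G" for X Y
  proof -
    have "X ** Y = ((w \<bullet> X) *\<^sub>R (mat 1 + \<psi> X)) ** ((w \<bullet> Y) *\<^sub>R (mat 1 + \<psi> Y))"
      by (rule arg_cong2[OF dec[OF XY(1)] dec[OF XY(2)]])
    also have "\<dots> = ((w \<bullet> X) * (w \<bullet> Y)) *\<^sub>R (mat 1 + (\<psi> X + \<psi> Y))"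
      by (simp add: mm.scaleR_left mm.scaleR_right mm.add_left mm.add_right N(4)[OF \<psi>N \<psi>N] XY scaleR_add_right add_ac mult.commute)
    finally have 1: "X ** Y = ((w \<bullet> X) * (w \<bullet> Y)) *\<^sub>R (mat 1 + (\<psi> X + \<psi> Y))" .
    have "w \<bullet> (\<psi> X + \<psi> Y) = 0" by (rule w(2)[OF subspace_add[OF N(1) \<psi>N[OF XY(1)] \<psi>N[OF XY(2)]]])
    then have 2: "w \<bullet> (X ** Y) = (w \<bullet> X) * (w \<bullet> Y)" by (simp add: 1 inner_add_right w(1))
    show ?thesis unfolding \<psi>_def[of "X ** Y"] 2 unfolding 1
      using nz[OF XY(1)] nz[OF XY(2)] by (simp add: scaleR_add_right)
  qed
  obtain T :: "(real^'n) set" and g k where T: "T = {x. x $ k = 0}" "subspace T" "dim T = CARD('n) - 1"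
    "continuous_on T g" "inj_on g T" "g ` T = G"
    "\<And>x y. x \<in> T \<Longrightarrow> y \<in> T \<Longrightarrow> g (x + y) = g x ** g y" "g 0 = mat 1"
    by (rule Ab_hat_parametrization[OF G]) (rule that)
  define \<pi> where "\<pi> x = x - x $ k *\<^sub>R axis k 1" for x :: "real^'n"
  have \<pi>T: "\<pi> x \<in> T" for x by (simp add: \<pi>_def T(1))
  have \<pi>id: "\<pi> x = x" if "x \<in> T" for x using that by (simp add: \<pi>_def T(1))
  have \<pi>add: "\<pi> (x + y) = \<pi> x + \<pi> y" for x y by (simp add: \<pi>_def scaleR_add_left)
  have c\<pi>: "continuous_on UNIV \<pi>" unfolding \<pi>_def[abs_def] by (intro continuous_intros)
  have gG: "g (\<pi> x) \<in> G" for x using \<pi>T T(6) by blast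
  have cg: "continuous_on UNIV (\<lambda>x. g (\<pi> x))"
    by (rule continuous_on_compose2[OF T(4) c\<pi>]) (use \<pi>T in auto)
  have lin: "linear (\<lambda>x. \<psi> (g (\<pi> x)))"
  proof (rule additive_continuous_linear)
    show "\<psi> (g (\<pi> (x + y))) = \<psi> (g (\<pi> x)) + \<psi> (g (\<pi> y))" for x y
      by (simp add: \<pi>add T(7) \<pi>T \<psi>mult gG)
    show "continuous_on UNIV (\<lambda>x. \<psi> (g (\<pi> x)))" unfolding \<psi>_def
      by (intro continuous_intros cg) (use nz[OF gG] in auto)
  qed
  let ?R = "(\<lambda>x. \<psi> (g (\<pi> x))) ` T"
  have GR: "G \<subseteq> span (insert (mat 1) ?R)"
  proof
    fix X assume X: "X \<in> G"
    then obtain x where x: "x \<in> T" "X = g x" using T(6) by blast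
    then have "\<psi> X \<in> ?R" using \<pi>id by force
    then have "(w \<bullet> X) *\<^sub>R (mat 1 + \<psi> X) \<in> span (insert (mat 1) ?R)"
      by (intro span_scale span_add span_base) auto
    then show "X \<in> span (insert (mat 1) ?R)" using dec[OF X] by simp
  qed
  \<comment> \<open>\<open>mat 1\<close> and \<open>N\<close> lie in the span of \<open>G\<close>,
    which is contained in the span of \<open>mat 1\<close> and a linear image of the (n -
    1)-dimensional \<open>T\<close>.\<close>
  have "dim N + 1 = dim (insert (mat 1) N)" using dim_insert[of "mat 1" N] N(1,3) by (simp add: span_eq_iff[THEN iffD2])
  also have "insert (mat 1) N \<subseteq> span G" using N(2) span_Ab_hat(3)[OF G] by simp
  then have "dim (insert (mat 1) N) \<le> dim (span G)" by (rule dim_subset)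
  also have "\<dots> \<le> dim (insert (mat 1) ?R)" using dim_subset[OF GR] by simp
  also have "\<dots> \<le> dim ?R + 1" by (simp add: dim_insert)
  also have "dim ?R \<le> CARD('n) - 1" using dim_image_le[OF lin, of T] T(3) by simp
  finally have "dim N + 1 \<le> CARD('n) - 1 + 1" by simp
  then show ?thesis by (simp add: Suc_le_eq)
qed

text \<open>Only the unsplit case in dimension four uses the group. There a basis \<open>B\<close>
  of the span of the nilpotent parts is chosen; if all its products vanish,
  \<open>square_zero_dim_less\<close> leaves it at most three elements, as
  \<open>nil_on_approx\<close> demands.\<close>

lemma span_Ab_hat_approx:
  fixes G :: "(real^'n^'n) set"
  assumes G: "G \<in> Ab_hat" and n: "CARD('n) \<le> 4" and S: "finite S" "span S = span G"
  shows "approx_on UNIV S"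
proof -
  define A where "A = span G"
  note comm = span_Ab_hat(1)[OF G, folded A_def] and one = span_Ab_hat(3)[OF G, folded A_def]
  have SA: "S \<subseteq> A" unfolding A_def S(2)[symmetric] by (rule span_superset)
  show ?thesis
  proof (rule real_commuting_approx[OF subspace_UNIV S(1)])
    show "b *v (c *v u) = c *v (b *v u)" if "b \<in> S" "c \<in> S" for b c u
    proof -
      have "b ** c = c ** b" by (rule comm[OF subsetD[OF SA that(1)] subsetD[OF SA that(2)]])
      then show ?thesis by (simp add: matrix_vector_mul_assoc)
    qed
    show "real_on UNIV b" if "b \<in> S" for b
      by (rule real_on_if_real_spec[OF real_spec_span[OF G n subsetD[OF SA that, unfolded A_def]]])
    have loc: "approx_on UNIV ((\<lambda>b. b - l b *\<^sub>R mat 1) ` S)" (is "approx_on _ ?S'")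
      if n4: "CARD('n) = 4" and nil: "nil_on UNIV ((\<lambda>b. b - l b *\<^sub>R mat 1) ` S)" for l
    proof -
      obtain B where B: "B \<subseteq> ?S'" "independent B" "?S' \<subseteq> span B"
        by (rule maximal_independent_subset) (rule that)
      have finB: "finite B" by (rule finite_subset[OF B(1)]) (simp add: S(1))
      have S'A: "?S' \<subseteq> A"
        using subsetD[OF SA] one unfolding A_def by (intro image_subsetI span_diff span_scale)
      have BA: "B \<subseteq> A" using B(1) S'A by blast
      have NA: "span B \<subseteq> A" using BA unfolding A_def by (simp add: span_minimal)
      have nB: "nil_on UNIV B" unfolding nil_on_def
        using nil_onD[OF nil] subsetD[OF B(1)] finB by (intro conjI ballI) simp_all
      have "(\<exists>x\<in>B. \<exists>y\<in>B. \<exists>u\<in>UNIV. x *v (y *v u) \<noteq> 0) \<or> card B \<le> 3"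
      proof (cases "\<exists>x\<in>B. \<exists>y\<in>B. \<exists>u\<in>UNIV. x *v (y *v u) \<noteq> 0")
        case False
        have 0: "X ** Y = 0" if "X \<in> B" "Y \<in> B" for X Y
          using False that by (simp add: matrix_eq matrix_vector_mul_assoc[symmetric])
        have 1: "X ** Y = 0" if "X \<in> B" "Y \<in> span B" for X Y
        proof -
          have "span B \<subseteq> {Y. X ** Y = 0}"
            by (rule span_minimal) (use 0 that(1) in \<open>auto simp: subspace_def mm.add_right mm.scaleR_right\<close>)
          then show ?thesis using that(2) by blast
        qed
        have 2: "X ** Y = 0" if "X \<in> span B" "Y \<in> span B" for X Y
        proof -
          have "span B \<subseteq> {X. X ** Y = 0}"
            by (rule span_minimal) (use 1 that(2) in \<open>auto simp: subspace_def mm.add_left mm.scaleR_left\<close>)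
          then show ?thesis using that(1) by blast
        qed
        have "dim (span B) < CARD('n)"
        proof (rule square_zero_dim_less[OF G subspace_span NA[unfolded A_def] _ 2])
          show "mat 1 \<notin> span B"
          proof
            assume "mat 1 \<in> span B"
            from 2[OF this this] have "(mat 1 :: real^'n^'n) = 0" by simp
            then have "det (mat 1 :: real^'n^'n) = 0" by (simp only: det_zero_matrix)
            then show False by simp
          qed
          fix X assume "X \<in> G"
          then have "X \<in> span S" unfolding S(2) by (rule span_base)
          moreover have "S \<subseteq> span (insert (mat 1) B)"
          proof
            fix s assume s: "s \<in> S"
            then have "s - l s *\<^sub>R mat 1 \<in> span B" using B(3) by blast
            then show "s \<in> span (insert (mat 1) B)" unfolding span_insert by blast
          qed
          then have "span S \<subseteq> span (insert (mat 1) B)" by (simp add: span_minimal)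
          ultimately have "X \<in> span (insert (mat 1) B)" by blast
          then show "\<exists>c. X - c *\<^sub>R mat 1 \<in> span B" unfolding span_insert by blast
        qed
        then show ?thesis using dim_eq_card_independent[OF B(2)] n4 by simp
      qed simp
      then have 1: "approx_on UNIV B" using n4 nB by (intro nil_on_approx) auto
      have 2: "?S' \<subseteq> span (insert (mat 1) B)" using B(3) span_mono[of B "insert (mat 1) B"] by blast
      show ?thesis by (rule approx_on_span[OF 1 finB _ 2]) (simp add: S(1))
    qed
    show "b *v u \<in> UNIV" for b :: "real^'n^'n" and u by (rule UNIV_I)
    show "dim (UNIV :: (real^'n) set) \<le> 3 \<or> (dim (UNIV :: (real^'n) set) = 4 \<and>
      (\<forall>l. nil_on UNIV ((\<lambda>b. b - l b *\<^sub>R mat 1) ` S) \<longrightarrow> approx_on UNIV ((\<lambda>b. b - l b *\<^sub>R mat 1) ` S)))"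
    proof (cases "CARD('n) = 4")
      case True
      show ?thesis by (intro disjI2 conjI allI impI loc[OF True]) (simp_all add: True)
    next
      case False
      then have "dim (UNIV :: (real^'n) set) \<le> 3" using n by simp
      then show ?thesis by (rule disjI1)
    qed
  qed
qed

section \<open>Realization as a conjugacy limit\<close>

lemma closed_subgroup_conjugate_pos_diag:
  assumes P: "det (P :: real^'n^'n) = 1"
  shows "closed_subgroup_SL (conjugate P pos_diag)"
proof -
  have Pn: "det P \<noteq> 0" using P by simp
  have A: "comm_alg (range (cdiag P))"
    unfolding comm_alg_def
  proof (intro conjI ballI)
    show "mat 1 \<in> range (cdiag P)" using cdiag_one[OF Pn] by (intro range_eqI[of _ _ 1]) simp
    fix X assume X: "X \<in> range (cdiag P)"
    \<comment> \<open>A constant sequence turns the statement about limits into one about the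
      algebra itself.\<close>
    show "real_spec X" by (rule real_spec_limit_cdiag[of "\<lambda>_. P" "\<lambda>_. X"]) (use P X in auto)
    fix Y assume "Y \<in> range (cdiag P)"
    with X obtain v w where "X = cdiag P v" "Y = cdiag P w" by blast
    then show "X ** Y \<in> range (cdiag P)" "X ** Y = Y ** X"
      by (simp_all add: cdiag_mult[OF Pn] mult.commute)
  qed (rule subspace_range_cdiag)
  define T where "T = cdiag P ` {v. (\<Sum>i\<in>UNIV. v $ i) = 0}"
  have "subspace {v :: real^'n. (\<Sum>i\<in>UNIV. v $ i) = 0}"
    by (auto simp: subspace_def sum.distrib sum_distrib_left[symmetric])
  then have T: "subspace T" unfolding T_def by (rule linear_subspace_image[OF linear_cdiag])
  have eq: "mexp ` T = conjugate P pos_diag"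
  proof
    show "mexp ` T \<subseteq> conjugate P pos_diag"
      unfolding T_def conjugate_pos_diag[OF P] image_image mexp_cdiag[OF Pn]
      by (auto simp: exp_sum[symmetric] intro!: imageI)
    show "conjugate P pos_diag \<subseteq> mexp ` T" unfolding conjugate_pos_diag[OF P]
    proof (rule image_subsetI)
      fix v :: "real^'n" assume "v \<in> {v. (\<forall>i. v $ i > 0) \<and> (\<Prod>i\<in>UNIV. v $ i) = 1}"
      then have v: "\<And>i. v $ i > 0" "(\<Prod>i\<in>UNIV. v $ i) = 1" by auto
      have e: "v = (\<chi> i. exp ((\<chi> i. ln (v $ i)) $ i))" using v(1) by (simp add: vec_eq_iff)
      have "(\<Sum>i\<in>UNIV. ln (v $ i)) = ln (\<Prod>i\<in>UNIV. v $ i)" using v(1) by (simp add: ln_prod less_imp_neq[symmetric])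
      then have "cdiag P (\<chi> i. ln (v $ i)) \<in> T" unfolding T_def using v(2) by (intro imageI) simp
      moreover have "cdiag P v = mexp (cdiag P (\<chi> i. ln (v $ i)))"
        unfolding mexp_cdiag[OF Pn] by (rule arg_cong[OF e])
      ultimately show "cdiag P v \<in> mexp ` T" by blast
    qed
  qed
  have SL: "conjugate P pos_diag \<subseteq> carrier SL"
    unfolding conjugate_pos_diag[OF P] by (auto simp: SL_def det_cdiag[OF Pn])
  show ?thesis unfolding eq[symmetric]
    by (rule mexp_closed_subgroup(1)[OF A T]) (use SL eq in \<open>auto simp: T_def\<close>)
qed

text \<open>Squaring makes the eigenvalues positive, and the factor restores determinant 1.\<close>

lemma scaled_square_in_conjugate:
  assumes P: "det (P :: real^'n^'n) = 1" and Y: "Y \<in> range (cdiag P)" "det Y \<noteq> 0"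
  shows "(1 / root CARD('n) ((det Y)\<^sup>2)) *\<^sub>R (Y ** Y) \<in> conjugate P pos_diag"
proof -
  have Pn: "det P \<noteq> 0" using P by simp
  obtain v where v: "Y = cdiag P v" using Y(1) by blast
  have dv: "det Y = (\<Prod>i\<in>UNIV. v $ i)" by (simp add: v det_cdiag[OF Pn])
  then have vn: "v $ i \<noteq> 0" for i using Y(2) by (metis UNIV_I finite prod_zero_iff)
  define c where "c = 1 / root CARD('n) ((det Y)\<^sup>2)"
  have c: "c > 0" using Y(2) by (simp add: c_def)
  have cn: "c ^ CARD('n) = 1 / (det Y)\<^sup>2" by (simp add: c_def power_divide)
  have "c *\<^sub>R (Y ** Y) = cdiag P (c *\<^sub>R (v * v))" by (simp add: v cdiag_mult[OF Pn] linear_scale[OF linear_cdiag])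
  moreover have "(\<Prod>i\<in>UNIV. (c *\<^sub>R (v * v)) $ i) = c ^ CARD('n) * (det Y)\<^sup>2"
    by (simp add: prod.distrib dv power2_eq_square)
  then have "(\<Prod>i\<in>UNIV. (c *\<^sub>R (v * v)) $ i) = 1" using Y(2) by (simp add: cn)
  moreover have "(c *\<^sub>R (v * v)) $ i > 0" for i
    using c vn[of i] by (simp add: mult_pos_pos zero_less_mult_iff) (metis linorder_neqE_linordered_idom)
  ultimately show ?thesis unfolding conjugate_pos_diag[OF P] c_def[symmetric] by blast
qed

text \<open>An element of \<open>G\<close> is the square of some \<open>k\<close> in
  \<open>G\<close>, and approximants of \<open>k\<close> are squared to reach the positive matrices.
  Conversely a limit stays in \<open>A\<close> for reasons of dimension, and in \<open>G\<close>
  because a segment of invertible matrices joins it to the identity.\<close>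

lemma Ab_hat_conjugacy_limit:
  fixes G :: "(real^'n^'n) set"
  assumes G: "G \<in> Ab_hat" and n: "CARD('n) \<le> 4"
  shows "conjugacy_limit pos_diag G"
proof -
  note GP = Ab_hat_props[OF G]
  define A where "A = span G"
  have sA: "subspace A" and GA: "G \<subseteq> A" by (auto simp: A_def span_base)
  have oneA: "mat 1 \<in> A" using GA GP(1) by blast
  obtain B where B: "B \<subseteq> A" "independent B" "A \<subseteq> span B" "card B = dim A" using basis_exists[of A] by metis
  have sB: "span B = A" using B(1,3) sA by (metis span_subspace)
  have finB: "finite B" using B(2) by (rule independent_imp_finite)
  have ap: "approx_on UNIV B" by (rule span_Ab_hat_approx[OF G n finB]) (simp add: sB A_def)
  have "\<exists>P. det P = 1 \<and> (\<forall>b\<in>B. \<exists>v. norm (cdiag P v - b) \<le> 1 / real (Suc r))" for r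
    by (rule approx_on_UNIV_cdiag[OF ap]) simp
  then obtain P where P: "\<And>r. det (P r) = 1"
    and ex: "\<And>r b. b \<in> B \<Longrightarrow> \<exists>v. norm (cdiag (P r) v - b) \<le> 1 / real (Suc r)" by metis
  define v where "v r b = (SOME v. norm (cdiag (P r) v - b) \<le> 1 / real (Suc r))" for r b
  have v: "norm (cdiag (P r) (v r b) - b) \<le> 1 / real (Suc r)" if "b \<in> B" for r b
    unfolding v_def by (rule someI_ex[OF ex[OF that]])
  define d where "d r b = cdiag (P r) (v r b)" for r b
  have Pn: "det (P r) \<noteq> 0" for r using P by simp
  have dD: "d r b \<in> range (cdiag (P r))" for r b by (simp add: d_def)
  have dlim: "(\<lambda>r. d r b) \<longlonglongrightarrow> b" if b: "b \<in> B" for b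
  proof (rule LIM_zero_cancel, rule Lim_null_comparison)
    show "\<forall>\<^sub>F r in sequentially. norm (d r b - b) \<le> inverse (real (Suc r))"
      using v[OF b] by (simp add: d_def inverse_eq_divide)
  qed (rule LIMSEQ_inverse_real_of_nat)
  have approx: "\<exists>y. (\<forall>r. y r \<in> range (cdiag (P r))) \<and> y \<longlonglongrightarrow> a" if "a \<in> A" for a
  proof -
    have "a \<in> range (\<lambda>c. \<Sum>b\<in>B. c b *\<^sub>R b)" using that span_finite[OF finB] sB by auto
    then obtain c where c: "a = (\<Sum>b\<in>B. c b *\<^sub>R b)" by blast
    have "(\<lambda>r. \<Sum>b\<in>B. c b *\<^sub>R d r b) \<longlonglongrightarrow> a" unfolding c by (intro tendsto_intros dlim)
    moreover have "(\<Sum>b\<in>B. c b *\<^sub>R d r b) \<in> range (cdiag (P r))" for r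
      by (intro subspace_sum subspace_scale subspace_range_cdiag dD)
    ultimately show ?thesis by (intro exI[of _ "\<lambda>r. \<Sum>b\<in>B. c b *\<^sub>R d r b"] conjI allI)
  qed
  \<comment> \<open>Independent limits of sequences from the diagonalizable algebras number at most
    n. For \<open>B\<close> this bounds \<open>dim A\<close>; for \<open>B\<close> with one further
    limit it shows that no limit lies outside \<open>A\<close>.\<close>
  have le: "card C \<le> CARD('n)"
    if C: "independent C" and y: "\<And>b. b \<in> C \<Longrightarrow> (\<lambda>k. y k b) \<longlonglongrightarrow> b" "\<And>k b. b \<in> C \<Longrightarrow> y k b \<in> range (cdiag (P (s k)))"
    for C :: "(real^'n^'n) set" and y s
  proof -
    obtain \<delta> where \<delta>: "\<delta> > 0" "\<And>y T. subspace T \<Longrightarrow> (\<And>b. b \<in> C \<Longrightarrow> y b \<in> T) \<Longrightarrow> (\<And>b. b \<in> C \<Longrightarrow> norm (y b - b) \<le> \<delta>) \<Longrightarrow> card C \<le> dim T"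
      using dim_ge_card_near_independent[OF C] by blast
    have "\<forall>\<^sub>F k in sequentially. \<forall>b\<in>C. dist (y k b) b < \<delta>"
      using independent_imp_finite[OF C] tendstoD[OF y(1) \<delta>(1)] by (intro eventually_ball_finite) auto
    then obtain k where "\<forall>b\<in>C. dist (y k b) b < \<delta>" by (auto simp: eventually_sequentially)
    then have "card C \<le> dim (range (cdiag (P (s k))))"
      by (intro \<delta>(2)[of _ "y k"] subspace_range_cdiag y(2)) (auto simp: dist_norm less_imp_le)
    then show ?thesis by (simp add: dim_range_cdiag[OF Pn])
  qed
  have "dim A \<le> CARD('n)" using le[OF B(2), of "d" "\<lambda>k. k"] dlim dD B(4) by simp
  then have dA: "dim A = CARD('n)" using Ab_hat_dim_ge[OF G sA GA] by simp
  have limA: "h \<in> A"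
    if s: "strict_mono (s :: nat \<Rightarrow> nat)" and y: "\<And>k. y k \<in> range (cdiag (P (s k)))" "y \<longlonglongrightarrow> h" for s y h
  proof (rule ccontr)
    assume "h \<notin> A"
    then have h: "h \<notin> span B" by (simp add: sB)
    then have hB: "h \<notin> B" using span_base by blast
    have "independent (insert h B)" using h B(2) by (rule independent_insertI)
    then have "card (insert h B) \<le> CARD('n)"
    proof (rule le[where y = "\<lambda>k b. if b = h then y k else d (s k) b" and s = s])
      fix b assume b: "b \<in> insert h B"
      show "(\<lambda>k. if b = h then y k else d (s k) b) \<longlonglongrightarrow> b"
      proof (cases "b = h")
        case False
        then have "(\<lambda>r. d r b) \<longlonglongrightarrow> b" using b by (intro dlim) simp
        then show ?thesis using False LIMSEQ_subseq_LIMSEQ[OF _ s, of "\<lambda>r. d r b" b] by (simp add: o_def)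
      qed (simp add: y(2))
      show "(if b = h then y k else d (s k) b) \<in> range (cdiag (P (s k)))" for k
        using y(1) dD by simp
    qed
    then show False using hB finB B(4) dA by simp
  qed
  have sub: "conjugate (P r) pos_diag \<subseteq> range (cdiag (P r))" for r
    unfolding conjugate_pos_diag[OF P] by blast
  have "chabauty_limit (\<lambda>r. conjugate (P r) pos_diag) G"
    unfolding chabauty_limit_def
  proof (intro conjI allI ballI impI)
    show "closed_subgroup_SL (conjugate (P r) pos_diag)" for r
      by (rule closed_subgroup_conjugate_pos_diag[OF P])
    show "closed_subgroup_SL G" using G by (simp add: Ab_hat_def)
  next
    fix h assume h: "h \<in> G"
    obtain k where k: "k \<in> G" "h = k ** k" using GP(5)[OF h] by blast
    obtain y where y: "\<And>r. y r \<in> range (cdiag (P r))" "y \<longlonglongrightarrow> k" using approx k(1) GA by blast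
    \<comment> \<open>\<open>det (y r)\<close> tends to 1 but may vanish for early indices, where
      the identity is inserted.\<close>
    define g where "g r = (if det (y r) \<noteq> 0 then (1 / root CARD('n) ((det (y r))\<^sup>2)) *\<^sub>R (y r ** y r) else mat 1)" for r
    have "g r \<in> conjugate (P r) pos_diag" for r
      using scaled_square_in_conjugate[OF P y(1)] one_in_cdiag[OF P] by (simp add: g_def)
    moreover have "g \<longlonglongrightarrow> h"
    proof (rule Lim_transform_eventually)
      have dl: "(\<lambda>r. det (y r)) \<longlonglongrightarrow> 1" using tendsto_det[OF y(2)] GP(2)[OF k(1)] by simp
      have r: "(\<lambda>r. root CARD('n) ((det (y r))\<^sup>2)) \<longlonglongrightarrow> root CARD('n) (1\<^sup>2)" by (intro tendsto_intros dl)
      have "(\<lambda>r. (1 / root CARD('n) ((det (y r))\<^sup>2)) *\<^sub>R (y r ** y r)) \<longlonglongrightarrow> (1 / root CARD('n) (1\<^sup>2)) *\<^sub>R (k ** k)"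
        by (intro tendsto_scaleR tendsto_divide tendsto_const r mm.tendsto y(2)) simp
      then show "(\<lambda>r. (1 / root CARD('n) ((det (y r))\<^sup>2)) *\<^sub>R (y r ** y r)) \<longlonglongrightarrow> h" using k(2) by simp
      have "\<forall>\<^sub>F r in sequentially. det (y r) \<noteq> 0" by (rule tendsto_imp_eventually_ne[OF dl]) simp
      then show "\<forall>\<^sub>F r in sequentially. (1 / root CARD('n) ((det (y r))\<^sup>2)) *\<^sub>R (y r ** y r) = g r"
        by (rule eventually_mono) (simp add: g_def)
    qed
    ultimately show "\<exists>g. (\<forall>r. g r \<in> conjugate (P r) pos_diag) \<and> g \<longlonglongrightarrow> h" by blast
  next
    fix g s h assume "(\<forall>r. g r \<in> conjugate (P r) pos_diag) \<and> strict_mono (s :: nat \<Rightarrow> nat) \<and> (g \<circ> s) \<longlonglongrightarrow> h"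
    then have g: "\<And>r. (g \<circ> s) r \<in> conjugate (P (s r)) pos_diag" and s: "strict_mono s" and lim: "(g \<circ> s) \<longlonglongrightarrow> h" by auto
    have hA: "h \<in> A" using limA[OF s _ lim] g sub by blast
    note seg = det_segment_limit[OF P g lim]
    have "closed_segment (mat 1) h \<subseteq> cone G"
    proof (rule connected_subset_cone[OF G sA GA])
      show "closed_segment (mat 1) h \<subseteq> A" by (rule closed_segment_subset[OF oneA hA subspace_imp_convex[OF sA]])
      show "det x \<noteq> 0" if "x \<in> closed_segment (mat 1) h" for x
        using that seg(1) by (force simp: closed_segment_def)
    qed (simp_all add: dA)
    moreover have "det h = 1" by (rule seg(2)[of 0]) simp_all
    ultimately show "h \<in> G" by (intro cone_det_one[OF G]) auto
  qed
  then show ?thesis unfolding conjugacy_limit_def using P by (intro exI[of _ P]) (simp add: SL_def)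
qed

theorem theorem2:
  shows "(CARD('n::finite) \<le> 4 \<longrightarrow> (Ab :: (real^'n^'n) set set set) = Red) \<and>
         (CARD('n) \<ge> 5 \<longrightarrow> (Red :: (real^'n^'n) set set set) \<subset> Ab)"
proof (intro conjI impI)
  assume n: "CARD('n) \<le> 4"
  have "(Ab_hat :: (real^'n^'n) set set) = Red_hat"
    using Red_hat_subset_Ab_hat Ab_hat_conjugacy_limit[OF _ n] by (intro subset_antisym) (auto simp: Red_hat_def Ab_hat_def closed_subgroup_SL_def)
  then show "(Ab :: (real^'n^'n) set set set) = Red" by (simp only: Ab_def Red_def)
qed (rule Red_strict_subset_Ab)

end
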